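(* Let $\mathcal{H} \subseteq L^2(\mathbb{R}^n)$ be a reproducing kernel Hilbert space with reproducing kernels $\{k_x\}_{x \in \mathbb{R}^n}$ and let $k(x,y) = \langle k_y, k_x\rangle$. Suppose that the following three conditions hold. (DC) There exist constants $0 < C_1 \le C_2 < \infty$ such that $C_1 \le \|k_x\|^2 \le C_2$ for all $x \in \mathbb{R}^n$. (WL) For every $\varepsilon > 0$ there exists $r = r(\varepsilon) > 0$ such that $$\sup_{x \in \mathbb{R}^n} \int_{\mathbb{R}^n \setminus B_r(x)} |\langle k_x, k_y\rangle|^2 \, dy < \varepsilon^2 .$$ (HAP) If $\Lambda \subseteq \mathbb{R}^n$ is a countable set such that $\{k_\lambda\}_{\lambda \in \Lambda}$ is a Bessel sequence in $\mathcal{H}$ and $\varepsilon > 0$, then there exists $r = r(\varepsilon) > 0$ such that $$\sup_{x \in \mathbb{R}^n} \sum_{\lambda \in \Lambda \setminus B_r(x)} |\langle k_x, k_\lambda\rangle|^2 < \varepsilon^2 .$$ Then for every $\varepsilon > 0$ there exists a countable set $\Lambda \subseteq \mathbb{R}^n$ satisfying $$D_0^-(\Lambda) := \liminf_{r \to \infty} \inf_{x \in \mathbb{R}^n} \frac{\#(\Lambda \cap B_r(x))}{\int_{B_r(x)} k(y,y)\, dy} \ge 1 - \varepsilon$$ and such that $\{k_\lambda\}_{\lambda \in \Lambda}$ is a Riesz sequence in $\mathcal{H}$.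
   Context: A reproducing kernel Hilbert space $\mathcal{H} \subseteq L^2(\mathbb{R}^n)$ is a closed subspace, consisting of functions defined pointwise, on which each point evaluation $f \mapsto f(x)$, $x \in \mathbb{R}^n$, is a well-defined bounded linear functional; the reproducing kernel $k_x \in \mathcal{H}$ at $x$ is the vector with $f(x) = \langle f, k_x\rangle$ for all $f \in \mathcal{H}$. $B_r(x)$ is the open Euclidean ball of radius $r$ centered at $x$. A countable family $\{g_i\}_{i \in I}$ in $\mathcal{H}$ is a Bessel sequence if there is $B>0$ with $\sum_{i\in I} |\langle f, g_i\rangle|^2 \le B\|f\|^2$ for all $f \in \mathcal{H}$. It is a Riesz sequence if there are $A, B > 0$ with $A\|c\|^2 \le \|\sum_{i \in I} c_i g_i\|^2 \le B\|c\|^2$ for all $c \in \ell^2(I)$. Countable sets $\Lambda$ are treated as index families, with multiplicities allowed. *)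

theory Defs
  imports "HOL-Analysis.Analysis"
begin

section \<open>Pointwise defined square-integrable functions\<close>

text \<open>Functions on \<open>\<real>\<^sup>n\<close> are complex valued. They are genuine functions, not classes modulo null sets.\<close>

definition L2 :: "(real ^ 'n \<Rightarrow> complex) set" where
  "L2 = {f. f \<in> borel_measurable lebesgue \<and> integrable lebesgue (\<lambda>x. (cmod (f x))\<^sup>2)}"

definition L2_inner :: "(real ^ 'n \<Rightarrow> complex) \<Rightarrow> (real ^ 'n \<Rightarrow> complex) \<Rightarrow> complex" where
  "L2_inner f g = (LINT x|lebesgue. f x * cnj (g x))"

definition L2_norm :: "(real ^ 'n \<Rightarrow> complex) \<Rightarrow> real" where
  "L2_norm f = sqrt (LINT x|lebesgue. (cmod (f x))\<^sup>2)"

section \<open>Reproducing kernel Hilbert spaces\<close>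

text \<open>Closedness is that of the image of \<open>H\<close> in the quotient of \<open>L2\<close> modulo null sets, hence
  the limit is only required to have a representative in \<open>H\<close>. That representative is unique, and
  \<open>H\<close> embeds in the quotient, because point evaluations are bounded in the \<open>L\<^sup>2\<close> norm.\<close>

definition rkhs :: "(real ^ 'n \<Rightarrow> complex) set \<Rightarrow> bool" where
  "rkhs H \<longleftrightarrow>
     H \<subseteq> L2 \<and>
     (\<lambda>_. 0) \<in> H \<and>
     (\<forall>f\<in>H. \<forall>g\<in>H. (\<lambda>x. f x + g x) \<in> H) \<and>
     (\<forall>c. \<forall>f\<in>H. (\<lambda>x. c * f x) \<in> H) \<and>
     (\<forall>F g. (\<forall>m::nat. F m \<in> H) \<longrightarrow> g \<in> L2 \<longrightarrow>
        (\<lambda>m. L2_norm (\<lambda>x. F m x - g x)) \<longlonglongrightarrow> 0 \<longrightarrow>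
        (\<exists>h\<in>H. AE x in lebesgue. h x = g x)) \<and>
     (\<forall>x. \<exists>C. \<forall>f\<in>H. cmod (f x) \<le> C * L2_norm f)"

definition reproducing_kernels ::
    "(real ^ 'n \<Rightarrow> complex) set \<Rightarrow> (real ^ 'n \<Rightarrow> real ^ 'n \<Rightarrow> complex) \<Rightarrow> bool" where
  "reproducing_kernels H k \<longleftrightarrow> (\<forall>x. k x \<in> H \<and> (\<forall>f\<in>H. f x = L2_inner f (k x)))"

definition kernel_fun ::
    "(real ^ 'n \<Rightarrow> real ^ 'n \<Rightarrow> complex) \<Rightarrow> real ^ 'n \<Rightarrow> real ^ 'n \<Rightarrow> complex" where
  "kernel_fun k x y = L2_inner (k y) (k x)"

section \<open>Bessel and Riesz sequences\<close>

definition bessel_sequence ::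
    "(real ^ 'n \<Rightarrow> complex) set \<Rightarrow> 'i set \<Rightarrow> ('i \<Rightarrow> real ^ 'n \<Rightarrow> complex) \<Rightarrow> bool" where
  "bessel_sequence H I g \<longleftrightarrow>
     countable I \<and> (\<forall>i\<in>I. g i \<in> H) \<and>
     (\<exists>B>0. \<forall>f\<in>H.
        (\<Sum>\<^sub>\<infinity>i\<in>I. ennreal ((cmod (L2_inner f (g i)))\<^sup>2)) \<le> ennreal (B * (L2_norm f)\<^sup>2))"

text \<open>Unconditional convergence in the \<open>L\<^sup>2\<close> norm of a family of functions.\<close>

definition L2_has_sum ::
    "('i \<Rightarrow> real ^ 'n \<Rightarrow> complex) \<Rightarrow> (real ^ 'n \<Rightarrow> complex) \<Rightarrow> 'i set \<Rightarrow> bool" where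
  "L2_has_sum g s I \<longleftrightarrow>
     ((\<lambda>F. L2_norm (\<lambda>x. (\<Sum>i\<in>F. g i x) - s x)) \<longlongrightarrow> 0) (finite_subsets_at_top I)"

text \<open>The convergence in \<open>H\<close> of \<open>\<Sum> c\<^sub>i g\<^sub>i\<close> for every square-summable \<open>c\<close> is
  part of the condition; the limit \<open>s\<close> is unique in \<open>H\<close>.\<close>

definition riesz_sequence ::
    "(real ^ 'n \<Rightarrow> complex) set \<Rightarrow> 'i set \<Rightarrow> ('i \<Rightarrow> real ^ 'n \<Rightarrow> complex) \<Rightarrow> bool" where
  "riesz_sequence H I g \<longleftrightarrow>
     countable I \<and> (\<forall>i\<in>I. g i \<in> H) \<and>
     (\<exists>A>0. \<exists>B>0. \<forall>c :: 'i \<Rightarrow> complex. (\<lambda>i. (cmod (c i))\<^sup>2) summable_on I \<longrightarrow>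
        (\<exists>s\<in>H. L2_has_sum (\<lambda>i x. c i * g i x) s I \<and>
           A * (\<Sum>\<^sub>\<infinity>i\<in>I. (cmod (c i))\<^sup>2) \<le> (L2_norm s)\<^sup>2 \<and>
           (L2_norm s)\<^sup>2 \<le> B * (\<Sum>\<^sub>\<infinity>i\<in>I. (cmod (c i))\<^sup>2)))"

section \<open>The conditions on the kernel\<close>

text \<open>Countable sets of points with multiplicities are families \<open>p\<close> indexed by an arbitrary
  set \<open>I\<close> of natural numbers (finite or infinite). Sums, integrals and counts of nonnegative
  quantities are taken in the extended nonnegative reals.\<close>

definition diagonal_condition :: "(real ^ 'n \<Rightarrow> real ^ 'n \<Rightarrow> complex) \<Rightarrow> bool" where
  "diagonal_condition k \<longleftrightarrow>
     (\<exists>C1 C2. 0 < C1 \<and> C1 \<le> C2 \<and> (\<forall>x. C1 \<le> (L2_norm (k x))\<^sup>2 \<and> (L2_norm (k x))\<^sup>2 \<le> C2))"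

definition weak_localization :: "(real ^ 'n \<Rightarrow> real ^ 'n \<Rightarrow> complex) \<Rightarrow> bool" where
  "weak_localization k \<longleftrightarrow>
     (\<forall>\<epsilon>>0. \<exists>r>0.
        (SUP x. \<integral>\<^sup>+y\<in>- ball x r. ennreal ((cmod (L2_inner (k x) (k y)))\<^sup>2) \<partial>lebesgue)
          < ennreal (\<epsilon>\<^sup>2))"

definition homogeneous_approximation ::
    "(real ^ 'n \<Rightarrow> complex) set \<Rightarrow> (real ^ 'n \<Rightarrow> real ^ 'n \<Rightarrow> complex) \<Rightarrow> bool" where
  "homogeneous_approximation H k \<longleftrightarrow>
     (\<forall>(I :: nat set) (p :: nat \<Rightarrow> real ^ 'n). bessel_sequence H I (\<lambda>i. k (p i)) \<longrightarrow>
        (\<forall>\<epsilon>>0. \<exists>r>0.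
           (SUP x. \<Sum>\<^sub>\<infinity>i\<in>{i \<in> I. p i \<notin> ball x r}. ennreal ((cmod (L2_inner (k x) (k (p i))))\<^sup>2))
             < ennreal (\<epsilon>\<^sup>2)))"

section \<open>Dimension-free lower density\<close>

text \<open>The real part only serves to change type: \<open>k(y,y)\<close> is a nonnegative real number.\<close>

definition lower_density ::
    "(real ^ 'n \<Rightarrow> real ^ 'n \<Rightarrow> complex) \<Rightarrow> 'i set \<Rightarrow> ('i \<Rightarrow> real ^ 'n) \<Rightarrow> ennreal" where
  "lower_density k I p =
     Liminf at_top (\<lambda>r :: real. INF x.
       emeasure (count_space I) {i \<in> I. p i \<in> ball x r} /
       (\<integral>\<^sup>+y\<in>ball x r. ennreal (Re (kernel_fun k y y)) \<partial>lebesgue))"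

end

theory Submission
  imports Defs "Jordan_Normal_Form.Determinant" "HOL-Computational_Algebra.Fundamental_Theorem_Algebra"
begin

text \<open>
  The selection steps use the barrier method of Marcus, Spielman and Srivastava. A determinant such
  as \<open>det (1 + diag z G)\<close> is affine in each variable and real stable. Averaging such a function over
  the choice of one index in a block amounts to an operator \<open>1 \<plusminus> c \<Sum> \<partial>\<^sub>i\<close>, which
  preserves stability. The barrier functions \<open>\<partial>\<^sub>i F / F\<close> control where the average stays positive,
  and there positivity survives for one of the choices. This yields an upper bound for a Gram matrix
  with one index chosen per block, and a lower bound after the deletion of one index per block.

  Partition space into small cells. The upper selection gives one point \<open>x\<^sub>m\<close> with a weight
  \<open>w\<^sub>m\<close> in each cell such that \<open>\<Sum> w\<^sub>m |f(x\<^sub>m)|\<^sup>2 \<le> X \<parallel>f\<parallel>\<^sup>2\<close> with \<open>X\<close> close to \<open>1\<close>, while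
  \<open>w\<^sub>m \<parallel>k\<^sub>x\<parallel>\<^sup>2\<close> at \<open>x = x\<^sub>m\<close> is close to the integral of \<open>k(y,y)\<close> over the cell. The kernels at
  these points form a Bessel sequence, so (HAP) makes kernels in distant regions almost orthogonal.
  In each large cube, a set \<open>S\<close> of indices maximising a regularised Gram determinant satisfies
  \<open>\<Sum> w\<^sub>m (\<parallel>k\<^sub>x\<parallel>\<^sup>2 - e) \<le> X |S|\<close>, hence has almost the cardinality required by the density, and its
  elements have regularised dual vectors of bounded norm. Only few of these dual vectors are
  noticed by the other cubes. The remaining indices are grouped into blocks of a fixed large size,
  and the lower selection deletes one index per block, which leaves a Riesz sequence.
\<close>

text \<open>The order of the construction is forced by (HAP): it applies only to a family already
  known to be Bessel, so the points have to be fixed before the distance, and hence the size of the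
  large cubes, can be chosen. The weights stay above a positive constant, so dropping them leaves a
  Bessel family, and every subfamily inherits its upper Riesz bound. The obstacle is a lower bound
  without loss of density: a set of nearly full cardinality may have an almost singular Gram matrix.
  The parameter a > 0 makes every matrix invertible; deleting one index out of K leaves the lower
  bound 1/(3 K \<beta>) - a, and a is taken so small against e / K that a positive number remains.
  The barrier method concerns finite matrices, but its bounds do not depend on their size and every
  cell or index has finitely many options, so compactness yields the infinite families. Density is
  lost through one factor 1 - \<theta> each for the weights, the charge e, the boundary of a cube,
  the discarded dual vectors and the deleted indices, and through the Bessel bound X.\<close>

section \<open>Multiaffine real stable functions\<close>

text \<open>For a function that is affine in the variable \<open>z i\<close>, this difference is the partial derivative.\<close>

definition pdiff :: "'i \<Rightarrow> (('i \<Rightarrow> complex) \<Rightarrow> complex) \<Rightarrow> ('i \<Rightarrow> complex) \<Rightarrow> complex" where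
  "pdiff i F z = F (z(i := 1)) - F (z(i := 0))"

text \<open>Models a polynomial of degree at most one in each of finitely many variables. It is a
  function of all assignments, so fixing a variable is a \<open>fun_upd\<close> and a derivative is
  a difference of two values; \<open>T\<close> contains the variables that occur.\<close>

definition multiaffine :: "'i set \<Rightarrow> (('i \<Rightarrow> complex) \<Rightarrow> complex) \<Rightarrow> bool" where
  "multiaffine T F \<longleftrightarrow> finite T \<and> (\<forall>z z'. (\<forall>i\<in>T. z i = z' i) \<longrightarrow> F z = F z') \<and>
     (\<forall>i z t. F (z(i := t)) = F (z(i := 0)) + t * pdiff i F z)"

lemma multiaffine_dep: "multiaffine T F \<Longrightarrow> (\<And>i. i \<in> T \<Longrightarrow> z i = z' i) \<Longrightarrow> F z = F z'"
  unfolding multiaffine_def by blast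

lemma pdiff_upd [simp]: "pdiff i F (z(i := t)) = pdiff i F z"
  by (simp add: pdiff_def)

lemma multiaffine_shift:
  assumes "multiaffine T F"
  shows "F (z(i := z i + t)) = F z + t * pdiff i F z"
proof -
  have "F (z(i := z i)) = F (z(i := 0)) + z i * pdiff i F z"
    using assms unfolding multiaffine_def by blast
  moreover have "F (z(i := z i + t)) = F (z(i := 0)) + (z i + t) * pdiff i F z"
    using assms unfolding multiaffine_def by blast
  ultimately show ?thesis by (simp add: algebra_simps)
qed

lemma pdiff_notin: "multiaffine T F \<Longrightarrow> i \<notin> T \<Longrightarrow> pdiff i F z = 0"
  unfolding pdiff_def by (subst multiaffine_dep[of T F _ "z(i := 0)"]) auto

lemma pdiff_comm: "pdiff i (pdiff j F) z = pdiff j (pdiff i F) z"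
proof (cases "i = j")
  case False
  then show ?thesis by (simp add: pdiff_def fun_upd_twist)
qed simp

lemma pdiff_same [simp]: "pdiff i (pdiff i F) z = 0"
  by (simp add: pdiff_def)

lemma multiaffine_pdiff:
  assumes "multiaffine T F"
  shows "multiaffine T (pdiff j F)"
  unfolding multiaffine_def
proof (intro conjI allI impI)
  show "finite T" using assms by (simp add: multiaffine_def)
  show "pdiff j F z = pdiff j F z'" if "\<forall>i\<in>T. z i = z' i" for z z'
    unfolding pdiff_def using that by (intro arg_cong2[of _ _ _ _ minus] multiaffine_dep[OF assms]) auto
  show "pdiff j F (z(i := t)) = pdiff j F (z(i := 0)) + t * pdiff i (pdiff j F) z" for i z t
  proof (cases "i = j")
    case False
    have *: "F (y(i := t)) = F (y(i := 0)) + t * pdiff i F y" for y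
      using assms unfolding multiaffine_def by blast
    show ?thesis
      using False *[of "z(j:=1)"] *[of "z(j:=0)"]
      by (simp add: pdiff_def fun_upd_twist algebra_simps)
  qed simp
qed

text \<open>Both averages of the selection steps have this form. Adding \<open>c * card b\<close> to
  a uniformly chosen coordinate of \<open>b\<close> has this mean, and so, for
  \<open>c = - 1\<close>, has subtracting \<open>1 / p s\<close> from coordinate \<open>s\<close>
  with probability \<open>p s\<close>.\<close>

definition add_partials :: "real \<Rightarrow> 'i set \<Rightarrow> (('i \<Rightarrow> complex) \<Rightarrow> complex) \<Rightarrow> ('i \<Rightarrow> complex) \<Rightarrow> complex" where
  "add_partials c b F z = F z + of_real c * (\<Sum>i\<in>b. pdiff i F z)"

lemma pdiff_add_partials: "pdiff j (add_partials c b F) z = add_partials c b (pdiff j F) z"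
proof -
  have "pdiff j (add_partials c b F) z = pdiff j F z + of_real c * (\<Sum>i\<in>b. pdiff j (pdiff i F) z)"
    by (simp add: add_partials_def pdiff_def[of j] right_diff_distrib sum_subtractf)
  then show ?thesis by (simp add: add_partials_def pdiff_comm[of j])
qed

lemma multiaffine_add_partials:
  assumes "multiaffine T F"
  shows "multiaffine T (add_partials c b F)"
  unfolding multiaffine_def
proof (intro conjI allI impI)
  show "finite T" using assms by (simp add: multiaffine_def)
  show "add_partials c b F z = add_partials c b F z'" if "\<forall>i\<in>T. z i = z' i" for z z'
  proof -
    have "F z = F z'" "pdiff i F z = pdiff i F z'" for i
      using multiaffine_dep[OF assms] multiaffine_dep[OF multiaffine_pdiff[OF assms]] that by blast+
    then show ?thesis by (simp add: add_partials_def)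
  qed
  show "add_partials c b F (z(i := t)) = add_partials c b F (z(i := 0)) + t * pdiff i (add_partials c b F) z" for i z t
  proof -
    have "F (z(i := t)) = F (z(i := 0)) + t * pdiff i F z"
      "pdiff k F (z(i := t)) = pdiff k F (z(i := 0)) + t * pdiff i (pdiff k F) z" for k
      using assms multiaffine_pdiff[OF assms] unfolding multiaffine_def by blast+
    then show ?thesis
      by (simp add: pdiff_add_partials, simp add: add_partials_def pdiff_comm[of i] sum.distrib sum_distrib_left algebra_simps)
  qed
qed

text \<open>Each further direction \<open>j\<close> adds \<open>t * d j\<close> times the polynomial
  of \<open>pdiff j F\<close>, and the second conjunct is the chain rule. This brings roots and
  degrees of polynomials in one variable to bear on \<open>F\<close>.\<close>

lemma multiaffine_line:
  assumes "multiaffine T F" "finite b"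
  shows "\<exists>p. (\<forall>t. poly p t = F (\<lambda>i. if i \<in> b then a i + t * d i else a i)) \<and>
    (\<forall>t. poly (pderiv p) t = (\<Sum>i\<in>b. d i * pdiff i F (\<lambda>i. if i \<in> b then a i + t * d i else a i)))"
  using assms(2,1)
proof (induction b arbitrary: F)
  case empty
  show ?case by (rule exI[of _ "[:F a:]"]) auto
next
  case (insert j b)
  define l where "l = (\<lambda>t i. if i \<in> b then a i + t * d i else a i)"
  have l': "(\<lambda>i. if i \<in> insert j b then a i + t * d i else a i) = (l t)(j := l t j + t * d j)" for t
    using insert(2) by (auto simp: l_def fun_eq_iff)
  obtain p where p: "\<And>t. poly p t = F (l t)" "\<And>t. poly (pderiv p) t = (\<Sum>i\<in>b. d i * pdiff i F (l t))"
    using insert.IH[OF insert.prems] unfolding l_def by blast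
  obtain q where q: "\<And>t. poly q t = pdiff j F (l t)" "\<And>t. poly (pderiv q) t = (\<Sum>i\<in>b. d i * pdiff i (pdiff j F) (l t))"
    using insert.IH[OF multiaffine_pdiff[OF insert.prems]] unfolding l_def by blast
  show ?case
  proof (rule exI[of _ "p + [:0, d j:] * q"], intro conjI allI)
    fix t
    show "poly (p + [:0, d j:] * q) t = F (\<lambda>i. if i \<in> insert j b then a i + t * d i else a i)"
      unfolding l' multiaffine_shift[OF insert.prems] by (simp add: p q)
    have "pdiff i F ((l t)(j := l t j + t * d j)) = pdiff i F (l t) + t * d j * pdiff i (pdiff j F) (l t)" for i
      unfolding multiaffine_shift[OF multiaffine_pdiff[OF insert.prems]] by (simp add: pdiff_comm[of j])
    then show "poly (pderiv (p + [:0, d j:] * q)) t =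
      (\<Sum>i\<in>insert j b. d i * pdiff i F (\<lambda>i. if i \<in> insert j b then a i + t * d i else a i))"
      unfolding l' using insert(1,2)
      by (simp add: pderiv_add pderiv_mult pderiv_pCons pderiv_smult p q sum.distrib sum_distrib_left algebra_simps)
  qed
qed

definition real_stable :: "'i set \<Rightarrow> (('i \<Rightarrow> complex) \<Rightarrow> complex) \<Rightarrow> bool" where
  "real_stable T F \<longleftrightarrow> multiaffine T F \<and> (\<forall>z. (\<forall>i. z i \<in> \<real>) \<longrightarrow> F z \<in> \<real>) \<and>
     (\<forall>z. (\<forall>i\<in>T. Im (z i) > 0) \<longrightarrow> F z \<noteq> 0)"

lemma real_stable_multiaffine: "real_stable T F \<Longrightarrow> multiaffine T F"
  by (simp add: real_stable_def)

text \<open>In the variable \<open>j\<close> alone \<open>F\<close> is affine, with its zero at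
  \<open>z j + s\<close> for \<open>s = - F z / pdiff j F z\<close>. Stability keeps this zero out
  of the upper half plane, so \<open>Im s < 0\<close>, and \<open>Im s\<close> has the sign of the
  left-hand side.\<close>

lemma real_stable_strict:
  assumes F: "real_stable T F" and z: "\<And>i. i \<in> T \<Longrightarrow> Im (z i) > 0" and nz: "pdiff j F z \<noteq> 0"
  shows "Im (pdiff j F z * cnj (F z)) < 0"
proof -
  define R where "R = pdiff j F z"
  define s where "s = - F z / R"
  have jT: "j \<in> T" using nz pdiff_notin[OF real_stable_multiaffine[OF F]] by blast
  have "F (z(j := z j + s)) = 0"
    unfolding multiaffine_shift[OF real_stable_multiaffine[OF F]] using nz by (simp add: s_def R_def)
  then have "\<not> (\<forall>i\<in>T. Im ((z(j := z j + s)) i) > 0)"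
    using F unfolding real_stable_def by blast
  then have "Im (z j + s) \<le> 0" using z by (auto split: if_splits)
  then have "Im s < 0" using z[OF jT] by simp
  moreover have "Im s = Im (R * cnj (F z)) / (cmod R)\<^sup>2"
    by (simp add: s_def Im_divide cmod_power2 algebra_simps) (simp add: add_divide_distrib diff_divide_distrib)
  ultimately show ?thesis using nz by (simp add: R_def divide_less_0_iff)
qed

text \<open>The limit of \<open>real_stable_strict\<close> when a positive imaginary part, added to
  all variables of \<open>T\<close>, tends to 0.\<close>

lemma real_stable_weak:
  assumes F: "real_stable T F" and z: "\<And>i. i \<in> T \<Longrightarrow> Im (z i) \<ge> 0"
  shows "Im (pdiff j F z * cnj (F z)) \<le> 0"
proof -
  note mF = real_stable_multiaffine[OF F]
  have fT: "finite T" using mF by (simp add: multiaffine_def)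
  define l where "l = (\<lambda>t i. if i \<in> T then z i + t * \<i> else z i)"
  obtain p where p: "\<And>t. poly p t = F (l t)"
    using multiaffine_line[OF mF fT, where a = z and d = "\<lambda>_. \<i>"] unfolding l_def by blast
  obtain q where q: "\<And>t. poly q t = pdiff j F (l t)"
    using multiaffine_line[OF multiaffine_pdiff[OF mF] fT, where a = z and d = "\<lambda>_. \<i>"] unfolding l_def by blast
  let ?g = "\<lambda>t::real. Im (poly q (of_real t) * cnj (poly p (of_real t)))"
  have "(?g \<longlongrightarrow> ?g 0) (at_right 0)"
    by (intro tendsto_intros)
  moreover have "eventually (\<lambda>t. ?g t \<le> 0) (at_right 0)"
  proof (rule eventually_at_rightI[of 0 1])
    fix t :: real assume "t \<in> {0<..<1}"
    then have "Im (l (of_real t) i) > 0" if "i \<in> T" for i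
      using z[OF that] that by (simp add: l_def)
    then show "?g t \<le> 0"
      unfolding p q using real_stable_strict[OF F, of "l (of_real t)" j]
      by (cases "pdiff j F (l (of_real t)) = 0") (auto simp del: times_complex.sel)
  qed simp
  ultimately have "?g 0 \<le> 0"
    by (rule tendsto_upperbound) simp
  moreover have "l 0 = z" by (simp add: l_def fun_eq_iff)
  ultimately show ?thesis by (simp add: p q)
qed

text \<open>At a zero of \<open>F + c * S\<close>, where \<open>S\<close> is the sum of the
  derivatives, \<open>S * cnj (F z)\<close> is real. But its imaginary part is negative: no
  derivative contributes a positive amount, and a nonzero one contributes a negative amount.\<close>

lemma real_stable_add_partials:
  assumes F: "real_stable T F" and "finite b"
  shows "real_stable T (add_partials c b F)"
  unfolding real_stable_def
proof (intro conjI allI impI)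
  note mF = real_stable_multiaffine[OF F]
  show "multiaffine T (add_partials c b F)" by (rule multiaffine_add_partials[OF mF])
  show "add_partials c b F z \<in> \<real>" if "\<forall>i. z i \<in> \<real>" for z
  proof -
    have r: "F y \<in> \<real>" if "\<forall>i. y i \<in> \<real>" for y
      using F that unfolding real_stable_def by blast
    show ?thesis unfolding add_partials_def pdiff_def
      using that by (intro Reals_add Reals_mult Reals_of_real sum_in_Reals Reals_diff r) auto
  qed
  show "add_partials c b F z \<noteq> 0" if z: "\<forall>i\<in>T. Im (z i) > 0" for z
  proof
    assume 0: "add_partials c b F z = 0"
    have Fz: "F z \<noteq> 0" using F z unfolding real_stable_def by blast
    define S where "S = (\<Sum>i\<in>b. pdiff i F z)"
    have FS: "F z = - of_real c * S" using 0 by (simp add: add_partials_def S_def add_eq_0_iff2)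
    then have S0: "S \<noteq> 0" "c \<noteq> 0" using Fz by auto
    then obtain j where j: "j \<in> b" "pdiff j F z \<noteq> 0"
      unfolding S_def by (meson sum.neutral)
    have "Im (S * cnj (F z)) = (\<Sum>i\<in>b. Im (pdiff i F z * cnj (F z)))"
      by (simp add: S_def sum_distrib_right del: times_complex.sel)
    also have "\<dots> < (\<Sum>i\<in>b. 0)"
      using real_stable_weak[OF F, of z] real_stable_strict[OF F, of z j] z j
      by (intro sum_strict_mono_strong[of _ j] assms) (auto simp: less_imp_le simp del: times_complex.sel)
    finally have "Im (S * cnj (F z)) < 0" by simp
    moreover have "S * cnj (F z) = of_real (- c * (cmod S)\<^sup>2)"
      unfolding FS by (simp add: complex_norm_square del: of_real_power)
    ultimately show False by simp
  qed
qed

section \<open>Values at real points and the Rayleigh inequality\<close>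

definition cvec :: "('i \<Rightarrow> real) \<Rightarrow> 'i \<Rightarrow> complex" where "cvec x = (\<lambda>i. of_real (x i))"

definition real_val :: "(('i \<Rightarrow> complex) \<Rightarrow> complex) \<Rightarrow> ('i \<Rightarrow> real) \<Rightarrow> real" where
  "real_val F x = Re (F (cvec x))"

lemma cvec_upd: "cvec (x(i := t)) = (cvec x)(i := of_real t)"
  by (auto simp: cvec_def)

lemma real_stable_real_val: "real_stable T F \<Longrightarrow> F (cvec x) = of_real (real_val F x)"
  unfolding real_stable_def real_val_def by (simp add: cvec_def)

lemma real_stable_real_val_pdiff: "real_stable T F \<Longrightarrow> pdiff i F (cvec x) = of_real (real_val (pdiff i F) x)"
proof -
  assume F: "real_stable T F"
  have "pdiff i F (cvec x) = F (cvec (x(i:=1))) - F (cvec (x(i:=0)))"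
    by (simp add: pdiff_def cvec_upd)
  also have "\<dots> \<in> \<real>" unfolding real_stable_real_val[OF F] by simp
  finally show ?thesis by (simp add: real_val_def)
qed

lemma real_stable_real_val_pdiff2: "real_stable T F \<Longrightarrow> pdiff j (pdiff i F) (cvec x) = of_real (real_val (pdiff j (pdiff i F)) x)"
proof -
  assume F: "real_stable T F"
  have "pdiff j (pdiff i F) (cvec x) = pdiff i F (cvec (x(j:=1))) - pdiff i F (cvec (x(j:=0)))"
    by (simp add: pdiff_def[of j] cvec_upd)
  also have "\<dots> \<in> \<real>" unfolding real_stable_real_val_pdiff[OF F] by simp
  finally show ?thesis by (simp add: real_val_def)
qed

lemma real_val_shift: "multiaffine T F \<Longrightarrow> real_val F (x(i := x i + t)) = real_val F x + t * real_val (pdiff i F) x"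
  unfolding real_val_def cvec_upd using multiaffine_shift[of T F "cvec x" i "of_real t"]
  by (simp add: cvec_def)

lemma real_val_cong: "multiaffine T F \<Longrightarrow> (\<And>i. i \<in> T \<Longrightarrow> x i = y i) \<Longrightarrow> real_val F x = real_val F y"
  unfolding real_val_def using multiaffine_dep[of T F "cvec x" "cvec y"] by (simp add: cvec_def)

lemma real_val_add_partials: "real_val (add_partials c b F) x = real_val F x + c * (\<Sum>i\<in>b. real_val (pdiff i F) x)"
  by (simp add: real_val_def add_partials_def)

text \<open>Adding \<open>\<i>\<close> to coordinate \<open>j\<close> turns \<open>F\<close> into
  \<open>F + \<i> * pdiff j F\<close>, and likewise for \<open>pdiff i F\<close>. The imaginary part
  in \<open>real_stable_weak\<close> is then the difference of the two sides.\<close>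

lemma rayleigh:
  assumes F: "real_stable T F"
  shows "real_val F x * real_val (pdiff i (pdiff j F)) x \<le> real_val (pdiff i F) x * real_val (pdiff j F) x"
proof (cases "i = j")
  case True
  then show ?thesis by (simp add: real_val_def)
next
  case False
  define z where "z = (cvec x)(j := cvec x j + \<i>)"
  have "Im (pdiff i F z * cnj (F z)) \<le> 0"
    by (rule real_stable_weak[OF F]) (auto simp: z_def cvec_def)
  moreover have "F z = of_real (real_val F x) + \<i> * of_real (real_val (pdiff j F) x)"
    unfolding z_def multiaffine_shift[OF real_stable_multiaffine[OF F]] real_stable_real_val[OF F] real_stable_real_val_pdiff[OF F] ..
  moreover have "pdiff i F z = of_real (real_val (pdiff i F) x) + \<i> * of_real (real_val (pdiff i (pdiff j F)) x)"
    unfolding z_def multiaffine_shift[OF multiaffine_pdiff[OF real_stable_multiaffine[OF F]]] pdiff_comm[of j]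
      real_stable_real_val_pdiff[OF F] real_stable_real_val_pdiff2[OF F] ..
  ultimately show ?thesis by (simp add: algebra_simps)
qed

section \<open>Barrier functions\<close>

text \<open>The barrier method's notion of a point above all zeros. Positivity on the orthant,
  instead of mere nonvanishing, also fixes the sign of \<open>F\<close>.\<close>

definition above :: "(('i \<Rightarrow> complex) \<Rightarrow> complex) \<Rightarrow> ('i \<Rightarrow> real) \<Rightarrow> bool" where
  "above F x \<longleftrightarrow> (\<forall>y. (\<forall>i. x i \<le> y i) \<longrightarrow> real_val F y > 0)"

text \<open>The logarithmic derivative. As \<open>F\<close> is affine in coordinate
  \<open>i\<close>, lowering that coordinate by \<open>t\<close> multiplies \<open>F\<close> by
  \<open>1 - t * Phi i F x\<close>, so a positive \<open>Phi i F x\<close> is the reciprocal of the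
  distance down to the zero.\<close>

definition Phi :: "'i \<Rightarrow> (('i \<Rightarrow> complex) \<Rightarrow> complex) \<Rightarrow> ('i \<Rightarrow> real) \<Rightarrow> real" where
  "Phi i F x = real_val (pdiff i F) x / real_val F x"

lemma frac_cross: "0 < b \<Longrightarrow> 0 < d \<Longrightarrow> a * d \<le> c * b \<Longrightarrow> a / b \<le> c / (d::real)"
  by (simp add: field_simps)

lemma aboveD: "above F x \<Longrightarrow> real_val F x > 0"
  by (simp add: above_def)

lemma above_mono: "above F x \<Longrightarrow> (\<And>i. x i \<le> y i) \<Longrightarrow> above F y"
  unfolding above_def by (meson order_trans)

lemma above_mono_on:
  assumes "multiaffine T F" "above F x" "\<And>i. i \<in> T \<Longrightarrow> x i \<le> y i"
  shows "above F y"
  unfolding above_def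
proof (intro allI impI)
  fix u assume u: "\<forall>i. y i \<le> u i"
  have "real_val F u = real_val F (\<lambda>i. max (x i) (u i))"
    using assms(3) u by (intro real_val_cong[OF assms(1)]) (metis max.absorb2 order_trans)
  then show "real_val F u > 0" using assms(2) unfolding above_def by simp
qed

text \<open>A negative slope would make the affine function of coordinate \<open>j\<close> negative
  far up; \<open>t\<close> is the step at which it equals -1.\<close>

lemma nonneg_pdiff:
  assumes "multiaffine T F" "\<And>y. (\<And>i. x i \<le> y i) \<Longrightarrow> real_val F y \<ge> 0"
  shows "real_val (pdiff j F) x \<ge> 0"
proof (rule ccontr)
  assume "\<not> ?thesis"
  then have neg: "real_val (pdiff j F) x < 0" by simp
  define t where "t = (real_val F x + 1) / - real_val (pdiff j F) x"
  have "real_val F x \<ge> 0" by (rule assms(2)) simp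
  then have "t \<ge> 0" using neg by (simp add: t_def divide_nonneg_neg)
  then have "real_val F (x(j := x j + t)) \<ge> 0" by (intro assms(2)) auto
  then have "real_val F x + t * real_val (pdiff j F) x \<ge> 0" by (simp only: real_val_shift[OF assms(1)])
  moreover have "t * real_val (pdiff j F) x = - (real_val F x + 1)" using neg by (simp add: t_def)
  ultimately show False by simp
qed

lemma above_pdiff: "multiaffine T F \<Longrightarrow> above F x \<Longrightarrow> real_val (pdiff j F) x \<ge> 0"
  by (rule nonneg_pdiff) (auto simp: above_def less_imp_le)

lemma above_pdiff2:
  assumes "multiaffine T F" "above F x"
  shows "real_val (pdiff i (pdiff j F)) x \<ge> 0"
  by (rule nonneg_pdiff[OF multiaffine_pdiff[OF assms(1)]]) (use above_pdiff[OF assms(1)] above_mono[OF assms(2)] in blast)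

lemma Phi_nonneg: "multiaffine T F \<Longrightarrow> above F x \<Longrightarrow> Phi j F x \<ge> 0"
  unfolding Phi_def using above_pdiff[of T F x j] aboveD[of F x] by simp

text \<open>After cross-multiplication this is \<open>t\<close> times the Rayleigh
  inequality.\<close>

lemma Phi_anti1:
  assumes F: "real_stable T F" and x: "above F x" and t: "t \<ge> 0"
  shows "Phi j F (x(i := x i + t)) \<le> Phi j F x"
proof -
  note mF = real_stable_multiaffine[OF F]
  have 1: "real_val F x > 0" using x by (rule aboveD)
  have "real_val F (x(i := x i + t)) > 0" using x t unfolding above_def by auto
  then have 2: "real_val F x + t * real_val (pdiff i F) x > 0" by (simp only: real_val_shift[OF mF])
  have "t * (real_val F x * real_val (pdiff i (pdiff j F)) x) \<le> t * (real_val (pdiff i F) x * real_val (pdiff j F) x)"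
    by (rule mult_left_mono[OF rayleigh[OF F] t])
  then have "(real_val (pdiff j F) x + t * real_val (pdiff i (pdiff j F)) x) / (real_val F x + t * real_val (pdiff i F) x) \<le> real_val (pdiff j F) x / real_val F x"
    by (intro frac_cross 1 2) (simp add: algebra_simps)
  then show ?thesis unfolding Phi_def real_val_shift[OF mF] real_val_shift[OF multiaffine_pdiff[OF mF]] .
qed

lemma Phi_anti:
  assumes F: "real_stable T F" and x: "above F x" and xy: "\<And>i. x i \<le> y i"
  shows "Phi j F y \<le> Phi j F x"
proof -
  note mF = real_stable_multiaffine[OF F]
  have "Phi j F (\<lambda>i. if i \<in> S then y i else x i) \<le> Phi j F x" if "finite S" for S
    using that
  proof (induction S)
    case (insert k S)
    let ?z = "\<lambda>i. if i \<in> S then y i else x i"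
    have e: "(\<lambda>i. if i \<in> insert k S then y i else x i) = ?z(k := ?z k + (y k - ?z k))"
      by auto
    have "above F ?z" by (rule above_mono[OF x]) (use xy in auto)
    then have "Phi j F (?z(k := ?z k + (y k - ?z k))) \<le> Phi j F ?z"
      by (rule Phi_anti1[OF F]) (use xy in auto)
    then show ?case unfolding e using insert.IH by linarith
  qed simp
  moreover have "finite T" using mF by (simp add: multiaffine_def)
  ultimately have "Phi j F (\<lambda>i. if i \<in> T then y i else x i) \<le> Phi j F x" by blast
  moreover have "Phi j F (\<lambda>i. if i \<in> T then y i else x i) = Phi j F y"
    unfolding Phi_def
    by (intro arg_cong2[of _ _ _ _ "(/)"] real_val_cong[OF mF] real_val_cong[OF multiaffine_pdiff[OF mF]]) auto
  ultimately show ?thesis by simp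
qed

text \<open>A point above the lowered one arises from a point \<open>u\<close> above
  \<open>x\<close> by lowering it by \<open>t\<close>, and there \<open>F\<close> equals
  \<open>real_val F u * (1 - t * Phi i F u)\<close> with \<open>Phi i F u \<le> Phi i F x\<close>.
  In the quotient for \<open>Phi j\<close> the numerator can only drop, because second derivatives
  are nonnegative.\<close>

lemma above_down1:
  assumes F: "real_stable T F" and x: "above F x" and t: "t \<ge> 0" "t * Phi i F x < 1"
  shows "above F (x(i := x i - t))"
    and "Phi j F (x(i := x i - t)) \<le> Phi j F x / (1 - t * Phi i F x)"
proof -
  note mF = real_stable_multiaffine[OF F]
  show "above F (x(i := x i - t))"
    unfolding above_def
  proof (intro allI impI)
    fix y assume y: "\<forall>k. (x(i := x i - t)) k \<le> y k"
    define u where "u = y(i := y i + t)"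
    have xu: "x k \<le> u k" for k
      using y[rule_format, of k] t(1) by (auto simp: u_def split: if_splits)
    have raise_on: "real_val F u > 0" using above_mono[OF x xu] by (rule aboveD)
    have "y = u(i := u i + - t)" by (simp add: u_def)
    then have "real_val F y = real_val F u + - t * real_val (pdiff i F) u" by (simp only: real_val_shift[OF mF])
    also have "\<dots> = real_val F u * (1 - t * Phi i F u)" using raise_on by (simp add: Phi_def field_simps)
    finally have e: "real_val F y = \<dots>" .
    have "t * Phi i F u \<le> t * Phi i F x" by (intro mult_left_mono Phi_anti[OF F x xu] t)
    then show "real_val F y > 0" unfolding e using t(2) raise_on by simp
  qed
  have fp: "real_val F x > 0" using x by (rule aboveD)
  have e: "x(i := x i - t) = x(i := x i + - t)" by simp
  have "real_val (pdiff j F) x - t * real_val (pdiff i (pdiff j F)) x \<le> real_val (pdiff j F) x"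
    using above_pdiff2[OF mF x] t(1) by simp
  moreover have "real_val F x - t * real_val (pdiff i F) x = real_val F x * (1 - t * Phi i F x)"
    using fp by (simp add: Phi_def field_simps)
  moreover have "real_val F x * (1 - t * Phi i F x) > 0" using fp t(2) by simp
  ultimately show "Phi j F (x(i := x i - t)) \<le> Phi j F x / (1 - t * Phi i F x)"
    unfolding Phi_def[of j] e real_val_shift[OF mF] real_val_shift[OF multiaffine_pdiff[OF mF]]
    by (simp add: divide_right_mono)
qed

text \<open>Coordinates are lowered one by one. If the denominator so far is \<open>q\<close>, the
  next coordinate has barrier at most \<open>Phi k F x / q\<close>, and \<open>q * (1 - \<delta> *
  Phi k F x / q) = q - \<delta> * Phi k F x\<close>; so the product of the denominators is linear in
  the sum of the barriers.\<close>

lemma above_down: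
  assumes F: "real_stable T F" and x: "above F x" and d: "\<delta> \<ge> 0" and "finite b" "\<delta> * (\<Sum>i\<in>b. Phi i F x) < 1"
  shows "above F (\<lambda>i. if i \<in> b then x i - \<delta> else x i) \<and>
    (\<forall>j. Phi j F (\<lambda>i. if i \<in> b then x i - \<delta> else x i) \<le> Phi j F x / (1 - \<delta> * (\<Sum>i\<in>b. Phi i F x)))"
  using assms(4,5)
proof (induction b)
  case empty
  then show ?case using x by simp
next
  case (insert k b)
  note mF = real_stable_multiaffine[OF F]
  let ?y = "\<lambda>i. if i \<in> b then x i - \<delta> else x i"
  let ?s = "\<Sum>i\<in>b. Phi i F x"
  have p0: "Phi k F x \<ge> 0" by (rule Phi_nonneg[OF mF x])
  have le: "\<delta> * ?s + \<delta> * Phi k F x < 1" using insert by (simp add: algebra_simps)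
  have "\<delta> * ?s < 1" using le mult_nonneg_nonneg[OF d p0] by linarith
  then have IH: "above F ?y" "\<And>j. Phi j F ?y \<le> Phi j F x / (1 - \<delta> * ?s)"
    using insert.IH by auto
  have pos: "1 - \<delta> * ?s > 0" using \<open>\<delta> * ?s < 1\<close> by simp
  have e: "(\<lambda>i. if i \<in> insert k b then x i - \<delta> else x i) = ?y(k := ?y k - \<delta>)"
    using insert(2) by auto
  have "\<delta> * Phi k F ?y \<le> \<delta> * (Phi k F x / (1 - \<delta> * ?s))"
    by (intro mult_left_mono IH d)
  then have 1: "\<delta> * Phi k F ?y \<le> \<delta> * Phi k F x / (1 - \<delta> * ?s)" by simp
  have 2: "\<delta> * Phi k F x / (1 - \<delta> * ?s) < 1" using le pos by (simp add: field_simps)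
  have lt: "\<delta> * Phi k F ?y < 1" using 1 2 by linarith
  have e1: "A / q / (1 - d / q) = A / (q - d)" if "q > 0" for A q d :: real
  proof -
    have "1 - d / q = (q - d) / q" using that by (simp add: diff_divide_distrib)
    then show ?thesis using that by simp
  qed
  have e2: "A / (1 - \<delta> * ?s) / (1 - \<delta> * Phi k F x / (1 - \<delta> * ?s)) = A / (1 - \<delta> * (\<Sum>i\<in>insert k b. Phi i F x))" for A
    unfolding e1[OF pos] using insert(1,2) by (simp add: distrib_left)
  show ?case unfolding e
  proof (intro conjI allI)
    show "above F (?y(k := ?y k - \<delta>))" by (rule above_down1(1)[OF F IH(1) d lt])
    fix j
    have "Phi j F (?y(k := ?y k - \<delta>)) \<le> Phi j F ?y / (1 - \<delta> * Phi k F ?y)"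
      by (rule above_down1(2)[OF F IH(1) d lt])
    also have "\<dots> \<le> (Phi j F x / (1 - \<delta> * ?s)) / (1 - \<delta> * Phi k F x / (1 - \<delta> * ?s))"
      using 1 2 IH(2)[of j] Phi_nonneg[OF mF x, of j] pos by (intro frac_le) auto
    also have "\<dots> = Phi j F x / (1 - \<delta> * (\<Sum>i\<in>insert k b. Phi i F x))"
      by (rule e2)
    finally show "Phi j F (?y(k := ?y k - \<delta>)) \<le> Phi j F x / (1 - \<delta> * (\<Sum>i\<in>insert k b. Phi i F x))" .
  qed
qed

section \<open>The boundary of the region above the zeros, and the choice of one index\<close>

lemma real_val_ray_tendsto:
  assumes "multiaffine T F"
  shows "((\<lambda>e. real_val F (\<lambda>i. x i + e)) \<longlongrightarrow> real_val F x) (at_right 0)"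
proof -
  have fT: "finite T" using assms by (simp add: multiaffine_def)
  obtain p where p: "\<And>t. poly p t = F (\<lambda>i. if i \<in> T then cvec x i + t * 1 else cvec x i)"
    using multiaffine_line[OF assms fT, where a = "cvec x" and d = "\<lambda>_. 1"] by blast
  have "real_val F (\<lambda>i. x i + e) = Re (poly p (of_real e))" for e
    unfolding real_val_def p by (intro arg_cong[of _ _ Re] multiaffine_dep[OF assms]) (auto simp: cvec_def)
  moreover have "((\<lambda>e::real. Re (poly p (of_real e))) \<longlongrightarrow> Re (poly p (of_real 0))) (at_right 0)"
    by (intro tendsto_intros)
  moreover have "Re (poly p (of_real 0)) = real_val F x"
    unfolding real_val_def p by (intro arg_cong[of _ _ Re] multiaffine_dep[OF assms]) (auto simp: cvec_def)
  ultimately show ?thesis by simp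
qed

lemma closure_nonneg:
  assumes "multiaffine T F" "\<And>e. e > 0 \<Longrightarrow> above F (\<lambda>i. x i + e)" "\<And>i. x i \<le> y i"
  shows "real_val F y \<ge> 0"
proof (rule tendsto_lowerbound[OF real_val_ray_tendsto[OF assms(1), of y]])
  show "\<forall>\<^sub>F e in at_right 0. 0 \<le> real_val F (\<lambda>i. y i + e)"
  proof (rule eventually_at_rightI[of 0 1])
    fix e :: real assume "e \<in> {0<..<1}"
    then have "above F (\<lambda>i. x i + e)" using assms(2) by simp
    then show "0 \<le> real_val F (\<lambda>i. y i + e)"
      unfolding above_def using assms(3) by (simp add: less_imp_le)
  qed simp
qed simp

text \<open>At a limit of points above the zeros all values upward, and hence all derivatives, are
  nonnegative; so \<open>F\<close> does not fall below its positive value at \<open>x\<close> when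
  coordinates are raised one after the other.\<close>

lemma closure_above:
  assumes mF: "multiaffine T F" and cl: "\<And>e. e > 0 \<Longrightarrow> above F (\<lambda>i. x i + e)" and pos: "real_val F x > 0"
  shows "above F x"
  unfolding above_def
proof (intro allI impI)
  fix y assume xy: "\<forall>i. x i \<le> y i"
  have fT: "finite T" using mF by (simp add: multiaffine_def)
  have "real_val F (\<lambda>i. if i \<in> S then y i else x i) \<ge> real_val F x" if "finite S" for S
    using that
  proof (induction S)
    case (insert k S)
    let ?z = "\<lambda>i. if i \<in> S then y i else x i"
    have e: "(\<lambda>i. if i \<in> insert k S then y i else x i) = ?z(k := ?z k + (y k - ?z k))"
      by auto
    have "real_val (pdiff k F) ?z \<ge> 0"
    proof (rule nonneg_pdiff[OF mF])
      fix u assume u: "\<And>i. (if i \<in> S then y i else x i) \<le> u i"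
      show "real_val F u \<ge> 0"
      proof (rule closure_nonneg[OF mF cl])
        show "x i \<le> u i" for i using u[of i] xy[rule_format, of i] by (auto split: if_splits)
      qed
    qed
    moreover have "y k - ?z k \<ge> 0" using xy by auto
    ultimately have "(y k - ?z k) * real_val (pdiff k F) ?z \<ge> 0" by (rule mult_nonneg_nonneg[rotated])
    moreover have "real_val F (?z(k := ?z k + (y k - ?z k))) = real_val F ?z + (y k - ?z k) * real_val (pdiff k F) ?z"
      by (rule real_val_shift[OF mF])
    ultimately show ?case unfolding e using insert.IH by linarith
  qed simp
  then have "real_val F (\<lambda>i. if i \<in> T then y i else x i) > 0" using fT pos by (meson less_le_trans)
  moreover have "real_val F (\<lambda>i. if i \<in> T then y i else x i) = real_val F y" by (rule real_val_cong[OF mF]) auto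
  ultimately show "real_val F y > 0" by simp
qed

text \<open>Lowering all coordinates by \<open>e\<close> uses up \<open>e\<close> times the total
  barrier, which the choice of \<open>e\<close> keeps below 1.\<close>

lemma above_open:
  assumes F: "real_stable T F" and x: "above F x"
  shows "\<exists>e>0. above F (\<lambda>i. x i - e)"
proof -
  note mF = real_stable_multiaffine[OF F]
  have fT: "finite T" using mF by (simp add: multiaffine_def)
  define s where "s = (\<Sum>i\<in>T. Phi i F x)"
  have s: "s \<ge> 0" unfolding s_def by (intro sum_nonneg Phi_nonneg[OF mF x])
  define e where "e = 1 / (s + 1)"
  have e: "e > 0" "e * s < 1" using s by (auto simp: e_def field_simps)
  have "above F (\<lambda>i. if i \<in> T then x i - e else x i)"
    using above_down[OF F x _ fT, of e] e unfolding s_def by simp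
  then have "above F (\<lambda>i. x i - e)" by (rule above_mono_on[OF mF]) auto
  then show ?thesis using e by blast
qed

text \<open>\<open>t\<close> is the infimum of the nonnegative shifts along the all-ones vector that
  end above the zeros. Openness of that region prevents the infimum from being attained, and this
  provides a boundary point at which \<open>F\<close> can be examined.\<close>

lemma boundary:
  assumes F: "real_stable T F" and x0: "above F x0" and x: "\<not> above F x"
  obtains t where "t \<ge> 0" "\<And>e. e > 0 \<Longrightarrow> above F (\<lambda>i. x i + t + e)" "\<not> above F (\<lambda>i. x i + t)"
proof -
  note mF = real_stable_multiaffine[OF F]
  have fT: "finite T" using mF by (simp add: multiaffine_def)
  define S where "S = {t. t \<ge> 0 \<and> above F (\<lambda>i. x i + t)}"
  define t0 where "t0 = (\<Sum>i\<in>T. \<bar>x0 i - x i\<bar>)"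
  have "above F (\<lambda>i. x i + t0)"
  proof (rule above_mono_on[OF mF x0])
    fix i assume "i \<in> T"
    then have "\<bar>x0 i - x i\<bar> \<le> t0" unfolding t0_def by (intro member_le_sum fT) auto
    then show "x0 i \<le> x i + t0" by linarith
  qed
  then have S: "S \<noteq> {}" unfolding S_def t0_def by (auto intro!: exI[of _ t0] simp: t0_def sum_nonneg)
  have bdd: "bdd_below S" by (rule bdd_belowI[of _ 0]) (simp add: S_def)
  define t where "t = Inf S"
  have t: "t \<ge> 0" unfolding t_def by (rule cInf_greatest[OF S]) (simp add: S_def)
  have raise_on: "above F (\<lambda>i. x i + t + e)" if "e > 0" for e
  proof -
    have "Inf S < t + e" using that by (simp add: t_def)
    then obtain s where "s \<in> S" "s < t + e" using cInf_lessD[OF S] by blast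
    then show ?thesis unfolding S_def by (auto intro: above_mono[of F "\<lambda>i. x i + s"])
  qed
  have "\<not> above F (\<lambda>i. x i + t)"
  proof
    assume a: "above F (\<lambda>i. x i + t)"
    then obtain e where e: "e > 0" "above F (\<lambda>i. x i + t - e)" using above_open[OF F] by blast
    have "t > 0" using a x t by (cases "t = 0") auto
    have "above F (\<lambda>i. x i + max 0 (t - e))" by (rule above_mono[OF e(2)]) auto
    then have "max 0 (t - e) \<in> S" by (simp add: S_def)
    then have "t \<le> max 0 (t - e)" unfolding t_def by (rule cInf_lower[OF _ bdd])
    then show False using e(1) \<open>t > 0\<close> by linarith
  qed
  then show ?thesis using that t raise_on by blast
qed

text \<open>At a point above the zeros of the average, the barriers of the block sum to less than 1,
  the total probability. So some \<open>Phi s F x\<close> is below \<open>p s\<close>, which is the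
  room needed to lower coordinate \<open>s\<close> by \<open>1 / p s\<close>.\<close>

lemma selection_upper:
  assumes F: "real_stable T F" and x0: "above F x0" and x: "above (add_partials (-1) b F) x"
    and p: "\<And>s. s \<in> b \<Longrightarrow> p s > 0" and p1: "sum p b = 1"
  shows "\<exists>s\<in>b. above F (x(s := x s - 1 / p s))"
proof -
  note mF = real_stable_multiaffine[OF F]
  \<comment> \<open>Positivity has to be passed from the average to \<open>F\<close>. Otherwise the
    orthant of a boundary point contains a \<open>y\<close> with \<open>F\<close> nonpositive and
    all derivatives nonnegative, and there the average would be nonpositive as well.\<close>
  have aF: "above F x"
  proof (rule ccontr)
    assume "\<not> above F x"
    then obtain t where t: "t \<ge> 0" "\<And>e. e > 0 \<Longrightarrow> above F (\<lambda>i. x i + t + e)" "\<not> above F (\<lambda>i. x i + t)"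
      using boundary[OF F x0] by blast
    from t(3) obtain y where y: "\<And>i. x i + t \<le> y i" "real_val F y \<le> 0" unfolding above_def not_all not_imp not_less by blast
    have norm_sq: "real_val F u \<ge> 0" if "\<And>i. y i \<le> u i" for u
      by (rule closure_nonneg[OF mF t(2)], assumption, rule order_trans[OF y(1) that])
    have "(\<Sum>i\<in>b. real_val (pdiff i F) y) \<ge> 0" by (intro sum_nonneg nonneg_pdiff[OF mF norm_sq])
    then have "real_val (add_partials (-1) b F) y \<le> 0" using y(2) by (simp add: real_val_add_partials)
    moreover have "x i \<le> y i" for i using y(1)[of i] t(1) by linarith
    ultimately show False using x[unfolded above_def, rule_format, of y] by simp
  qed
  have Fx: "real_val F x > 0" using aF by (rule aboveD)
  have "real_val (add_partials (-1) b F) x > 0" using x by (rule aboveD)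
  also have "real_val (add_partials (-1) b F) x = real_val F x * (1 - (\<Sum>i\<in>b. Phi i F x))"
    using Fx by (simp add: real_val_add_partials Phi_def sum_divide_distrib[symmetric] field_simps)
  finally have lt: "(\<Sum>i\<in>b. Phi i F x) < sum p b" using Fx by (simp add: zero_less_mult_iff p1)
  have "\<exists>s\<in>b. Phi s F x < p s"
  proof (rule ccontr)
    assume "\<not> ?thesis"
    then have "sum p b \<le> (\<Sum>i\<in>b. Phi i F x)" by (intro sum_mono) force
    then show False using lt by simp
  qed
  then obtain s where s: "s \<in> b" "Phi s F x < p s" by blast
  have "above F (x(s := x s - 1 / p s))"
    by (rule above_down1(1)[OF F aF]) (use s p[OF s(1)] in \<open>auto simp: field_simps\<close>)
  then show ?thesis using s by blast
qed

text \<open>\<open>card b\<close> times the average is the sum of the values of \<open>F\<close>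
  after raising one coordinate of \<open>b\<close> by \<open>C\<close>. If no choice ended above the
  zeros, all of them could be shifted along the all-ones vector until the first one touches the
  closure of the region; there every value in the sum is at most 0, against the positivity of the
  average.\<close>

lemma selection_lower:
  assumes F: "real_stable T F" and x0: "above F x0" and b: "finite b" "b \<noteq> {}" and c: "c \<ge> 0"
    and x: "above (add_partials c b F) x"
  shows "\<exists>s\<in>b. above F (x(s := x s + c * card b))"
proof (rule ccontr)
  note mF = real_stable_multiaffine[OF F]
  define C where "C = c * card b"
  have C: "C \<ge> 0" using c by (simp add: C_def)
  assume "\<not> ?thesis"
  then have no: "\<not> above F (x(s := x s + C))" if "s \<in> b" for s using that by (simp add: C_def)
  have "\<forall>s\<in>b. \<exists>t\<ge>0. (\<forall>e>0. above F (\<lambda>i. (x(s := x s + C)) i + t + e)) \<and> \<not> above F (\<lambda>i. (x(s := x s + C)) i + t)"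
    using boundary[OF F x0 no] by metis
  then obtain t where t: "\<And>s. s \<in> b \<Longrightarrow> t s \<ge> 0"
      "\<And>s e. s \<in> b \<Longrightarrow> e > 0 \<Longrightarrow> above F (\<lambda>i. (x(s := x s + C)) i + t s + e)"
      "\<And>s. s \<in> b \<Longrightarrow> \<not> above F (\<lambda>i. (x(s := x s + C)) i + t s)"
    by metis
  \<comment> \<open>\<open>r\<close> is an index that needs the smallest shift, so that at
    \<open>y\<close> the choice \<open>r\<close> is on the boundary and no choice is inside.\<close>
  obtain r where r: "r \<in> b" "\<And>s. s \<in> b \<Longrightarrow> t r \<le> t s"
  proof -
    have "Min (t ` b) \<in> t ` b" using b by (intro Min_in) auto
    then obtain r where "r \<in> b" "t r = Min (t ` b)" by force
    then show ?thesis using that[of r] b by auto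
  qed
  define y where "y = (\<lambda>i. x i + t r)"
  have P: "(\<lambda>i. (x(s := x s + C)) i + t r) = y(s := y s + C)" for s by (auto simp: y_def)
  have nab: "\<not> above F (y(s := y s + C))" if "s \<in> b" for s
    using t(3)[OF that] r(2)[OF that] unfolding P[symmetric] by (meson above_mono add_left_mono)
  have cl: "above F (\<lambda>i. (y(r := y r + C)) i + e)" if "e > 0" for e
    using t(2)[OF r(1) that] unfolding fun_cong[OF P[of r]] .
  have "real_val F (y(s := y s + C)) \<le> 0" if s: "s \<in> b" for s
  proof (rule ccontr)
    assume "\<not> ?thesis"
    then have pos: "real_val F (y(s := y s + C)) > 0" by simp
    then have "eventually (\<lambda>e. real_val F (\<lambda>i. (y(s := y s + C)) i + e) > 0) (at_right 0)"
      using order_tendstoD(1)[OF real_val_ray_tendsto[OF mF]] by blast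
    then obtain e0 where e0: "e0 > 0" "\<And>e. 0 < e \<Longrightarrow> e < e0 \<Longrightarrow> real_val F (\<lambda>i. (y(s := y s + C)) i + e) > 0"
      unfolding eventually_at_right_field by auto
    have small: "above F (\<lambda>i. (y(s := y s + C)) i + e)" if e: "0 < e" "e < e0" for e
    proof (cases "s = r")
      case True
      then show ?thesis using cl[OF e(1)] by simp
    next
      case False
      \<comment> \<open>The way from choice \<open>r\<close> to choice \<open>s\<close> leads
        through the point with both coordinates raised. It lies above the boundary point of
        \<open>r\<close>, and since taking \<open>C\<close> off coordinate \<open>r\<close> leaves
        \<open>F\<close> positive, \<open>C * Phi r F u < 1\<close> and \<open>above_down1\<close>
        applies.\<close>
      define u where "u = (\<lambda>i. y i + e + (if i = s \<or> i = r then C else 0))"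
      have au: "above F u" by (rule above_mono[OF cl[OF e(1)]]) (use C in \<open>auto simp: u_def\<close>)
      have eq: "(\<lambda>i. (y(s := y s + C)) i + e) = u(r := u r + - C)" using False by (auto simp: u_def)
      have "real_val F (u(r := u r + - C)) > 0" using e0(2)[OF e] unfolding eq .
      then have "real_val F u + - C * real_val (pdiff r F) u > 0" by (simp only: real_val_shift[OF mF])
      then have "C * Phi r F u < 1" using aboveD[OF au] by (simp add: Phi_def field_simps)
      from above_down1(1)[OF F au C this] show ?thesis unfolding eq by simp
    qed
    have "above F (y(s := y s + C))"
    proof (rule closure_above[OF mF _ pos])
      fix e :: real assume "e > 0"
      then have "above F (\<lambda>i. (y(s := y s + C)) i + min e (e0 / 2))"
        using e0(1) by (intro small) auto
      then show "above F (\<lambda>i. (y(s := y s + C)) i + e)" by (rule above_mono) auto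
    qed
    then show False using nab[OF s] by simp
  qed
  then have "(\<Sum>s\<in>b. real_val F (y(s := y s + C))) \<le> 0" by (rule sum_nonpos)
  moreover have "(\<Sum>s\<in>b. real_val F (y(s := y s + C))) = card b * real_val (add_partials c b F) y"
    unfolding real_val_shift[OF mF] real_val_add_partials by (simp add: C_def sum.distrib sum_distrib_left algebra_simps)
  ultimately have "real_val (add_partials c b F) y \<le> 0" using b by (simp add: mult_le_0_iff card_gt_0_iff)
  moreover have "\<forall>i. x i \<le> y i" using t(1)[OF r(1)] by (simp add: y_def)
  ultimately show False using x[unfolded above_def, rule_format, of y] by simp
qed

section \<open>Convexity of the barrier functions along blocks\<close>

text \<open>Near \<open>\<rho>\<close> the quotient \<open>r / p\<close> behaves like
  \<open>c\<close> times the power \<open>- m\<close> of \<open>w - \<rho>\<close>. On small half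
  circles above \<open>\<rho>\<close> its argument runs through an interval of length
  \<open>m * pi\<close>, while the imaginary part may not become positive. This forces
  \<open>m = 1\<close> and then \<open>c\<close> real and nonnegative.\<close>

lemma root_simple:
  fixes p r :: "complex poly"
  assumes H: "\<And>w. Im w > 0 \<Longrightarrow> Im (poly r w * cnj (poly p w)) \<le> 0"
    and p: "p = [:-\<rho>, 1:] ^ m * q" and q: "poly q \<rho> \<noteq> 0" and r: "poly r \<rho> \<noteq> 0"
    and \<rho>: "Im \<rho> = 0" and m: "m \<ge> 1"
  shows "m = 1 \<and> Im (poly r \<rho> / poly q \<rho>) = 0 \<and> Re (poly r \<rho> / poly q \<rho>) \<ge> 0"
proof -
  define c where "c = poly r \<rho> / poly q \<rho>"
  have c0: "c \<noteq> 0" using q r by (simp add: c_def)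
  have key: "Im (c * cis (- (m * \<theta>))) \<le> 0" if \<theta>: "0 < \<theta>" "\<theta> < pi" for \<theta> :: real
  proof -
    let ?w = "\<lambda>e::real. \<rho> + of_real e * cis \<theta>"
    let ?g = "\<lambda>e::real. poly r (?w e) / poly q (?w e) * cis (- (m * \<theta>))"
    have lim: "(?g \<longlongrightarrow> poly r (?w 0) / poly q (?w 0) * cis (- (m * \<theta>))) (at_right 0)"
      using q by (intro tendsto_intros) auto
    have "((\<lambda>e. poly q (?w e)) \<longlongrightarrow> poly q (?w 0)) (at_right (0::real))"
      by (intro tendsto_intros)
    then have ev: "eventually (\<lambda>e. poly q (?w e) \<noteq> 0) (at_right (0::real))"
      using q by (intro tendsto_imp_eventually_ne[of _ "poly q (?w 0)"]) auto
    have "eventually (\<lambda>e. Im (?g e) \<le> 0) (at_right (0::real))"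
      using ev eventually_at_right_less
    proof eventually_elim
      case (elim e)
      let ?W = "?w e"
      have pw: "poly p ?W = of_real (e ^ m) * cis (m * \<theta>) * poly q ?W"
        by (simp add: p power_mult_distrib Complex.DeMoivre)
      have imw: "Im ?W > 0" using elim \<theta> \<rho> by (simp add: sin_gt_zero)
      define G where "G = ?g e"
      have "poly r ?W = G * poly q ?W * cis (m * \<theta>)"
        using elim by (simp add: G_def cis_mult)
      then have "poly r ?W * cnj (poly p ?W) = G * of_real (e ^ m * (cmod (poly q ?W))\<^sup>2)"
        unfolding pw
        by (simp add: cis_cnj complex_norm_square[symmetric] cis_mult mult_ac)
      then have "Im G * (e ^ m * (cmod (poly q ?W))\<^sup>2) \<le> 0"
        using H[OF imw] by simp
      moreover have "e ^ m * (cmod (poly q ?W))\<^sup>2 > 0" using elim by simp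
      ultimately have "Im G \<le> 0" by (metis mult_le_0_iff not_le)
      then show "Im (?g e) \<le> 0" unfolding G_def .
    qed
    then have "Im (poly r (?w 0) / poly q (?w 0) * cis (- (m * \<theta>))) \<le> 0"
      by (intro tendsto_upperbound[OF tendsto_Im[OF lim]]) auto
    then show ?thesis by (simp add: c_def)
  qed
  have m1: "m = 1"
  proof (rule ccontr)
    assume "m \<noteq> 1"
    then have m2: "m \<ge> 2" using m by simp
    \<comment> \<open>For \<open>m \<ge> 2\<close> both \<open>\<phi>\<close> and
      \<open>\<phi> + pi\<close> have the form \<open>m * \<theta>\<close> with
      \<open>\<theta>\<close> between 0 and \<open>pi\<close>, and the two resulting numbers are
      negatives of each other.\<close>
    have k: "Im (c * cis (- \<phi>)) = 0" if \<phi>: "0 < \<phi>" "\<phi> < pi" for \<phi> :: real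
    proof -
      have "2 * pi \<le> real m * pi" using m2 by (intro mult_right_mono) auto
      then have "\<phi> < real m * pi" "\<phi> + pi < real m * pi" using \<phi> by linarith+
      then have "Im (c * cis (- (m * (\<phi> / m)))) \<le> 0" "Im (c * cis (- (m * ((\<phi> + pi) / m)))) \<le> 0"
        using \<phi> m2 by (intro key; simp add: field_simps)+
      moreover have "cis (- \<phi> - pi) = - cis (- \<phi>)" by (simp add: cis.ctr complex_eq_iff cos_diff sin_diff)
      ultimately show ?thesis using m2 by simp
    qed
    have "Re c = 0" using k[of "pi/2"] by simp
    moreover have "Im c = 0" using k[of "pi/4"] \<open>Re c = 0\<close> by (simp add: cos_45)
    ultimately show False using c0 by (simp add: complex_eq_iff)
  qed
  have key1: "Im c * cos \<theta> - Re c * sin \<theta> \<le> 0" if "0 < \<theta>" "\<theta> < pi" for \<theta>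
    using key[OF that] m1 by (simp add: algebra_simps)
  have re: "Re c \<ge> 0" using key1[of "pi/2"] by simp
  have "Im c * cos 0 - Re c * sin 0 \<le> 0"
  proof (rule tendsto_upperbound)
    show "((\<lambda>\<theta>. Im c * cos \<theta> - Re c * sin \<theta>) \<longlongrightarrow> Im c * cos 0 - Re c * sin 0) (at_right 0)"
      by (intro tendsto_intros)
    show "\<forall>\<^sub>F \<theta> in at_right 0. Im c * cos \<theta> - Re c * sin \<theta> \<le> 0"
      by (rule eventually_at_rightI[of 0 pi]) (use key1 in auto)
  qed simp
  moreover have "Im c * cos pi - Re c * sin pi \<le> 0"
  proof (rule tendsto_upperbound)
    show "((\<lambda>\<theta>. Im c * cos \<theta> - Re c * sin \<theta>) \<longlongrightarrow> Im c * cos pi - Re c * sin pi) (at_left pi)"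
      by (intro tendsto_intros)
    show "\<forall>\<^sub>F \<theta> in at_left pi. Im c * cos \<theta> - Re c * sin \<theta> \<le> 0"
      by (rule eventually_at_leftI[of 0]) (use key1 in auto)
  qed simp
  ultimately show ?thesis using m1 re unfolding c_def by simp
qed

text \<open>By \<open>root_simple\<close> the quotient has simple real poles with nonnegative
  residues, so its expansion consists of a constant and terms \<open>a / (w - \<rho>)\<close> with
  \<open>a \<ge> 0\<close>. Such terms are convex to the right of their poles, which is what the
  barrier argument uses.\<close>

lemma partial_fractions_coprime:
  fixes p r :: "complex poly"
  assumes p0: "p \<noteq> 0" and roots: "\<And>w. poly p w = 0 \<Longrightarrow> Im w = 0 \<and> poly r w \<noteq> 0"
    and H: "\<And>w. Im w > 0 \<Longrightarrow> Im (poly r w * cnj (poly p w)) \<le> 0"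
    and deg: "degree r \<le> degree p"
  shows "\<exists>\<beta> a. (\<forall>\<rho>. a \<rho> \<ge> (0::real)) \<and>
    (\<forall>w. poly p w \<noteq> 0 \<longrightarrow> poly r w / poly p w = \<beta> + (\<Sum>\<rho> | poly p \<rho> = 0. of_real (a \<rho>) / (w - \<rho>)))"
proof -
  define Z where "Z = {\<rho>. poly p \<rho> = 0}"
  have fZ: "finite Z" unfolding Z_def by (rule poly_roots_finite[OF p0])
  have ord: "Polynomial.order \<rho> p = 1" if "\<rho> \<in> Z" for \<rho>
  proof -
    obtain q where q: "p = [:- \<rho>, 1:] ^ Polynomial.order \<rho> p * q" "\<not> [:- \<rho>, 1:] dvd q"
      using order_decomp[OF p0] by blast
    have "Polynomial.order \<rho> p \<ge> 1" using that p0 order_root[of p \<rho>] by (simp add: Z_def Suc_le_eq)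
    then show ?thesis
      using root_simple[OF H q(1)] q(2) roots[of \<rho>] that by (auto simp: Z_def poly_eq_0_iff_dvd)
  qed
  define lc where "lc = lead_coeff p"
  have lc: "lc \<noteq> 0" using p0 by (simp add: lc_def)
  have "p = Polynomial.smult lc (\<Prod>z\<in>Z. [:-z, 1:] ^ Polynomial.order z p)"
    using complex_poly_decompose[of p] by (simp add: Z_def lc_def)
  also have "(\<Prod>z\<in>Z. [:-z, 1:] ^ Polynomial.order z p) = (\<Prod>z\<in>Z. [:-z, 1:])"
    by (intro prod.cong) (simp_all add: ord)
  finally have pZ: "p = Polynomial.smult lc (\<Prod>z\<in>Z. [:-z, 1:])" .
  define P where "P = (\<lambda>z. Polynomial.smult lc (\<Prod>y\<in>Z - {z}. [:-y, 1:]))"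
  have pP: "p = [:-z, 1:] * P z" if "z \<in> Z" for z
    unfolding pZ P_def using prod.remove[OF fZ that, of "\<lambda>z. [:-z, 1:]"] by simp
  have Pz: "poly (P z) z \<noteq> 0" if "z \<in> Z" for z
    using fZ lc by (auto simp: P_def poly_prod)
  have Pzy: "poly (P z) y = 0" if "y \<in> Z" "y \<noteq> z" for z y
    using fZ that by (auto simp: P_def poly_prod)
  have degp: "degree p = card Z"
    unfolding pZ using lc by (simp add: degree_prod_sum_eq)
  have degP: "degree (P z) < card Z" if "z \<in> Z" for z
    using that fZ lc card_gt_0_iff[of Z] by (auto simp: P_def degree_prod_sum_eq)
  define c where "c = (\<lambda>z. poly r z / poly (P z) z)"
  have cz: "Im (c z) = 0 \<and> Re (c z) \<ge> 0" if "z \<in> Z" for z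
    unfolding c_def using root_simple[OF H, of z 1 "P z"] pP[OF that] Pz[OF that] roots[of z] that
    by (auto simp: Z_def)
  \<comment> \<open>Subtracting this multiple of \<open>p\<close> removes the top coefficient of
    \<open>r\<close>. If there are roots, the difference has degree below their number and is found
    by Lagrange interpolation at them.\<close>
  define \<beta> where "\<beta> = coeff r (degree p) / lc"
  define q where "q = r - Polynomial.smult \<beta> p"
  have degq: "degree q < card Z" if "Z \<noteq> {}"
  proof -
    have "coeff q (degree p) = 0" using lc by (simp add: q_def \<beta>_def lc_def)
    moreover have "degree q \<le> degree p" unfolding q_def using deg by (intro degree_diff_le) auto
    moreover have "degree p > 0" using that fZ by (simp add: degp card_gt_0_iff)
    ultimately show ?thesis
      by (metis degp eq_zero_or_degree_less le_neq_implies_less leading_coeff_0_iff degree_0)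
  qed
  have q_eq: "q = (\<Sum>z\<in>Z. Polynomial.smult (c z) (P z))"
  proof (cases "Z = {}")
    case True
    then have "degree p = 0" "degree r = 0" using degp deg by auto
    then have "p = [:lc:]" "r = [:coeff r 0:]"
      unfolding lc_def by (auto elim!: degree_eq_zeroE)
    then show ?thesis using True lc \<open>degree p = 0\<close> by (simp add: q_def \<beta>_def)
  next
    case False
    show ?thesis
    proof (rule poly_eqI_degree[of Z])
      fix y assume y: "y \<in> Z"
      have "poly (\<Sum>z\<in>Z. Polynomial.smult (c z) (P z)) y = (\<Sum>z\<in>Z. if z = y then c y * poly (P y) y else 0)"
        unfolding poly_sum by (intro sum.cong refl) (use Pzy[OF y] in auto)
      also have "\<dots> = poly q y"
        using y fZ Pz[OF y] by (simp add: c_def q_def Z_def)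
      finally show "poly q y = poly (\<Sum>z\<in>Z. Polynomial.smult (c z) (P z)) y" ..
    next
      show "degree q < card Z" using degq False .
      show "degree (\<Sum>z\<in>Z. Polynomial.smult (c z) (P z)) < card Z"
        using False fZ by (intro degree_sum_less) (auto intro: degP simp: card_gt_0_iff)
    qed
  qed
  have main: "poly r w / poly p w = \<beta> + (\<Sum>\<rho>\<in>Z. of_real (Re (c \<rho>)) / (w - \<rho>))" if w: "poly p w \<noteq> 0" for w
  proof -
    have "poly r w = \<beta> * poly p w + (\<Sum>z\<in>Z. c z * poly (P z) w)"
      using arg_cong[OF q_eq, of "\<lambda>q. poly q w"] by (simp add: q_def poly_sum algebra_simps)
    then have "poly r w / poly p w = \<beta> + (\<Sum>z\<in>Z. c z * poly (P z) w / poly p w)"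
      using w by (simp add: add_divide_distrib sum_divide_distrib)
    also have "(\<Sum>z\<in>Z. c z * poly (P z) w / poly p w) = (\<Sum>\<rho>\<in>Z. of_real (Re (c \<rho>)) / (w - \<rho>))"
    proof (intro sum.cong refl)
      fix z assume z: "z \<in> Z"
      have "poly p w = poly ([:-z, 1:] * P z) w" using pP[OF z] by simp
      then have "poly p w = (w - z) * poly (P z) w" by (simp add: algebra_simps)
      moreover have "of_real (Re (c z)) = c z" using cz[OF z] by (simp add: complex_eq_iff)
      ultimately show "c z * poly (P z) w / poly p w = of_real (Re (c z)) / (w - z)"
        using w by auto
    qed
    finally show ?thesis .
  qed
  have "(\<Sum>\<rho>\<in>Z. of_real (Re (c \<rho>)) / (w - \<rho>)) = (\<Sum>\<rho>\<in>Z. of_real (if \<rho> \<in> Z then Re (c \<rho>) else 0) / (w - \<rho>))" for w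
    by (intro sum.cong) auto
  note main' = main[unfolded this]
  show ?thesis
    by (rule exI[of _ \<beta>], rule exI[of _ "\<lambda>\<rho>. if \<rho> \<in> Z then Re (c \<rho>) else 0"])
      (use cz main' in \<open>simp add: Z_def\<close>)
qed

text \<open>Common roots are divided out. A common factor \<open>w - z\<close> changes
  \<open>poly r w * cnj (poly p w)\<close> only by the positive factor
  \<open>(cmod (w - z))\<^sup>2\<close>, so the sign hypothesis survives; the poles that remain form
  a subset \<open>Z\<close> of the roots.\<close>

lemma partial_fractions:
  fixes p r :: "complex poly"
  assumes "p \<noteq> 0" and "\<And>w. poly p w = 0 \<Longrightarrow> Im w = 0"
    and "\<And>w. Im w > 0 \<Longrightarrow> Im (poly r w * cnj (poly p w)) \<le> 0"
    and "degree r \<le> degree p"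
  shows "\<exists>\<beta> a Z. finite Z \<and> (\<forall>\<rho>\<in>Z. poly p \<rho> = 0) \<and> (\<forall>\<rho>. a \<rho> \<ge> (0::real)) \<and>
    (\<forall>w. poly p w \<noteq> 0 \<longrightarrow> poly r w / poly p w = \<beta> + (\<Sum>\<rho>\<in>Z. of_real (a \<rho>) / (w - \<rho>)))"
  using assms
proof (induction "degree p" arbitrary: p r rule: less_induct)
  case less
  show ?case
  proof (cases "\<exists>z. poly p z = 0 \<and> poly r z = 0")
    case False
    then obtain \<beta> a where "\<forall>\<rho>. a \<rho> \<ge> (0::real)"
      "\<forall>w. poly p w \<noteq> 0 \<longrightarrow> poly r w / poly p w = \<beta> + (\<Sum>\<rho> | poly p \<rho> = 0. of_real (a \<rho>) / (w - \<rho>))"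
      using partial_fractions_coprime[of p r] less.prems by blast
    then show ?thesis using poly_roots_finite[OF less.prems(1)]
      by (intro exI[of _ \<beta>] exI[of _ a] exI[of _ "{\<rho>. poly p \<rho> = 0}"]) auto
  next
    case True
    then obtain z where z: "poly p z = 0" "poly r z = 0" by blast
    then obtain p1 r1 where pr: "p = [:-z, 1:] * p1" "r = [:-z, 1:] * r1"
      by (metis poly_eq_0_iff_dvd dvdE)
    have p1: "p1 \<noteq> 0" using less.prems(1) pr by auto
    have dp: "degree p = Suc (degree p1)" unfolding pr using p1 by (subst degree_mult_eq) auto
    have dr: "degree r1 \<le> degree p1"
    proof (cases "r1 = 0")
      case False
      then have "degree r = Suc (degree r1)" unfolding pr by (subst degree_mult_eq) auto
      then show ?thesis using dp less.prems(4) by simp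
    qed simp
    have Hz: "Im (poly r1 w * cnj (poly p1 w)) \<le> 0" if w: "Im w > 0" for w
    proof -
      have "poly r w * cnj (poly p w) = of_real ((cmod (w - z))\<^sup>2) * (poly r1 w * cnj (poly p1 w))"
        unfolding pr complex_norm_square by (simp add: algebra_simps)
      then have "(cmod (w - z))\<^sup>2 * Im (poly r1 w * cnj (poly p1 w)) \<le> 0"
        using less.prems(3)[OF w] by simp
      moreover have "w \<noteq> z" using w less.prems(2)[OF z(1)] by auto
      ultimately show ?thesis by (simp add: mult_le_0_iff)
    qed
    have "poly p1 w = 0 \<Longrightarrow> Im w = 0" for w using less.prems(2)[of w] by (simp add: pr)
    then obtain \<beta> a Z where *: "finite Z" "\<forall>\<rho>\<in>Z. poly p1 \<rho> = 0" "\<forall>\<rho>. a \<rho> \<ge> (0::real)"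
      "\<forall>w. poly p1 w \<noteq> 0 \<longrightarrow> poly r1 w / poly p1 w = \<beta> + (\<Sum>\<rho>\<in>Z. of_real (a \<rho>) / (w - \<rho>))"
      using less.hyps[of p1 r1] dp p1 Hz dr by auto
    have "poly r w / poly p w = poly r1 w / poly p1 w" if "poly p w \<noteq> 0" for w
      using that unfolding pr poly_mult by simp
    then show ?thesis using * by (intro exI[of _ \<beta>] exI[of _ a] exI[of _ Z]) (auto simp: pr)
  qed
qed

section \<open>Restriction to the direction of a block\<close>

definition raise_on :: "'i set \<Rightarrow> real \<Rightarrow> ('i \<Rightarrow> real) \<Rightarrow> 'i \<Rightarrow> real" where
  "raise_on b t x = (\<lambda>i. if i \<in> b then x i + t else x i)"

lemma above_raise: "above F x \<Longrightarrow> t \<ge> 0 \<Longrightarrow> above F (raise_on b t x)"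
  by (rule above_mono[of F x]) (auto simp: raise_on_def)

text \<open>For \<open>w\<close> in the upper half plane only the coordinates of \<open>b\<close>
  leave the real axis, so stability by itself does not exclude zeros of \<open>p\<close>. The lemma
  collects what the partial fractions need: real roots, negative because \<open>x\<close> is above
  the zeros, the sign condition and the degree bound.\<close>

lemma block_line:
  assumes F: "real_stable T F" and x: "above F x" and b: "finite b"
  obtains p r where
    "\<And>t::real. poly p (of_real t) = of_real (real_val F (raise_on b t x))"
    "\<And>t::real. poly (pderiv p) (of_real t) = of_real (\<Sum>i\<in>b. real_val (pdiff i F) (raise_on b t x))"
    "\<And>t::real. poly r (of_real t) = of_real (real_val (pdiff j F) (raise_on b t x))"
    "\<And>t::real. poly (pderiv r) (of_real t) = of_real (\<Sum>i\<in>b. real_val (pdiff i (pdiff j F)) (raise_on b t x))"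
    "\<And>w. poly p w = 0 \<Longrightarrow> Im w = 0 \<and> Re w < 0"
    "\<And>w. Im w > 0 \<Longrightarrow> Im (poly r w * cnj (poly p w)) \<le> 0"
    "degree r \<le> degree p"
proof -
  note mF = real_stable_multiaffine[OF F]
  define l where "l = (\<lambda>w i. if i \<in> b then cvec x i + w * 1 else cvec x i)"
  have lr: "l (of_real t) = cvec (raise_on b t x)" for t by (auto simp: l_def cvec_def raise_on_def)
  obtain p where p: "\<And>w. poly p w = F (l w)" "\<And>w. poly (pderiv p) w = (\<Sum>i\<in>b. 1 * pdiff i F (l w))"
    using multiaffine_line[OF mF b, where a = "cvec x" and d = "\<lambda>_. 1"] unfolding l_def by blast
  obtain r where r: "\<And>w. poly r w = pdiff j F (l w)" "\<And>w. poly (pderiv r) w = (\<Sum>i\<in>b. 1 * pdiff i (pdiff j F) (l w))"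
    using multiaffine_line[OF multiaffine_pdiff[OF mF] b, where a = "cvec x" and d = "\<lambda>_. 1"] unfolding l_def by blast
  have P: "poly p (of_real t) = of_real (real_val F (raise_on b t x))" for t
    unfolding p lr real_stable_real_val[OF F] ..
  have R: "poly r (of_real t) = of_real (real_val (pdiff j F) (raise_on b t x))" for t
    unfolding r lr real_stable_real_val_pdiff[OF F] ..
  have P': "poly (pderiv p) (of_real t) = of_real (\<Sum>i\<in>b. real_val (pdiff i F) (raise_on b t x))" for t
    unfolding p lr real_stable_real_val_pdiff[OF F] by simp
  have R': "poly (pderiv r) (of_real t) = of_real (\<Sum>i\<in>b. real_val (pdiff i (pdiff j F)) (raise_on b t x))" for t
    unfolding r lr real_stable_real_val_pdiff2[OF F] by simp
  have imp: "Im (poly (pderiv p) w * cnj (poly p w)) \<le> 0" if "Im w \<ge> 0" for w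
  proof -
    have "Im (pdiff i F (l w) * cnj (F (l w))) \<le> 0" for i
      by (rule real_stable_weak[OF F]) (use that in \<open>auto simp: l_def cvec_def\<close>)
    then show ?thesis unfolding p by (simp add: sum_distrib_right sum_nonpos del: times_complex.sel)
  qed
  have imr: "Im (poly r w * cnj (poly p w)) \<le> 0" if "Im w > 0" for w
    unfolding p r by (rule real_stable_weak[OF F]) (use that in \<open>auto simp: l_def cvec_def\<close>)
  have pos: "real_val F (raise_on b t x) > 0" if "t \<ge> 0" for t
    by (rule aboveD[OF above_raise[OF x that]])
  have p0: "p \<noteq> 0" using pos[of 0] P[of 0] by auto
  \<comment> \<open>Along a vertical line the derivative of the squared modulus of \<open>p\<close>
    with respect to the height is \<open>- 2 * Im (p' * cnj p)\<close>, which is nonnegative. A root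
    at positive height would make \<open>p\<close> vanish on the whole segment below it.\<close>
  have noup: "poly p w \<noteq> 0" if w: "Im w > 0" for w
  proof
    assume 0: "poly p w = 0"
    define g where "g = (\<lambda>v. (cmod (poly p (Complex (Re w) v)))\<^sup>2)"
    have Ce: "Complex (Re w) = (\<lambda>v. of_real (Re w) + \<i> * of_real v)"
      by (auto simp: complex_eq_iff)
    have cd: "((\<lambda>v. poly p (Complex (Re w) v)) has_vector_derivative \<i> * poly (pderiv p) (Complex (Re w) v)) (at v)" for v
    proof -
      have "(Complex (Re w) has_vector_derivative \<i>) (at v)"
        unfolding Ce by (auto intro!: derivative_eq_intros)
      then show ?thesis
        using field_vector_diff_chain_at[of "Complex (Re w)" \<i> v "poly p"] poly_DERIV by (auto simp: o_def)
    qed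
    have gd: "(g has_real_derivative - 2 * Im (poly (pderiv p) (Complex (Re w) v) * cnj (poly p (Complex (Re w) v)))) (at v)" for v
    proof -
      note d1 = has_derivative_Re[OF cd[of v, unfolded has_vector_derivative_def]]
      note d2 = has_derivative_Im[OF cd[of v, unfolded has_vector_derivative_def]]
      show ?thesis
        unfolding g_def cmod_power2 has_field_derivative_def
        by (rule derivative_eq_intros d1 d2 refl)+ (auto simp: fun_eq_iff algebra_simps)
    qed
    have mono: "g u \<le> g v" if "0 \<le> u" "u \<le> v" for u v
    proof (rule DERIV_nonneg_imp_nondecreasing[OF that(2)])
      fix s assume "u \<le> s" "s \<le> v"
      then show "\<exists>y. (g has_real_derivative y) (at s) \<and> 0 \<le> y"
        using imp[of "Complex (Re w) s"] that(1)
        by (intro exI[of _ "- 2 * Im (poly (pderiv p) (Complex (Re w) s) * cnj (poly p (Complex (Re w) s)))"] conjI gd) auto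
    qed
    have "g (Im w) = 0" using 0 by (simp add: g_def)
    then have "g v = 0" if "0 \<le> v" "v \<le> Im w" for v
      using mono[OF that] by (metis g_def order_antisym zero_le_power2)
    then have "Complex (Re w) ` {0..Im w} \<subseteq> {z. poly p z = 0}"
      by (auto simp: g_def)
    then have "finite (Complex (Re w) ` {0..Im w})"
      using poly_roots_finite[OF p0] finite_subset by blast
    then have "finite {0..Im w}" by (rule finite_imageD) (auto intro: inj_onI)
    then show False using w infinite_Icc[of 0 "Im w"] by simp
  qed
  \<comment> \<open>\<open>p\<close> is real at real arguments; agreement with its conjugate at
    sufficiently many natural numbers shows that its coefficients are real. Roots in the lower half
    plane are thereby reflected to the upper one.\<close>
  have conj: "poly p (cnj w) = cnj (poly p w)" for w
  proof -
    define q where "q = map_poly cnj p"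
    have q: "poly q (cnj w) = cnj (poly p w)" for w unfolding q_def by (simp add: poly_map_poly_cnj)
    have "p = q"
    proof (rule poly_eqI_degree[of "(of_real \<circ> real) ` {..degree p + degree q}"])
      fix z assume "z \<in> (complex_of_real \<circ> real) ` {..degree p + degree q}"
      then obtain n where n: "z = of_real (real n)" by auto
      have "poly q z = cnj (poly p z)" using q[of z] by (simp add: n)
      then show "poly p z = poly q z" unfolding n P by simp
    next
      have "card ((complex_of_real \<circ> real) ` {..degree p + degree q}) = degree p + degree q + 1"
        by (subst card_image) (auto simp: inj_on_def)
      then show "degree p < card ((complex_of_real \<circ> real) ` {..degree p + degree q})"
        "degree q < card ((complex_of_real \<circ> real) ` {..degree p + degree q})" by auto
    qed
    then show ?thesis using q by metis
  qed
  have roots: "Im w = 0 \<and> Re w < 0" if "poly p w = 0" for w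
  proof -
    have "\<not> Im w > 0" using noup that by blast
    moreover have "\<not> Im w < 0" using noup[of "cnj w"] that conj[of w] by auto
    ultimately have "Im w = 0" by simp
    then have "w = of_real (Re w)" by (simp add: complex_eq_iff)
    then have "real_val F (raise_on b (Re w) x) = 0" using that P[of "Re w"] by simp
    then show ?thesis using pos[of "Re w"] \<open>Im w = 0\<close> by force
  qed
  \<comment> \<open>With a larger degree of \<open>r\<close> the quotient \<open>p / r\<close> tends
    to 0 on the positive ray, whereas \<open>r / p\<close> is \<open>Phi j F\<close> there and never
    exceeds its value at \<open>x\<close>. Then \<open>r\<close> has to vanish at all large
    arguments.\<close>
  have deg: "degree r \<le> degree p"
  proof (rule ccontr)
    assume "\<not> ?thesis"
    then have "degree p < degree r" by simp
    then have lim0: "((\<lambda>w. poly p w / poly r w) \<longlongrightarrow> 0) at_infinity"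
      by (rule poly_divide_tendsto_0_at_infinity)
    have "filterlim (\<lambda>t::real. complex_of_real t) at_infinity at_top"
      by (simp add: filterlim_at_infinity_conv_norm_at_top filterlim_abs_real)
    then have lim: "((\<lambda>t::real. poly p (of_real t) / poly r (of_real t)) \<longlongrightarrow> 0) at_top"
      by (rule filterlim_compose[OF lim0])
    define M where "M = Phi j F x + 1"
    have M: "M > 0" using Phi_nonneg[OF mF x, of j] by (simp add: M_def)
    have "\<forall>\<^sub>F t in at_top. dist (poly p (of_real t) / poly r (of_real t)) 0 < 1 / M"
      using tendstoD[OF lim, of "1 / M"] M by simp
    then have "\<forall>\<^sub>F t::real in at_top. poly r (of_real t) = 0"
      using eventually_ge_at_top[of 0]
    proof eventually_elim
      case (elim t)
      let ?P = "real_val F (raise_on b t x)" and ?R = "real_val (pdiff j F) (raise_on b t x)"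
      have le: "Phi j F (raise_on b t x) \<le> Phi j F x"
        by (rule Phi_anti[OF F x]) (use elim in \<open>auto simp: raise_on_def\<close>)
      have "?R \<ge> 0" by (rule above_pdiff[OF mF above_raise[OF x elim(2)]])
      show ?case
      proof (rule ccontr)
        assume "poly r (of_real t) \<noteq> 0"
        then have R0: "?R > 0" using \<open>?R \<ge> 0\<close> R[of t] by auto
        have "\<bar>?P / ?R\<bar> < 1 / M"
          using elim(1) unfolding P R by (simp flip: of_real_divide)
        then have "?P * M < ?R" using R0 M pos[OF elim(2)] by (simp add: field_simps)
        moreover have "?R / ?P < M" using le unfolding Phi_def[of j F "raise_on b t x"] M_def by linarith
        then have "?R < M * ?P" using pos[OF elim(2)] by (simp add: field_simps)
        ultimately show False by (simp add: mult.commute)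
      qed
    qed
    then obtain t0 where t0: "\<And>t::real. t \<ge> t0 \<Longrightarrow> poly r (of_real t) = 0"
      unfolding eventually_at_top_linorder by blast
    have r0: "r \<noteq> 0" using \<open>degree p < degree r\<close> by auto
    have "of_real ` {t0..t0+1} \<subseteq> {z. poly r z = 0}" using t0 by auto
    then have "finite (complex_of_real ` {t0..t0+1})"
      using poly_roots_finite[OF r0] finite_subset by blast
    then have "finite {t0..t0+1}" by (rule finite_imageD) (auto intro: inj_onI)
    then show False using infinite_Icc[of t0 "t0+1"] by simp
  qed
  show ?thesis by (rule that[OF P P' R R' roots imr deg])
qed

text \<open>By the quotient rule, the derivative of \<open>Phi j F\<close> at \<open>x\<close> in
  the direction of the indicator of \<open>b\<close>.\<close>

definition dPhi :: "'i set \<Rightarrow> 'i \<Rightarrow> (('i \<Rightarrow> complex) \<Rightarrow> complex) \<Rightarrow> ('i \<Rightarrow> real) \<Rightarrow> real" where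
  "dPhi b j F x = ((\<Sum>i\<in>b. real_val (pdiff i (pdiff j F)) x) * real_val F x - real_val (pdiff j F) x * (\<Sum>i\<in>b. real_val (pdiff i F) x)) / (real_val F x)\<^sup>2"

text \<open>The tangent inequalities of a convex function at the two ends of the segment. On the ray
  \<open>Phi j F\<close> is a constant plus a sum of terms \<open>a \<rho> / (t - Re \<rho>)\<close>
  with \<open>a \<rho> \<ge> 0\<close> and negative poles, each convex for
  \<open>t \<ge> 0\<close>.\<close>

lemma Phi_block_convex:
  assumes F: "real_stable T F" and x: "above F x" and b: "finite b" and t: "t \<ge> 0"
  shows "Phi j F x \<ge> Phi j F (raise_on b t x) - t * dPhi b j F (raise_on b t x)"
    and "Phi j F (raise_on b t x) \<ge> Phi j F x + t * dPhi b j F x"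
proof -
  obtain p r where pr:
    "\<And>t::real. poly p (of_real t) = of_real (real_val F (raise_on b t x))"
    "\<And>t::real. poly (pderiv p) (of_real t) = of_real (\<Sum>i\<in>b. real_val (pdiff i F) (raise_on b t x))"
    "\<And>t::real. poly r (of_real t) = of_real (real_val (pdiff j F) (raise_on b t x))"
    "\<And>t::real. poly (pderiv r) (of_real t) = of_real (\<Sum>i\<in>b. real_val (pdiff i (pdiff j F)) (raise_on b t x))"
    and roots: "\<And>w. poly p w = 0 \<Longrightarrow> Im w = 0 \<and> Re w < 0"
    and H: "\<And>w. Im w > 0 \<Longrightarrow> Im (poly r w * cnj (poly p w)) \<le> 0"
    and deg: "degree r \<le> degree p"
    by (rule block_line[OF F x b, where j = j]) (rule that; blast)
  have pos: "real_val F (raise_on b t x) > 0" if "t \<ge> 0" for t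
    by (rule aboveD[OF above_raise[OF x that]])
  have p0: "p \<noteq> 0" using pos[of 0] pr(1)[of 0] by auto
  obtain \<beta> a Z where Z: "finite Z" "\<And>\<rho>. \<rho> \<in> Z \<Longrightarrow> poly p \<rho> = 0" "\<And>\<rho>. a \<rho> \<ge> (0::real)"
    and pf: "\<And>w. poly p w \<noteq> 0 \<Longrightarrow> poly r w / poly p w = \<beta> + (\<Sum>\<rho>\<in>Z. of_real (a \<rho>) / (w - \<rho>))"
    using partial_fractions[OF p0 _ H deg] roots by blast
  have Zr: "\<rho> = of_real (Re \<rho>) \<and> Re \<rho> < 0" if "\<rho> \<in> Z" for \<rho>
    using roots[OF Z(2)[OF that]] by (simp add: complex_eq_iff)
  have opn: "open {w. poly p w \<noteq> 0}"
    by (intro open_Collect_neq continuous_intros)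
  have N: "Phi j F (raise_on b t x) = Re \<beta> + (\<Sum>\<rho>\<in>Z. a \<rho> / (t - Re \<rho>))" if t: "t \<ge> 0" for t
  proof -
    have "poly p (of_real t) \<noteq> 0" using pos[OF t] pr(1)[of t] by simp
    from pf[OF this] have "of_real (Phi j F (raise_on b t x)) = \<beta> + (\<Sum>\<rho>\<in>Z. of_real (a \<rho>) / (of_real t - \<rho>))"
      unfolding pr Phi_def by simp
    also have "(\<Sum>\<rho>\<in>Z. of_real (a \<rho>) / (of_real t - \<rho>)) = of_real (\<Sum>\<rho>\<in>Z. a \<rho> / (t - Re \<rho>))"
      unfolding of_real_sum
    proof (intro sum.cong refl)
      fix \<rho> assume "\<rho> \<in> Z"
      then obtain s where s: "\<rho> = of_real s" using Zr by blast
      show "of_real (a \<rho>) / (of_real t - \<rho>) = complex_of_real (a \<rho> / (t - Re \<rho>))" unfolding s by simp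
    qed
    finally have "Re (of_real (Phi j F (raise_on b t x))) = Re (\<beta> + of_real (\<Sum>\<rho>\<in>Z. a \<rho> / (t - Re \<rho>)))" by (rule arg_cong)
    then show ?thesis by simp
  qed
  have D: "dPhi b j F (raise_on b t x) = - (\<Sum>\<rho>\<in>Z. a \<rho> / (t - Re \<rho>)\<^sup>2)" if t: "t \<ge> 0" for t
  proof -
    let ?w = "complex_of_real t"
    have pw: "poly p ?w \<noteq> 0" using pos[OF t] pr(1)[of t] by simp
    have 1: "((\<lambda>w. poly r w / poly p w) has_field_derivative
        (poly (pderiv r) ?w * poly p ?w - poly r ?w * poly (pderiv p) ?w) / (poly p ?w * poly p ?w)) (at ?w)"
      by (intro DERIV_divide poly_DERIV pw)
    have nz: "?w - \<rho> \<noteq> 0" if "\<rho> \<in> Z" for \<rho> using Zr[OF that] t by (auto simp: complex_eq_iff)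
    have "((\<lambda>w. \<beta> + (\<Sum>\<rho>\<in>Z. of_real (a \<rho>) / (w - \<rho>))) has_field_derivative
        0 + (\<Sum>\<rho>\<in>Z. - of_real (a \<rho>) / (?w - \<rho>)\<^sup>2)) (at ?w)"
      using nz by (intro DERIV_add DERIV_const DERIV_sum) (auto intro!: derivative_eq_intros simp: power2_eq_square)
    then have 2: "((\<lambda>w. poly r w / poly p w) has_field_derivative (0 + (\<Sum>\<rho>\<in>Z. - of_real (a \<rho>) / (?w - \<rho>)\<^sup>2))) (at ?w)"
      by (rule has_field_derivative_transform_within_open[OF _ opn]) (use pw pf in auto)
    have "of_real (dPhi b j F (raise_on b t x)) = (\<Sum>\<rho>\<in>Z. - of_real (a \<rho>) / (?w - \<rho>)\<^sup>2)"
      using DERIV_unique[OF 1 2] unfolding pr dPhi_def by (simp add: power2_eq_square)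
    also have "\<dots> = of_real (\<Sum>\<rho>\<in>Z. - a \<rho> / (t - Re \<rho>)\<^sup>2)"
      unfolding of_real_sum
    proof (intro sum.cong refl)
      fix \<rho> assume "\<rho> \<in> Z"
      then obtain s where s: "\<rho> = of_real s" using Zr by blast
      show "- of_real (a \<rho>) / (?w - \<rho>)\<^sup>2 = complex_of_real (- a \<rho> / (t - Re \<rho>)\<^sup>2)" unfolding s by simp
    qed
    finally have "dPhi b j F (raise_on b t x) = (\<Sum>\<rho>\<in>Z. - a \<rho> / (t - Re \<rho>)\<^sup>2)" unfolding of_real_eq_iff .
    then show ?thesis by (simp add: sum_negf)
  qed
  have x0: "raise_on b 0 x = x" by (auto simp: raise_on_def)
  have e1: "1 / s \<ge> 1 / (t + s) + t * (1 / (t + s)\<^sup>2)" if s: "s > 0" for s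
  proof -
    have "1 / s - 1 / (t + s) = t * (1 / (s * (t + s)))" using s t by (simp add: field_simps)
    also have "\<dots> \<ge> t * (1 / (t + s)\<^sup>2)"
      using s t by (intro mult_left_mono divide_left_mono) (auto simp: power2_eq_square intro!: mult_right_mono)
    finally show ?thesis by simp
  qed
  have e2: "1 / (t + s) \<ge> 1 / s - t * (1 / s\<^sup>2)" if s: "s > 0" for s
  proof -
    have "1 / s - 1 / (t + s) = t * (1 / (s * (t + s)))" using s t by (simp add: field_simps)
    also have "\<dots> \<le> t * (1 / s\<^sup>2)"
      using s t by (intro mult_left_mono divide_left_mono) (auto simp: power2_eq_square)
    finally show ?thesis by simp
  qed
  have "(\<Sum>\<rho>\<in>Z. a \<rho> * (1 / (t - Re \<rho>) + t * (1 / (t - Re \<rho>)\<^sup>2))) \<le> (\<Sum>\<rho>\<in>Z. a \<rho> * (1 / (0 - Re \<rho>)))"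
  proof (intro sum_mono mult_left_mono Z(3))
    fix \<rho> assume "\<rho> \<in> Z"
    then have "0 - Re \<rho> > 0" using Zr by simp
    from e1[OF this] show "1 / (t - Re \<rho>) + t * (1 / (t - Re \<rho>)\<^sup>2) \<le> 1 / (0 - Re \<rho>)" by simp
  qed
  then show "Phi j F x \<ge> Phi j F (raise_on b t x) - t * dPhi b j F (raise_on b t x)"
    using N[of 0] N[OF t] D[OF t] unfolding x0 by (simp add: sum.distrib sum_distrib_left distrib_left mult_ac)
  have "(\<Sum>\<rho>\<in>Z. a \<rho> * (1 / (t - Re \<rho>))) \<ge> (\<Sum>\<rho>\<in>Z. a \<rho> * (1 / (0 - Re \<rho>) - t * (1 / (0 - Re \<rho>)\<^sup>2)))"
  proof (intro sum_mono mult_left_mono Z(3))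
    fix \<rho> assume "\<rho> \<in> Z"
    then have "0 - Re \<rho> > 0" using Zr by simp
    from e2[OF this] show "1 / (0 - Re \<rho>) - t * (1 / (0 - Re \<rho>)\<^sup>2) \<le> 1 / (t - Re \<rho>)" by simp
  qed
  then show "Phi j F (raise_on b t x) \<ge> Phi j F x + t * dPhi b j F x"
    using N[of 0] N[OF t] D[of 0] unfolding x0 by (simp add: sum_subtractf sum_distrib_left right_diff_distrib mult_ac)
qed

section \<open>How averaging changes the barrier\<close>

lemma dPhi_nonpos:
  assumes F: "real_stable T F"
  shows "dPhi b j F x \<le> 0"
proof -
  have "(\<Sum>i\<in>b. real_val (pdiff i (pdiff j F)) x) * real_val F x \<le> real_val (pdiff j F) x * (\<Sum>i\<in>b. real_val (pdiff i F) x)"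
    unfolding sum_distrib_left sum_distrib_right
    by (intro sum_mono) (metis rayleigh[OF F] mult.commute)
  then show ?thesis unfolding dPhi_def by (simp add: divide_le_0_iff)
qed

text \<open>The averaged function is \<open>F\<close> times
  \<open>1 + c * (\<Sum>i\<in>b. Phi i F x)\<close>, so logarithmic derivatives add. By symmetry of
  the second derivatives, the derivative of the sum of the \<open>Phi i F\<close> in coordinate
  \<open>j\<close> is \<open>dPhi b j F\<close>.\<close>

lemma Phi_add_partials:
  assumes "real_val F x > 0" and nz: "real_val (add_partials c b F) x \<noteq> 0"
  shows "Phi j (add_partials c b F) x = Phi j F x + c * dPhi b j F x / (1 + c * (\<Sum>i\<in>b. Phi i F x))"
proof -
  let ?P = "real_val F x" and ?R = "real_val (pdiff j F) x" and ?P' = "\<Sum>i\<in>b. real_val (pdiff i F) x"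
  let ?R' = "\<Sum>i\<in>b. real_val (pdiff i (pdiff j F)) x"
  have 1: "real_val (pdiff j (add_partials c b F)) x = ?R + c * ?R'"
    by (simp add: real_val_def pdiff_add_partials add_partials_def)
  have 2: "1 + c * (\<Sum>i\<in>b. Phi i F x) = (?P + c * ?P') / ?P"
    using assms(1) by (simp add: Phi_def sum_divide_distrib[symmetric] add_divide_distrib)
  have nz': "?P + c * ?P' \<noteq> 0" using nz by (simp add: real_val_add_partials)
  have "(R + c * R') / (P + c * P') = R / P + c * ((R' * P - R * P') / P\<^sup>2) / ((P + c * P') / P)"
    if "P \<noteq> 0" "P + c * P' \<noteq> 0" for P P' R R' :: real
  proof -
    have "c * ((R' * P - R * P') / P\<^sup>2) / ((P + c * P') / P) = c * (R' * P - R * P') / (P * (P + c * P'))"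
      using that by (simp add: power2_eq_square)
    also have "R / P + \<dots> = (R * (P + c * P') + c * (R' * P - R * P')) / (P * (P + c * P'))"
      using that by (simp add: add_divide_distrib)
    also have "R * (P + c * P') + c * (R' * P - R * P') = P * (R + c * R')" by (simp add: algebra_simps)
    finally show ?thesis using that by simp
  qed
  from this[OF _ nz', of ?R ?R'] show ?thesis
    unfolding Phi_def[of j] 1 2 dPhi_def real_val_add_partials using assms(1) by simp
qed

text \<open>With \<open>s\<close> the sum of the barriers over \<open>b\<close>, averaging adds
  \<open>- dPhi / (1 - s)\<close> to the barrier, while by convexity raising the block by
  \<open>\<tau>\<close> has lowered it by at least \<open>- \<tau> * dPhi\<close>. The condition on
  \<open>\<tau>\<close> and \<open>\<phi>\<close> gives \<open>1 / (1 - s) \<le> \<tau>\<close>, so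
  the net change is not positive.\<close>

lemma barrier_upper:
  assumes F: "real_stable T F" and x: "above F x" and b: "finite b"
    and \<phi>: "(\<Sum>i\<in>b. Phi i F x) \<le> \<phi>" "\<phi> < 1" and \<tau>: "\<tau> * (1 - \<phi>) \<ge> 1" "\<tau> \<ge> 0"
  shows "above (add_partials (-1) b F) (raise_on b \<tau> x)" and "Phi j (add_partials (-1) b F) (raise_on b \<tau> x) \<le> Phi j F x"
proof -
  have ax: "above F (raise_on b \<tau> x)" by (rule above_raise[OF x \<tau>(2)])
  have Pb: "(\<Sum>i\<in>b. Phi i F y) \<le> \<phi>" if "\<And>i. x i \<le> y i" for y
  proof -
    have "(\<Sum>i\<in>b. Phi i F y) \<le> (\<Sum>i\<in>b. Phi i F x)" by (intro sum_mono Phi_anti[OF F x that])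
    then show ?thesis using \<phi> by linarith
  qed
  have xu: "x i \<le> raise_on b \<tau> x i" for i using \<tau>(2) by (simp add: raise_on_def)
  have pos: "real_val (add_partials (-1) b F) y > 0" if y: "\<And>i. x i \<le> y i" for y
  proof -
    have "real_val F y > 0" using above_mono[OF x y] by (rule aboveD)
    moreover have "real_val (add_partials (-1) b F) y = real_val F y * (1 - (\<Sum>i\<in>b. Phi i F y))"
      using calculation by (simp add: real_val_add_partials Phi_def sum_divide_distrib[symmetric] field_simps)
    ultimately show ?thesis using Pb[OF y] \<phi>(2) by simp
  qed
  show "above (add_partials (-1) b F) (raise_on b \<tau> x)"
    unfolding above_def using pos xu by (meson order_trans)
  let ?y = "raise_on b \<tau> x"
  define s where "s = (\<Sum>i\<in>b. Phi i F ?y)"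
  have s: "1 - s > 0" "1 - s \<ge> 1 - \<phi>" using Pb[OF xu] \<phi>(2) by (auto simp: s_def)
  have "1 \<le> \<tau> * (1 - s)" using \<tau> s(2) mult_left_mono[of "1 - \<phi>" "1 - s" \<tau>] by linarith
  then have "1 / (1 - s) \<le> \<tau>" using s(1) by (simp add: field_simps)
  then have "- dPhi b j F ?y * (1 / (1 - s)) \<le> - dPhi b j F ?y * \<tau>"
    using dPhi_nonpos[OF F] by (intro mult_left_mono) auto
  moreover have "Phi j (add_partials (-1) b F) ?y = Phi j F ?y - dPhi b j F ?y * (1 / (1 - s))"
    using Phi_add_partials[OF aboveD[OF ax], of "-1" b j] pos[OF xu] by (simp add: s_def)
  moreover have "Phi j F x \<ge> Phi j F ?y - \<tau> * dPhi b j F ?y"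
    by (rule Phi_block_convex(1)[OF F x b \<tau>(2)])
  ultimately show "Phi j (add_partials (-1) b F) ?y \<le> Phi j F x" by (simp add: mult.commute)
qed

text \<open>The signs are reversed: lowering the block by \<open>\<delta>\<close> raises the barrier
  by at most \<open>- \<delta> * dPhi\<close>, and averaging lowers it by
  \<open>- 2 * \<delta> / (1 + 2 * \<delta> * s) * dPhi\<close>. The bound 1/3 gives
  \<open>\<delta> * s \<le> 1 / 2\<close> at the lowered point, which makes the second amount at
  least the first.\<close>

lemma barrier_lower:
  assumes F: "real_stable T F" and x: "above F x" and b: "finite b"
    and \<phi>: "(\<Sum>i\<in>b. Phi i F x) \<le> \<phi>" and \<delta>: "\<delta> * \<phi> \<le> 1 / 3" "\<delta> \<ge> 0"
  shows "above (add_partials (2 * \<delta>) b F) (raise_on b (- \<delta>) x)" and "Phi j (add_partials (2 * \<delta>) b F) (raise_on b (- \<delta>) x) \<le> Phi j F x"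
proof -
  note mF = real_stable_multiaffine[OF F]
  let ?y = "raise_on b (- \<delta>) x"
  have y_eq: "?y = (\<lambda>i. if i \<in> b then x i - \<delta> else x i)" by (auto simp: raise_on_def)
  define u where "u = (\<Sum>i\<in>b. Phi i F x)"
  have u: "u \<ge> 0" unfolding u_def by (intro sum_nonneg Phi_nonneg[OF mF x])
  have du: "\<delta> * u \<le> 1 / 3" using \<delta> \<phi> mult_left_mono[of u \<phi> \<delta>] by (simp add: u_def)
  have ay: "above F ?y" and Py: "\<And>j. Phi j F ?y \<le> Phi j F x / (1 - \<delta> * u)"
    using above_down[OF F x \<delta>(2) b] du unfolding y_eq u_def by auto
  define s where "s = (\<Sum>i\<in>b. Phi i F ?y)"
  have s0: "s \<ge> 0" unfolding s_def by (intro sum_nonneg Phi_nonneg[OF mF ay])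
  have "s \<le> u / (1 - \<delta> * u)" unfolding s_def u_def sum_divide_distrib
    by (intro sum_mono Py[unfolded u_def])
  then have "\<delta> * s \<le> \<delta> * (u / (1 - \<delta> * u))" by (intro mult_left_mono \<delta>(2))
  also have "\<dots> = \<delta> * u / (1 - \<delta> * u)" by simp
  also have "\<dots> \<le> 1 / 2" using du by (simp add: divide_le_eq)
  finally have ds: "\<delta> * s \<le> 1 / 2" .
  have pos: "real_val (add_partials (2 * \<delta>) b F) z > 0" if "\<And>i. ?y i \<le> z i" for z
  proof -
    have az: "above F z" by (rule above_mono[OF ay that])
    have "(\<Sum>i\<in>b. real_val (pdiff i F) z) \<ge> 0" by (intro sum_nonneg above_pdiff[OF mF az])
    then show ?thesis using aboveD[OF az] \<delta>(2) by (simp add: real_val_add_partials add_pos_nonneg)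
  qed
  show "above (add_partials (2 * \<delta>) b F) ?y" unfolding above_def using pos by blast
  have xe: "raise_on b \<delta> ?y = x" by (auto simp: raise_on_def)
  have "\<delta> * (1 + 2 * (\<delta> * s)) \<le> \<delta> * 2" using ds by (intro mult_left_mono \<delta>(2)) simp
  then have "2 * \<delta> / (1 + 2 * \<delta> * s) \<ge> \<delta>"
    using \<delta>(2) s0 by (subst pos_le_divide_eq) (auto simp: algebra_simps add_pos_nonneg)
  then have "- dPhi b j F ?y * \<delta> \<le> - dPhi b j F ?y * (2 * \<delta> / (1 + 2 * \<delta> * s))"
    using dPhi_nonpos[OF F] by (intro mult_left_mono) auto
  moreover have "Phi j (add_partials (2 * \<delta>) b F) ?y = Phi j F ?y + dPhi b j F ?y * (2 * \<delta> / (1 + 2 * \<delta> * s))"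
    using Phi_add_partials[OF aboveD[OF ay], of "2 * \<delta>" b j] pos[of ?y] by (simp add: s_def)
  moreover have "Phi j F x \<ge> Phi j F ?y + \<delta> * dPhi b j F ?y"
    using Phi_block_convex(2)[OF F ay b \<delta>(2), of j] unfolding xe .
  ultimately show "Phi j (add_partials (2 * \<delta>) b F) ?y \<le> Phi j F x" by (simp add: mult.commute)
qed

text \<open>The barrier bound passes from \<open>F\<close> to its average over \<open>b\<close>, so
  the other blocks can be treated first for that average. Only then is the index of \<open>b\<close>
  chosen, at the point already shifted for them; disjointness keeps this choice apart from the other
  coordinates.\<close>

theorem block_selection_upper:
  assumes "finite B" and "real_stable T F" and "above F x"
    and "\<And>b. b \<in> B \<Longrightarrow> finite b" and "disjoint B"
    and "\<And>b. b \<in> B \<Longrightarrow> (\<Sum>i\<in>b. Phi i F x) \<le> \<phi>" and "\<phi> < 1" and "\<tau> * (1 - \<phi>) \<ge> 1" and "\<tau> \<ge> 0"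
    and "\<And>b. b \<in> B \<Longrightarrow> sum p b = 1" and "\<And>i. i \<in> \<Union>B \<Longrightarrow> p i > 0"
  shows "\<exists>sel. (\<forall>b\<in>B. sel b \<in> b) \<and>
    above F (\<lambda>i. raise_on (\<Union>B) \<tau> x i - (if i \<in> sel ` B then 1 / p i else 0))"
  using assms(1-6,10,11)
proof (induction B arbitrary: F x)
  case empty
  then show ?case by (simp add: raise_on_def)
next
  case (insert b B)
  note F = insert.prems(1) and x = insert.prems(2)
  have fb: "finite b" using insert.prems by simp
  have "b \<inter> c = {}" if "c \<in> B" for c
    using disjointD[OF insert.prems(4), of b c] that insert.hyps(2) by auto
  then have bB: "b \<inter> \<Union>B = {}" by blast
  have Pb: "(\<Sum>i\<in>b. Phi i F x) \<le> \<phi>" using insert.prems by simp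
  note bu = barrier_upper[OF F x fb Pb assms(7,8,9)]
  let ?x' = "raise_on b \<tau> x"
  have "\<exists>sel. (\<forall>b\<in>B. sel b \<in> b) \<and>
    above (add_partials (-1) b F) (\<lambda>i. raise_on (\<Union>B) \<tau> ?x' i - (if i \<in> sel ` B then 1 / p i else 0))"
  proof (rule insert.IH[OF real_stable_add_partials[OF F fb] bu(1)])
    show "(\<Sum>i\<in>c. Phi i (add_partials (-1) b F) ?x') \<le> \<phi>" if "c \<in> B" for c
      using sum_mono[of c, OF bu(2)] insert.prems(5)[of c] that by (meson insertI2 order_trans)
    show "disjoint B" using insert.prems(4) by (auto simp: disjoint_def)
  qed (use insert.prems in auto)
  then obtain sel where sel: "\<And>c. c \<in> B \<Longrightarrow> sel c \<in> c"
    and ab: "above (add_partials (-1) b F) (\<lambda>i. raise_on (\<Union>B) \<tau> ?x' i - (if i \<in> sel ` B then 1 / p i else 0))"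
    by blast
  let ?z = "\<lambda>i. raise_on (\<Union>B) \<tau> ?x' i - (if i \<in> sel ` B then 1 / p i else 0)"
  obtain s where s: "s \<in> b" "above F (?z(s := ?z s - 1 / p s))"
    using selection_upper[OF F x ab, of p] insert.prems by auto
  define sel' where "sel' = sel(b := s)"
  have im: "sel' ` insert b B = insert s (sel ` B)"
    using insert.hyps(2) by (auto simp: sel'_def)
  have "s \<notin> sel ` B" using s(1) bB sel by blast
  then have "?z(s := ?z s - 1 / p s) = (\<lambda>i. raise_on (\<Union>(insert b B)) \<tau> x i - (if i \<in> sel' ` insert b B then 1 / p i else 0))"
    unfolding im using bB by (auto simp: raise_on_def fun_eq_iff)
  then show ?case using s sel insert.hyps(2) by (intro exI[of _ sel']) (auto simp: sel'_def)
qed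

text \<open>The same induction with \<open>add_partials (2 * \<delta>)\<close>. The selected index
  gains \<open>2 * \<delta> * card b\<close>, rounded up to \<open>2 * \<delta> * K\<close>, while
  the other indices of the block end \<open>\<delta>\<close> lower. The gain pays for deleting the
  selected index later.\<close>

theorem block_selection_lower:
  assumes "finite B" and "real_stable T F" and "above F x"
    and "\<And>b. b \<in> B \<Longrightarrow> finite b \<and> b \<noteq> {} \<and> card b \<le> K" and "disjoint B"
    and "\<And>b. b \<in> B \<Longrightarrow> (\<Sum>i\<in>b. Phi i F x) \<le> \<phi>" and "\<delta> * \<phi> \<le> 1 / 3" and "\<delta> \<ge> 0"
  shows "\<exists>sel. (\<forall>b\<in>B. sel b \<in> b) \<and>
    above F (\<lambda>i. raise_on (\<Union>B) (- \<delta>) x i + (if i \<in> sel ` B then 2 * \<delta> * K else 0))"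
  using assms(1-6)
proof (induction B arbitrary: F x)
  case empty
  then show ?case by (simp add: raise_on_def)
next
  case (insert b B)
  note F = insert.prems(1) and x = insert.prems(2)
  have fb: "finite b" "b \<noteq> {}" "card b \<le> K" using insert.prems by auto
  have "b \<inter> c = {}" if "c \<in> B" for c
    using disjointD[OF insert.prems(4), of b c] that insert.hyps(2) by auto
  then have bB: "b \<inter> \<Union>B = {}" by blast
  have Pb: "(\<Sum>i\<in>b. Phi i F x) \<le> \<phi>" using insert.prems by simp
  note bu = barrier_lower[OF F x fb(1) Pb assms(7,8)]
  let ?x' = "raise_on b (- \<delta>) x"
  have "\<exists>sel. (\<forall>b\<in>B. sel b \<in> b) \<and>
    above (add_partials (2 * \<delta>) b F) (\<lambda>i. raise_on (\<Union>B) (- \<delta>) ?x' i + (if i \<in> sel ` B then 2 * \<delta> * K else 0))"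
  proof (rule insert.IH[OF real_stable_add_partials[OF F fb(1)] bu(1)])
    show "(\<Sum>i\<in>c. Phi i (add_partials (2 * \<delta>) b F) ?x') \<le> \<phi>" if "c \<in> B" for c
      using sum_mono[of c, OF bu(2)] insert.prems(5)[of c] that by (meson insertI2 order_trans)
    show "disjoint B" using insert.prems(4) by (auto simp: disjoint_def)
  qed (use insert.prems in auto)
  then obtain sel where sel: "\<And>c. c \<in> B \<Longrightarrow> sel c \<in> c"
    and ab: "above (add_partials (2 * \<delta>) b F) (\<lambda>i. raise_on (\<Union>B) (- \<delta>) ?x' i + (if i \<in> sel ` B then 2 * \<delta> * K else 0))"
    by blast
  let ?z = "\<lambda>i. raise_on (\<Union>B) (- \<delta>) ?x' i + (if i \<in> sel ` B then 2 * \<delta> * K else 0)"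
  have d2: "2 * \<delta> \<ge> 0" using assms(8) by simp
  obtain s where s: "s \<in> b" "above F (?z(s := ?z s + 2 * \<delta> * card b))"
    using selection_lower[OF F x fb(1,2) d2 ab] by blast
  have s': "above F (?z(s := ?z s + 2 * \<delta> * K))"
    by (rule above_mono[OF s(2)]) (use d2 fb(3) in \<open>auto intro!: mult_left_mono\<close>)
  define sel' where "sel' = sel(b := s)"
  have im: "sel' ` insert b B = insert s (sel ` B)"
    using insert.hyps(2) by (auto simp: sel'_def)
  have "s \<notin> sel ` B" using s(1) bB sel by blast
  then have "?z(s := ?z s + 2 * \<delta> * K) = (\<lambda>i. raise_on (\<Union>(insert b B)) (- \<delta>) x i + (if i \<in> sel' ` insert b B then 2 * \<delta> * K else 0))"
    unfolding im using bB by (auto simp: raise_on_def fun_eq_iff)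
  then show ?case using s(1) s' sel insert.hyps(2) by (intro exI[of _ sel']) (auto simp: sel'_def)
qed

section \<open>Hermitian forms and determinants\<close>

definition mat_vec :: "('i \<Rightarrow> 'i \<Rightarrow> complex) \<Rightarrow> 'i set \<Rightarrow> ('i \<Rightarrow> complex) \<Rightarrow> 'i \<Rightarrow> complex" where
  "mat_vec G T v i = (\<Sum>j\<in>T. G i j * v j)"

definition sesq_form :: "('i \<Rightarrow> 'i \<Rightarrow> complex) \<Rightarrow> 'i set \<Rightarrow> ('i \<Rightarrow> complex) \<Rightarrow> ('i \<Rightarrow> complex) \<Rightarrow> complex" where
  "sesq_form G T u v = (\<Sum>i\<in>T. cnj (u i) * mat_vec G T v i)"

definition quad_form :: "('i \<Rightarrow> 'i \<Rightarrow> complex) \<Rightarrow> 'i set \<Rightarrow> ('i \<Rightarrow> complex) \<Rightarrow> real" where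
  "quad_form G T v = Re (sesq_form G T v v)"

definition norm_sq :: "'i set \<Rightarrow> ('i \<Rightarrow> complex) \<Rightarrow> real" where
  "norm_sq T v = (\<Sum>i\<in>T. (cmod (v i))\<^sup>2)"

definition hermitian :: "'i set \<Rightarrow> ('i \<Rightarrow> 'i \<Rightarrow> complex) \<Rightarrow> bool" where
  "hermitian T G \<longleftrightarrow> finite T \<and> (\<forall>i\<in>T. \<forall>j\<in>T. G j i = cnj (G i j))"

definition pos_semidef :: "'i set \<Rightarrow> ('i \<Rightarrow> 'i \<Rightarrow> complex) \<Rightarrow> bool" where
  "pos_semidef T G \<longleftrightarrow> hermitian T G \<and> (\<forall>v. quad_form G T v \<ge> 0)"

lemma cnj_mult_self: "cnj z * z = of_real ((cmod z)\<^sup>2)" "z * cnj z = of_real ((cmod z)\<^sup>2)"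
  unfolding complex_norm_square by (simp_all add: mult.commute)

lemma norm_sq_nonneg [simp]: "norm_sq T v \<ge> 0" by (simp add: norm_sq_def sum_nonneg)

lemma norm_sq_ge: "finite T \<Longrightarrow> i \<in> T \<Longrightarrow> (cmod (v i))\<^sup>2 \<le> norm_sq T v"
  unfolding norm_sq_def by (rule member_le_sum) auto

lemma sesq_form_cnj:
  assumes "hermitian T G"
  shows "cnj (sesq_form G T u v) = sesq_form G T v u"
proof -
  have "cnj (sesq_form G T u v) = (\<Sum>i\<in>T. \<Sum>j\<in>T. u i * cnj (G i j) * cnj (v j))"
    by (simp add: sesq_form_def mat_vec_def sum_distrib_left mult.assoc)
  also have "\<dots> = (\<Sum>i\<in>T. \<Sum>j\<in>T. cnj (v j) * (G j i * u i))"
  proof (intro sum.cong refl)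
    fix i j assume "i \<in> T" "j \<in> T"
    then have "G j i = cnj (G i j)" using assms unfolding hermitian_def by blast
    then show "u i * cnj (G i j) * cnj (v j) = cnj (v j) * (G j i * u i)" by (simp only: mult_ac)
  qed
  also have "\<dots> = sesq_form G T v u"
    unfolding sesq_form_def mat_vec_def sum_distrib_left by (rule sum.swap)
  finally show ?thesis .
qed

lemma sesq_form_self: "hermitian T G \<Longrightarrow> sesq_form G T v v = of_real (quad_form G T v)"
  using sesq_form_cnj[of T G v v] by (simp add: quad_form_def complex_eq_iff)

lemma sesq_form_right: "sesq_form G T u (\<lambda>i. v i + t * w i) = sesq_form G T u v + t * sesq_form G T u w"
  by (simp add: sesq_form_def mat_vec_def sum.distrib sum_distrib_left algebra_simps)

lemma sesq_form_left: "sesq_form G T (\<lambda>i. v i + t * w i) u = sesq_form G T v u + cnj t * sesq_form G T w u"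
  by (simp add: sesq_form_def mat_vec_def sum.distrib sum_distrib_left sum_distrib_right algebra_simps)

lemma quad_form_shift:
  assumes "hermitian T G"
  shows "quad_form G T (\<lambda>i. v i + t * w i) = quad_form G T v + 2 * Re (t * sesq_form G T v w) + (cmod t)\<^sup>2 * quad_form G T w"
proof -
  have "sesq_form G T (\<lambda>i. v i + t * w i) (\<lambda>i. v i + t * w i) =
    sesq_form G T v v + (t * sesq_form G T v w + cnj (t * sesq_form G T v w)) + (t * cnj t) * sesq_form G T w w"
    unfolding sesq_form_right sesq_form_left complex_cnj_mult sesq_form_cnj[OF assms] by (simp add: algebra_simps)
  then have "complex_of_real (quad_form G T (\<lambda>i. v i + t * w i)) =
    of_real (quad_form G T v) + (t * sesq_form G T v w + cnj (t * sesq_form G T v w)) + (t * cnj t) * of_real (quad_form G T w)"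
    unfolding sesq_form_self[OF assms] .
  also have "t * cnj t = of_real ((cmod t)\<^sup>2)" by (rule complex_norm_square[symmetric])
  finally have "Re (complex_of_real (quad_form G T (\<lambda>i. v i + t * w i))) =
    Re (of_real (quad_form G T v) + (t * sesq_form G T v w + cnj (t * sesq_form G T v w)) + of_real ((cmod t)\<^sup>2) * of_real (quad_form G T w))"
    by (rule arg_cong)
  then show ?thesis by (simp del: of_real_power)
qed

lemma sesq_form_CS:
  assumes "pos_semidef T G"
  shows "(cmod (sesq_form G T u v))\<^sup>2 \<le> quad_form G T u * quad_form G T v"
proof -
  have h: "hermitian T G" and p: "\<And>v. quad_form G T v \<ge> 0" using assms by (auto simp: pos_semidef_def)
  define z where "z = sesq_form G T u v"
  have *: "quad_form G T u - 2 * s * (cmod z)\<^sup>2 + s\<^sup>2 * (cmod z)\<^sup>2 * quad_form G T v \<ge> 0" for s :: real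
  proof -
    have "Re (- of_real s * cnj z * z) = - s * (cmod z)\<^sup>2"
      unfolding mult.assoc cnj_mult_self by (simp del: of_real_power)
    moreover have "(cmod (- of_real s * cnj z))\<^sup>2 = s\<^sup>2 * (cmod z)\<^sup>2"
      by (simp add: norm_mult power_mult_distrib)
    ultimately show ?thesis
      using p[of "\<lambda>i. u i + (- of_real s * cnj z) * v i"] unfolding quad_form_shift[OF h] z_def[symmetric] by simp
  qed
  show ?thesis
  proof (cases "quad_form G T v = 0")
    case True
    have "(cmod z)\<^sup>2 \<le> 0"
    proof (rule ccontr)
      assume "\<not> ?thesis"
      then have "(cmod z)\<^sup>2 > 0" by simp
      then have "2 * ((quad_form G T u + 1) / (cmod z)\<^sup>2) * (cmod z)\<^sup>2 = 2 * (quad_form G T u + 1)" by simp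
      then show False using *[of "(quad_form G T u + 1) / (cmod z)\<^sup>2"] p[of u] True by simp
    qed
    then show ?thesis using True z_def by simp
  next
    case False
    then have v: "quad_form G T v > 0" using p[of v] by simp
    have "quad_form G T u - (cmod z)\<^sup>2 / quad_form G T v \<ge> 0"
      using *[of "1 / quad_form G T v"] v by (simp add: power2_eq_square)
    then show ?thesis using v by (simp add: z_def field_simps)
  qed
qed

lemma sesq_form_mat_vec: "sesq_form G T (mat_vec G T v) v = of_real (norm_sq T (mat_vec G T v))"
  unfolding sesq_form_def norm_sq_def cnj_mult_self by simp

text \<open>In operator terms, the square of \<open>G\<close> is at most \<open>L\<close> times
  \<open>G\<close>. The proof is Cauchy-Schwarz for the form of \<open>G\<close>, applied to
  \<open>G v\<close> and \<open>v\<close>.\<close>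

lemma mat_vec_bound:
  assumes "pos_semidef T G" and L: "\<And>c. quad_form G T c \<le> L * norm_sq T c"
  shows "norm_sq T (mat_vec G T v) \<le> L * quad_form G T v"
proof -
  define S where "S = norm_sq T (mat_vec G T v)"
  have "S\<^sup>2 \<le> quad_form G T (mat_vec G T v) * quad_form G T v"
    using sesq_form_CS[OF assms(1), of "mat_vec G T v" v] unfolding sesq_form_mat_vec by (simp add: S_def)
  also have "\<dots> \<le> (L * S) * quad_form G T v"
    unfolding S_def using assms(1) by (intro mult_right_mono L) (auto simp: pos_semidef_def)
  finally have "S * S \<le> S * (L * quad_form G T v)" by (simp add: power2_eq_square mult_ac)
  moreover have "S \<ge> 0" by (simp add: S_def)
  moreover have "L * quad_form G T v \<ge> 0" if "S = 0"
  proof (cases "norm_sq T v = 0")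
    case True
    then have "quad_form G T v = 0" using L[of v] assms(1) by (auto simp: pos_semidef_def intro: antisym)
    then show ?thesis by simp
  next
    case False
    then have "norm_sq T v > 0" using norm_sq_nonneg[of T v] by linarith
    moreover have "0 \<le> L * norm_sq T v" using L[of v] assms(1) by (meson order_trans pos_semidef_def)
    ultimately have "L \<ge> 0" by (simp add: zero_le_mult_iff)
    then show ?thesis using assms(1) by (auto simp: pos_semidef_def)
  qed
  ultimately show ?thesis unfolding S_def[symmetric] by (cases "S = 0") auto
qed

text \<open>Cauchy-Schwarz for the form of \<open>G\<close> against the unit vector at
  \<open>i\<close>.\<close>

lemma mat_vec_diag_bound:
  assumes "pos_semidef T G" "i \<in> T"
  shows "(cmod (mat_vec G T v i))\<^sup>2 \<le> Re (G i i) * quad_form G T v"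
proof -
  have fT: "finite T" using assms by (auto simp: pos_semidef_def hermitian_def)
  let ?e = "\<lambda>k. if k = i then 1 else 0 :: complex"
  have 1: "sesq_form G T ?e v = mat_vec G T v i" for v
    unfolding sesq_form_def using fT assms(2) by (simp add: if_distrib[of cnj] if_distrib[of "\<lambda>x. x * _"] cong: if_cong)
  have 2: "mat_vec G T ?e i = G i i"
    unfolding mat_vec_def using fT assms(2) by (simp add: if_distrib[of "\<lambda>x. _ * x"] cong: if_cong)
  show ?thesis using sesq_form_CS[OF assms(1), of ?e v] unfolding quad_form_def[of G T ?e] 1 2 .
qed

lemma quad_form_bounded:
  assumes "finite T"
  shows "\<bar>quad_form G T v\<bar> \<le> (\<Sum>i\<in>T. \<Sum>j\<in>T. cmod (G i j)) * norm_sq T v"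
proof -
  have "\<bar>quad_form G T v\<bar> \<le> cmod (sesq_form G T v v)" unfolding quad_form_def by (rule abs_Re_le_cmod)
  also have "\<dots> \<le> (\<Sum>i\<in>T. \<Sum>j\<in>T. cmod (v i) * cmod (G i j) * cmod (v j))"
    unfolding sesq_form_def mat_vec_def sum_distrib_left
    by (intro sum_norm_le order_trans[OF norm_sum]) (simp add: norm_mult mult.assoc)
  also have "\<dots> \<le> (\<Sum>i\<in>T. \<Sum>j\<in>T. cmod (G i j) * norm_sq T v)"
  proof (intro sum_mono)
    fix i j assume ij: "i \<in> T" "j \<in> T"
    have "2 * (cmod (v i) * cmod (v j)) \<le> (cmod (v i))\<^sup>2 + (cmod (v j))\<^sup>2"
      using sum_squares_bound[of "cmod (v i)" "cmod (v j)"] by simp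
    also have "\<dots> \<le> norm_sq T v + norm_sq T v" using ij by (intro add_mono norm_sq_ge assms)
    finally have "cmod (v i) * cmod (v j) \<le> norm_sq T v" by simp
    then have "cmod (G i j) * (cmod (v i) * cmod (v j)) \<le> cmod (G i j) * norm_sq T v"
      by (rule mult_left_mono) simp
    then show "cmod (v i) * cmod (G i j) * cmod (v j) \<le> cmod (G i j) * norm_sq T v" by (simp add: mult_ac)
  qed
  finally show ?thesis by (simp add: sum_distrib_right)
qed

lemma quad_form_diag:
  assumes "finite T"
  shows "quad_form (\<lambda>i j. G i j + (if i = j then of_real (d i) else 0)) T v = quad_form G T v + (\<Sum>i\<in>T. d i * (cmod (v i))\<^sup>2)"
proof -
  have "mat_vec (\<lambda>i j. G i j + (if i = j then of_real (d i) else 0)) T v i = mat_vec G T v i + of_real (d i) * v i" if "i \<in> T" for i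
    using that assms by (simp add: mat_vec_def distrib_right sum.distrib if_distrib[of "\<lambda>x. x * _"] cong: if_cong)
  then have "sesq_form (\<lambda>i j. G i j + (if i = j then of_real (d i) else 0)) T v v =
    sesq_form G T v v + (\<Sum>i\<in>T. of_real (d i) * (cnj (v i) * v i))"
    unfolding sesq_form_def by (simp add: sum.distrib[symmetric] algebra_simps)
  then show ?thesis unfolding cnj_mult_self by (simp add: quad_form_def del: of_real_power)
qed

lemma hermitianD: "hermitian T G \<Longrightarrow> i \<in> T \<Longrightarrow> j \<in> T \<Longrightarrow> G j i = cnj (G i j)"
  unfolding hermitian_def by blast

lemma hermitian_diag:
  assumes "hermitian T G"
  shows "hermitian T (\<lambda>i j. G i j + (if i = j then of_real (d i) else 0))"
  unfolding hermitian_def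
proof (intro conjI ballI)
  show "finite T" using assms by (simp add: hermitian_def)
  fix i j assume "i \<in> T" "j \<in> T"
  from hermitianD[OF assms this] show "G j i + (if j = i then of_real (d j) else 0) = cnj (G i j + (if i = j then of_real (d i) else 0))"
    by simp
qed

section \<open>Determinants and positive semidefiniteness\<close>

definition fdet :: "nat \<Rightarrow> (nat \<Rightarrow> nat \<Rightarrow> complex) \<Rightarrow> complex" where
  "fdet n M = Determinant.det (Matrix.mat n n (\<lambda>(i, j). M i j))"

lemma fdet_expand: "fdet n M = (\<Sum>p | p permutes {0..<n}. signof p * (\<Prod>i = 0..<n. M i (p i)))"
proof -
  have "fdet n M = (\<Sum>p | p permutes {0..<n}. signof p * (\<Prod>i = 0..<n. Matrix.mat n n (\<lambda>(i, j). M i j) $$ (i, p i)))"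
    unfolding fdet_def by (rule det_def') simp
  also have "\<dots> = (\<Sum>p | p permutes {0..<n}. signof p * (\<Prod>i = 0..<n. M i (p i)))"
  proof (intro sum.cong refl arg_cong2[of _ _ _ _ "(*)"] prod.cong)
    fix p i assume "p \<in> {p. p permutes {0..<n}}" "i \<in> {0..<n}"
    then have "p i < n" "i < n" using permutes_in_image[of p "{0..<n}" i] by auto
    then show "Matrix.mat n n (\<lambda>(i, j). M i j) $$ (i, p i) = M i (p i)" by simp
  qed
  finally show ?thesis .
qed

lemma mat_mult_vec_eq:
  "i < n \<Longrightarrow> vec_index (Matrix.mat n n (\<lambda>(i, j). M i j) *\<^sub>v Matrix.vec n v) i = mat_vec M {..<n} v i"
  by (simp add: mat_vec_def scalar_prod_def lessThan_atLeast0)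

lemma fdet_zero_iff: "fdet n M = 0 \<longleftrightarrow> (\<exists>v. (\<exists>i<n. v i \<noteq> 0) \<and> (\<forall>i<n. mat_vec M {..<n} v i = 0))"
proof -
  let ?A = "Matrix.mat n n (\<lambda>(i, j). M i j)"
  have "fdet n M = 0 \<longleftrightarrow> (\<exists>v. v \<in> carrier_vec n \<and> v \<noteq> 0\<^sub>v n \<and> ?A *\<^sub>v v = 0\<^sub>v n)"
    unfolding fdet_def by (rule det_0_iff_vec_prod_zero) simp
  also have "\<dots> \<longleftrightarrow> (\<exists>v. (\<exists>i<n. v i \<noteq> 0) \<and> (\<forall>i<n. mat_vec M {..<n} v i = 0))"
  proof safe
    fix v assume v: "v \<in> carrier_vec n" "v \<noteq> 0\<^sub>v n" "?A *\<^sub>v v = 0\<^sub>v n"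
    have ve: "v = Matrix.vec n (\<lambda>i. vec_index v i)" using v(1) by (intro eq_vecI) auto
    have "\<exists>i<n. vec_index v i \<noteq> 0" using v(1,2) by (metis carrier_vecD eq_vecI index_zero_vec(1,2))
    moreover have "mat_vec M {..<n} (\<lambda>i. vec_index v i) i = 0" if "i < n" for i
      using mat_mult_vec_eq[OF that, of M "\<lambda>i. vec_index v i"] v(3) ve that by simp
    ultimately show "\<exists>v. (\<exists>i<n. v i \<noteq> 0) \<and> (\<forall>i<n. mat_vec M {..<n} v i = 0)" by blast
  next
    fix v i assume v: "\<forall>i<n. mat_vec M {..<n} v i = 0" "i < n" "v i \<noteq> 0"
    have "Matrix.vec n v \<noteq> 0\<^sub>v n" using v(2,3) by (metis index_vec index_zero_vec(1))
    moreover have "?A *\<^sub>v Matrix.vec n v = 0\<^sub>v n"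
      by (rule eq_vecI) (use v(1) mat_mult_vec_eq[of _ n M v] in auto)
    ultimately show "\<exists>v. v \<in> carrier_vec n \<and> v \<noteq> 0\<^sub>v n \<and> ?A *\<^sub>v v = 0\<^sub>v n"
      by (intro exI[of _ "Matrix.vec n v"]) auto
  qed
  finally show ?thesis .
qed

lemma fdet_inverse:
  assumes "fdet n M \<noteq> 0"
  obtains N where "\<And>v i. i < n \<Longrightarrow> mat_vec N {..<n} (mat_vec M {..<n} v) i = v i"
    and "\<And>v i. i < n \<Longrightarrow> mat_vec M {..<n} (mat_vec N {..<n} v) i = v i"
proof -
  let ?A = "Matrix.mat n n (\<lambda>(i, j). M i j)"
  have "?A \<in> Units (ring_mat TYPE(complex) n ())"
    by (rule det_non_zero_imp_unit) (use assms in \<open>auto simp: fdet_def\<close>)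
  then obtain B where B: "B \<in> carrier_mat n n" "B * ?A = 1\<^sub>m n" "?A * B = 1\<^sub>m n"
    by (auto simp: Units_def ring_mat_def)
  define N where "N = (\<lambda>i j. B $$ (i, j))"
  have BN: "B = Matrix.mat n n (\<lambda>(i, j). N i j)" using B(1) by (intro eq_matI) (auto simp: N_def)
  have key: "mat_vec P {..<n} (mat_vec Q {..<n} v) i = v i"
    if "Matrix.mat n n (\<lambda>(i, j). P i j) * Matrix.mat n n (\<lambda>(i, j). Q i j) = 1\<^sub>m n" "i < n" for P Q v i
  proof -
    let ?P = "Matrix.mat n n (\<lambda>(i, j). P i j)" and ?Q = "Matrix.mat n n (\<lambda>(i, j). Q i j)"
    have q: "?Q *\<^sub>v Matrix.vec n v = Matrix.vec n (mat_vec Q {..<n} v)"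
      by (rule eq_vecI) (use mat_mult_vec_eq[of _ n Q v] in auto)
    have "?P *\<^sub>v (?Q *\<^sub>v Matrix.vec n v) = (?P * ?Q) *\<^sub>v Matrix.vec n v"
      by (rule assoc_mult_mat_vec[symmetric]) auto
    also have "\<dots> = Matrix.vec n v" unfolding that(1) by (rule one_mult_mat_vec) simp
    finally have "vec_index (?P *\<^sub>v Matrix.vec n (mat_vec Q {..<n} v)) i = vec_index (Matrix.vec n v) i" unfolding q by simp
    then show ?thesis unfolding mat_mult_vec_eq[OF that(2)] using that(2) by simp
  qed
  show ?thesis
    by (rule that[of N]) (use key B(2,3) in \<open>auto simp: BN\<close>)
qed

lemma fdet_transpose: "fdet n (\<lambda>i j. M j i) = fdet n M"
proof -
  have "Matrix.mat n n (\<lambda>(i, j). M j i) = transpose_mat (Matrix.mat n n (\<lambda>(i, j). M i j))"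
    by (rule eq_matI) auto
  then show ?thesis unfolding fdet_def by (simp add: Determinant.det_transpose[of _ n])
qed

lemma fdet_cnj: "cnj (fdet n M) = fdet n (\<lambda>i j. cnj (M i j))"
  by (simp add: fdet_expand sign_def if_distrib[of cnj] cong: if_cong)

text \<open>Variable \<open>i\<close> occurs in row \<open>i\<close> only, and every term of the
  Leibniz expansion takes exactly one entry from each row.\<close>

lemma multiaffine_fdet: "multiaffine {..<n} (\<lambda>z. fdet n (\<lambda>i j. A i j + z i * B i j))"
  unfolding multiaffine_def
proof (intro conjI allI impI)
  let ?F = "\<lambda>z. fdet n (\<lambda>i j. A i j + z i * B i j)"
  show "?F z = ?F z'" if "\<forall>i\<in>{..<n}. z i = z' i" for z z'
    unfolding fdet_expand using that by (intro sum.cong refl arg_cong2[of _ _ _ _ "(*)"] prod.cong) auto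
  show "?F (z(k := t)) = ?F (z(k := 0)) + t * pdiff k ?F z" for k z t
  proof -
    let ?P = "\<lambda>p s. \<Prod>i = 0..<n. A i (p i) + (z(k := s)) i * B i (p i)"
    have "?P p t = ?P p 0 + t * (?P p 1 - ?P p 0)" for p
    proof (cases "k < n")
      case True
      then have k: "k \<in> {0..<n}" by simp
      have e: "?P p s = (A k (p k) + s * B k (p k)) * (\<Prod>i \<in> {0..<n} - {k}. A i (p i) + z i * B i (p i))" for s
        by (subst prod.remove[OF _ k]) auto
      show ?thesis unfolding e by (simp add: algebra_simps)
    next
      case False
      then have "?P p s = (\<Prod>i = 0..<n. A i (p i) + z i * B i (p i))" for s
        by (intro prod.cong) auto
      then show ?thesis by simp
    qed
    note e = this
    have "?F (z(k := t)) = (\<Sum>p | p permutes {0..<n}. signof p * (?P p 0 + t * (?P p 1 - ?P p 0)))"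
      unfolding fdet_expand by (intro sum.cong refl arg_cong2[of _ _ _ _ "(*)"] e)
    then show ?thesis
      unfolding pdiff_def fdet_expand by (simp add: distrib_left right_diff_distrib sum.distrib sum_subtractf sum_distrib_left mult_ac)
  qed
qed simp

lemma sum_if_eq:
  fixes f :: "'a \<Rightarrow> 'b::comm_ring_1"
  assumes "finite T" "i \<in> T"
  shows "(\<Sum>j\<in>T. (if i = j then a else 0) * f j) = a * f i"
proof -
  have "(\<Sum>j\<in>T. (if i = j then a else 0) * f j) = (\<Sum>j\<in>T. if i = j then a * f j else 0)"
    by (intro sum.cong) auto
  also have "\<dots> = a * f i" using assms by (simp add: sum.delta')
  finally show ?thesis .
qed

lemma mat_vec_diag:
  assumes "finite T" "i \<in> T"
  shows "mat_vec (\<lambda>i j. (if i = j then a i else 0) + H i j) T v i = a i * v i + mat_vec H T v i"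
  using assms by (simp add: mat_vec_def distrib_right sum.distrib sum_if_eq)

lemma mat_vec_diag':
  assumes "finite T" "i \<in> T"
  shows "mat_vec (\<lambda>i j. H i j + (if i = j then a i else 0)) T v i = mat_vec H T v i + a i * v i"
  using assms by (simp add: mat_vec_def distrib_right sum.distrib sum_if_eq)

lemma quad_form_zero_imp: "finite T \<Longrightarrow> norm_sq T v = 0 \<Longrightarrow> i \<in> T \<Longrightarrow> v i = 0"
  using norm_sq_ge[of T i v] by simp

text \<open>There is a least \<open>x \<ge> 0\<close> for which \<open>N + x\<close> is
  semidefinite. If it were positive, \<open>N + x\<close> would be semidefinite and invertible,
  hence bounded below by some \<open>g > 0\<close>, and \<open>x\<close> could be decreased. This is
  how nonvanishing determinants become a matrix inequality.\<close>

lemma pos_semidef_of_nonsingular: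
  assumes N: "hermitian {..<n} N"
    and ns: "\<And>s::real. s \<ge> 0 \<Longrightarrow> fdet n (\<lambda>i j. N i j + (if i = j then of_real s else 0)) \<noteq> 0"
  shows "quad_form N {..<n} v \<ge> 0"
proof -
  let ?T = "{..<n}"
  define m where "m = (\<Sum>i\<in>?T. \<Sum>j\<in>?T. cmod (N i j))"
  have m0: "m \<ge> 0" by (simp add: m_def sum_nonneg)
  have m: "\<bar>quad_form N ?T v\<bar> \<le> m * norm_sq ?T v" for v unfolding m_def by (rule quad_form_bounded) simp
  define S where "S = {x. x \<ge> 0 \<and> (\<forall>v. quad_form N ?T v + x * norm_sq ?T v \<ge> 0)}"
  have "quad_form N ?T v + m * norm_sq ?T v \<ge> 0" for v using m[of v] by linarith
  then have mS: "m \<in> S" using m0 by (simp add: S_def)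
  have bdd: "bdd_below S" by (rule bdd_belowI[of _ 0]) (simp add: S_def)
  define x where "x = Inf S"
  have x0: "x \<ge> 0" unfolding x_def using mS by (intro cInf_greatest) (auto simp: S_def)
  have xS: "x \<in> S"
  proof -
    have "quad_form N ?T v + x * norm_sq ?T v \<ge> 0" for v
    proof (rule field_le_epsilon)
      fix e :: real assume e: "e > 0"
      define d where "d = e / (norm_sq ?T v + 1)"
      have nv: "norm_sq ?T v \<ge> 0" by simp
      have "d > 0" using e nv by (simp add: d_def add_nonneg_pos)
      moreover have "d * norm_sq ?T v \<le> d * (norm_sq ?T v + 1)" using calculation by simp
      moreover have "d * (norm_sq ?T v + 1) = e" using nv by (simp add: d_def add_nonneg_eq_0_iff)
      ultimately have d: "d > 0" "d * norm_sq ?T v \<le> e" by auto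
      have "Inf S < x + d" using d by (simp add: x_def)
      then obtain y where y: "y \<in> S" "y < x + d" using cInf_lessD[of S] mS by blast
      have "0 \<le> quad_form N ?T v + y * norm_sq ?T v" using y by (simp add: S_def)
      also have "\<dots> \<le> quad_form N ?T v + (x + d) * norm_sq ?T v" using y nv by (intro add_left_mono mult_right_mono) auto
      finally show "0 \<le> quad_form N ?T v + x * norm_sq ?T v + e" using d by (simp add: algebra_simps)
    qed
    then show ?thesis using x0 by (simp add: S_def)
  qed
  show ?thesis
  proof (cases "x = 0")
    case True
    then show ?thesis using xS by (simp add: S_def)
  next
    case False
    then have xp: "x > 0" using x0 by simp
    define B where "B = (\<lambda>i j. N i j + (if i = j then complex_of_real x else 0))"
    have qB: "quad_form B ?T v = quad_form N ?T v + x * norm_sq ?T v" for v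
      unfolding B_def by (subst quad_form_diag) (simp_all add: norm_sq_def sum_distrib_left)
    have pB: "pos_semidef ?T B"
      unfolding pos_semidef_def using xS qB hermitian_diag[OF N] by (auto simp: S_def B_def)
    have LB: "quad_form B ?T v \<le> (m + x) * norm_sq ?T v" for v
      using m[of v] by (simp add: qB algebra_simps abs_le_iff)
    obtain M where M: "\<And>v i. i < n \<Longrightarrow> mat_vec M ?T (mat_vec B ?T v) i = v i"
      by (rule fdet_inverse[OF ns[OF x0], folded B_def]) (rule that)
    define C where "C = (\<Sum>i\<in>?T. norm_sq ?T (M i))"
    have C0: "C \<ge> 0" by (simp add: C_def sum_nonneg)
    \<comment> \<open>Invertibility bounds \<open>v\<close> by \<open>B v\<close>, and
      \<open>mat_vec_bound\<close> bounds \<open>B v\<close> by the form of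
      \<open>B\<close>.\<close>
    have coer: "norm_sq ?T v \<le> C * ((m + x) * quad_form B ?T v)" for v
    proof -
      define w where "w = mat_vec B ?T v"
      have "(cmod (v i))\<^sup>2 \<le> norm_sq ?T (M i) * norm_sq ?T w" if "i \<in> ?T" for i
      proof -
        have "cmod (v i) = cmod (\<Sum>j\<in>?T. M i j * w j)"
          using M[of i v] that by (simp add: mat_vec_def w_def)
        also have "\<dots> \<le> (\<Sum>j\<in>?T. cmod (M i j) * cmod (w j))"
          by (rule order_trans[OF norm_sum]) (simp add: norm_mult)
        finally have "(cmod (v i))\<^sup>2 \<le> (\<Sum>j\<in>?T. cmod (M i j) * cmod (w j))\<^sup>2"
          by (rule power_mono) simp
        also have "\<dots> \<le> norm_sq ?T (M i) * norm_sq ?T w"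
          unfolding norm_sq_def by (rule Cauchy_Schwarz_ineq_sum)
        finally show ?thesis .
      qed
      then have "norm_sq ?T v \<le> (\<Sum>i\<in>?T. norm_sq ?T (M i) * norm_sq ?T w)"
        unfolding norm_sq_def[of ?T v] by (rule sum_mono)
      also have "\<dots> = C * norm_sq ?T w" by (simp add: C_def sum_distrib_right)
      also have "\<dots> \<le> C * ((m + x) * quad_form B ?T v)"
        unfolding w_def by (intro mult_left_mono mat_vec_bound[OF pB LB] C0)
      finally show ?thesis .
    qed
    define g where "g = 1 / (C * (m + x) + 1)"
    have g: "g > 0" using C0 m0 x0 by (auto simp: g_def add_nonneg_pos)
    have cg: "g * norm_sq ?T v \<le> quad_form B ?T v" for v
    proof -
      have q: "quad_form B ?T v \<ge> 0" using pB by (simp add: pos_semidef_def)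
      have "norm_sq ?T v \<le> (C * (m + x) + 1) * quad_form B ?T v" using coer[of v] q by (simp add: algebra_simps)
      then show ?thesis using g unfolding g_def by (simp add: field_simps)
    qed
    define y where "y = max 0 (x - g)"
    have "quad_form N ?T v + y * norm_sq ?T v \<ge> 0" for v
    proof -
      have "quad_form N ?T v + (x - g) * norm_sq ?T v \<ge> 0" using cg[of v] by (simp add: qB algebra_simps)
      moreover have "(x - g) * norm_sq ?T v \<le> y * norm_sq ?T v" by (intro mult_right_mono) (auto simp: y_def)
      ultimately show ?thesis by linarith
    qed
    then have "y \<in> S" by (simp add: S_def y_def)
    then have "x \<le> y" unfolding x_def by (rule cInf_lower[OF _ bdd])
    then show ?thesis using xp g by (simp add: y_def)
  qed
qed

lemma real_stable_scale:
  assumes "real_stable T F" "c \<noteq> 0"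
  shows "real_stable T (\<lambda>z. of_real c * F z)"
proof -
  have p: "pdiff i (\<lambda>z. of_real c * F z) z = of_real c * pdiff i F z" for i z
    by (simp add: pdiff_def right_diff_distrib)
  have m: "multiaffine T F" using assms by (simp add: real_stable_def)
  have "multiaffine T (\<lambda>z. of_real c * F z)"
    unfolding multiaffine_def p
  proof (intro conjI allI impI)
    show "finite T" using m by (simp add: multiaffine_def)
    show "of_real c * F z = of_real c * F z'" if "\<forall>i\<in>T. z i = z' i" for z z'
      using multiaffine_dep[OF m, of z z'] that by simp
    fix i z t
    have "F (z(i := t)) = F (z(i := 0)) + t * pdiff i F z" using m unfolding multiaffine_def by blast
    then show "of_real c * F (z(i := t)) = of_real c * F (z(i := 0)) + t * (of_real c * pdiff i F z)"
      by (simp add: algebra_simps)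
  qed
  then show ?thesis using assms unfolding real_stable_def by (auto intro!: Reals_mult)
qed

lemma real_val_continuous_segment:
  assumes "multiaffine T F"
  shows "continuous_on UNIV (\<lambda>t. real_val F (\<lambda>i. x i + t * d i))"
proof -
  have fT: "finite T" using assms by (simp add: multiaffine_def)
  obtain p where p: "\<And>t. poly p t = F (\<lambda>i. if i \<in> T then cvec x i + t * cvec d i else cvec x i)"
    using multiaffine_line[OF assms fT, where a = "cvec x" and d = "cvec d"] by blast
  have "real_val F (\<lambda>i. x i + t * d i) = Re (poly p (of_real t))" for t
    unfolding real_val_def p by (intro arg_cong[of _ _ Re] multiaffine_dep[OF assms]) (auto simp: cvec_def)
  then show ?thesis by (simp add: continuous_intros)
qed

text \<open>The orthant is convex: a nonpositive value would, by the intermediate value theorem,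
  produce a zero on the segment to \<open>u\<close>.\<close>

lemma above_of_nonzero:
  assumes F: "multiaffine T F" and nz: "\<And>y. (\<And>i. x i \<le> y i) \<Longrightarrow> real_val F y \<noteq> 0"
    and u: "\<And>i. x i \<le> u i" "real_val F u > 0"
  shows "above F x"
  unfolding above_def
proof (intro allI impI, rule ccontr)
  fix y assume y: "\<forall>i. x i \<le> y i" and "\<not> 0 < real_val F y"
  then have neg: "real_val F y \<le> 0" by simp
  define g where "g = (\<lambda>t. real_val F (\<lambda>i. u i + t * (y i - u i)))"
  have "\<exists>t\<ge>0. t \<le> 1 \<and> g t = 0"
  proof (rule IVT2')
    show "g 1 \<le> 0" using neg by (simp add: g_def)
    show "0 \<le> g 0" using u(2) by (simp add: g_def)
    show "continuous_on {0..1} g"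
      unfolding g_def by (rule continuous_on_subset[OF real_val_continuous_segment[OF F]]) simp
  qed simp
  then obtain t where t: "0 \<le> t" "t \<le> 1" "g t = 0" by blast
  have "x i \<le> u i + t * (y i - u i)" for i
  proof -
    have "u i + t * (y i - u i) = (1 - t) * u i + t * y i" by (simp add: algebra_simps)
    also have "\<dots> \<ge> (1 - t) * x i + t * x i"
      using u(1)[of i] y t by (intro add_mono mult_left_mono) auto
    finally show ?thesis by (simp add: algebra_simps)
  qed
  then show False using nz[of "\<lambda>i. u i + t * (y i - u i)"] t(3) unfolding g_def by simp
qed

text \<open>Lowering coordinate \<open>i\<close> by \<open>1 / Phi i F x\<close> reaches a zero of
  \<open>F\<close>, so this distance must violate \<open>t * g < d\<close>.\<close>

lemma Phi_le:
  assumes F: "multiaffine T F" and x: "real_val F x > 0" and d: "d > 0" and g: "g \<ge> 0"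
    and nz: "\<And>t. t \<ge> 0 \<Longrightarrow> t * g < d \<Longrightarrow> real_val F (x(i := x i - t)) \<noteq> 0"
  shows "Phi i F x \<le> g / d"
proof (rule ccontr)
  assume "\<not> ?thesis"
  then have P: "Phi i F x > g / d" by simp
  then have P0: "Phi i F x > 0" using d g by (meson divide_nonneg_pos le_less_trans)
  define t where "t = 1 / Phi i F x"
  have t: "t \<ge> 0" "t * g < d" using P P0 d by (auto simp: t_def field_simps)
  have "real_val F (x(i := x i + - t)) = real_val F x + - t * real_val (pdiff i F) x" by (rule real_val_shift[OF F])
  also have "\<dots> = real_val F x * (1 - t * Phi i F x)" using x by (simp add: Phi_def field_simps)
  also have "\<dots> = 0" using P0 by (simp add: t_def)
  finally show False using nz[OF t] by simp
qed

section \<open>Two stable determinants attached to a Hermitian matrix\<close>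

definition det_one_plus :: "nat \<Rightarrow> (nat \<Rightarrow> nat \<Rightarrow> complex) \<Rightarrow> (nat \<Rightarrow> complex) \<Rightarrow> complex" where
  "det_one_plus n G z = fdet n (\<lambda>i j. (if i = j then 1 else 0) + z i * G i j)"

lemma mat_vec_det_one_plus: "i < (n::nat) \<Longrightarrow> mat_vec (\<lambda>i j. (if i = j then 1 else 0) + z i * G i j) {..<n} v i = v i + z i * mat_vec G {..<n} v i"
  by (subst mat_vec_diag) (auto simp: mat_vec_def sum_distrib_left mult.assoc)

lemma det_one_plus_zero_iff: "det_one_plus n G z = 0 \<longleftrightarrow> (\<exists>v. (\<exists>i<n. v i \<noteq> 0) \<and> (\<forall>i<n. v i = - z i * mat_vec G {..<n} v i))"
  unfolding det_one_plus_def fdet_zero_iff by (auto simp: mat_vec_det_one_plus add_eq_0_iff2 cong: conj_cong)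

text \<open>For the diagonal matrix \<open>D\<close> of \<open>z\<close> this is
  \<open>det (1 + G D) = det (1 + D G)\<close>. It holds term by term: a permutation maps the set of
  its nonfixed points to itself, so the product of \<open>z\<close> over that set is unchanged, and
  at fixed points the entries agree. It shows that \<open>det_one_plus\<close> is real at real
  points.\<close>

lemma fdet_scale_columns:
  "fdet n (\<lambda>i j. (if i = j then 1 else 0) + z j * G i j) = fdet n (\<lambda>i j. (if i = j then 1 else 0) + z i * G i j)"
  unfolding fdet_expand
proof (intro sum.cong refl arg_cong2[of _ _ _ _ "(*)"])
  fix p assume "p \<in> {p. p permutes {0..<n}}"
  then have p: "p permutes {0..<n}" by simp
  define K where "K = {i \<in> {0..<n}. p i \<noteq> i}"
  have pK: "p permutes K"
    using p unfolding K_def permutes_def by (metis (mono_tags, lifting) mem_Collect_eq)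
  have s: "prod f {0..<n} = prod f K * prod f {i \<in> {0..<n}. p i = i}" for f :: "nat \<Rightarrow> complex"
  proof -
    have "{0..<n} = K \<union> {i \<in> {0..<n}. p i = i}" by (auto simp: K_def)
    then have "prod f {0..<n} = prod f (K \<union> {i \<in> {0..<n}. p i = i})" by (rule arg_cong)
    also have "\<dots> = prod f K * prod f {i \<in> {0..<n}. p i = i}"
      by (rule prod.union_disjoint) (auto simp: K_def)
    finally show ?thesis .
  qed
  have "(\<Prod>i\<in>K. z (p i)) = (\<Prod>i\<in>K. z i)" using prod.permute[OF pK, of z] by (simp add: o_def)
  moreover have "(\<Prod>i\<in>K. (if i = p i then 1 else 0) + z (p i) * G i (p i)) = (\<Prod>i\<in>K. z (p i) * G i (p i))"
    "(\<Prod>i\<in>K. (if i = p i then 1 else 0) + z i * G i (p i)) = (\<Prod>i\<in>K. z i * G i (p i))"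
    by (intro prod.cong; auto simp: K_def)+
  ultimately show "(\<Prod>i = 0..<n. (if i = p i then 1 else 0) + z (p i) * G i (p i)) =
    (\<Prod>i = 0..<n. (if i = p i then 1 else 0) + z i * G i (p i))"
    unfolding s by (simp add: prod.distrib)
qed

lemma sum_mat_vec_hermitian:
  assumes "hermitian T G"
  shows "(\<Sum>i\<in>T. v i * cnj (mat_vec G T v i)) = of_real (quad_form G T v)"
proof -
  have "(\<Sum>i\<in>T. v i * cnj (mat_vec G T v i)) = cnj (sesq_form G T v v)" by (simp add: sesq_form_def)
  then show ?thesis unfolding sesq_form_self[OF assms] by simp
qed

text \<open>A kernel vector satisfies \<open>v i = - z i * (G v) i\<close>. Pairing with
  \<open>G v\<close> writes the real number \<open>quad_form G {..<n} v\<close> as minus the sum of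
  the \<open>z i\<close> weighted with the squared moduli of \<open>G v\<close>. With all
  \<open>Im (z i)\<close> positive this forces \<open>G v = 0\<close>, and then
  \<open>v = 0\<close>.\<close>

lemma real_stable_det_one_plus:
  assumes G: "pos_semidef {..<n} G"
  shows "real_stable {..<n} (det_one_plus n G)"
  unfolding real_stable_def
proof (intro conjI allI impI)
  have h: "hermitian {..<n} G" using G by (simp add: pos_semidef_def)
  show "multiaffine {..<n} (det_one_plus n G)" unfolding det_one_plus_def by (rule multiaffine_fdet)
  show "det_one_plus n G z \<in> \<real>" if z: "\<forall>i. z i \<in> \<real>" for z
  proof -
    have "cnj (det_one_plus n G z) = fdet n (\<lambda>i j. cnj ((if i = j then 1 else 0) + z i * G i j))"
      unfolding det_one_plus_def by (rule fdet_cnj)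
    also have "\<dots> = fdet n (\<lambda>i j. (if j = i then 1 else 0) + z i * G j i)"
      unfolding fdet_expand
    proof (intro sum.cong refl arg_cong2[of _ _ _ _ "(*)"] prod.cong)
      fix p i assume "p \<in> {p. p permutes {0..<n}}" "i \<in> {0..<n}"
      then have "p i < n" "i < n" using permutes_in_image[of p "{0..<n}" i] by auto
      then have "G (p i) i = cnj (G i (p i))" by (intro hermitianD[OF h]) auto
      moreover have "cnj (z i) = z i" using z by (simp add: Reals_cnj_iff)
      ultimately show "cnj ((if i = p i then 1 else 0) + z i * G i (p i)) = (if p i = i then 1 else 0) + z i * G (p i) i"
        by simp
    qed
    also have "\<dots> = fdet n (\<lambda>i j. (if i = j then 1 else 0) + z j * G i j)"
      using fdet_transpose[of n "\<lambda>i j. (if i = j then 1 else 0) + z j * G i j"] .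
    also have "\<dots> = det_one_plus n G z" unfolding det_one_plus_def by (rule fdet_scale_columns)
    finally show ?thesis by (simp add: Reals_cnj_iff)
  qed
  show "det_one_plus n G z \<noteq> 0" if z: "\<forall>i\<in>{..<n}. 0 < Im (z i)" for z
  proof
    assume "det_one_plus n G z = 0"
    then obtain v k where v: "k < n" "v k \<noteq> 0" "\<And>i. i < n \<Longrightarrow> v i = - z i * mat_vec G {..<n} v i"
      unfolding det_one_plus_zero_iff by blast
    let ?g = "mat_vec G {..<n} v"
    have "of_real (quad_form G {..<n} v) = (\<Sum>i<n. v i * cnj (?g i))" by (rule sum_mat_vec_hermitian[OF h, symmetric])
    also have "\<dots> = (\<Sum>i<n. - z i * of_real ((cmod (?g i))\<^sup>2))"
      by (intro sum.cong refl) (subst v(3), auto simp: complex_norm_square mult_ac simp del: of_real_power)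
    finally have "Im (of_real (quad_form G {..<n} v)) = Im (\<Sum>i<n. - z i * of_real ((cmod (?g i))\<^sup>2))" by (rule arg_cong)
    then have "(\<Sum>i<n. Im (z i) * (cmod (?g i))\<^sup>2) = 0" by (simp add: sum_negf del: of_real_power)
    moreover have "0 \<le> Im (z i) * (cmod (?g i))\<^sup>2" if "i \<in> {..<n}" for i using z that by (auto simp: less_imp_le)
    ultimately have "Im (z k) * (cmod (?g k))\<^sup>2 = 0"
      using v(1) by (subst (asm) sum_nonneg_eq_0_iff) auto
    moreover have "Im (z k) > 0" using z v(1) by blast
    ultimately have "?g k = 0" by simp
    then show False using v by auto
  qed
qed

text \<open>The companion of \<open>det_one_plus\<close> for lower bounds. There the variables scale
  \<open>G\<close>, and going down tests an upper bound; here they are added to the diagonal, so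
  that lowering a variable demands a better lower bound at its index, and raising it releases the
  index.\<close>

definition det_plus_diag :: "nat \<Rightarrow> (nat \<Rightarrow> nat \<Rightarrow> complex) \<Rightarrow> (nat \<Rightarrow> complex) \<Rightarrow> complex" where
  "det_plus_diag n M z = fdet n (\<lambda>i j. M i j + z i * (if i = j then 1 else 0))"

lemma det_plus_diag_zero_iff: "det_plus_diag n M z = 0 \<longleftrightarrow> (\<exists>v. (\<exists>i<n. v i \<noteq> 0) \<and> (\<forall>i<n. mat_vec M {..<n} v i = - z i * v i))"
proof -
  have "mat_vec (\<lambda>i j. M i j + z i * (if i = j then 1 else 0)) {..<n} v i = mat_vec M {..<n} v i + z i * v i" if "i < n" for v i
  proof -
    have "(\<lambda>i j. M i j + z i * (if i = j then 1 else 0)) = (\<lambda>i j. M i j + (if i = j then z i else 0))"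
      by (auto simp: fun_eq_iff)
    then show ?thesis using that by (simp add: mat_vec_diag')
  qed
  then show ?thesis unfolding det_plus_diag_def fdet_zero_iff by (auto simp: add_eq_0_iff2 cong: conj_cong)
qed

lemma real_stable_det_plus_diag:
  assumes h: "hermitian {..<n} M"
  shows "real_stable {..<n} (det_plus_diag n M)"
  unfolding real_stable_def
proof (intro conjI allI impI)
  show "multiaffine {..<n} (det_plus_diag n M)" unfolding det_plus_diag_def by (rule multiaffine_fdet)
  show "det_plus_diag n M z \<in> \<real>" if z: "\<forall>i. z i \<in> \<real>" for z
  proof -
    have "cnj (det_plus_diag n M z) = fdet n (\<lambda>i j. cnj (M i j + z i * (if i = j then 1 else 0)))"
      unfolding det_plus_diag_def by (rule fdet_cnj)
    also have "\<dots> = fdet n (\<lambda>i j. M j i + z j * (if j = i then 1 else 0))"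
      unfolding fdet_expand
    proof (intro sum.cong refl arg_cong2[of _ _ _ _ "(*)"] prod.cong)
      fix p i assume "p \<in> {p. p permutes {0..<n}}" "i \<in> {0..<n}"
      then have "p i < n" "i < n" using permutes_in_image[of p "{0..<n}" i] by auto
      then have "M (p i) i = cnj (M i (p i))" by (intro hermitianD[OF h]) auto
      moreover have "cnj (z i) = z i" using z by (simp add: Reals_cnj_iff)
      ultimately show "cnj (M i (p i) + z i * (if i = p i then 1 else 0)) = M (p i) i + z (p i) * (if p i = i then 1 else 0)"
        by simp
    qed
    also have "\<dots> = det_plus_diag n M z"
      unfolding det_plus_diag_def using fdet_transpose[of n "\<lambda>i j. M i j + z i * (if i = j then 1 else 0)"] .
    finally show ?thesis by (simp add: Reals_cnj_iff)
  qed
  show "det_plus_diag n M z \<noteq> 0" if z: "\<forall>i\<in>{..<n}. 0 < Im (z i)" for z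
  proof
    assume "det_plus_diag n M z = 0"
    then obtain v k where v: "k < n" "v k \<noteq> 0" "\<And>i. i < n \<Longrightarrow> mat_vec M {..<n} v i = - z i * v i"
      unfolding det_plus_diag_zero_iff by blast
    have "of_real (quad_form M {..<n} v) = (\<Sum>i<n. cnj (v i) * mat_vec M {..<n} v i)"
      unfolding sesq_form_self[OF h, symmetric] sesq_form_def ..
    also have "\<dots> = (\<Sum>i<n. - z i * of_real ((cmod (v i))\<^sup>2))"
      by (intro sum.cong refl) (subst v(3), auto simp: complex_norm_square mult_ac simp del: of_real_power)
    finally have "Im (of_real (quad_form M {..<n} v)) = Im (\<Sum>i<n. - z i * of_real ((cmod (v i))\<^sup>2))" by (rule arg_cong)
    then have "(\<Sum>i<n. Im (z i) * (cmod (v i))\<^sup>2) = 0" by (simp add: sum_negf del: of_real_power)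
    moreover have "0 \<le> Im (z i) * (cmod (v i))\<^sup>2" if "i \<in> {..<n}" for i using z that by (auto simp: less_imp_le)
    ultimately have "Im (z k) * (cmod (v k))\<^sup>2 = 0"
      using v(1) by (subst (asm) sum_nonneg_eq_0_iff) auto
    moreover have "Im (z k) > 0" using z v(1) by blast
    ultimately show False using v(2) by simp
  qed
qed

text \<open>For a kernel vector \<open>v\<close> the form of \<open>G\<close> at \<open>v\<close> is
  at most \<open>\<tau>\<close> times the squared norm of \<open>G v\<close> plus \<open>t\<close>
  times the squared modulus of its entry \<open>k\<close>. The two bounds on \<open>G v\<close> turn
  this into \<open>\<tau> * L + t * Re (G k k)\<close> times the form itself, with a factor below 1.
  So the form vanishes, and with it \<open>G v\<close> and \<open>v\<close>.\<close>

lemma det_one_plus_nonzero: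
  assumes G: "pos_semidef {..<n} G" and L: "\<And>c. quad_form G {..<n} c \<le> L * norm_sq {..<n} c"
    and t: "t \<ge> 0" "\<tau> \<ge> 0" "\<tau> * L + t * Re (G k k) < 1" and k: "k < n"
    and y: "\<And>i. y i \<ge> - \<tau> - (if i = k then t else 0)"
  shows "real_val (det_one_plus n G) y \<noteq> 0"
proof
  assume "real_val (det_one_plus n G) y = 0"
  then have "det_one_plus n G (cvec y) = 0" using real_stable_real_val[OF real_stable_det_one_plus[OF G]] by simp
  then obtain v j where v: "j < n" "v j \<noteq> 0" "\<And>i. i < n \<Longrightarrow> v i = - cvec y i * mat_vec G {..<n} v i"
    unfolding det_one_plus_zero_iff by blast
  have h: "hermitian {..<n} G" using G by (simp add: pos_semidef_def)
  let ?g = "mat_vec G {..<n} v" and ?q = "quad_form G {..<n} v"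
  have "of_real ?q = (\<Sum>i<n. v i * cnj (?g i))" by (rule sum_mat_vec_hermitian[OF h, symmetric])
  also have "\<dots> = (\<Sum>i<n. of_real (- y i * (cmod (?g i))\<^sup>2))"
    by (intro sum.cong refl) (subst v(3), auto simp: complex_norm_square cvec_def mult_ac simp del: of_real_power)
  also have "\<dots> = of_real (\<Sum>i<n. - y i * (cmod (?g i))\<^sup>2)" by simp
  finally have "?q = (\<Sum>i<n. - y i * (cmod (?g i))\<^sup>2)" unfolding of_real_eq_iff .
  also have "\<dots> \<le> (\<Sum>i<n. (\<tau> + (if i = k then t else 0)) * (cmod (?g i))\<^sup>2)"
  proof (intro sum_mono mult_right_mono)
    fix i show "- y i \<le> \<tau> + (if i = k then t else 0)" using y[of i] by linarith
  qed simp
  also have "\<dots> = \<tau> * norm_sq {..<n} ?g + t * (cmod (?g k))\<^sup>2"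
    using k sum_if_eq[of "{..<n}" k t "\<lambda>i. (cmod (?g i))\<^sup>2"]
    by (simp add: norm_sq_def distrib_right sum.distrib sum_distrib_left eq_commute[of k])
  also have "\<dots> \<le> \<tau> * (L * ?q) + t * (Re (G k k) * ?q)"
    using k t by (intro add_mono mult_left_mono mat_vec_bound[OF G L] mat_vec_diag_bound[OF G]) auto
  finally have "?q * (1 - (\<tau> * L + t * Re (G k k))) \<le> 0" by (simp add: algebra_simps)
  then have q: "?q = 0" using t(3) G by (auto simp: mult_le_0_iff pos_semidef_def intro: antisym)
  have "norm_sq {..<n} ?g \<le> L * ?q" by (rule mat_vec_bound[OF G L])
  then have "norm_sq {..<n} ?g = 0" using q norm_sq_nonneg[of "{..<n}" ?g] by simp
  then have "?g j = 0" using v(1) by (intro quad_form_zero_imp[of "{..<n}"]) auto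
  then show False using v by auto
qed

section \<open>Selection for Gram matrices\<close>

lemma det_one_plus_zero_arg: "real_val (det_one_plus n G) (\<lambda>_. 0) = 1"
proof -
  have "det_one_plus n G (cvec (\<lambda>_. 0)) = Determinant.det (1\<^sub>m n)"
    unfolding det_one_plus_def fdet_def by (intro arg_cong[of _ _ Determinant.det] eq_matI) (auto simp: cvec_def)
  then show ?thesis by (simp add: real_val_def)
qed

text \<open>The function is \<open>det_one_plus\<close> of \<open>G / x\<close>, and the starting
  point is the constant \<open>- \<tau>\<close>. There index \<open>i\<close> has barrier at most
  \<open>G i i / (x - \<tau> * L)\<close>, a block at most
  \<open>\<kappa> / (x - \<tau> * L)\<close>, and the last condition on \<open>\<tau>\<close> is the
  one of \<open>barrier_upper\<close>. Raising by \<open>\<tau>\<close> leads back to 0, so the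
  selected indices end at \<open>- 1 / p i\<close>, which encodes the upper bound.\<close>

theorem upper_selection:
  fixes n :: nat
  assumes G: "pos_semidef {..<n} G" and L: "\<And>c. quad_form G {..<n} c \<le> L * norm_sq {..<n} c"
    and B: "finite B" "disjoint B" "\<Union>B \<subseteq> {..<n}"
    and p: "\<And>b. b \<in> B \<Longrightarrow> sum p b = 1" "\<And>i. i \<in> \<Union>B \<Longrightarrow> p i > 0"
    and tr: "\<And>b. b \<in> B \<Longrightarrow> (\<Sum>i\<in>b. Re (G i i)) \<le> \<kappa>"
    and \<tau>: "\<tau> \<ge> 1" "\<tau> * L < x" "\<tau> * \<kappa> \<le> (\<tau> - 1) * (x - \<tau> * L)" and x: "x > 0"
  shows "\<exists>sel. (\<forall>b\<in>B. sel b \<in> b) \<and>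
    (\<forall>c. quad_form (\<lambda>i j. G i j / of_real (sqrt (p i) * sqrt (p j))) (sel ` B) c \<le> x * norm_sq (sel ` B) c)"
proof -
  let ?T = "{..<n}"
  have h: "hermitian ?T G" using G by (simp add: pos_semidef_def)
  define G' where "G' = (\<lambda>i j. G i j / of_real x)"
  have mvG': "mat_vec G' S v i = mat_vec G S v i / of_real x" for S v i by (simp add: G'_def mat_vec_def sum_divide_distrib)
  have qG': "quad_form G' S v = quad_form G S v / x" for S v
    by (simp add: quad_form_def sesq_form_def mvG' sum_divide_distrib[symmetric])
  have "hermitian ?T G'"
    unfolding hermitian_def
  proof (intro conjI ballI)
    fix i j assume "i \<in> ?T" "j \<in> ?T"
    from hermitianD[OF h this] show "G' j i = cnj (G' i j)" by (simp add: G'_def)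
  qed simp
  then have pG': "pos_semidef ?T G'" using G x unfolding pos_semidef_def qG' by auto
  have LG': "quad_form G' ?T c \<le> (L / x) * norm_sq ?T c" for c
    using L[of c] x by (simp add: qG' divide_right_mono)
  let ?F = "det_one_plus n G'"
  have F: "real_stable ?T ?F" by (rule real_stable_det_one_plus[OF pG'])
  note mF = real_stable_multiaffine[OF F]
  have d: "1 - \<tau> * (L / x) > 0" using \<tau>(2) x by (simp add: field_simps)
  define x0 where "x0 = (\<lambda>_::nat. - \<tau>)"
  have ab: "above ?F x0" if "n > 0"
  proof (rule above_of_nonzero[OF mF, of _ "\<lambda>_. 0"])
    show "real_val ?F y \<noteq> 0" if "\<And>i. x0 i \<le> y i" for y
      by (rule det_one_plus_nonzero[OF pG' LG', of 0 \<tau> 0]) (use that d \<open>n > 0\<close> \<tau> in \<open>auto simp: x0_def\<close>)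
  qed (use \<tau> in \<open>auto simp: x0_def det_one_plus_zero_arg\<close>)
  show ?thesis
  proof (cases "B = {}")
    case True
    then show ?thesis by (simp add: quad_form_def sesq_form_def norm_sq_def)
  next
    case False
    then obtain b0 where "b0 \<in> B" by blast
    moreover have "b0 \<noteq> {}" using p(1)[OF calculation] by auto
    ultimately have n0: "n > 0" using B(3) by auto
    note ab = ab[OF n0]
    have Gii: "Re (G i i) \<ge> 0" if "i < n" for i
    proof -
      let ?e = "\<lambda>k. if i = k then 1 else 0 :: complex"
      have 1: "mat_vec G ?T ?e k = G k i" if "k \<in> ?T" for k
        using sum_if_eq[of ?T i 1 "G k"] \<open>i < n\<close> by (simp add: mat_vec_def mult.commute)
      have "sesq_form G ?T ?e ?e = (\<Sum>k<n. (if i = k then 1 else 0) * G k i)"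
        unfolding sesq_form_def by (intro sum.cong) (auto simp: 1)
      then have "quad_form G ?T ?e = Re (G i i)"
        using sum_if_eq[of ?T i 1 "\<lambda>k. G k i"] \<open>i < n\<close> by (simp add: quad_form_def)
      then show ?thesis using G unfolding pos_semidef_def by metis
    qed
    have Ph: "Phi i ?F x0 \<le> Re (G i i) / (x - \<tau> * L)" if i: "i < n" for i
    proof -
      have "Phi i ?F x0 \<le> Re (G' i i) / (1 - \<tau> * (L / x))"
      proof (rule Phi_le[OF mF aboveD[OF ab] d])
        show "Re (G' i i) \<ge> 0" using Gii[OF i] x by (simp add: G'_def)
        fix t :: real assume t: "t \<ge> 0" "t * Re (G' i i) < 1 - \<tau> * (L / x)"
        show "real_val ?F (x0(i := x0 i - t)) \<noteq> 0"
          by (rule det_one_plus_nonzero[OF pG' LG', of t \<tau> i]) (use t \<tau> i in \<open>auto simp: x0_def\<close>)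
      qed
      also have "\<dots> = Re (G i i) / (x - \<tau> * L)"
        using x \<tau>(2) by (simp add: G'_def field_simps)
      finally show ?thesis .
    qed
    define \<phi> where "\<phi> = \<kappa> / (x - \<tau> * L)"
    have fb: "finite b" if "b \<in> B" for b using that B(3) by (meson Union_upper finite_lessThan finite_subset)
    have Pb: "(\<Sum>i\<in>b. Phi i ?F x0) \<le> \<phi>" if b: "b \<in> B" for b
    proof -
      have "(\<Sum>i\<in>b. Phi i ?F x0) \<le> (\<Sum>i\<in>b. Re (G i i) / (x - \<tau> * L))"
        using b B(3) by (intro sum_mono Ph) auto
      also have "\<dots> \<le> \<phi>"
        unfolding \<phi>_def sum_divide_distrib[symmetric] using tr[OF b] \<tau>(2) by (intro divide_right_mono) auto
      finally show ?thesis .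
    qed
    have \<phi>1: "\<tau> * (1 - \<phi>) \<ge> 1"
    proof -
      have "\<tau> * \<phi> \<le> \<tau> - 1" using \<tau> by (simp add: \<phi>_def divide_le_eq)
      then show ?thesis by (simp add: algebra_simps)
    qed
    have \<phi>2: "\<phi> < 1"
    proof (rule ccontr)
      assume "\<not> \<phi> < 1"
      then have "\<tau> * (1 - \<phi>) \<le> 0" using \<tau>(1) by (intro mult_nonneg_nonpos) auto
      then show False using \<phi>1 by linarith
    qed
    obtain sel where sel: "\<And>b. b \<in> B \<Longrightarrow> sel b \<in> b"
      and ab': "above ?F (\<lambda>i. raise_on (\<Union>B) \<tau> x0 i - (if i \<in> sel ` B then 1 / p i else 0))"
      using block_selection_upper[OF B(1) F ab fb B(2) Pb \<phi>2 \<phi>1 _ p] \<tau>(1) by auto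
    define S where "S = sel ` B"
    have SB: "S \<subseteq> \<Union>B" using sel by (auto simp: S_def)
    have Sn: "S \<subseteq> ?T" using SB B(3) by blast
    define C where "C = (\<lambda>i. if i \<in> S then 1 / p i else 0)"
    have C0: "C i \<ge> 0" for i using p(2) SB by (force simp: C_def)
    have ab2: "above ?F (\<lambda>i. - C i)"
      by (rule above_mono[OF ab']) (use \<tau> in \<open>auto simp: raise_on_def x0_def C_def S_def\<close>)
    \<comment> \<open>The Hermitian form of \<open>1 - C G / x\<close>. Since \<open>C\<close> is
      \<open>1 / p\<close> on the selected indices and 0 elsewhere, semidefiniteness of
      \<open>N\<close> is the bound to be proved.\<close>
    define N where "N = (\<lambda>i j. (if i = j then 1 else 0) - of_real (sqrt (C i)) * G' i j * of_real (sqrt (C j)))"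
    have mvN: "mat_vec N ?T v i = v i - of_real (sqrt (C i)) * mat_vec G' ?T (\<lambda>j. of_real (sqrt (C j)) * v j) i" if "i < n" for v i
      using that unfolding N_def mat_vec_def
      by (simp add: left_diff_distrib sum_subtractf sum_distrib_left mult.assoc sum_if_eq)
    have hN: "hermitian ?T N"
      unfolding hermitian_def
    proof (intro conjI ballI)
      fix i j assume "i \<in> ?T" "j \<in> ?T"
      then have "G' j i = cnj (G' i j)" using pG' by (intro hermitianD) (auto simp: pos_semidef_def)
      then show "N j i = cnj (N i j)" by (simp add: N_def)
    qed simp
    \<comment> \<open>A kernel vector of \<open>N + s\<close> yields one of
      \<open>1 - (C / (1 + s)) G / x\<close>. But the point \<open>- C / (1 + s)\<close> lies above
      \<open>- C\<close>, so the determinant is positive there.\<close>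
    have "fdet n (\<lambda>i j. N i j + (if i = j then of_real s else 0)) \<noteq> 0" if s: "s \<ge> 0" for s :: real
    proof
      assume "fdet n (\<lambda>i j. N i j + (if i = j then of_real s else 0)) = 0"
      then obtain v k where v: "k < n" "v k \<noteq> 0"
        "\<And>i. i < n \<Longrightarrow> mat_vec (\<lambda>i j. N i j + (if i = j then of_real s else 0)) ?T v i = 0"
        unfolding fdet_zero_iff by blast
      have v': "of_real (1 + s) * v i = of_real (sqrt (C i)) * mat_vec G' ?T (\<lambda>j. of_real (sqrt (C j)) * v j) i" if i: "i < n" for i
      proof -
        have "mat_vec (\<lambda>i j. N i j + (if i = j then of_real s else 0)) ?T v i = mat_vec N ?T v i + of_real s * v i"
          using i by (subst mat_vec_diag') auto
        then show ?thesis using v(3)[OF i] unfolding mvN[OF i] by (simp add: algebra_simps)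
      qed
      define u where "u = (\<lambda>j. of_real (sqrt (C j)) * v j)"
      have s1: "complex_of_real (1 + s) \<noteq> 0" using s by (simp flip: of_real_add add: add_nonneg_eq_0_iff del: of_real_add)
      have vu: "v i = of_real (sqrt (C i)) * mat_vec G' ?T u i / of_real (1 + s)" if "i < n" for i
        using v'[OF that] s1 unfolding u_def by (simp add: field_simps)
      have ueq: "u i = - cvec (\<lambda>i. - C i / (1 + s)) i * mat_vec G' ?T u i" if i: "i < n" for i
      proof -
        have "u i = of_real (sqrt (C i)) * (of_real (sqrt (C i)) * mat_vec G' ?T u i / of_real (1 + s))"
          unfolding u_def[of] by (subst vu[OF i, unfolded u_def]) (simp add: u_def)
        also have "\<dots> = of_real (sqrt (C i) * sqrt (C i)) * mat_vec G' ?T u i / of_real (1 + s)"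
          by (simp only: of_real_mult times_divide_eq_right mult.assoc)
        also have "sqrt (C i) * sqrt (C i) = C i" using C0 by simp
        finally show ?thesis by (simp add: cvec_def)
      qed
      have "\<exists>i<n. u i \<noteq> 0"
      proof (rule ccontr)
        assume "\<not> ?thesis"
        then have "mat_vec G' ?T u k = 0" by (simp add: mat_vec_def)
        then show False using vu[OF v(1)] v(2) by simp
      qed
      then have "det_one_plus n G' (cvec (\<lambda>i. - C i / (1 + s))) = 0"
        unfolding det_one_plus_zero_iff using ueq by blast
      then have "real_val ?F (\<lambda>i. - C i / (1 + s)) = 0" by (simp add: real_val_def)
      moreover have "- C i \<le> - C i / (1 + s)" for i
      proof -
        have "C i / (1 + s) \<le> C i" using C0[of i] s by (simp add: divide_le_eq mult_left_mono algebra_simps)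
        then show ?thesis by simp
      qed
      ultimately show False
        using ab2[unfolded above_def, rule_format, of "\<lambda>i. - C i / (1 + s)"] by simp
    qed
    note psN = pos_semidef_of_nonsingular[OF hN this]
    have "quad_form (\<lambda>i j. G i j / of_real (sqrt (p i) * sqrt (p j))) S c \<le> x * norm_sq S c" for c
    proof -
      define v where "v = (\<lambda>i. if i \<in> S then c i else 0)"
      have nv: "norm_sq ?T v = norm_sq S c"
        unfolding norm_sq_def v_def using Sn by (intro sum.mono_neutral_cong_right) auto
      have "sesq_form N ?T v v = of_real (norm_sq ?T v) - (\<Sum>i<n. cnj (v i) * of_real (sqrt (C i)) * mat_vec G' ?T (\<lambda>j. of_real (sqrt (C j)) * v j) i)"
        unfolding sesq_form_def norm_sq_def by (simp add: mvN right_diff_distrib sum_subtractf cnj_mult_self mult.assoc)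
      moreover have "(\<Sum>i<n. cnj (v i) * of_real (sqrt (C i)) * mat_vec G' ?T (\<lambda>j. of_real (sqrt (C j)) * v j) i) =
        (\<Sum>i\<in>S. cnj (c i) * of_real (sqrt (C i)) * mat_vec G' ?T (\<lambda>j. of_real (sqrt (C j)) * v j) i)"
        unfolding v_def using Sn by (intro sum.mono_neutral_cong_right) auto
      moreover have "mat_vec G' ?T (\<lambda>j. of_real (sqrt (C j)) * v j) i = mat_vec G' S (\<lambda>j. of_real (sqrt (C j)) * c j) i" for i
        unfolding mat_vec_def v_def using Sn by (intro sum.mono_neutral_cong_right) auto
      moreover have "(\<Sum>i\<in>S. cnj (c i) * of_real (sqrt (C i)) * mat_vec G' S (\<lambda>j. of_real (sqrt (C j)) * c j) i) =
        sesq_form (\<lambda>i j. G i j / of_real (sqrt (p i) * sqrt (p j))) S c c / of_real x"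
        unfolding sesq_form_def sum_divide_distrib mat_vec_def sum_distrib_left
        by (intro sum.cong refl) (auto simp: C_def G'_def real_sqrt_divide field_simps)
      ultimately have "sesq_form N ?T v v = of_real (norm_sq S c) - sesq_form (\<lambda>i j. G i j / of_real (sqrt (p i) * sqrt (p j))) S c c / of_real x"
        using nv by simp
      then have "quad_form N ?T v = norm_sq S c - quad_form (\<lambda>i j. G i j / of_real (sqrt (p i) * sqrt (p j))) S c / x"
        by (simp add: quad_form_def)
      then have "0 \<le> norm_sq S c - quad_form (\<lambda>i j. G i j / of_real (sqrt (p i) * sqrt (p j))) S c / x"
        using psN[of v] by simp
      then have "quad_form (\<lambda>i j. G i j / of_real (sqrt (p i) * sqrt (p j))) S c / x \<le> norm_sq S c" by simp
      then show ?thesis using x by (simp only: pos_divide_le_eq mult.commute)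
    qed
    then show ?thesis using sel unfolding S_def by blast
  qed
qed

text \<open>The index \<open>sel b\<close> is the one deleted from the block \<open>b\<close>.\<close>

theorem lower_selection:
  fixes n :: nat
  assumes G: "pos_semidef {..<n} G" and a: "a > 0" and \<beta>: "\<beta> > 0" and K: "K > 0"
    and B: "finite B" "disjoint B" "\<Union>B \<subseteq> {..<n}" "\<And>b. b \<in> B \<Longrightarrow> b \<noteq> {} \<and> card b \<le> K"
    and dg: "\<And>i c. i \<in> \<Union>B \<Longrightarrow> (cmod (c i))\<^sup>2 \<le> \<beta> * (quad_form G {..<n} c + a * norm_sq {..<n} c)"
  shows "\<exists>sel. (\<forall>b\<in>B. sel b \<in> b) \<and>
    (\<forall>c. (\<forall>i<n. i \<notin> \<Union>B - sel ` B \<longrightarrow> c i = 0) \<longrightarrow> (1 / (3 * K * \<beta>) - a) * norm_sq {..<n} c \<le> quad_form G {..<n} c)"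
proof -
  let ?T = "{..<n}"
  have h: "hermitian ?T G" and pG: "\<And>v. quad_form G ?T v \<ge> 0" using G by (auto simp: pos_semidef_def)
  define M where "M = (\<lambda>i j. G i j + (if i = j then complex_of_real a else 0))"
  have hM: "hermitian ?T M" unfolding M_def by (rule hermitian_diag[OF h])
  have qM: "quad_form M ?T v = quad_form G ?T v + a * norm_sq ?T v" for v
    unfolding M_def by (subst quad_form_diag) (simp_all add: norm_sq_def sum_distrib_left)
  have det_plus_diag: "real_stable ?T (det_plus_diag n M)" by (rule real_stable_det_plus_diag[OF hM])
  have eq: "quad_form M ?T v = (\<Sum>i<n. - y i * (cmod (v i))\<^sup>2)" if "\<And>i. i < n \<Longrightarrow> mat_vec M ?T v i = - cvec y i * v i" for v y
  proof -
    have "sesq_form M ?T v v = (\<Sum>i<n. of_real (- y i * (cmod (v i))\<^sup>2))"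
      unfolding sesq_form_def by (intro sum.cong refl) (auto simp: that complex_norm_square cvec_def mult_ac simp del: of_real_power)
    then show ?thesis unfolding quad_form_def by (simp del: of_real_power)
  qed
  \<comment> \<open>If only coordinate \<open>k\<close> goes below 0, and by some
    \<open>t < 1 / \<beta>\<close>, then \<open>dg\<close> bounds the loss at \<open>k\<close> by a
    proper fraction of the regularised form, so there is no kernel vector. This is where the barrier
    bound \<open>\<beta>\<close> at 0 comes from.\<close>
  have nz: "real_val (det_plus_diag n M) y \<noteq> 0" if y: "\<And>i. y i \<ge> (if i = k then - t else 0)" and t: "t \<ge> 0" "t * \<beta> < 1"
      and k: "k \<in> \<Union>B" for y t k
  proof
    assume "real_val (det_plus_diag n M) y = 0"
    then have "det_plus_diag n M (cvec y) = 0" using real_stable_real_val[OF det_plus_diag] by simp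
    then obtain v j where v: "j < n" "v j \<noteq> 0" "\<And>i. i < n \<Longrightarrow> mat_vec M ?T v i = - cvec y i * v i"
      unfolding det_plus_diag_zero_iff by blast
    have kn: "k < n" using k B(3) by auto
    have "quad_form M ?T v = (\<Sum>i<n. - y i * (cmod (v i))\<^sup>2)" by (rule eq[OF v(3)])
    also have "\<dots> \<le> (\<Sum>i<n. (if i = k then t else 0) * (cmod (v i))\<^sup>2)"
    proof (intro sum_mono mult_right_mono)
      fix i show "- y i \<le> (if i = k then t else 0)" using y[of i] by (auto split: if_splits)
    qed simp
    also have "\<dots> = t * (cmod (v k))\<^sup>2"
      using kn sum_if_eq[of ?T k t "\<lambda>i. (cmod (v i))\<^sup>2"] by (simp add: eq_commute[of k])
    also have "\<dots> \<le> t * (\<beta> * quad_form M ?T v)" unfolding qM by (intro mult_left_mono dg[OF k] t)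
    finally have "quad_form M ?T v * (1 - t * \<beta>) \<le> 0" by (simp add: algebra_simps)
    then have "quad_form M ?T v \<le> 0" using t by (auto simp: mult_le_0_iff)
    then have "a * norm_sq ?T v \<le> 0" using pG[of v] by (simp add: qM)
    then have "norm_sq ?T v = 0" using a norm_sq_nonneg[of ?T v] by (simp add: mult_le_0_iff)
    then show False using v quad_form_zero_imp[of ?T v j] by auto
  qed
  show ?thesis
  proof (cases "B = {}")
    case True
    have "(1 / (3 * K * \<beta>) - a) * norm_sq ?T c \<le> quad_form G ?T c" if "\<forall>i<n. c i = 0" for c
    proof -
      have "norm_sq ?T c = 0" using that by (simp add: norm_sq_def)
      then show ?thesis using pG by simp
    qed
    then show ?thesis using True by simp
  next
    case False
    then obtain k0 where k0: "k0 \<in> \<Union>B" using B(4) by blast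
    define r where "r = real_val (det_plus_diag n M) (\<lambda>_. 0)"
    have r: "r \<noteq> 0" unfolding r_def by (rule nz[of k0 0]) (use k0 in auto)
    \<comment> \<open>Division by the value at 0 makes \<open>F\<close> positive there, so only the
      nonvanishing of the determinant has to be known.\<close>
    define F where "F = (\<lambda>z. of_real (1 / r) * det_plus_diag n M z)"
    have F: "real_stable ?T F" unfolding F_def by (rule real_stable_scale[OF det_plus_diag]) (use r in simp)
    note mF = real_stable_multiaffine[OF F]
    have rvF: "real_val F y = real_val (det_plus_diag n M) y / r" for y by (simp add: real_val_def F_def)
    have ab: "above F (\<lambda>_. 0)"
      by (rule above_of_nonzero[OF mF, of _ "\<lambda>_. 0"]) (use r nz[of k0 0] k0 in \<open>auto simp: rvF r_def\<close>)
    have Ph: "Phi i F (\<lambda>_. 0) \<le> \<beta>" if i: "i \<in> \<Union>B" for i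
    proof -
      have "Phi i F (\<lambda>_. 0) \<le> \<beta> / 1"
      proof (rule Phi_le[OF mF aboveD[OF ab]])
        fix t :: real assume t: "t \<ge> 0" "t * \<beta> < 1"
        have "real_val (det_plus_diag n M) ((\<lambda>_. 0)(i := 0 - t)) \<noteq> 0" by (rule nz[of i t]) (use t i in auto)
        then show "real_val F ((\<lambda>_. 0)(i := 0 - t)) \<noteq> 0" using r by (simp add: rvF)
      qed (use \<beta> in auto)
      then show ?thesis by simp
    qed
    \<comment> \<open>A block of at most \<open>K\<close> indices has total barrier at most
      \<open>K * \<beta>\<close>, and \<open>barrier_lower\<close> admits
      \<open>\<delta> * (K * \<beta>) = 1 / 3\<close>.\<close>
    define \<delta> where "\<delta> = 1 / (3 * K * \<beta>)"
    have \<delta>: "\<delta> \<ge> 0" "\<delta> * (K * \<beta>) \<le> 1 / 3" using K \<beta> by (auto simp: \<delta>_def)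
    have fb: "finite b" if "b \<in> B" for b using that B(3) by (meson Union_upper finite_lessThan finite_subset)
    have Pb: "(\<Sum>i\<in>b. Phi i F (\<lambda>_. 0)) \<le> K * \<beta>" if b: "b \<in> B" for b
    proof -
      have "(\<Sum>i\<in>b. Phi i F (\<lambda>_. 0)) \<le> (\<Sum>i\<in>b. \<beta>)" using b by (intro sum_mono Ph) auto
      also have "\<dots> \<le> K * \<beta>" using B(4)[OF b] \<beta> by (simp add: mult_right_mono)
      finally show ?thesis .
    qed
    have "\<exists>sel. (\<forall>b\<in>B. sel b \<in> b) \<and>
      above F (\<lambda>i. raise_on (\<Union>B) (- \<delta>) (\<lambda>_. 0) i + (if i \<in> sel ` B then 2 * \<delta> * K else 0))"
      by (rule block_selection_lower[OF B(1) F ab _ B(2) Pb \<delta>(2,1)]) (use fb B(4) in auto)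
    then obtain sel where sel: "\<And>b. b \<in> B \<Longrightarrow> sel b \<in> b"
      and ab': "above F (\<lambda>i. raise_on (\<Union>B) (- \<delta>) (\<lambda>_. 0) i + (if i \<in> sel ` B then 2 * \<delta> * K else 0))"
      by blast
    define D where "D = (\<lambda>i. raise_on (\<Union>B) (- \<delta>) (\<lambda>_. 0) i + (if i \<in> sel ` B then 2 * \<delta> * K else 0))"
    define N where "N = (\<lambda>i j. M i j + (if i = j then complex_of_real (D i) else 0))"
    have hN: "hermitian ?T N" unfolding N_def by (rule hermitian_diag[OF hM])
    have "fdet n (\<lambda>i j. N i j + (if i = j then of_real s else 0)) \<noteq> 0" if s: "s \<ge> 0" for s :: real
    proof -
      have "real_val F (\<lambda>i. D i + s) > 0" using ab' s unfolding above_def D_def by simp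
      then have "real_val (det_plus_diag n M) (\<lambda>i. D i + s) \<noteq> 0" using rvF by auto
      then have "det_plus_diag n M (cvec (\<lambda>i. D i + s)) \<noteq> 0" by (auto simp: real_val_def)
      moreover have "det_plus_diag n M (cvec (\<lambda>i. D i + s)) = fdet n (\<lambda>i j. N i j + (if i = j then of_real s else 0))"
        unfolding det_plus_diag_def N_def by (intro arg_cong[of _ _ "fdet n"] ext) (simp add: cvec_def)
      ultimately show ?thesis by simp
    qed
    note psN = pos_semidef_of_nonsingular[OF hN this]
    have "(\<delta> - a) * norm_sq ?T c \<le> quad_form G ?T c" if c: "\<forall>i<n. i \<notin> \<Union>B - sel ` B \<longrightarrow> c i = 0" for c
    proof -
      have "0 \<le> quad_form N ?T c" by (rule psN)
      also have "\<dots> = quad_form M ?T c + (\<Sum>i<n. D i * (cmod (c i))\<^sup>2)"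
        unfolding N_def by (rule quad_form_diag) simp
      \<comment> \<open>\<open>c\<close> vanishes at the deleted indices and outside the blocks, and
        \<open>D\<close> equals \<open>- \<delta>\<close> at the kept ones; so the large entries of
        \<open>D\<close> do not enter.\<close>
      also have "(\<Sum>i<n. D i * (cmod (c i))\<^sup>2) = (\<Sum>i<n. - \<delta> * (cmod (c i))\<^sup>2)"
        using c by (intro sum.cong refl) (auto simp: D_def raise_on_def)
      also have "\<dots> = - \<delta> * norm_sq ?T c" by (simp add: norm_sq_def sum_distrib_left)
      finally show ?thesis by (simp add: qM algebra_simps)
    qed
    then show ?thesis
      unfolding \<delta>_def by (intro exI[of _ sel] conjI ballI sel allI impI) auto
  qed
qed

section \<open>Determinantal subsets and compactness\<close>

text \<open>\<open>E A\<close> is the determinant of \<open>1 + G / a\<close> compressed to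
  \<open>A\<close>. The vector \<open>u\<close> is the unit vector at \<open>k\<close>, corrected
  within \<open>S\<close> so that on \<open>insert k S\<close> the matrix \<open>G + a\<close> maps
  it to a multiple of that unit vector. The multiple is a Schur complement and therefore
  \<open>a\<close> times a quotient of two determinants.\<close>

lemma schur_vector:
  fixes n :: nat
  assumes G: "pos_semidef {..<n} G" and a: "a > 0" and S: "S \<subseteq> {..<n}" and k: "k < n" "k \<notin> S"
  defines "E \<equiv> \<lambda>S. real_val (det_one_plus n (\<lambda>i j. G i j / of_real a)) (indicator S)"
  shows "E S > 0" and "\<exists>u. u k = 1 \<and> (\<forall>i. i \<notin> insert k S \<longrightarrow> u i = 0) \<and>
    (\<forall>i\<in>insert k S. mat_vec G {..<n} u i + of_real a * u i = (if i = k then of_real (a * E (insert k S) / E S) else 0))"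
proof -
  let ?T = "{..<n}"
  define G' where "G' = (\<lambda>i j. G i j / of_real a)"
  have mvG': "mat_vec G' ?T v i = mat_vec G ?T v i / of_real a" for v i by (simp add: G'_def mat_vec_def sum_divide_distrib)
  have qG': "quad_form G' ?T v = quad_form G ?T v / a" for v
    by (simp add: quad_form_def sesq_form_def mvG' sum_divide_distrib[symmetric])
  have h: "hermitian ?T G" using G by (simp add: pos_semidef_def)
  have "hermitian ?T G'"
    unfolding hermitian_def
  proof (intro conjI ballI)
    fix i j assume "i \<in> ?T" "j \<in> ?T"
    from hermitianD[OF h this] show "G' j i = cnj (G' i j)" by (simp add: G'_def)
  qed simp
  then have pG': "pos_semidef ?T G'" using G a unfolding pos_semidef_def qG' by auto
  let ?F = "det_one_plus n G'"
  have F: "real_stable ?T ?F" by (rule real_stable_det_one_plus[OF pG'])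
  note mF = real_stable_multiaffine[OF F]
  define L where "L = (\<Sum>i<n. \<Sum>j<n. cmod (G' i j))"
  have L: "quad_form G' ?T c \<le> L * norm_sq ?T c" for c
    using quad_form_bounded[of ?T G' c] unfolding L_def by auto
  have ab: "above ?F (\<lambda>_. 0)"
  proof (rule above_of_nonzero[OF mF, of _ "\<lambda>_. 0"])
    show "real_val ?F y \<noteq> 0" if "\<And>i. 0 \<le> y i" for y
      by (rule det_one_plus_nonzero[OF pG' L, of 0 0 k]) (use that k in auto)
  qed (auto simp: det_one_plus_zero_arg)
  have Epos: "E A > 0" for A
    unfolding E_def G'_def[symmetric] using above_mono[OF ab, of "indicator A"] by (intro aboveD) auto
  then show "E S > 0" .
  have ES: "?F (cvec (indicator S)) = of_real (E S)" "?F (cvec (indicator (insert k S))) = of_real (E (insert k S))"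
    unfolding E_def G'_def[symmetric] by (rule real_stable_real_val[OF F])+
  define N where "N = (\<lambda>i j. (if i = j then 1 else 0) + cvec (indicator S) i * G' i j)"
  have "fdet n N \<noteq> 0" using ES(1) Epos[of S] unfolding det_one_plus_def N_def[symmetric] by simp
  then obtain R where R1: "\<And>v i. i < n \<Longrightarrow> mat_vec R ?T (mat_vec N ?T v) i = v i"
    and R: "\<And>v i. i < n \<Longrightarrow> mat_vec N ?T (mat_vec R ?T v) i = v i"
    by (rule fdet_inverse) blast
  have mvN: "mat_vec N ?T v i = v i + cvec (indicator S) i * mat_vec G' ?T v i" if "i < n" for v i
    unfolding N_def using that by (rule mat_vec_det_one_plus)
  define y where "y = (\<lambda>i. if i \<in> S then - G' i k else 0)"
  define u where "u = (\<lambda>i. if i = k then 1 else if i \<in> S then mat_vec R ?T y i else 0)"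
  have w0: "mat_vec R ?T y i = 0" if "i < n" "i \<notin> S" for i
    using R[OF that(1), of y] mvN[OF that(1), of "mat_vec R ?T y"] that by (simp add: y_def cvec_def)
  have mvu: "mat_vec G' ?T u i = G' i k + mat_vec G' ?T (mat_vec R ?T y) i" for i
  proof -
    have "mat_vec G' ?T u i = (\<Sum>j<n. (if k = j then 1 else 0) * G' i j + G' i j * mat_vec R ?T y j)"
      unfolding mat_vec_def[of G' ?T u] using w0 k by (intro sum.cong) (auto simp: u_def)
    then show ?thesis using sum_if_eq[of ?T k 1 "G' i"] k(1) by (simp add: sum.distrib mat_vec_def[of G'])
  qed
  have rowS: "u i + mat_vec G' ?T u i = 0" if i: "i \<in> S" for i
  proof -
    have "i < n" using i S by auto
    have "mat_vec R ?T y i + mat_vec G' ?T (mat_vec R ?T y) i = - G' i k"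
      using R[OF \<open>i < n\<close>, of y] mvN[OF \<open>i < n\<close>, of "mat_vec R ?T y"] i by (simp add: y_def cvec_def)
    moreover have "u i = mat_vec R ?T y i" using i k by (auto simp: u_def)
    ultimately show ?thesis unfolding mvu by (simp add: algebra_simps eq_neg_iff_add_eq_0)
  qed
  define g where "g = mat_vec G' ?T u k"
  have affine: "?F ((cvec (indicator S))(k := z)) = of_real (E S) + z * (of_real (E (insert k S)) - of_real (E S))" for z
  proof -
    have "?F ((cvec (indicator S))(k := z)) = ?F ((cvec (indicator S))(k := 0)) + z * pdiff k ?F (cvec (indicator S))"
      using mF unfolding multiaffine_def by blast
    moreover have "(cvec (indicator S))(k := 0) = cvec (indicator S)" "(cvec (indicator S))(k := 1) = cvec (indicator (insert k S))"
      using k by (auto simp: cvec_def fun_eq_iff indicator_def)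
    ultimately show ?thesis unfolding pdiff_def ES[symmetric] by simp
  qed
  \<comment> \<open>The quotient of determinants is found by comparing zeros. In variable
    \<open>k\<close> the determinant is affine, and a kernel vector exists exactly if
    \<open>1 + z * g = 0\<close>, because it has to be a multiple of \<open>u\<close>.\<close>
  have zero_iff: "?F ((cvec (indicator S))(k := z)) = 0 \<longleftrightarrow> 1 + z * g = 0" for z
  proof
    assume "1 + z * g = 0"
    then have "u i = - ((cvec (indicator S))(k := z)) i * mat_vec G' ?T u i" if "i < n" for i
      using rowS[of i] k by (auto simp: u_def[of] g_def cvec_def eq_neg_iff_add_eq_0 add.commute split: if_splits)
    moreover have "u k \<noteq> 0" by (simp add: u_def)
    ultimately show "?F ((cvec (indicator S))(k := z)) = 0" unfolding det_one_plus_zero_iff using k(1) by blast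
  next
    assume "?F ((cvec (indicator S))(k := z)) = 0"
    then obtain v where v: "\<exists>i<n. v i \<noteq> 0" "\<And>i. i < n \<Longrightarrow> v i = - ((cvec (indicator S))(k := z)) i * mat_vec G' ?T v i"
      unfolding det_one_plus_zero_iff by blast
    define w where "w = (\<lambda>i. v i + (- v k) * u i)"
    have mw: "mat_vec G' ?T w i = mat_vec G' ?T v i - v k * mat_vec G' ?T u i" for i
      by (simp add: w_def mat_vec_def algebra_simps sum.distrib sum_distrib_left sum_subtractf)
    have "mat_vec N ?T w i = 0" if i: "i < n" for i
    proof -
      consider "i = k" | "i \<in> S" "i \<noteq> k" | "i \<notin> S" "i \<noteq> k" by blast
      then show ?thesis
      proof cases
        case 1
        then show ?thesis using mvN[OF i, of w] k by (simp add: w_def u_def cvec_def)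
      next
        case 2
        then have "v i + mat_vec G' ?T v i = 0" using v(2)[OF i] by (simp add: cvec_def)
        moreover have "v k * u i + v k * mat_vec G' ?T u i = 0"
          using rowS[OF 2(1)] by (metis distrib_left mult_zero_right)
        moreover have "mat_vec N ?T w i = (v i + mat_vec G' ?T v i) - (v k * u i + v k * mat_vec G' ?T u i)"
          using mvN[OF i, of w] 2 unfolding mw by (simp add: w_def cvec_def)
        ultimately show ?thesis by simp
      next
        case 3
        then show ?thesis using mvN[OF i, of w] v(2)[OF i] by (simp add: w_def u_def cvec_def)
      qed
    qed
    then have "mat_vec R ?T (mat_vec N ?T w) i = 0" for i by (simp add: mat_vec_def[of R])
    then have wz: "w i = 0" if "i < n" for i using R1[OF that, of w] by simp
    then have vu: "v i = v k * u i" if "i < n" for i using that by (force simp: w_def)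
    have vk: "v k \<noteq> 0" using v(1) vu by force
    have "mat_vec G' ?T v k = v k * g"
      unfolding g_def mat_vec_def sum_distrib_left by (intro sum.cong refl) (simp add: vu)
    then have "v k = - (z * (v k * g))" using v(2)[OF k(1)] by simp
    then have "v k + z * (v k * g) = 0" by (simp only: eq_neg_iff_add_eq_0)
    then have "v k * (1 + z * g) = 0" by (simp add: algebra_simps)
    then show "1 + z * g = 0" using vk by simp
  qed
  \<comment> \<open>If \<open>g = 0\<close> there is no zero, so the affine function is constant;
    otherwise its zero is \<open>- 1 / g\<close>.\<close>
  have ratio: "1 + g = of_real (E (insert k S) / E S)"
  proof (cases "g = 0")
    case True
    have "E (insert k S) = E S"
    proof (rule ccontr)
      assume "E (insert k S) \<noteq> E S"
      then have "complex_of_real (E (insert k S)) - of_real (E S) \<noteq> 0" by simp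
      then have "?F ((cvec (indicator S))(k := - of_real (E S) / (of_real (E (insert k S)) - of_real (E S)))) = 0"
        unfolding affine by simp
      then show False unfolding zero_iff using True by simp
    qed
    then show ?thesis using True Epos[of S] by simp
  next
    case False
    then have "1 + (- 1 / g) * g = 0" by simp
    then have "of_real (E S) + (- 1 / g) * (of_real (E (insert k S)) - of_real (E S)) = (0::complex)"
      unfolding zero_iff[symmetric] affine .
    then have "g * of_real (E S) = of_real (E (insert k S)) - of_real (E S)"
      using False by (simp add: field_simps)
    then have "(1 + g) * of_real (E S) = of_real (E (insert k S))" by (simp add: algebra_simps)
    then show ?thesis using Epos[of S] by (simp add: field_simps)
  qed
  have mvGu: "mat_vec G ?T u i + of_real a * u i = of_real a * (u i + mat_vec G' ?T u i)" for i
    unfolding mvG' using a by (simp add: algebra_simps)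
  show "\<exists>u. u k = 1 \<and> (\<forall>i. i \<notin> insert k S \<longrightarrow> u i = 0) \<and>
    (\<forall>i\<in>insert k S. mat_vec G {..<n} u i + of_real a * u i = (if i = k then of_real (a * E (insert k S) / E S) else 0))"
  proof (intro exI[of _ u] conjI ballI allI impI)
    show "u k = 1" by (simp add: u_def)
    show "u i = 0" if "i \<notin> insert k S" for i using that by (auto simp: u_def)
    fix i assume i: "i \<in> insert k S"
    show "mat_vec G ?T u i + of_real a * u i = (if i = k then of_real (a * E (insert k S) / E S) else 0)"
    proof (cases "i = k")
      case True
      have "u k + mat_vec G' ?T u k = of_real (E (insert k S) / E S)" using ratio by (simp add: u_def g_def)
      then show ?thesis unfolding mvGu using True by simp
    next
      case False
      then show ?thesis unfolding mvGu using rowS[of i] i by simp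
    qed
  qed
qed

text \<open>Among the subsets of \<open>U\<close> one maximises a regularised Gram determinant, in which each chosen
  index is charged the factor \<open>e / a\<close>.\<close>

lemma determinantal_subset:
  fixes n :: nat
  assumes G: "pos_semidef {..<n} G" and a: "a > 0" and e: "e > 0" and U: "U \<subseteq> {..<n}"
  obtains S where "S \<subseteq> U"
    and "\<And>k. k \<in> S \<Longrightarrow> \<exists>u s. s \<ge> e \<and> u k = 1 \<and> (\<forall>i. i \<notin> S \<longrightarrow> u i = 0) \<and>
        (\<forall>i\<in>S. mat_vec G {..<n} u i + of_real a * u i = (if i = k then of_real s else 0))"
    and "\<And>k. k \<in> U - S \<Longrightarrow> \<exists>u s. s \<le> e \<and> u k = 1 \<and> (\<forall>i. i \<notin> insert k S \<longrightarrow> u i = 0) \<and>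
        (\<forall>i\<in>insert k S. mat_vec G {..<n} u i + of_real a * u i = (if i = k then of_real s else 0))"
proof -
  define E where "E = (\<lambda>S. real_val (det_one_plus n (\<lambda>i j. G i j / of_real a)) (indicator S))"
  have E_eq: "real_val (det_one_plus n (\<lambda>i j. G i j / of_real a)) (indicator S) = E S" for S
    by (simp add: E_def)
  \<comment> \<open>Adding \<open>k\<close> to a set multiplies \<open>W\<close> by the Schur
    complement at \<open>k\<close> divided by \<open>e\<close>. At a maximum this quotient is at
    least 1 for the members of \<open>S\<close> and at most 1 for the other indices of
    \<open>U\<close>.\<close>
  define W where "W = (\<lambda>S. E S * (a / e) ^ card S)"
  have fU: "finite U" using U finite_subset by blast
  have "finite (W ` Pow U)" "W ` Pow U \<noteq> {}" using fU by auto
  then have "Max (W ` Pow U) \<in> W ` Pow U" by (rule Max_in)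
  then obtain S where S: "S \<subseteq> U" "W S = Max (W ` Pow U)" by auto
  have mx: "W S' \<le> W S" if "S' \<subseteq> U" for S' unfolding S(2) using fU that by (intro Max_ge) auto
  have fS: "finite S" using S(1) fU finite_subset by blast
  show ?thesis
  proof (rule that[OF S(1)])
    fix k assume k: "k \<in> S"
    define S' where "S' = S - {k}"
    have kS: "insert k S' = S" "k \<notin> S'" "S' \<subseteq> {..<n}" "k < n" using k S(1) U by (auto simp: S'_def)
    note sv = schur_vector[OF G a kS(3,4,2), unfolded E_eq]
    have c: "card S = Suc (card S')" using card_Suc_Diff1[OF fS k] by (simp add: S'_def)
    have "W S' \<le> W S" using S(1) by (intro mx) (auto simp: S'_def)
    then have "E S' * (a / e) ^ card S' \<le> (E S * (a / e)) * (a / e) ^ card S'"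
      by (simp add: W_def c mult_ac)
    then have "E S' \<le> E S * (a / e)"
      by (rule mult_right_le_imp_le) (use a e in simp)
    then have "a * E S / E S' \<ge> e" using sv(1) e by (simp add: field_simps)
    then show "\<exists>u s. s \<ge> e \<and> u k = 1 \<and> (\<forall>i. i \<notin> S \<longrightarrow> u i = 0) \<and>
        (\<forall>i\<in>S. mat_vec G {..<n} u i + of_real a * u i = (if i = k then of_real s else 0))"
      using sv(2) unfolding kS(1) by blast
  next
    fix k assume k: "k \<in> U - S"
    then have k': "k < n" "k \<notin> S" "S \<subseteq> {..<n}" using S(1) U by auto
    note sv = schur_vector[OF G a k'(3,1,2), unfolded E_eq]
    have "W (insert k S) \<le> W S" using S(1) k by (intro mx) auto
    then have "(E (insert k S) * (a / e)) * (a / e) ^ card S \<le> E S * (a / e) ^ card S"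
      using fS k by (simp add: W_def mult_ac)
    then have "E (insert k S) * (a / e) \<le> E S"
      by (rule mult_right_le_imp_le) (use a e in simp)
    then have "a * E (insert k S) / E S \<le> e" using sv(1) e by (simp add: field_simps)
    then show "\<exists>u s. s \<le> e \<and> u k = 1 \<and> (\<forall>i. i \<notin> insert k S \<longrightarrow> u i = 0) \<and>
        (\<forall>i\<in>insert k S. mat_vec G {..<n} u i + of_real a * u i = (if i = k then of_real s else 0))"
      using sv(2) by blast
  qed
qed

text \<open>Koenig's lemma. \<open>F N\<close> solves the problem up to \<open>N\<close>; prefixes
  \<open>g k\<close> are extended one value at a time so that infinitely many of the
  \<open>F N\<close> agree with them, which is possible since each value has finitely many
  options.\<close>

lemma compactness_choice:
  fixes A :: "nat \<Rightarrow> 'a set" and P :: "nat \<Rightarrow> (nat \<Rightarrow> 'a) \<Rightarrow> bool"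
  assumes fin: "\<And>m. finite (A m)"
    and dep: "\<And>N f g. (\<And>m. m < N \<Longrightarrow> f m = g m) \<Longrightarrow> P N f \<Longrightarrow> P N g"
    and dec: "\<And>N f. P (Suc N) f \<Longrightarrow> P N f"
    and ex: "\<And>N. \<exists>f. (\<forall>m. f m \<in> A m) \<and> P N f"
  shows "\<exists>f. (\<forall>m. f m \<in> A m) \<and> (\<forall>N. P N f)"
proof -
  have dec': "P N f" if "P M f" "N \<le> M" for N M f
    using that(2,1) by (induction rule: dec_induct) (auto intro: dec)
  obtain F where F: "\<And>N m. F N m \<in> A m" "\<And>N. P N (F N)" using ex by metis
  define good where "good = (\<lambda>k g. infinite {N. \<forall>m<k. F N m = (g::nat \<Rightarrow> 'a) m})"
  have step: "\<exists>x. x \<in> A k \<and> good (Suc k) (g(k := x))" if g: "good k g" for k g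
  proof (rule ccontr)
    assume no: "\<not> ?thesis"
    have "{N. \<forall>m<k. F N m = g m} \<subseteq> (\<Union>x\<in>A k. {N. \<forall>m<Suc k. F N m = (g(k := x)) m})"
      using F(1) by (auto simp: less_Suc_eq)
    moreover have "finite (\<Union>x\<in>A k. {N. \<forall>m<Suc k. F N m = (g(k := x)) m})"
      using no fin by (auto simp: good_def)
    ultimately show False using g finite_subset unfolding good_def by blast
  qed
  define nxt where "nxt = (\<lambda>k g. g(k := (SOME x. x \<in> A k \<and> good (Suc k) (g(k := x)))))"
  define g where "g = rec_nat (\<lambda>_. undefined) nxt"
  have g0: "g 0 = (\<lambda>_. undefined)" and gS: "g (Suc k) = nxt k (g k)" for k by (simp_all add: g_def)
  have good_g: "good k (g k)" for k
  proof (induction k)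
    case 0
    then show ?case by (simp add: good_def)
  next
    case (Suc k)
    then show ?case unfolding gS nxt_def using someI_ex[OF step[OF Suc]] by blast
  qed
  define f where "f = (\<lambda>m. g (Suc m) m)"
  have fA: "f m \<in> A m" for m
    unfolding f_def gS nxt_def using someI_ex[OF step[OF good_g[of m]]] by simp
  have stab: "g k m = f m" if "m < k" for k m
    using that
  proof (induction k)
    case (Suc k)
    then show ?case
      by (cases "m = k") (auto simp: f_def, simp add: gS nxt_def)
  qed simp
  have "P N f" for N
  proof -
    have "infinite {M. \<forall>m<N. F M m = g N m}" using good_g[of N] by (simp add: good_def)
    then obtain M where M: "M \<ge> N" "\<forall>m<N. F M m = g N m"
      by (metis (mono_tags, lifting) finite_nat_set_iff_bounded mem_Collect_eq not_le)
    have "P N (F M)" using dec' F(2) M(1) by blast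
    then show ?thesis using dep[of N "F M" f] M(2) stab by simp
  qed
  then show ?thesis using fA by blast
qed

section \<open>Hilbert spaces of functions with reproducing kernels\<close>

lemma L2_prod_integrable:
  assumes "f \<in> L2" "g \<in> L2"
  shows "integrable lebesgue (\<lambda>x. f x * cnj (g x))"
proof (rule Bochner_Integration.integrable_bound)
  show "integrable lebesgue (\<lambda>x. (cmod (f x))\<^sup>2 + (cmod (g x))\<^sup>2)"
    using assms by (simp add: L2_def)
  show "(\<lambda>x. f x * cnj (g x)) \<in> borel_measurable lebesgue"
    using assms by (intro borel_measurable_times) (auto simp: L2_def borel_measurable_complex_iff)
  show "AE x in lebesgue. norm (f x * cnj (g x)) \<le> norm ((cmod (f x))\<^sup>2 + (cmod (g x))\<^sup>2)"
  proof (rule AE_I2)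
    fix x
    have "2 * (cmod (f x) * cmod (g x)) \<le> (cmod (f x))\<^sup>2 + (cmod (g x))\<^sup>2"
      using sum_squares_bound[of "cmod (f x)" "cmod (g x)"] by simp
    moreover have "0 \<le> cmod (f x) * cmod (g x)" by simp
    ultimately show "norm (f x * cnj (g x)) \<le> norm ((cmod (f x))\<^sup>2 + (cmod (g x))\<^sup>2)"
      by (simp add: norm_mult del: mult_nonneg_nonneg)
  qed
qed

lemma L2_norm_nonneg [simp]: "L2_norm f \<ge> 0"
  by (simp add: L2_norm_def)

lemma L2_norm_sq: "(L2_norm f)\<^sup>2 = (LINT x|lebesgue. (cmod (f x))\<^sup>2)"
  by (simp add: L2_norm_def)

lemma L2_inner_self: "L2_inner f f = of_real ((L2_norm f)\<^sup>2)"
  unfolding L2_inner_def L2_norm_sq complex_norm_square[symmetric] by (rule integral_complex_of_real)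

lemma L2_inner_cnj: "cnj (L2_inner f g) = L2_inner g f"
  unfolding L2_inner_def Bochner_Integration.integral_cnj[symmetric] by (simp add: mult.commute)

lemma L2_inner_add_left:
  "f \<in> L2 \<Longrightarrow> g \<in> L2 \<Longrightarrow> h \<in> L2 \<Longrightarrow> L2_inner (\<lambda>x. f x + g x) h = L2_inner f h + L2_inner g h"
  unfolding L2_inner_def by (simp add: distrib_right L2_prod_integrable)

lemma L2_inner_scale_left: "L2_inner (\<lambda>x. c * f x) h = c * L2_inner f h"
  unfolding L2_inner_def by (simp add: mult.assoc)

lemma L2_nn_norm: "f \<in> L2 \<Longrightarrow> (\<integral>\<^sup>+x. ennreal ((cmod (f x))\<^sup>2) \<partial>lebesgue) = ennreal ((L2_norm f)\<^sup>2)"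
  unfolding L2_norm_sq by (rule nn_integral_eq_integral) (auto simp: L2_def)

locale kernel_space =
  fixes H :: "(real ^ 'n \<Rightarrow> complex) set" and k :: "real ^ 'n \<Rightarrow> real ^ 'n \<Rightarrow> complex"
  assumes rkhs: "rkhs H" and kernels: "reproducing_kernels H k"
begin

lemma H_L2: "f \<in> H \<Longrightarrow> f \<in> L2"
  using rkhs unfolding rkhs_def by blast

lemma H_zero: "(\<lambda>_. 0) \<in> H"
  using rkhs unfolding rkhs_def by blast

lemma H_add: "f \<in> H \<Longrightarrow> g \<in> H \<Longrightarrow> (\<lambda>x. f x + g x) \<in> H"
  using rkhs unfolding rkhs_def by blast

lemma H_scale: "f \<in> H \<Longrightarrow> (\<lambda>x. c * f x) \<in> H"
  using rkhs unfolding rkhs_def by blast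

lemma H_diff: "f \<in> H \<Longrightarrow> g \<in> H \<Longrightarrow> (\<lambda>x. f x - g x) \<in> H"
  using H_add[of f "\<lambda>x. - 1 * g x"] H_scale[of g "- 1"] by simp

lemma kH: "k x \<in> H"
  using kernels unfolding reproducing_kernels_def by blast

lemma reproducing: "f \<in> H \<Longrightarrow> f x = L2_inner f (k x)"
  using kernels unfolding reproducing_kernels_def by blast

lemma H_sum: "(\<And>i. i \<in> F \<Longrightarrow> g i \<in> H) \<Longrightarrow> (\<lambda>x. \<Sum>i\<in>F. c i * g i x) \<in> H"
  by (induction F rule: infinite_finite_induct) (auto simp: H_zero intro!: H_add H_scale)

lemma inner_sum_left:
  assumes "\<And>i. i \<in> F \<Longrightarrow> g i \<in> H" "h \<in> H"
  shows "L2_inner (\<lambda>x. \<Sum>i\<in>F. c i * g i x) h = (\<Sum>i\<in>F. c i * L2_inner (g i) h)"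
  using assms
proof (induction F rule: infinite_finite_induct)
  case (insert i F)
  have "L2_inner (\<lambda>x. c i * g i x + (\<Sum>i\<in>F. c i * g i x)) h =
    L2_inner (\<lambda>x. c i * g i x) h + L2_inner (\<lambda>x. \<Sum>i\<in>F. c i * g i x) h"
    using insert.prems by (intro L2_inner_add_left H_L2 H_scale H_sum) auto
  then show ?case using insert by (simp add: L2_inner_scale_left)
qed (simp_all add: L2_inner_def)

lemma inner_sum_right:
  assumes "\<And>i. i \<in> F \<Longrightarrow> g i \<in> H" "h \<in> H"
  shows "L2_inner h (\<lambda>x. \<Sum>i\<in>F. c i * g i x) = (\<Sum>i\<in>F. cnj (c i) * L2_inner h (g i))"
proof -
  have "L2_inner h (\<lambda>x. \<Sum>i\<in>F. c i * g i x) = cnj (L2_inner (\<lambda>x. \<Sum>i\<in>F. c i * g i x) h)"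
    by (rule L2_inner_cnj[symmetric])
  also have "L2_inner (\<lambda>x. \<Sum>i\<in>F. c i * g i x) h = (\<Sum>i\<in>F. c i * L2_inner (g i) h)"
    by (rule inner_sum_left[OF assms])
  finally have "L2_inner h (\<lambda>x. \<Sum>i\<in>F. c i * g i x) = cnj (\<Sum>i\<in>F. c i * L2_inner (g i) h)" .
  then show ?thesis by (simp add: L2_inner_cnj)
qed

lemma inner_diff_left:
  assumes "f \<in> H" "g \<in> H" "h \<in> H"
  shows "L2_inner (\<lambda>x. f x - g x) h = L2_inner f h - L2_inner g h"
  using L2_inner_add_left[of f "\<lambda>x. - 1 * g x" h] L2_inner_scale_left[of "- 1" g h] assms H_L2 H_scale[of g "- 1"]
  by simp

text \<open>The order of the arguments in the Gram matrix is chosen so that its form at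
  \<open>c\<close> is the squared norm of the combination with the coefficients \<open>c\<close>
  themselves, not their conjugates.\<close>

lemma gram_quad_form:
  assumes T: "finite T" and g: "\<And>i. i \<in> T \<Longrightarrow> g i \<in> H"
  shows "sesq_form (\<lambda>i j. L2_inner (g j) (g i)) T u v = L2_inner (\<lambda>x. \<Sum>i\<in>T. v i * g i x) (\<lambda>x. \<Sum>i\<in>T. u i * g i x)"
proof -
  have "L2_inner (\<lambda>x. \<Sum>i\<in>T. v i * g i x) (\<lambda>x. \<Sum>i\<in>T. u i * g i x) =
    (\<Sum>i\<in>T. cnj (u i) * L2_inner (\<lambda>x. \<Sum>i\<in>T. v i * g i x) (g i))"
    by (rule inner_sum_right) (auto intro: g H_sum)
  also have "\<dots> = (\<Sum>i\<in>T. cnj (u i) * (\<Sum>j\<in>T. v j * L2_inner (g j) (g i)))"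
    by (intro sum.cong refl arg_cong2[of _ _ _ _ "(*)"] inner_sum_left) (auto intro: g)
  finally show ?thesis unfolding sesq_form_def mat_vec_def by (simp add: mult.commute)
qed

lemma gram_norm:
  assumes "finite T" "\<And>i. i \<in> T \<Longrightarrow> g i \<in> H"
  shows "quad_form (\<lambda>i j. L2_inner (g j) (g i)) T c = (L2_norm (\<lambda>x. \<Sum>i\<in>T. c i * g i x))\<^sup>2"
proof -
  have "sesq_form (\<lambda>i j. L2_inner (g j) (g i)) T c c = L2_inner (\<lambda>x. \<Sum>i\<in>T. c i * g i x) (\<lambda>x. \<Sum>i\<in>T. c i * g i x)"
    by (rule gram_quad_form[OF assms])
  then show ?thesis unfolding quad_form_def L2_inner_self by simp
qed

lemma gram_pos_semidef:
  assumes "finite T" "\<And>i. i \<in> T \<Longrightarrow> g i \<in> H"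
  shows "pos_semidef T (\<lambda>i j. L2_inner (g j) (g i))"
  unfolding pos_semidef_def hermitian_def using gram_norm[OF assms] assms(1) by (simp add: L2_inner_cnj)

text \<open>Read off from \<open>sesq_form_CS\<close> for the Gram matrix of the two vectors,
  indexed by \<open>bool\<close>.\<close>

lemma inner_CS:
  assumes "f \<in> H" "g \<in> H"
  shows "cmod (L2_inner f g) \<le> L2_norm f * L2_norm g"
proof -
  let ?h = "\<lambda>b. if b then f else g"
  have h: "?h b \<in> H" for b using assms by simp
  have "(cmod (sesq_form (\<lambda>i j. L2_inner (?h j) (?h i)) UNIV (\<lambda>b. if b then 0 else 1) (\<lambda>b. if b then 1 else 0)))\<^sup>2
    \<le> quad_form (\<lambda>i j. L2_inner (?h j) (?h i)) UNIV (\<lambda>b. if b then 0 else 1) * quad_form (\<lambda>i j. L2_inner (?h j) (?h i)) UNIV (\<lambda>b. if b then 1 else 0)"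
    by (rule sesq_form_CS[OF gram_pos_semidef]) (use assms in auto)
  then have "(cmod (L2_inner f g))\<^sup>2 \<le> (L2_norm f * L2_norm g)\<^sup>2"
    unfolding gram_quad_form[OF finite h] gram_norm[OF finite h] UNIV_bool
    by (simp add: power_mult_distrib mult.commute)
  then show ?thesis by (rule power2_le_imp_le) simp
qed

lemma pointwise_bound: "f \<in> H \<Longrightarrow> cmod (f x) \<le> L2_norm f * L2_norm (k x)"
  using inner_CS[of f "k x"] reproducing[of f x] kH by simp

lemma norm_add_sq:
  assumes "f \<in> H" "g \<in> H"
  shows "(L2_norm (\<lambda>x. f x + g x))\<^sup>2 = (L2_norm f)\<^sup>2 + 2 * Re (L2_inner f g) + (L2_norm g)\<^sup>2"
proof -
  have fg: "(\<lambda>x. f x + g x) \<in> H" by (rule H_add[OF assms])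
  have 1: "L2_inner (\<lambda>x. f x + g x) h = L2_inner f h + L2_inner g h" if "h \<in> H" for h
    using assms that by (intro L2_inner_add_left H_L2)
  have 2: "L2_inner h (\<lambda>x. f x + g x) = L2_inner h f + L2_inner h g" if "h \<in> H" for h
    unfolding L2_inner_cnj[of "\<lambda>x. f x + g x" h, symmetric] 1[OF that] by (simp add: L2_inner_cnj)
  have "complex_of_real ((L2_norm (\<lambda>x. f x + g x))\<^sup>2) =
      of_real ((L2_norm f)\<^sup>2) + (L2_inner f g + cnj (L2_inner f g)) + of_real ((L2_norm g)\<^sup>2)"
    unfolding L2_inner_self[symmetric] 1[OF fg] 2[OF assms(1)] 2[OF assms(2)] L2_inner_cnj by simp
  then have "Re (complex_of_real ((L2_norm (\<lambda>x. f x + g x))\<^sup>2)) =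
      Re (of_real ((L2_norm f)\<^sup>2) + (L2_inner f g + cnj (L2_inner f g)) + of_real ((L2_norm g)\<^sup>2))"
    by (rule arg_cong)
  then show ?thesis by (simp del: of_real_power)
qed

lemma norm_triangle:
  assumes "f \<in> H" "g \<in> H"
  shows "L2_norm (\<lambda>x. f x + g x) \<le> L2_norm f + L2_norm g"
proof (rule power2_le_imp_le)
  have "Re (L2_inner f g) \<le> L2_norm f * L2_norm g"
    using inner_CS[OF assms] complex_Re_le_cmod order_trans by blast
  then show "(L2_norm (\<lambda>x. f x + g x))\<^sup>2 \<le> (L2_norm f + L2_norm g)\<^sup>2"
    unfolding norm_add_sq[OF assms] by (simp add: power2_sum)
qed simp

lemma norm_scale: "L2_norm (\<lambda>x. c * f x) = cmod c * L2_norm f"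
  unfolding L2_norm_def by (simp add: norm_mult power_mult_distrib real_sqrt_mult)

lemma norm_triangle_diff:
  assumes "f \<in> H" "g \<in> H" "h \<in> H"
  shows "L2_norm (\<lambda>x. f x - h x) \<le> L2_norm (\<lambda>x. f x - g x) + L2_norm (\<lambda>x. g x - h x)"
  using norm_triangle[OF H_diff[OF assms(1,2)] H_diff[OF assms(2,3)]] by simp

lemma norm_diff_commute: "L2_norm (\<lambda>x. f x - g x) = L2_norm (\<lambda>x. g x - f x)"
  by (simp add: L2_norm_def norm_minus_commute)

text \<open>Bounded point evaluations give a pointwise limit \<open>g\<close>, Fatou's lemma bounds
  the distance to it, and the closedness in \<open>rkhs\<close> replaces \<open>g\<close> by a
  representative in \<open>H\<close>.\<close>

lemma complete:
  assumes F: "\<And>m. F m \<in> H" and C: "\<And>e. e > 0 \<Longrightarrow> \<exists>N. \<forall>m\<ge>N. \<forall>l\<ge>N. L2_norm (\<lambda>x. F m x - F l x) < e"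
  shows "\<exists>h\<in>H. (\<lambda>m. L2_norm (\<lambda>x. F m x - h x)) \<longlonglongrightarrow> 0"
proof -
  have "convergent (\<lambda>m. F m x)" for x
  proof (rule Cauchy_convergent, rule metric_CauchyI)
    fix e :: real assume e: "e > 0"
    let ?K = "L2_norm (k x) + 1"
    have K: "?K > 0" by (simp add: add_nonneg_pos)
    obtain N where N: "\<And>m l. m \<ge> N \<Longrightarrow> l \<ge> N \<Longrightarrow> L2_norm (\<lambda>x. F m x - F l x) < e / ?K"
      using C[of "e / ?K"] e K by auto
    have "dist (F m x) (F l x) < e" if "m \<ge> N" "l \<ge> N" for m l
    proof -
      have "cmod (F m x - F l x) \<le> L2_norm (\<lambda>x. F m x - F l x) * L2_norm (k x)"
        by (rule pointwise_bound[OF H_diff[OF F F]])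
      also have "\<dots> \<le> L2_norm (\<lambda>x. F m x - F l x) * ?K" by (intro mult_left_mono) auto
      also have "\<dots> < e" using N[OF that] K by (simp add: field_simps)
      finally show ?thesis by (simp add: dist_norm)
    qed
    then show "\<exists>M. \<forall>m\<ge>M. \<forall>n\<ge>M. dist (F m x) (F n x) < e" by blast
  qed
  then obtain g where g: "\<And>x. (\<lambda>m. F m x) \<longlonglongrightarrow> g x" unfolding convergent_def by metis
  have Fm [measurable]: "F m \<in> borel_measurable lebesgue" for m using H_L2[OF F] by (simp add: L2_def)
  have gm [measurable]: "g \<in> borel_measurable lebesgue"
    by (rule borel_measurable_LIMSEQ_metric[OF Fm]) (rule g)
  have fatou: "(\<integral>\<^sup>+x. ennreal ((cmod (F m x - g x))\<^sup>2) \<partial>lebesgue) \<le> ennreal (e\<^sup>2)"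
    if e: "e > 0" and N: "\<And>l. l \<ge> N \<Longrightarrow> L2_norm (\<lambda>x. F m x - F l x) < e" for m N e
  proof -
    have "(\<integral>\<^sup>+x. ennreal ((cmod (F m x - g x))\<^sup>2) \<partial>lebesgue) =
      (\<integral>\<^sup>+x. liminf (\<lambda>l. ennreal ((cmod (F m x - F l x))\<^sup>2)) \<partial>lebesgue)"
    proof (intro nn_integral_cong)
      fix x
      have "(\<lambda>l. ennreal ((cmod (F m x - F l x))\<^sup>2)) \<longlonglongrightarrow> ennreal ((cmod (F m x - g x))\<^sup>2)"
        by (intro tendsto_ennrealI tendsto_intros g)
      from lim_imp_Liminf[OF sequentially_bot this]
      show "ennreal ((cmod (F m x - g x))\<^sup>2) = liminf (\<lambda>l. ennreal ((cmod (F m x - F l x))\<^sup>2))" by simp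
    qed
    also have "\<dots> \<le> liminf (\<lambda>l. \<integral>\<^sup>+x. ennreal ((cmod (F m x - F l x))\<^sup>2) \<partial>lebesgue)"
      by (rule nn_integral_liminf) measurable
    also have "\<dots> = liminf (\<lambda>l. ennreal ((L2_norm (\<lambda>x. F m x - F l x))\<^sup>2))"
      by (simp add: L2_nn_norm H_L2 H_diff F)
    also have "\<dots> \<le> limsup (\<lambda>l. ennreal ((L2_norm (\<lambda>x. F m x - F l x))\<^sup>2))"
      by (rule Liminf_le_Limsup) simp
    also have "\<dots> \<le> ennreal (e\<^sup>2)"
    proof (rule Limsup_bounded)
      show "\<forall>\<^sub>F l in sequentially. ennreal ((L2_norm (\<lambda>x. F m x - F l x))\<^sup>2) \<le> ennreal (e\<^sup>2)"
        using eventually_ge_at_top[of N]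
        by eventually_elim (use N e in \<open>auto intro!: ennreal_leI power_mono less_imp_le\<close>)
    qed
    finally show ?thesis .
  qed
  have diffL2: "(\<lambda>x. F m x - g x) \<in> L2 \<and> L2_norm (\<lambda>x. F m x - g x) \<le> e"
    if e: "e > 0" and N: "\<And>l. l \<ge> N \<Longrightarrow> L2_norm (\<lambda>x. F m x - F l x) < e" for m N e
  proof -
    have ft: "(\<integral>\<^sup>+x. ennreal ((cmod (F m x - g x))\<^sup>2) \<partial>lebesgue) \<le> ennreal (e\<^sup>2)"
      by (rule fatou[OF e N])
    have m: "(\<lambda>x. F m x - g x) \<in> borel_measurable lebesgue" by measurable
    have "integrable lebesgue (\<lambda>x. (cmod (F m x - g x))\<^sup>2)"
    proof (rule integrableI_bounded)
      show "(\<lambda>x. (cmod (F m x - g x))\<^sup>2) \<in> borel_measurable lebesgue" using m by measurable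
      show "(\<integral>\<^sup>+x. ennreal (norm ((cmod (F m x - g x))\<^sup>2)) \<partial>lebesgue) < \<infinity>"
        using le_less_trans[OF ft ennreal_less_top] by simp
    qed
    then have L: "(\<lambda>x. F m x - g x) \<in> L2" using m by (simp add: L2_def)
    have "ennreal ((L2_norm (\<lambda>x. F m x - g x))\<^sup>2) \<le> ennreal (e\<^sup>2)" using ft unfolding L2_nn_norm[OF L] .
    then have "L2_norm (\<lambda>x. F m x - g x) \<le> e" using e by (simp add: ennreal_le_iff power2_le_iff_abs_le)
    then show ?thesis using L by simp
  qed
  have small: "\<exists>N. \<forall>m\<ge>N. (\<lambda>x. F m x - g x) \<in> L2 \<and> L2_norm (\<lambda>x. F m x - g x) \<le> e" if "e > 0" for e
    using C[OF that] diffL2[OF that] by meson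
  obtain m0 where m0: "(\<lambda>x. F m0 x - g x) \<in> L2" using small[of 1] by auto
  have gL: "g \<in> L2"
  proof -
    have "integrable lebesgue (\<lambda>x. (cmod (g x))\<^sup>2)"
    proof (rule Bochner_Integration.integrable_bound)
      show "integrable lebesgue (\<lambda>x. 2 * (cmod (F m0 x))\<^sup>2 + 2 * (cmod (F m0 x - g x))\<^sup>2)"
        using H_L2[OF F, of m0] m0 by (simp add: L2_def)
      show "AE x in lebesgue. norm ((cmod (g x))\<^sup>2) \<le> norm (2 * (cmod (F m0 x))\<^sup>2 + 2 * (cmod (F m0 x - g x))\<^sup>2)"
      proof (rule AE_I2)
        fix x
        have "cmod (g x) \<le> cmod (F m0 x) + cmod (F m0 x - g x)"
          using norm_triangle_ineq4[of "F m0 x" "F m0 x - g x"] by simp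
        then have "(cmod (g x))\<^sup>2 \<le> (cmod (F m0 x) + cmod (F m0 x - g x))\<^sup>2" by (rule power_mono) simp
        also have "\<dots> \<le> 2 * (cmod (F m0 x))\<^sup>2 + 2 * (cmod (F m0 x - g x))\<^sup>2"
          using sum_squares_bound[of "cmod (F m0 x)" "cmod (F m0 x - g x)"] by (simp add: power2_sum)
        finally show "norm ((cmod (g x))\<^sup>2) \<le> norm (2 * (cmod (F m0 x))\<^sup>2 + 2 * (cmod (F m0 x - g x))\<^sup>2)" by simp
      qed
    qed measurable
    then show ?thesis using gm by (simp add: L2_def)
  qed
  have lim: "(\<lambda>m. L2_norm (\<lambda>x. F m x - g x)) \<longlonglongrightarrow> 0"
  proof (rule metric_LIMSEQ_I)
    fix e :: real assume "e > 0"
    then show "\<exists>N. \<forall>m\<ge>N. dist (L2_norm (\<lambda>x. F m x - g x)) 0 < e"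
      using small[of "e / 2"] by (fastforce simp: dist_norm)
  qed
  have "\<exists>h\<in>H. AE x in lebesgue. h x = g x"
    using rkhs F gL lim unfolding rkhs_def by blast
  then obtain h where h: "h \<in> H" "AE x in lebesgue. h x = g x" by blast
  have "L2_norm (\<lambda>x. F m x - h x) = L2_norm (\<lambda>x. F m x - g x)" for m
  proof -
    have "(LINT x|lebesgue. (cmod (F m x - h x))\<^sup>2) = (LINT x|lebesgue. (cmod (F m x - g x))\<^sup>2)"
      by (rule integral_cong_AE) (use h Fm gm H_L2[OF h(1)] in \<open>auto simp: L2_def\<close>)
    then show ?thesis by (simp add: L2_norm_def)
  qed
  then show ?thesis using h(1) lim by (intro bexI[of _ h]) auto
qed

end

section \<open>Orthonormal systems and separability\<close>

context kernel_space begin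

definition orthonormal :: "(real ^ 'n \<Rightarrow> complex) set \<Rightarrow> bool" where
  "orthonormal B \<longleftrightarrow> B \<subseteq> H \<and> (\<forall>b\<in>B. L2_norm b = 1) \<and> (\<forall>b\<in>B. \<forall>c\<in>B. b \<noteq> c \<longrightarrow> L2_inner b c = 0)"

lemma orthonormalD:
  assumes "orthonormal B"
  shows "b \<in> B \<Longrightarrow> b \<in> H" "b \<in> B \<Longrightarrow> L2_norm b = 1" "b \<in> B \<Longrightarrow> c \<in> B \<Longrightarrow> b \<noteq> c \<Longrightarrow> L2_inner b c = 0"
  using assms unfolding orthonormal_def by (simp_all add: subset_iff)

lemma orth_residual:
  assumes F: "finite F" and e: "\<And>i. i \<in> F \<Longrightarrow> e i \<in> H"
    and orth: "\<And>i j. i \<in> F \<Longrightarrow> j \<in> F \<Longrightarrow> i \<noteq> j \<Longrightarrow> L2_inner (e i) (e j) = 0"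
    and nrm: "\<And>i. i \<in> F \<Longrightarrow> L2_norm (e i) = 1 \<or> L2_norm (e i) = 0" and f: "f \<in> H"
  shows "(L2_norm (\<lambda>x. f x - (\<Sum>i\<in>F. L2_inner f (e i) * e i x)))\<^sup>2 =
    (L2_norm f)\<^sup>2 - (\<Sum>i\<in>F. (cmod (L2_inner f (e i)))\<^sup>2)"
    and "\<And>i. i \<in> F \<Longrightarrow> L2_inner (\<lambda>x. f x - (\<Sum>i\<in>F. L2_inner f (e i) * e i x)) (e i) = 0"
proof -
  define s where "s = (\<lambda>x. \<Sum>i\<in>F. L2_inner f (e i) * e i x)"
  have sH: "s \<in> H" unfolding s_def by (rule H_sum[OF e])
  have rH: "(\<lambda>x. f x - s x) \<in> H" by (rule H_diff[OF f sH])
  have ee: "L2_inner f (e i) * L2_inner (e i) (e i) = L2_inner f (e i)" if "i \<in> F" for i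
  proof (cases "L2_norm (e i) = 0")
    case True
    then have "L2_inner f (e i) = 0" using inner_CS[OF f e[OF that]] by simp
    then show ?thesis by simp
  next
    case False
    then show ?thesis using nrm[OF that] by (simp add: L2_inner_self)
  qed
  have se: "L2_inner s (e i) = L2_inner f (e i)" if i: "i \<in> F" for i
  proof -
    have "L2_inner s (e i) = (\<Sum>j\<in>F. L2_inner f (e j) * L2_inner (e j) (e i))"
      unfolding s_def by (rule inner_sum_left[OF e e[OF i]])
    also have "\<dots> = (\<Sum>j\<in>F. if j = i then L2_inner f (e i) * L2_inner (e i) (e i) else 0)"
      by (intro sum.cong refl) (use orth i in auto)
    also have "\<dots> = L2_inner f (e i)" using F i ee[OF i] by simp
    finally show ?thesis .
  qed
  have re: "L2_inner (\<lambda>x. f x - s x) (e i) = 0" if "i \<in> F" for i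
    unfolding inner_diff_left[OF f sH e[OF that]] se[OF that] by simp
  then show "L2_inner (\<lambda>x. f x - (\<Sum>i\<in>F. L2_inner f (e i) * e i x)) (e i) = 0" if "i \<in> F" for i
    using that unfolding s_def by simp
  have "L2_inner (\<lambda>x. f x - s x) s = (\<Sum>i\<in>F. cnj (L2_inner f (e i)) * L2_inner (\<lambda>x. f x - s x) (e i))"
    by (subst (2) s_def) (rule inner_sum_right[OF e rH])
  also have "\<dots> = 0" using re by simp
  finally have rs: "L2_inner (\<lambda>x. f x - s x) s = 0" .
  have "(L2_norm f)\<^sup>2 = (L2_norm (\<lambda>x. f x - s x))\<^sup>2 + (L2_norm s)\<^sup>2"
    using norm_add_sq[OF rH sH] rs by simp
  moreover have "L2_inner s s = (\<Sum>i\<in>F. cnj (L2_inner f (e i)) * L2_inner s (e i))"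
    by (subst (2) s_def) (rule inner_sum_right[OF e sH])
  then have "complex_of_real ((L2_norm s)\<^sup>2) = (\<Sum>i\<in>F. of_real ((cmod (L2_inner f (e i)))\<^sup>2))"
    unfolding L2_inner_self by (simp add: se cnj_mult_self del: of_real_power)
  then have "(L2_norm s)\<^sup>2 = (\<Sum>i\<in>F. (cmod (L2_inner f (e i)))\<^sup>2)"
    unfolding of_real_sum[symmetric] of_real_eq_iff .
  ultimately show "(L2_norm (\<lambda>x. f x - (\<Sum>i\<in>F. L2_inner f (e i) * e i x)))\<^sup>2 =
    (L2_norm f)\<^sup>2 - (\<Sum>i\<in>F. (cmod (L2_inner f (e i)))\<^sup>2)"
    unfolding s_def by simp
qed

text \<open>Bessel's inequality for \<open>k x\<close>, whose coefficients are the conjugates of the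
  values \<open>b x\<close>.\<close>

lemma orthonormal_pointwise:
  assumes B: "orthonormal B" and F: "finite F" "F \<subseteq> B"
  shows "(\<Sum>b\<in>F. (cmod (b x))\<^sup>2) \<le> (L2_norm (k x))\<^sup>2"
proof -
  have FB: "b \<in> B" if "b \<in> F" for b using F(2) that by blast
  have "0 \<le> (L2_norm (\<lambda>y. k x y - (\<Sum>b\<in>F. L2_inner (k x) b * b y)))\<^sup>2" by simp
  also have "\<dots> = (L2_norm (k x))\<^sup>2 - (\<Sum>b\<in>F. (cmod (L2_inner (k x) b))\<^sup>2)"
    by (rule orth_residual(1)[OF F(1), of "\<lambda>b. b"]) (simp_all add: orthonormalD[OF B] FB kH)
  also have "(\<Sum>b\<in>F. (cmod (L2_inner (k x) b))\<^sup>2) = (\<Sum>b\<in>F. (cmod (b x))\<^sup>2)"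
  proof (intro sum.cong refl)
    fix b assume "b \<in> F"
    then have "b \<in> H" using B F by (auto simp: orthonormal_def)
    then have "b x = L2_inner b (k x)" by (rule reproducing)
    then show "(cmod (L2_inner (k x) b))\<^sup>2 = (cmod (b x))\<^sup>2"
      by (simp add: L2_inner_cnj[of b "k x", symmetric])
  qed
  finally show ?thesis by simp
qed

end

locale bounded_kernel_space = kernel_space H k
  for H :: "(real ^ 'n \<Rightarrow> complex) set" and k :: "real ^ 'n \<Rightarrow> real ^ 'n \<Rightarrow> complex" +
  fixes C2 :: real
  assumes C2: "\<And>x. (L2_norm (k x))\<^sup>2 \<le> C2"
begin

lemma C2_nonneg: "C2 \<ge> 0"
  using C2[of undefined] order_trans zero_le_power2 by blast

text \<open>Finitely many members have half of their mass in a given ball: pointwise the squares of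
  the members sum to at most \<open>C2\<close>, so \<open>N\<close> such members force
  \<open>N / 2\<close> to be at most \<open>C2\<close> times the volume. Every member has half of
  its mass in some ball.\<close>

lemma orthonormal_countable:
  assumes B: "orthonormal B"
  shows "countable B"
proof -
  define X where "X = (\<lambda>m::nat. {b\<in>B. (\<integral>\<^sup>+x\<in>ball 0 (real m). ennreal ((cmod (b x))\<^sup>2) \<partial>lebesgue) \<ge> ennreal (1/2)})"
  have meas: "(\<lambda>x. ennreal ((cmod (b x))\<^sup>2)) \<in> borel_measurable lebesgue" if "b \<in> B" for b
  proof -
    have [measurable]: "b \<in> borel_measurable lebesgue" using that B H_L2 by (auto simp: orthonormal_def L2_def)
    show ?thesis by measurable
  qed
  have fin: "finite (X m)" for m
  proof (rule ccontr)
    assume inf: "infinite (X m)"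
    define V where "V = C2 * measure lebesgue (ball (0::real^'n) (real m))"
    obtain N :: nat where N: "real N > 2 * V" using reals_Archimedean2 by blast
    obtain F where F: "F \<subseteq> X m" "finite F" "card F = N"
      using infinite_arbitrarily_large[OF inf] by metis
    have FB: "F \<subseteq> B" using F by (auto simp: X_def)
    have "ennreal (N * (1/2)) = ennreal (\<Sum>b\<in>F. 1/2)" using F(3) by simp
    also have "\<dots> = (\<Sum>b\<in>F. ennreal (1/2))" by (rule sum_ennreal[symmetric]) simp
    also have "\<dots> \<le> (\<Sum>b\<in>F. \<integral>\<^sup>+x\<in>ball 0 (real m). ennreal ((cmod (b x))\<^sup>2) \<partial>lebesgue)"
      using F(1) by (intro sum_mono) (auto simp: X_def)
    also have "\<dots> = (\<integral>\<^sup>+x. (\<Sum>b\<in>F. ennreal ((cmod (b x))\<^sup>2) * indicator (ball 0 (real m)) x) \<partial>lebesgue)"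
      by (rule nn_integral_sum[symmetric]) (use meas FB in \<open>auto intro!: borel_measurable_times_ennreal borel_measurable_indicator fmeasurableD[OF lmeasurable_ball]\<close>)
    also have "\<dots> \<le> (\<integral>\<^sup>+x. ennreal C2 * indicator (ball (0::real^'n) (real m)) x \<partial>lebesgue)"
    proof (intro nn_integral_mono)
      fix x
      have "(\<Sum>b\<in>F. ennreal ((cmod (b x))\<^sup>2)) \<le> ennreal C2"
        using order_trans[OF orthonormal_pointwise[OF B F(2) FB] C2] by (simp add: sum_ennreal ennreal_leI)
      then show "(\<Sum>b\<in>F. ennreal ((cmod (b x))\<^sup>2) * indicator (ball 0 (real m)) x) \<le> ennreal C2 * indicator (ball 0 (real m)) x"
        by (auto split: split_indicator)
    qed
    also have "\<dots> = ennreal C2 * emeasure lebesgue (ball (0::real^'n) (real m))"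
      by (rule nn_integral_cmult_indicator) simp
    also have "\<dots> = ennreal V"
      unfolding V_def using C2_nonneg by (simp add: emeasure_eq_measure2[OF lmeasurable_ball] ennreal_mult)
    finally have "N * (1/2) \<le> V" using C2_nonneg by (subst (asm) ennreal_le_iff) (auto simp: V_def)
    then show False using N by simp
  qed
  have "B \<subseteq> (\<Union>m. X m)"
  proof
    fix b assume b: "b \<in> B"
    have L: "b \<in> L2" "L2_norm b = 1" using b B H_L2 by (auto simp: orthonormal_def)
    have "(\<lambda>m. \<integral>\<^sup>+x. ennreal ((cmod (b x))\<^sup>2) * indicator (ball 0 (real m)) x \<partial>lebesgue) \<longlonglongrightarrow>
      (\<integral>\<^sup>+x. ennreal ((cmod (b x))\<^sup>2) \<partial>lebesgue)"
    proof (rule nn_integral_LIMSEQ)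
      show "incseq (\<lambda>m x. ennreal ((cmod (b x))\<^sup>2) * indicator (ball 0 (real m)) x)"
        by (auto simp: incseq_def le_fun_def split: split_indicator)
      show "(\<lambda>x. ennreal ((cmod (b x))\<^sup>2) * indicator (ball 0 (real m)) x) \<in> borel_measurable lebesgue" for m
        using meas[OF b] by (intro borel_measurable_times_ennreal borel_measurable_indicator fmeasurableD[OF lmeasurable_ball])
      fix x :: "real ^ 'n"
      obtain m0 :: nat where "norm x < real m0" using reals_Archimedean2 by blast
      then have "\<forall>\<^sub>F m in sequentially. ennreal ((cmod (b x))\<^sup>2) * indicator (ball 0 (real m)) x = ennreal ((cmod (b x))\<^sup>2)"
        by (intro eventually_mono[OF eventually_ge_at_top[of m0]]) (auto simp: indicator_def dist_norm)
      then show "(\<lambda>m. ennreal ((cmod (b x))\<^sup>2) * indicator (ball 0 (real m)) x) \<longlonglongrightarrow> ennreal ((cmod (b x))\<^sup>2)"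
        by (rule tendsto_eventually)
    qed
    then have "(\<lambda>m. \<integral>\<^sup>+x. ennreal ((cmod (b x))\<^sup>2) * indicator (ball 0 (real m)) x \<partial>lebesgue) \<longlonglongrightarrow> 1"
      unfolding L2_nn_norm[OF L(1)] L(2) by simp
    then have "\<forall>\<^sub>F m in sequentially. ennreal (1/2) < (\<integral>\<^sup>+x. ennreal ((cmod (b x))\<^sup>2) * indicator (ball 0 (real m)) x \<partial>lebesgue)"
      by (rule order_tendstoD) (subst ennreal_1[symmetric], rule ennreal_lessI, simp_all del: ennreal_1)
    then obtain m where "ennreal (1/2) < (\<integral>\<^sup>+x. ennreal ((cmod (b x))\<^sup>2) * indicator (ball 0 (real m)) x \<partial>lebesgue)"
      unfolding eventually_sequentially by blast
    then have "b \<in> X m" using b less_imp_le unfolding X_def by blast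
    then show "b \<in> (\<Union>m. X m)" by blast
  qed
  moreover have "countable (\<Union>m. X m)" by (rule countable_UN) (auto intro: countable_finite fin)
  ultimately show ?thesis by (rule countable_subset)
qed

lemma maximal_orthonormal:
  obtains B where "orthonormal B" and "\<And>f. f \<in> H \<Longrightarrow> (\<And>b. b \<in> B \<Longrightarrow> L2_inner f b = 0) \<Longrightarrow> L2_norm f = 0"
proof -
  have "\<exists>M\<in>{B. orthonormal B}. \<forall>X\<in>{B. orthonormal B}. M \<subseteq> X \<longrightarrow> X = M"
  proof (rule subset_Zorn')
    fix C assume C: "subset.chain {B. orthonormal B} C"
    then have C1: "\<And>B. B \<in> C \<Longrightarrow> orthonormal B" and C2: "\<And>A B. A \<in> C \<Longrightarrow> B \<in> C \<Longrightarrow> A \<subseteq> B \<or> B \<subseteq> A"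
      by (auto simp: subset_chain_def)
    show "\<Union>C \<in> {B. orthonormal B}"
      unfolding orthonormal_def mem_Collect_eq
    proof (intro conjI ballI impI)
      show "\<Union>C \<subseteq> H" "\<And>b. b \<in> \<Union>C \<Longrightarrow> L2_norm b = 1" using orthonormalD[OF C1] by blast+
      fix b c assume bc: "b \<in> \<Union>C" "c \<in> \<Union>C" "b \<noteq> c"
      then obtain A A' where "A \<in> C" "b \<in> A" "A' \<in> C" "c \<in> A'" by blast
      then obtain A'' where "A'' \<in> C" "b \<in> A''" "c \<in> A''" using C2 by blast
      then show "L2_inner b c = 0" using C1[of A''] bc(3) by (auto simp: orthonormal_def)
    qed
  qed
  then obtain B where B: "orthonormal B" "\<And>X. orthonormal X \<Longrightarrow> B \<subseteq> X \<Longrightarrow> X = B" by blast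
  have "L2_norm f = 0" if f: "f \<in> H" and o: "\<And>b. b \<in> B \<Longrightarrow> L2_inner f b = 0" for f
  proof (rule ccontr)
    assume nz: "L2_norm f \<noteq> 0"
    define g where "g = (\<lambda>x. of_real (1 / L2_norm f) * f x)"
    have gH: "g \<in> H" unfolding g_def by (rule H_scale[OF f])
    have g1: "L2_norm g = 1" unfolding g_def norm_scale using nz by (simp add: norm_divide)
    have go: "L2_inner g b = 0" if "b \<in> B" for b unfolding g_def L2_inner_scale_left using o[OF that] by simp
    have og: "L2_inner b g = 0" if "b \<in> B" for b using go[OF that] L2_inner_cnj[of g b] by simp
    have "orthonormal (insert g B)"
      using B(1) gH g1 go og unfolding orthonormal_def by auto
    then have "insert g B = B" by (intro B(2)) auto
    then have "g \<in> B" by blast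
    then show False using go[of g] g1 by (simp add: L2_inner_self)
  qed
  then show ?thesis using that B(1) by blast
qed

lemma norm_reverse:
  assumes "f \<in> H" "g \<in> H"
  shows "\<bar>L2_norm f - L2_norm g\<bar> \<le> L2_norm (\<lambda>x. f x - g x)"
  using norm_triangle[OF H_diff[OF assms] assms(2)] norm_triangle[OF H_diff[OF assms(2,1)] assms(1)]
    norm_diff_commute[of f g] by simp

text \<open>The residuals of the partial sums have decreasing norms and satisfy Pythagoras, hence
  form a Cauchy sequence. Its limit is orthogonal to the whole maximal system and therefore has norm
  0.\<close>

lemma orthonormal_sequence:
  obtains e :: "nat \<Rightarrow> real ^ 'n \<Rightarrow> complex" where "\<And>i. e i \<in> H"
    and "\<And>f. f \<in> H \<Longrightarrow> (\<lambda>N. L2_norm (\<lambda>x. f x - (\<Sum>i<N. L2_inner f (e i) * e i x))) \<longlonglongrightarrow> 0"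
    and "\<And>f N. f \<in> H \<Longrightarrow> (L2_norm (\<lambda>x. f x - (\<Sum>i<N. L2_inner f (e i) * e i x)))\<^sup>2 =
      (L2_norm f)\<^sup>2 - (\<Sum>i<N. (cmod (L2_inner f (e i)))\<^sup>2)"
proof -
  obtain B where B: "orthonormal B" and mx: "\<And>f. f \<in> H \<Longrightarrow> (\<And>b. b \<in> B \<Longrightarrow> L2_inner f b = 0) \<Longrightarrow> L2_norm f = 0"
    using maximal_orthonormal by blast
  have cB: "countable B" by (rule orthonormal_countable[OF B])
  define e where "e = (\<lambda>i. if i \<in> to_nat_on B ` B then from_nat_into B i else (\<lambda>_. 0))"
  have eB: "e (to_nat_on B b) = b" if "b \<in> B" for b
    using cB that by (simp add: e_def)
  have e_cases: "e i = (\<lambda>_. 0) \<or> (\<exists>b\<in>B. i = to_nat_on B b \<and> e i = b)" for i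
    using cB by (auto simp: e_def)
  have z0: "L2_norm (\<lambda>_. 0) = 0" by (simp add: L2_norm_def)
  have iz: "L2_inner f (\<lambda>_. 0) = 0" "L2_inner (\<lambda>_. 0) f = 0" for f by (simp_all add: L2_inner_def)
  have eH: "e i \<in> H" for i using e_cases[of i] B H_zero by (auto simp: orthonormal_def)
  have en: "L2_norm (e i) = 1 \<or> L2_norm (e i) = 0" for i
    using e_cases[of i] B z0 by (auto simp: orthonormal_def)
  have eo: "L2_inner (e i) (e j) = 0" if "i \<noteq> j" for i j
    using e_cases[of i] e_cases[of j] iz that orthonormalD(3)[OF B, of "e i" "e j"] by metis
  have residual: "(L2_norm (\<lambda>x. f x - (\<Sum>i\<in>F. L2_inner f (e i) * e i x)))\<^sup>2 =
      (L2_norm f)\<^sup>2 - (\<Sum>i\<in>F. (cmod (L2_inner f (e i)))\<^sup>2)" if "f \<in> H" "finite F" for f F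
    by (rule orth_residual(1)) (use that eH en eo in auto)
  have reso: "L2_inner (\<lambda>x. f x - (\<Sum>i\<in>F. L2_inner f (e i) * e i x)) (e j) = 0" if "f \<in> H" "finite F" "j \<in> F" for f F j
    by (rule orth_residual(2)) (use that eH en eo in auto)
  have "(\<lambda>N. L2_norm (\<lambda>x. f x - (\<Sum>i<N. L2_inner f (e i) * e i x))) \<longlonglongrightarrow> 0" if f: "f \<in> H" for f
  proof -
    define r where "r = (\<lambda>N x. f x - (\<Sum>i<N. L2_inner f (e i) * e i x))"
    have rH: "r N \<in> H" for N unfolding r_def by (intro H_diff f H_sum eH)
    have rn: "(L2_norm (r N))\<^sup>2 = (L2_norm f)\<^sup>2 - (\<Sum>i<N. (cmod (L2_inner f (e i)))\<^sup>2)" for N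
      unfolding r_def using residual[OF f, of "{..<N}"] by simp
    have ro: "L2_inner (r N) (e j) = 0" if "j < N" for N j
      unfolding r_def using reso[OF f, of "{..<N}" j] that by simp
    have sH: "(\<lambda>x. \<Sum>i<N. L2_inner f (e i) * e i x) \<in> H" for N by (intro H_sum eH)
    have dn: "(L2_norm (\<lambda>x. r N x - r M x))\<^sup>2 = (L2_norm (r N))\<^sup>2 - (L2_norm (r M))\<^sup>2" if "N \<le> M" for N M
    proof -
      have split: "{..<M} = {..<N} \<union> {N..<M}" using that by auto
      have "r M x = r N x - (\<Sum>i\<in>{N..<M}. L2_inner f (e i) * e i x)" for x
        unfolding r_def split by (subst sum.union_disjoint) auto
      moreover have "L2_inner f (e i) = L2_inner (r N) (e i)" if "i \<in> {N..<M}" for i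
      proof -
        have "L2_inner (\<lambda>x. \<Sum>j<N. L2_inner f (e j) * e j x) (e i) = (\<Sum>j<N. L2_inner f (e j) * L2_inner (e j) (e i))"
          by (rule inner_sum_left) (auto intro: eH)
        also have "\<dots> = 0" using that eo by (intro sum.neutral) auto
        finally show ?thesis
          unfolding r_def using inner_diff_left[OF f sH eH] by simp
      qed
      ultimately have rM: "r M = (\<lambda>x. r N x - (\<Sum>i\<in>{N..<M}. L2_inner (r N) (e i) * e i x))" by auto
      define p where "p = (\<lambda>x. \<Sum>i\<in>{N..<M}. L2_inner (r N) (e i) * e i x)"
      have pH: "p \<in> H" unfolding p_def by (intro H_sum eH)
      have pe: "p = (\<lambda>x. r N x - r M x)" unfolding rM p_def by auto
      have "L2_inner (r M) p = (\<Sum>i\<in>{N..<M}. cnj (L2_inner (r N) (e i)) * L2_inner (r M) (e i))"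
        unfolding p_def by (rule inner_sum_right) (auto intro: eH rH)
      also have "\<dots> = 0" using ro by (intro sum.neutral) auto
      finally have "(L2_norm (\<lambda>x. r M x + p x))\<^sup>2 = (L2_norm (r M))\<^sup>2 + (L2_norm p)\<^sup>2"
        using norm_add_sq[OF rH pH, of M] by simp
      moreover have "(\<lambda>x. r M x + p x) = r N" unfolding pe by auto
      ultimately show ?thesis unfolding pe[symmetric] by simp
    qed
    have dec: "decseq (\<lambda>N. (L2_norm (r N))\<^sup>2)"
    proof (rule decseq_SucI)
      fix N show "(L2_norm (r (Suc N)))\<^sup>2 \<le> (L2_norm (r N))\<^sup>2" unfolding rn by simp
    qed
    have "convergent (\<lambda>N. (L2_norm (r N))\<^sup>2)"
      by (rule decseq_convergent[OF dec, of 0]) (auto simp: convergent_def)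
    then have Cau: "Cauchy (\<lambda>N. (L2_norm (r N))\<^sup>2)" by (rule convergent_Cauchy)
    have "\<exists>h\<in>H. (\<lambda>m. L2_norm (\<lambda>x. r m x - h x)) \<longlonglongrightarrow> 0"
    proof (rule complete[OF rH])
      fix d :: real assume d: "d > 0"
      then obtain N where N: "\<And>m l. m \<ge> N \<Longrightarrow> l \<ge> N \<Longrightarrow> dist ((L2_norm (r m))\<^sup>2) ((L2_norm (r l))\<^sup>2) < d\<^sup>2"
        using metric_CauchyD[OF Cau, of "d\<^sup>2"] by auto
      have "L2_norm (\<lambda>x. r m x - r l x) < d" if ml: "m \<ge> N" "l \<ge> N" "m \<le> l" for m l
      proof -
        have "(L2_norm (\<lambda>x. r m x - r l x))\<^sup>2 < d\<^sup>2"
          using N[OF ml(1,2)] unfolding dn[OF ml(3)] by (simp add: dist_norm)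
        then show ?thesis by (rule power_less_imp_less_base) (use d in simp)
      qed
      then have "L2_norm (\<lambda>x. r m x - r l x) < d" if "m \<ge> N" "l \<ge> N" for m l
        using that norm_diff_commute[of "r m" "r l"] by (metis nle_le)
      then show "\<exists>N. \<forall>m\<ge>N. \<forall>l\<ge>N. L2_norm (\<lambda>x. r m x - r l x) < d" by blast
    qed
    then obtain h where h: "h \<in> H" "(\<lambda>m. L2_norm (\<lambda>x. r m x - h x)) \<longlonglongrightarrow> 0" by blast
    have "L2_inner h (e j) = 0" for j
    proof -
      have "cmod (L2_inner h (e j)) \<le> L2_norm (\<lambda>x. r m x - h x)" if "m > j" for m
      proof -
        have "L2_inner (\<lambda>x. r m x - h x) (e j) = - L2_inner h (e j)"
          using inner_diff_left[OF rH h(1) eH] ro[OF that] by simp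
        then have "cmod (L2_inner h (e j)) \<le> L2_norm (\<lambda>x. r m x - h x) * L2_norm (e j)"
          using inner_CS[OF H_diff[OF rH h(1)] eH, of m j] by simp
        also have "\<dots> \<le> L2_norm (\<lambda>x. r m x - h x) * 1" using en[of j] by (intro mult_left_mono) auto
        finally show ?thesis by simp
      qed
      then have "\<forall>\<^sub>F m in sequentially. cmod (L2_inner h (e j)) \<le> L2_norm (\<lambda>x. r m x - h x)"
        by (intro eventually_mono[OF eventually_gt_at_top[of j]])
      then have "cmod (L2_inner h (e j)) \<le> 0" by (intro tendsto_lowerbound[OF h(2)]) auto
      then show ?thesis by simp
    qed
    then have "L2_inner h b = 0" if "b \<in> B" for b using eB[OF that] by metis
    then have h0: "L2_norm h = 0" using mx[OF h(1)] by blast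
    have "L2_norm (r m) = L2_norm (\<lambda>x. r m x - h x)" for m
      using norm_triangle[OF H_diff[OF rH h(1), of m] h(1)] norm_triangle_diff[OF rH H_zero h(1), of m]
        h0 norm_diff_commute[of "\<lambda>_. 0" h] by simp
    then show ?thesis using h(2) unfolding r_def by simp
  qed
  then show ?thesis using that[of e] eH residual by blast
qed

text \<open>The case of the vector \<open>k x\<close>. No continuity of \<open>k x\<close> in
  \<open>x\<close> is available; the identity for the residual lets the quality of a finite
  approximation to \<open>k x\<close> be read off from measurable scalar functions of
  \<open>x\<close>.\<close>

lemma kernel_expansion:
  obtains e :: "nat \<Rightarrow> real ^ 'n \<Rightarrow> complex" where "\<And>i. e i \<in> H"
    and "\<And>x. (\<lambda>N. \<Sum>i<N. (cmod (e i x))\<^sup>2) \<longlonglongrightarrow> (L2_norm (k x))\<^sup>2"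
    and "\<And>x N. (L2_norm (\<lambda>y. k x y - (\<Sum>i<N. cnj (e i x) * e i y)))\<^sup>2 = (L2_norm (k x))\<^sup>2 - (\<Sum>i<N. (cmod (e i x))\<^sup>2)"
proof -
  obtain e where e: "\<And>i. e i \<in> H"
    and lim: "\<And>f. f \<in> H \<Longrightarrow> (\<lambda>N. L2_norm (\<lambda>x. f x - (\<Sum>i<N. L2_inner f (e i) * e i x))) \<longlonglongrightarrow> 0"
    and residual: "\<And>f N. f \<in> H \<Longrightarrow> (L2_norm (\<lambda>x. f x - (\<Sum>i<N. L2_inner f (e i) * e i x)))\<^sup>2 =
      (L2_norm f)\<^sup>2 - (\<Sum>i<N. (cmod (L2_inner f (e i)))\<^sup>2)"
    using orthonormal_sequence by blast
  have ke: "L2_inner (k x) (e i) = cnj (e i x)" for x i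
    unfolding reproducing[OF e, of i x] L2_inner_cnj ..
  note residual' = residual[OF kH, unfolded ke complex_mod_cnj]
  have "(\<lambda>N. (L2_norm (k x))\<^sup>2 - (L2_norm (\<lambda>y. k x y - (\<Sum>i<N. cnj (e i x) * e i y)))\<^sup>2) \<longlonglongrightarrow> (L2_norm (k x))\<^sup>2 - 0\<^sup>2" for x
    using lim[OF kH, of x] unfolding ke by (intro tendsto_intros)
  then have "(\<lambda>N. \<Sum>i<N. (cmod (e i x))\<^sup>2) \<longlonglongrightarrow> (L2_norm (k x))\<^sup>2" for x
    unfolding residual' by simp
  then show ?thesis using that[of e] e residual' by blast
qed

end

section \<open>Cells cut into pieces of small oscillation\<close>

lemma floor_fibre_measurable:
  fixes g :: "'a::euclidean_space \<Rightarrow> real"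
  assumes [measurable]: "g \<in> borel_measurable lebesgue" and A: "A \<in> sets lebesgue"
  shows "{x \<in> A. \<lfloor>g x / d\<rfloor> = a} \<in> sets lebesgue"
proof -
  have "{x \<in> space lebesgue. of_int a \<le> g x / d \<and> g x / d < of_int a + 1} \<in> sets lebesgue"
    by measurable
  then have "{x. of_int a \<le> g x / d \<and> g x / d < of_int a + 1} \<in> sets lebesgue" by simp
  then have "A \<inter> {x. of_int a \<le> g x / d \<and> g x / d < of_int a + 1} \<in> sets lebesgue"
    using A by blast
  moreover have "A \<inter> {x. of_int a \<le> g x / d \<and> g x / d < of_int a + 1} = {x \<in> A. \<lfloor>g x / d\<rfloor> = a}"
    by (auto simp: floor_eq_iff)
  ultimately show ?thesis by simp
qed

text \<open>At points with equal labels all listed functions agree up to \<open>d\<close>.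
  Boundedness leaves finitely many labels.\<close>

lemma label_partition:
  fixes fs :: "('a::euclidean_space \<Rightarrow> real) list"
  assumes "\<And>g. g \<in> set fs \<Longrightarrow> g \<in> borel_measurable lebesgue" and A: "A \<in> sets lebesgue"
    and bd: "\<And>g x. g \<in> set fs \<Longrightarrow> x \<in> A \<Longrightarrow> \<bar>g x\<bar> \<le> R" and d: "d > 0"
  shows "finite ((\<lambda>x. map (\<lambda>g. \<lfloor>g x / d\<rfloor>) fs) ` A)"
    and "{x \<in> A. map (\<lambda>g. \<lfloor>g x / d\<rfloor>) fs = l} \<in> sets lebesgue"
proof -
  have "finite ((\<lambda>x. map (\<lambda>g. \<lfloor>g x / d\<rfloor>) fs) ` A) \<and> (\<forall>l. {x \<in> A. map (\<lambda>g. \<lfloor>g x / d\<rfloor>) fs = l} \<in> sets lebesgue)"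
    using assms(1) bd
  proof (induction fs)
    case Nil
    have "{x \<in> A. [] = l} = (if l = [] then A else {})" for l :: "int list" by auto
    moreover have "finite ((\<lambda>x. [] :: int list) ` A)" by (rule finite_subset[of _ "{[]}"]) auto
    ultimately show ?case using A by simp
  next
    case (Cons g fs)
    let ?L = "\<lambda>x. map (\<lambda>g. \<lfloor>g x / d\<rfloor>) fs"
    have IH: "finite (?L ` A)" "\<And>l. {x \<in> A. ?L x = l} \<in> sets lebesgue"
      using Cons by auto
    have rng: "\<lfloor>g x / d\<rfloor> \<in> {\<lfloor>- R / d\<rfloor>..\<lfloor>R / d\<rfloor>}" if "x \<in> A" for x
    proof -
      have "- R \<le> g x" "g x \<le> R" using Cons.prems(2)[of g x] that by (auto simp: abs_le_iff)
      from divide_right_mono[OF this(1), of d] divide_right_mono[OF this(2), of d] d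
      have "- R / d \<le> g x / d" "g x / d \<le> R / d" by simp_all
      from floor_mono[OF this(1)] floor_mono[OF this(2)] show ?thesis by simp
    qed
    have "(\<lambda>x. map (\<lambda>g. \<lfloor>g x / d\<rfloor>) (g # fs)) ` A \<subseteq> (\<lambda>(a, l). a # l) ` ({\<lfloor>- R / d\<rfloor>..\<lfloor>R / d\<rfloor>} \<times> ?L ` A)"
      using rng by force
    then have "finite ((\<lambda>x. map (\<lambda>g. \<lfloor>g x / d\<rfloor>) (g # fs)) ` A)"
      using IH(1) by (meson finite_SigmaI finite_atLeastAtMost_int finite_imageI finite_subset)
    moreover have "{x \<in> A. map (\<lambda>g. \<lfloor>g x / d\<rfloor>) (g # fs) = l} \<in> sets lebesgue" for l
    proof (cases l)
      case (Cons a l')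
      have "{x \<in> A. map (\<lambda>g. \<lfloor>g x / d\<rfloor>) (g # fs) = l} = {x \<in> A. \<lfloor>g x / d\<rfloor> = a} \<inter> {x \<in> A. ?L x = l'}"
        using Cons by auto
      then show ?thesis using floor_fibre_measurable[of g A d a] Cons.prems(1)[of g] A IH(2) by auto
    qed simp
    ultimately show ?case by blast
  qed
  then show "finite ((\<lambda>x. map (\<lambda>g. \<lfloor>g x / d\<rfloor>) fs) ` A)"
    and "{x \<in> A. map (\<lambda>g. \<lfloor>g x / d\<rfloor>) fs = l} \<in> sets lebesgue" by auto
qed

context bounded_kernel_space begin

definition knorm :: "real ^ 'n \<Rightarrow> real" where "knorm x = (L2_norm (k x))\<^sup>2"

lemma knorm_le: "knorm x \<le> C2" and knorm_nonneg: "0 \<le> knorm x"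
  unfolding knorm_def using C2 by auto

lemma kernel_norm_le: "L2_norm (k x) \<le> sqrt C2"
  using C2[of x] by (simp add: real_le_rsqrt)

lemma knorm_measurable [measurable]: "knorm \<in> borel_measurable lebesgue"
proof -
  obtain e :: "nat \<Rightarrow> real ^ 'n \<Rightarrow> complex" where e: "\<And>i. e i \<in> H"
    and lim: "\<And>x. (\<lambda>N. \<Sum>i<N. (cmod (e i x))\<^sup>2) \<longlonglongrightarrow> (L2_norm (k x))\<^sup>2"
  proof (rule kernel_expansion)
    fix e :: "nat \<Rightarrow> real ^ 'n \<Rightarrow> complex"
    assume "\<And>i. e i \<in> H" "\<And>x. (\<lambda>N. \<Sum>i<N. (cmod (e i x))\<^sup>2) \<longlonglongrightarrow> (L2_norm (k x))\<^sup>2"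
    then show thesis by (rule that)
  qed
  have [measurable]: "e i \<in> borel_measurable lebesgue" for i using H_L2[OF e] by (simp add: L2_def)
  show ?thesis
  proof (rule borel_measurable_LIMSEQ_real)
    show "(\<lambda>N. \<Sum>i<N. (cmod (e i x))\<^sup>2) \<longlonglongrightarrow> knorm x" for x unfolding knorm_def by (rule lim)
    show "(\<lambda>x. \<Sum>i<N. (cmod (e i x))\<^sup>2) \<in> borel_measurable lebesgue" for N by measurable
  qed
qed

text \<open>The squared tails of the expansion decrease to 0 pointwise on a set of finite measure,
  so outside a small set one truncation approximates every \<open>k x\<close> up to
  \<open>d\<close>. Rounding the finitely many coefficients makes truncations with equal labels
  differ by at most \<open>d\<close>; two tails and this difference give
  \<open>3 * d\<close>.\<close>

lemma kernel_pieces: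
  assumes A: "A \<in> lmeasurable" and d: "d > 0"
  obtains lab :: "real ^ 'n \<Rightarrow> int list" and A' where "A' \<subseteq> A" "A' \<in> lmeasurable" "measure lebesgue (A - A') < d"
    "finite (lab ` A')" "\<And>l. {x \<in> A'. lab x = l} \<in> sets lebesgue"
    "\<And>x y. x \<in> A' \<Longrightarrow> y \<in> A' \<Longrightarrow> lab x = lab y \<Longrightarrow> L2_norm (\<lambda>z. k x z - k y z) \<le> 3 * d"
proof -
  obtain e :: "nat \<Rightarrow> real ^ 'n \<Rightarrow> complex" where e: "\<And>i. e i \<in> H"
    and lim: "\<And>x. (\<lambda>N. \<Sum>i<N. (cmod (e i x))\<^sup>2) \<longlonglongrightarrow> (L2_norm (k x))\<^sup>2"
    and residual: "\<And>x N. (L2_norm (\<lambda>y. k x y - (\<Sum>i<N. cnj (e i x) * e i y)))\<^sup>2 = (L2_norm (k x))\<^sup>2 - (\<Sum>i<N. (cmod (e i x))\<^sup>2)"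
  proof (rule kernel_expansion)
    fix e :: "nat \<Rightarrow> real ^ 'n \<Rightarrow> complex"
    assume "\<And>i. e i \<in> H" "\<And>x. (\<lambda>N. \<Sum>i<N. (cmod (e i x))\<^sup>2) \<longlonglongrightarrow> (L2_norm (k x))\<^sup>2"
      "\<And>x N. (L2_norm (\<lambda>y. k x y - (\<Sum>i<N. cnj (e i x) * e i y)))\<^sup>2 = (L2_norm (k x))\<^sup>2 - (\<Sum>i<N. (cmod (e i x))\<^sup>2)"
    then show thesis by (rule that)
  qed
  have em [measurable]: "e i \<in> borel_measurable lebesgue" for i using H_L2[OF e] by (simp add: L2_def)
  have As: "A \<in> sets lebesgue" using A by (simp add: fmeasurableD)
  define X where "X = (\<lambda>N. {x \<in> A. knorm x - (\<Sum>i<N. (cmod (e i x))\<^sup>2) < d\<^sup>2})"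
  have Xs: "X N \<in> sets lebesgue" for N
  proof -
    have "{x \<in> space lebesgue. knorm x - (\<Sum>i<N. (cmod (e i x))\<^sup>2) < d\<^sup>2} \<in> sets lebesgue" by measurable
    then have "A \<inter> {x. knorm x - (\<Sum>i<N. (cmod (e i x))\<^sup>2) < d\<^sup>2} \<in> sets lebesgue" using As by auto
    moreover have "A \<inter> {x. knorm x - (\<Sum>i<N. (cmod (e i x))\<^sup>2) < d\<^sup>2} = X N" unfolding X_def by blast
    ultimately show ?thesis by simp
  qed
  have XA: "X N \<subseteq> A" for N by (auto simp: X_def)
  have Xl: "X N \<in> lmeasurable" for N by (rule fmeasurableI2[OF A XA Xs])
  have lim_meas: "(\<lambda>N. measure lebesgue (A - X N)) \<longlonglongrightarrow> measure lebesgue (\<Inter>N. A - X N)"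
  proof (rule Lim_measure_decseq)
    show "range (\<lambda>N. A - X N) \<subseteq> sets lebesgue" using As Xs by auto
    show "decseq (\<lambda>N. A - X N)"
    proof (rule decseq_SucI, rule Diff_mono[OF order_refl])
      fix N show "X N \<subseteq> X (Suc N)"
        unfolding X_def using zero_le_power2 by (auto intro: le_less_trans[rotated])
    qed
    show "emeasure lebesgue (A - X N) \<noteq> \<infinity>" for N
      using fmeasurableD2[OF fmeasurable.Diff[OF A Xl]] by simp
  qed
  have "(\<Inter>N. A - X N) = {}"
  proof -
    have "\<exists>N. x \<in> X N" if "x \<in> A" for x
    proof -
      have "(\<lambda>N. knorm x - (\<Sum>i<N. (cmod (e i x))\<^sup>2)) \<longlonglongrightarrow> knorm x - knorm x"
        unfolding knorm_def by (intro tendsto_intros lim)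
      then have "\<forall>\<^sub>F N in sequentially. knorm x - (\<Sum>i<N. (cmod (e i x))\<^sup>2) < d\<^sup>2"
        by (rule order_tendstoD) (use d in simp)
      then show ?thesis using that by (auto simp: X_def eventually_sequentially)
    qed
    then show ?thesis by auto
  qed
  from lim_meas[unfolded this] have "(\<lambda>N. measure lebesgue (A - X N)) \<longlonglongrightarrow> 0" by simp
  then have "\<forall>\<^sub>F N in sequentially. measure lebesgue (A - X N) < d" by (rule order_tendstoD) (rule d)
  then obtain N where N: "measure lebesgue (A - X N) < d" by (auto simp: eventually_sequentially)
  define M where "M = (\<Sum>i<N. L2_norm (e i)) + 1"
  have M: "M > 0" "(\<Sum>i<N. L2_norm (e i)) \<le> M" by (auto simp: M_def intro!: add_nonneg_pos sum_nonneg)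
  \<comment> \<open>Equal labels keep the real and imaginary parts of each coefficient within
    \<open>d'\<close>, hence the coefficient within \<open>2 * d'\<close>; weighted with the norms
    of the \<open>e i\<close>, whose sum is at most \<open>M\<close>, this makes
    \<open>d\<close>.\<close>
  define d' where "d' = d / (2 * M)"
  have d': "d' > 0" using d M by (simp add: d'_def)
  define fs where "fs = map (\<lambda>i x. Re (e i x)) [0..<N] @ map (\<lambda>i x. Im (e i x)) [0..<N]"
  define lab where "lab = (\<lambda>x. map (\<lambda>g. \<lfloor>g x / d'\<rfloor>) fs)"
  have ebd: "cmod (e i x) \<le> L2_norm (e i) * sqrt C2" for i x
    using pointwise_bound[OF e, of i x] kernel_norm_le[of x] by (meson L2_norm_nonneg mult_left_mono order_trans)
  have bd: "\<bar>g x\<bar> \<le> M * sqrt C2" if "g \<in> set fs" for g x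
  proof -
    obtain i where i: "i < N" "g = (\<lambda>x. Re (e i x)) \<or> g = (\<lambda>x. Im (e i x))"
    proof -
      have "g \<in> (\<lambda>i x. Re (e i x)) ` {0..<N} \<union> (\<lambda>i x. Im (e i x)) ` {0..<N}"
        using \<open>g \<in> set fs\<close> by (simp add: fs_def)
      then show thesis using that by auto
    qed
    have "\<bar>g x\<bar> \<le> cmod (e i x)" using i(2) abs_Re_le_cmod abs_Im_le_cmod by auto
    also have "\<dots> \<le> L2_norm (e i) * sqrt C2" by (rule ebd)
    also have "L2_norm (e i) \<le> (\<Sum>i<N. L2_norm (e i))" using i(1) by (intro member_le_sum) auto
    finally show ?thesis using M(2) C2_nonneg by (meson mult_right_mono order_trans real_sqrt_ge_zero)
  qed
  have fm: "g \<in> borel_measurable lebesgue" if "g \<in> set fs" for g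
    using that by (auto simp: fs_def)
  have osc: "L2_norm (\<lambda>z. k x z - k y z) \<le> 3 * d" if xy: "x \<in> X N" "y \<in> X N" "lab x = lab y" for x y
  proof -
    define s where "s = (\<lambda>x z. \<Sum>i<N. cnj (e i x) * e i z)"
    have sH: "s x \<in> H" for x unfolding s_def by (intro H_sum e)
    have tail: "L2_norm (\<lambda>z. k x z - s x z) \<le> d" if "x \<in> X N" for x
    proof -
      have "(L2_norm (\<lambda>z. k x z - s x z))\<^sup>2 \<le> d\<^sup>2"
        unfolding s_def residual using that by (simp add: X_def knorm_def)
      then show ?thesis using d by (simp add: power2_le_iff_abs_le)
    qed
    have fl: "\<lfloor>g x / d'\<rfloor> = \<lfloor>g y / d'\<rfloor>" if "g \<in> set fs" for g using xy(3) that by (auto simp: lab_def)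
    have close: "\<bar>g x - g y\<bar> \<le> d'" if "g \<in> set fs" for g
    proof -
      have "\<bar>g x / d' - g y / d'\<bar> \<le> 1" using fl[OF that] by linarith
      then have "\<bar>g x - g y\<bar> / d' \<le> 1" using d' by (simp add: diff_divide_distrib[symmetric])
      then show ?thesis using d' by simp
    qed
    have eclose: "cmod (e i x - e i y) \<le> 2 * d'" if i: "i < N" for i
    proof -
      have "(\<lambda>x. Re (e i x)) \<in> set fs" "(\<lambda>x. Im (e i x)) \<in> set fs" using i by (auto simp: fs_def)
      from close[OF this(1)] close[OF this(2)] show ?thesis
        using cmod_le[of "e i x - e i y"] by simp
    qed
    have "L2_norm (\<lambda>z. \<Sum>i\<in>F. c i * e i z) \<le> (\<Sum>i\<in>F. cmod (c i) * L2_norm (e i))" if "finite F" for F c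
      using that
    proof (induction F)
      case empty
      show ?case by (simp add: L2_norm_def)
    next
      case (insert i F)
      have "L2_norm (\<lambda>z. c i * e i z + (\<Sum>i\<in>F. c i * e i z)) \<le> L2_norm (\<lambda>z. c i * e i z) + L2_norm (\<lambda>z. \<Sum>i\<in>F. c i * e i z)"
        by (intro norm_triangle H_scale H_sum e)
      then show ?case using insert by (simp add: norm_scale)
    qed
    from this[of "{..<N}" "\<lambda>i. cnj (e i x) - cnj (e i y)"]
    have "L2_norm (\<lambda>z. s x z - s y z) \<le> (\<Sum>i<N. cmod (cnj (e i x) - cnj (e i y)) * L2_norm (e i))"
      by (simp add: s_def left_diff_distrib sum_subtractf)
    also have "\<dots> \<le> (\<Sum>i<N. 2 * d' * L2_norm (e i))"
      using eclose by (intro sum_mono mult_right_mono) (auto simp flip: complex_cnj_diff)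
    also have "\<dots> = 2 * d' * (\<Sum>i<N. L2_norm (e i))" by (simp add: sum_distrib_left)
    also have "\<dots> \<le> 2 * d' * M" using M d' by (intro mult_left_mono) auto
    also have "\<dots> = d" using M by (simp add: d'_def)
    finally have ss: "L2_norm (\<lambda>z. s x z - s y z) \<le> d" .
    have "L2_norm (\<lambda>z. k x z - k y z) \<le> L2_norm (\<lambda>z. k x z - s x z) + L2_norm (\<lambda>z. s x z - k y z)"
      by (rule norm_triangle_diff[OF kH sH kH])
    also have "L2_norm (\<lambda>z. s x z - k y z) \<le> L2_norm (\<lambda>z. s x z - s y z) + L2_norm (\<lambda>z. s y z - k y z)"
      by (rule norm_triangle_diff[OF sH sH kH])
    finally show ?thesis using tail[OF xy(1)] tail[OF xy(2)] ss norm_diff_commute[of "s y" "k y"] by simp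
  qed
  have "finite (lab ` X N)"
    unfolding lab_def by (rule label_partition(1)[OF _ Xs _ d', of _ _ "M * sqrt C2"]) (use fm bd in auto)
  moreover have "{x \<in> X N. lab x = l} \<in> sets lebesgue" for l
    unfolding lab_def by (rule label_partition(2)[OF _ Xs _ d', of _ _ "M * sqrt C2"]) (use fm bd in auto)
  ultimately show ?thesis by (rule that[OF XA Xl N _ _ osc])
qed

text \<open>A Riemann sum: one point in each piece, with the measure of the piece as weight. The
  oscillation of \<open>k x\<close> controls that of the squared modulus of \<open>f\<close> for all
  \<open>f\<close> in \<open>H\<close> at once, which is why the error has the form
  \<open>\<eta> * (L2_norm f)\<^sup>2\<close>.\<close>

lemma candidates_cell:
  assumes A: "A \<in> lmeasurable" and \<eta>: "\<eta> > 0"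
  obtains m :: nat and x :: "nat \<Rightarrow> real ^ 'n" and w :: "nat \<Rightarrow> real"
  where "\<And>l. l < m \<Longrightarrow> x l \<in> A \<and> w l > 0"
    and "\<And>f. f \<in> H \<Longrightarrow> (\<Sum>l<m. w l * (cmod (f (x l)))\<^sup>2) \<le> (LINT y|lebesgue. indicator A y * (cmod (f y))\<^sup>2) + \<eta> * (L2_norm f)\<^sup>2"
    and "(LINT y|lebesgue. indicator A y * knorm y) - \<eta> \<le> (\<Sum>l<m. w l * knorm (x l))"
    and "(\<Sum>l<m. w l * knorm (x l)) \<le> C2 * measure lebesgue A"
proof -
  let ?V = "measure lebesgue A"
  \<comment> \<open>Oscillation costs \<open>6 * d * sqrt C2\<close> times the measure of
    \<open>A\<close>, and the discarded part of \<open>A\<close> costs at most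
    \<open>d * C2\<close>; the summand 1 keeps \<open>c\<close> positive.\<close>
  define c where "c = 6 * sqrt C2 * ?V + C2 + 1"
  have c: "c > 0" using C2_nonneg by (simp add: c_def add_nonneg_pos)
  define d where "d = \<eta> / c"
  have d: "d > 0" using \<eta> c by (simp add: d_def)
  have dc: "d * (6 * sqrt C2 * ?V) \<le> \<eta>" "d * (6 * sqrt C2 * ?V + C2) \<le> \<eta>"
  proof -
    have "d * (6 * sqrt C2 * ?V + C2) \<le> d * c" using d by (intro mult_left_mono) (auto simp: c_def)
    also have "\<dots> = \<eta>" using c by (simp add: d_def)
    finally show 2: "d * (6 * sqrt C2 * ?V + C2) \<le> \<eta>" .
    have "d * (6 * sqrt C2 * ?V) \<le> d * (6 * sqrt C2 * ?V + C2)" using d C2_nonneg by (intro mult_left_mono) auto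
    then show "d * (6 * sqrt C2 * ?V) \<le> \<eta>" using 2 by linarith
  qed
  obtain lab :: "real ^ 'n \<Rightarrow> int list" and A' where A': "A' \<subseteq> A" "A' \<in> lmeasurable" "measure lebesgue (A - A') < d"
    and lab: "finite (lab ` A')" "\<And>l. {x \<in> A'. lab x = l} \<in> sets lebesgue"
    and osc: "\<And>x y. x \<in> A' \<Longrightarrow> y \<in> A' \<Longrightarrow> lab x = lab y \<Longrightarrow> L2_norm (\<lambda>z. k x z - k y z) \<le> 3 * d"
  proof (rule kernel_pieces[OF A d])
    fix lab :: "real ^ 'n \<Rightarrow> int list" and A'
    assume "A' \<subseteq> A" "A' \<in> lmeasurable" "measure lebesgue (A - A') < d"
      "finite (lab ` A')" "\<And>l. {x \<in> A'. lab x = l} \<in> sets lebesgue"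
      "\<And>x y. x \<in> A' \<Longrightarrow> y \<in> A' \<Longrightarrow> lab x = lab y \<Longrightarrow> L2_norm (\<lambda>z. k x z - k y z) \<le> 3 * d"
    then show thesis by (rule that)
  qed
  define E where "E = (\<lambda>l. {x \<in> A'. lab x = l})"
  define pt where "pt = (\<lambda>l. SOME x. x \<in> E l)"
  define P where "P = lab ` A'"
  have fP: "finite P" using lab(1) by (simp add: P_def)
  have pt: "pt l \<in> E l" if "l \<in> P" for l
    unfolding pt_def by (rule someI_ex) (use that in \<open>auto simp: P_def E_def\<close>)
  have El: "E l \<in> lmeasurable" for l
    by (rule fmeasurableI2[OF A'(2)]) (use lab(2) in \<open>auto simp: E_def\<close>)
  have ptA: "pt l \<in> A" if "l \<in> P" for l using pt[OF that] A'(1) by (auto simp: E_def)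
  have sumind: "(\<Sum>l\<in>P. indicator (E l) y * g l) = (if y \<in> A' then g (lab y) else (0::real))" for y g
  proof -
    have "(\<Sum>l\<in>P. indicator (E l) y * g l) = (\<Sum>l\<in>P. if l = lab y then (if y \<in> A' then g (lab y) else 0) else 0)"
      by (intro sum.cong refl) (auto simp: E_def indicator_def)
    then show ?thesis using fP by (auto simp: P_def)
  qed
  have Ei: "integrable lebesgue (indicat_real (E l))" for l
    by (rule integrable_real_indicator) (use El[of l] in \<open>auto simp: fmeasurable_def\<close>)
  have Ai: "integrable lebesgue (indicat_real A)"
    by (rule integrable_real_indicator) (use A in \<open>auto simp: fmeasurable_def\<close>)
  have int: "(LINT y|lebesgue. (\<Sum>l\<in>P. indicator (E l) y * g l)) = (\<Sum>l\<in>P. measure lebesgue (E l) * g l)" for g :: "int list \<Rightarrow> real"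
    by (subst Bochner_Integration.integral_sum) (auto intro: integrable_mult_left Ei)
  have intgr: "integrable lebesgue (\<lambda>y. \<Sum>l\<in>P. indicator (E l) y * g l)" for g :: "int list \<Rightarrow> real"
    by (intro Bochner_Integration.integrable_sum integrable_mult_left Ei)
  have iA: "integrable lebesgue (\<lambda>y. indicator A y * a)" for a :: real
    by (intro integrable_mult_left Ai)
  have As: "A \<in> sets lebesgue" using A by (simp add: fmeasurableD)
  have fbd: "(cmod (f x))\<^sup>2 \<le> (cmod (f y))\<^sup>2 + 6 * d * sqrt C2 * (L2_norm f)\<^sup>2"
    if f: "f \<in> H" and xy: "x \<in> A'" "y \<in> A'" "lab x = lab y" for f x y
  proof -
    let ?N = "L2_norm f"
    have fx: "cmod (f z) \<le> ?N * sqrt C2" for z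
      using pointwise_bound[OF f, of z] kernel_norm_le[of z] by (meson L2_norm_nonneg mult_left_mono order_trans)
    have "f x - f y = cnj (L2_inner (\<lambda>z. k x z - k y z) f)"
      unfolding inner_diff_left[OF kH kH f] complex_cnj_diff L2_inner_cnj reproducing[OF f, symmetric] ..
    then have "cmod (f x - f y) \<le> 3 * d * ?N"
      using inner_CS[OF H_diff[OF kH kH] f, of x y] mult_right_mono[OF osc[OF xy], of ?N] by simp
    then have 1: "cmod (f x) - cmod (f y) \<le> 3 * d * ?N" using norm_triangle_ineq2[of "f x" "f y"] by linarith
    have "(cmod (f x))\<^sup>2 - (cmod (f y))\<^sup>2 = (cmod (f x) - cmod (f y)) * (cmod (f x) + cmod (f y))"
      by (simp add: power2_eq_square algebra_simps)
    also have "\<dots> \<le> (3 * d * ?N) * (cmod (f x) + cmod (f y))" by (intro mult_right_mono 1) auto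
    also have "\<dots> \<le> (3 * d * ?N) * (?N * sqrt C2 + ?N * sqrt C2)"
      using d by (intro mult_left_mono add_mono fx) auto
    also have "\<dots> = 6 * d * sqrt C2 * ?N\<^sup>2" by (simp add: power2_eq_square)
    finally show ?thesis by simp
  qed
  have kbd: "knorm y \<le> knorm x + 6 * d * sqrt C2" if xy: "x \<in> A'" "y \<in> A'" "lab x = lab y" for x y
  proof -
    have 1: "L2_norm (k y) - L2_norm (k x) \<le> 3 * d"
      using norm_reverse[OF kH kH, of x y] osc[OF xy] by linarith
    have "knorm y - knorm x = (L2_norm (k y) - L2_norm (k x)) * (L2_norm (k y) + L2_norm (k x))"
      by (simp add: knorm_def power2_eq_square algebra_simps)
    also have "\<dots> \<le> (3 * d) * (L2_norm (k y) + L2_norm (k x))" by (intro mult_right_mono 1) auto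
    also have "\<dots> \<le> (3 * d) * (sqrt C2 + sqrt C2)"
      using d by (intro mult_left_mono add_mono kernel_norm_le) auto
    finally show ?thesis by simp
  qed
  have main1: "(\<Sum>l\<in>P. measure lebesgue (E l) * (cmod (f (pt l)))\<^sup>2) \<le>
      (LINT y|lebesgue. indicator A y * (cmod (f y))\<^sup>2) + \<eta> * (L2_norm f)\<^sup>2" if f: "f \<in> H" for f
  proof -
    let ?c = "6 * d * sqrt C2 * (L2_norm f)\<^sup>2"
    have c0: "?c \<ge> 0" using d C2_nonneg by simp
    have if2: "integrable lebesgue (\<lambda>y. indicator A y * (cmod (f y))\<^sup>2)"
      using H_L2[OF f] As integrable_mult_indicator[of A lebesgue "\<lambda>y. (cmod (f y))\<^sup>2"] by (simp add: L2_def)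
    have "(\<Sum>l\<in>P. measure lebesgue (E l) * (cmod (f (pt l)))\<^sup>2) = (LINT y|lebesgue. (\<Sum>l\<in>P. indicator (E l) y * (cmod (f (pt l)))\<^sup>2))"
      by (rule int[symmetric])
    also have "\<dots> \<le> (LINT y|lebesgue. indicator A y * (cmod (f y))\<^sup>2 + indicator A y * ?c)"
    proof (rule integral_mono[OF intgr Bochner_Integration.integrable_add[OF if2 iA]])
      fix y
      show "(\<Sum>l\<in>P. indicator (E l) y * (cmod (f (pt l)))\<^sup>2) \<le> indicator A y * (cmod (f y))\<^sup>2 + indicator A y * ?c"
      proof (cases "y \<in> A'")
        case True
        then have lp: "lab y \<in> P" by (auto simp: P_def)
        have "pt (lab y) \<in> A'" "lab (pt (lab y)) = lab y" using pt[OF lp] by (auto simp: E_def)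
        then show ?thesis unfolding sumind using fbd[OF f, of "pt (lab y)" y] True A'(1) by auto
      next
        case False
        then show ?thesis unfolding sumind using c0 by simp
      qed
    qed
    also have "\<dots> = (LINT y|lebesgue. indicator A y * (cmod (f y))\<^sup>2) + ?V * ?c"
      using A by (subst Bochner_Integration.integral_add[OF if2 iA]) (simp add: fmeasurable_def)
    also have "?V * ?c = d * (6 * sqrt C2 * ?V) * (L2_norm f)\<^sup>2" by simp
    also have "\<dots> \<le> \<eta> * (L2_norm f)\<^sup>2" by (intro mult_right_mono dc) simp
    finally show ?thesis by simp
  qed
  have main2: "(LINT y|lebesgue. indicator A y * knorm y) - \<eta> \<le> (\<Sum>l\<in>P. measure lebesgue (E l) * knorm (pt l))"
  proof -
    have AA: "A - A' \<in> lmeasurable" by (rule fmeasurable.Diff[OF A A'(2)])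
    have i1: "integrable lebesgue (\<lambda>y. indicator A y * knorm y)"
    proof (rule Bochner_Integration.integrable_bound[OF iA[of C2]])
      show "(\<lambda>y. indicator A y * knorm y) \<in> borel_measurable lebesgue" using As by measurable
      show "AE y in lebesgue. norm (indicator A y * knorm y) \<le> norm (indicator A y * C2)"
        using knorm_le knorm_nonneg C2_nonneg by (intro AE_I2) (auto simp: indicator_def)
    qed
    have i2: "integrable lebesgue (\<lambda>y. indicator (A - A') y * C2)"
      by (intro integrable_mult_left integrable_real_indicator) (use AA in \<open>auto simp: fmeasurable_def\<close>)
    have "(LINT y|lebesgue. indicator A y * knorm y) \<le>
      (LINT y|lebesgue. ((\<Sum>l\<in>P. indicator (E l) y * knorm (pt l)) + indicator A y * (6 * d * sqrt C2)) + indicator (A - A') y * C2)"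
    proof (rule integral_mono[OF i1 Bochner_Integration.integrable_add[OF Bochner_Integration.integrable_add[OF intgr iA] i2]])
      fix y
      show "indicator A y * knorm y \<le> ((\<Sum>l\<in>P. indicator (E l) y * knorm (pt l)) + indicator A y * (6 * d * sqrt C2)) + indicator (A - A') y * C2"
      proof (cases "y \<in> A'")
        case True
        then have lp: "lab y \<in> P" by (auto simp: P_def)
        have "pt (lab y) \<in> A'" "lab (pt (lab y)) = lab y" using pt[OF lp] by (auto simp: E_def)
        then show ?thesis unfolding sumind using kbd[of "pt (lab y)" y] True A'(1) by auto
      next
        case False
        then show ?thesis unfolding sumind using knorm_le[of y] d C2_nonneg by (auto simp: indicator_def add_increasing)
      qed
    qed
    also have "\<dots> = (\<Sum>l\<in>P. measure lebesgue (E l) * knorm (pt l)) + ?V * (6 * d * sqrt C2) + measure lebesgue (A - A') * C2"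
      unfolding Bochner_Integration.integral_add[OF Bochner_Integration.integrable_add[OF intgr iA] i2]
        Bochner_Integration.integral_add[OF intgr iA] int
      using A AA by (simp add: fmeasurable_def)
    also have "\<dots> \<le> (\<Sum>l\<in>P. measure lebesgue (E l) * knorm (pt l)) + ?V * (6 * d * sqrt C2) + d * C2"
      using A'(3) C2_nonneg by (intro add_left_mono mult_right_mono) auto
    also have "\<dots> \<le> (\<Sum>l\<in>P. measure lebesgue (E l) * knorm (pt l)) + \<eta>"
      using dc(2) by (simp add: algebra_simps)
    finally show ?thesis by simp
  qed
  have main3: "(\<Sum>l\<in>P. measure lebesgue (E l) * knorm (pt l)) \<le> C2 * ?V"
  proof -
    have "(\<Sum>l\<in>P. measure lebesgue (E l) * knorm (pt l)) = (LINT y|lebesgue. (\<Sum>l\<in>P. indicator (E l) y * knorm (pt l)))"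
      by (rule int[symmetric])
    also have "\<dots> \<le> (LINT y|lebesgue. indicator A y * C2)"
    proof (rule integral_mono[OF intgr iA])
      show "(\<Sum>l\<in>P. indicator (E l) y * knorm (pt l)) \<le> indicator A y * C2" for y
        unfolding sumind using knorm_le C2_nonneg A'(1) by (auto simp: indicator_def)
    qed
    also have "\<dots> = C2 * ?V" using A by (simp add: fmeasurable_def)
    finally show ?thesis .
  qed
  \<comment> \<open>Pieces of measure zero are dropped because the weights have to be positive; the
    sums do not change.\<close>
  define P' where "P' = {l \<in> P. measure lebesgue (E l) > 0}"
  have fP': "finite P'" using fP by (simp add: P'_def)
  have sP: "(\<Sum>l\<in>P'. measure lebesgue (E l) * g l) = (\<Sum>l\<in>P. measure lebesgue (E l) * g l)" for g :: "int list \<Rightarrow> real"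
    by (rule sum.mono_neutral_left) (use fP in \<open>auto simp: P'_def not_less measure_le_0_iff\<close>)
  obtain h where h: "bij_betw h {0..<card P'} P'" using ex_bij_betw_nat_finite[OF fP'] by blast
  have re: "(\<Sum>i<card P'. g (h i)) = sum g P'" for g :: "int list \<Rightarrow> real"
    using sum.reindex_bij_betw[OF h, of g] by (simp add: lessThan_atLeast0)
  have hP: "h i \<in> P'" if "i < card P'" for i using h that by (auto simp: bij_betw_def)
  show ?thesis
  proof (rule that[of "card P'" "\<lambda>i. pt (h i)" "\<lambda>i. measure lebesgue (E (h i))"])
    show "pt (h i) \<in> A \<and> 0 < measure lebesgue (E (h i))" if "i < card P'" for i
      using hP[OF that] ptA by (auto simp: P'_def)
  qed (use main1 main2 main3 in \<open>simp_all add: re[of "\<lambda>l. measure lebesgue (E l) * _ l"] sP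
      re[of "\<lambda>l. measure lebesgue (E l) * knorm (pt l)"] re[of "\<lambda>l. measure lebesgue (E l) * (cmod (_ (pt l)))\<^sup>2"]\<close>)
qed

end

section \<open>One point per cell\<close>

context kernel_space begin

text \<open>Synthesis and analysis are adjoint and so have the same norm: the analysis bound is
  applied to the combination \<open>F\<close> itself. \<open>analysis_bound\<close> is the
  converse.\<close>

lemma synthesis_bound:
  assumes T: "finite T" and g: "\<And>i. i \<in> T \<Longrightarrow> g i \<in> H" and B: "B \<ge> 0"
    and bes: "\<And>f. f \<in> H \<Longrightarrow> (\<Sum>i\<in>T. (cmod (L2_inner f (g i)))\<^sup>2) \<le> B * (L2_norm f)\<^sup>2"
  shows "(L2_norm (\<lambda>x. \<Sum>i\<in>T. c i * g i x))\<^sup>2 \<le> B * norm_sq T c"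
proof -
  define F where "F = (\<lambda>x. \<Sum>i\<in>T. c i * g i x)"
  have FH: "F \<in> H" unfolding F_def by (rule H_sum[OF g])
  let ?N = "(L2_norm F)\<^sup>2"
  have "L2_inner F F = (\<Sum>i\<in>T. cnj (c i) * L2_inner F (g i))"
    by (subst (2) F_def) (rule inner_sum_right[OF g FH])
  then have "complex_of_real ?N = (\<Sum>i\<in>T. cnj (c i) * L2_inner F (g i))" unfolding L2_inner_self .
  then have "?N = cmod (\<Sum>i\<in>T. cnj (c i) * L2_inner F (g i))"
    by (metis abs_of_nonneg norm_of_real zero_le_power2)
  also have "\<dots> \<le> (\<Sum>i\<in>T. cmod (c i) * cmod (L2_inner F (g i)))"
    by (rule order_trans[OF norm_sum]) (simp add: norm_mult)
  finally have "?N\<^sup>2 \<le> (\<Sum>i\<in>T. cmod (c i) * cmod (L2_inner F (g i)))\<^sup>2"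
    by (rule power_mono) simp
  also have "\<dots> \<le> norm_sq T c * (\<Sum>i\<in>T. (cmod (L2_inner F (g i)))\<^sup>2)"
    unfolding norm_sq_def by (rule Cauchy_Schwarz_ineq_sum)
  also have "\<dots> \<le> norm_sq T c * (B * ?N)" by (intro mult_left_mono bes FH) simp
  finally have le: "?N * ?N \<le> (B * norm_sq T c) * ?N" by (simp add: power2_eq_square mult_ac)
  show ?thesis unfolding F_def[symmetric]
  proof (cases "?N = 0")
    case False
    then have "?N > 0" by simp
    then show "?N \<le> B * norm_sq T c" using le by (rule mult_right_le_imp_le[rotated])
  qed (use B in simp)
qed

lemma analysis_bound:
  assumes T: "finite T" and g: "\<And>i. i \<in> T \<Longrightarrow> g i \<in> H" and B: "B \<ge> 0"
    and syn: "\<And>c. (L2_norm (\<lambda>x. \<Sum>i\<in>T. c i * g i x))\<^sup>2 \<le> B * norm_sq T c" and f: "f \<in> H"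
  shows "(\<Sum>i\<in>T. (cmod (L2_inner f (g i)))\<^sup>2) \<le> B * (L2_norm f)\<^sup>2"
proof -
  define c where "c = (\<lambda>i. L2_inner f (g i))"
  define F where "F = (\<lambda>x. \<Sum>i\<in>T. c i * g i x)"
  have FH: "F \<in> H" unfolding F_def by (rule H_sum[OF g])
  have "L2_inner f F = (\<Sum>i\<in>T. cnj (c i) * L2_inner f (g i))"
    unfolding F_def by (rule inner_sum_right[OF g f])
  also have "\<dots> = of_real (norm_sq T c)" by (simp add: norm_sq_def c_def cnj_mult_self)
  finally have "norm_sq T c = cmod (L2_inner f F)" by simp
  also have "\<dots> \<le> L2_norm f * L2_norm F" by (rule inner_CS[OF f FH])
  finally have "(norm_sq T c)\<^sup>2 \<le> (L2_norm f * L2_norm F)\<^sup>2" by (rule power_mono) simp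
  also have "\<dots> = (L2_norm f)\<^sup>2 * (L2_norm F)\<^sup>2" by (rule power_mult_distrib)
  also have "\<dots> \<le> (L2_norm f)\<^sup>2 * (B * norm_sq T c)" unfolding F_def by (intro mult_left_mono syn) simp
  finally have "norm_sq T c * norm_sq T c \<le> (B * (L2_norm f)\<^sup>2) * norm_sq T c" by (simp add: power2_eq_square mult_ac)
  then have "norm_sq T c \<le> B * (L2_norm f)\<^sup>2"
    using B norm_sq_nonneg[of T c] by (cases "norm_sq T c = 0") (auto simp: mult_le_cancel_right)
  then show ?thesis by (simp add: norm_sq_def c_def)
qed

lemma inner_scale_right: "L2_inner f (\<lambda>x. c * g x) = cnj c * L2_inner f g"
  unfolding L2_inner_def by (simp add: mult_ac flip: integral_mult_right_zero)

lemma inner_kernel: "f \<in> H \<Longrightarrow> L2_inner f (\<lambda>y. of_real a * k x y) = of_real a * f x"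
  unfolding inner_scale_right by (simp add: reproducing[symmetric])

end

section \<open>The measure k(y,y) dy and the weighted points\<close>

locale admissible_kernel_space = bounded_kernel_space H k C2
  for H :: "(real ^ 'n \<Rightarrow> complex) set" and k :: "real ^ 'n \<Rightarrow> real ^ 'n \<Rightarrow> complex" and C2 +
  fixes C1 :: real
  assumes C1: "C1 > 0" "\<And>x. C1 \<le> knorm x"
begin

definition mu :: "(real ^ 'n) set \<Rightarrow> real" where
  "mu A = (LINT y|lebesgue. indicator A y * knorm y)"

lemma knorm_pos: "knorm x > 0"
  using C1 by (rule less_le_trans)

lemma C2_pos: "C2 > 0"
  using knorm_pos[of undefined] knorm_le[of undefined] by linarith

lemma mu_integrable:
  assumes "A \<in> lmeasurable"
  shows "integrable lebesgue (\<lambda>y. indicator A y * knorm y)"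
proof (rule Bochner_Integration.integrable_bound)
  show "integrable lebesgue (\<lambda>y. indicator A y * C2)"
    by (intro integrable_mult_left integrable_real_indicator) (use assms in \<open>auto simp: fmeasurable_def\<close>)
  have [measurable]: "A \<in> sets lebesgue" using assms by (simp add: fmeasurableD)
  show "(\<lambda>y. indicator A y * knorm y) \<in> borel_measurable lebesgue" by measurable
  show "AE y in lebesgue. norm (indicator A y * knorm y) \<le> norm (indicator A y * C2)"
    using knorm_le knorm_nonneg C2_nonneg by (intro AE_I2) (auto simp: indicator_def)
qed

lemma mu_bounds:
  assumes "A \<in> lmeasurable"
  shows "C1 * measure lebesgue A \<le> mu A" "mu A \<le> C2 * measure lebesgue A"
proof -
  have i: "integrable lebesgue (\<lambda>y. indicator A y * c)" for c :: real
    by (intro integrable_mult_left integrable_real_indicator) (use assms in \<open>auto simp: fmeasurable_def\<close>)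
  have e: "(LINT y|lebesgue. indicator A y * c) = c * measure lebesgue A" for c :: real
    using assms by (simp add: fmeasurable_def)
  show "C1 * measure lebesgue A \<le> mu A"
    unfolding e[symmetric] mu_def
    by (rule integral_mono[OF i mu_integrable[OF assms]]) (auto simp: indicator_def C1)
  show "mu A \<le> C2 * measure lebesgue A"
    unfolding e[symmetric] mu_def
    by (rule integral_mono[OF mu_integrable[OF assms] i]) (auto simp: indicator_def knorm_le)
qed

text \<open>The candidates of cell \<open>m\<close> have total mass \<open>V m\<close>. Choosing one
  with probability proportional to its share of \<open>V m\<close> rescales each candidate vector to
  squared norm \<open>V m\<close>, so the chosen point takes over the mass of the whole cell. The
  selection needs this mass to be small, which is the role of
  \<open>C2 * v \<le> \<theta>\<^sup>2\<close>.\<close>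

lemma bessel_points:
  fixes c :: "nat \<Rightarrow> (real ^ 'n) set"
  assumes \<theta>: "0 < \<theta>" "\<theta> < 1" and c: "\<And>m. c m \<in> lmeasurable" "\<And>m. measure lebesgue (c m) = v"
    and dis: "disjoint_family c" and v: "v > 0" "C2 * v \<le> \<theta>\<^sup>2"
  obtains x w where "\<And>m. x m \<in> c m" "\<And>m. w m > 0"
    "\<And>m. (1 - \<theta>) * mu (c m) \<le> w m * knorm (x m)"
    "\<And>f M. f \<in> H \<Longrightarrow> (\<Sum>m<M. w m * (cmod (f (x m)))\<^sup>2) \<le> (1 + \<theta>) * (1 + 2 * \<theta>) * (L2_norm f)\<^sup>2"
proof -
  define X where "X = (1 + \<theta>) * (1 + 2 * \<theta>)"
  have X0: "X > 0" using \<theta> by (simp add: X_def)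
  \<comment> \<open>The first bound makes the errors sum to at most \<open>\<theta>\<close> over all
    cells, the second makes each of them at most \<open>\<theta> * mu (c m)\<close>.\<close>
  define \<eta> where "\<eta> = (\<lambda>m. min (\<theta> * (1/2) ^ Suc m) (\<theta> * (C1 * v)))"
  have \<eta>0: "\<eta> m > 0" for m using \<theta> C1 v by (simp add: \<eta>_def)
  have \<eta>sum: "(\<Sum>m<M. \<eta> m) \<le> \<theta>" for M
  proof -
    have "(\<Sum>m<M. \<eta> m) \<le> (\<Sum>m<M. \<theta> * (1/2) ^ Suc m)" by (intro sum_mono) (simp add: \<eta>_def)
    also have "\<dots> = \<theta> * (1 - (1/2) ^ M)" by (induction M) (simp_all add: algebra_simps)
    also have "\<dots> \<le> \<theta> * 1" using \<theta> by (intro mult_left_mono) auto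
    finally show ?thesis by simp
  qed
  define Q where "Q = (\<lambda>m (L::nat) x w. (\<forall>l<L. x l \<in> c m \<and> w l > (0::real)) \<and>
    (\<forall>f\<in>H. (\<Sum>l<L. w l * (cmod (f (x l)))\<^sup>2) \<le> (LINT y|lebesgue. indicator (c m) y * (cmod (f y))\<^sup>2) + \<eta> m * (L2_norm f)\<^sup>2) \<and>
    mu (c m) - \<eta> m \<le> (\<Sum>l<L. w l * knorm (x l)) \<and> (\<Sum>l<L. w l * knorm (x l)) \<le> C2 * v)"
  have "\<exists>L x w. Q m L x w" for m
  proof (rule candidates_cell[OF c(1)[of m] \<eta>0[of m]])
    fix L :: nat and x w
    assume "\<And>l. l < L \<Longrightarrow> x l \<in> c m \<and> w l > (0::real)"
      "\<And>f. f \<in> H \<Longrightarrow> (\<Sum>l<L. w l * (cmod (f (x l)))\<^sup>2) \<le> (LINT y|lebesgue. indicator (c m) y * (cmod (f y))\<^sup>2) + \<eta> m * (L2_norm f)\<^sup>2"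
      "(LINT y|lebesgue. indicator (c m) y * knorm y) - \<eta> m \<le> (\<Sum>l<L. w l * knorm (x l))"
      "(\<Sum>l<L. w l * knorm (x l)) \<le> C2 * measure lebesgue (c m)"
    then have "Q m L x w" unfolding Q_def c(2) mu_def[symmetric] by simp
    then show ?thesis by blast
  qed
  then obtain L xx ww where Q: "\<And>m. Q m (L m) (xx m) (ww m)" by metis
  have cand: "xx m l \<in> c m \<and> ww m l > 0" if "l < L m" for m l
    using Q[of m] that unfolding Q_def by blast
  have bes: "(\<Sum>l<L m. ww m l * (cmod (f (xx m l)))\<^sup>2) \<le> (LINT y|lebesgue. indicator (c m) y * (cmod (f y))\<^sup>2) + \<eta> m * (L2_norm f)\<^sup>2"
    if "f \<in> H" for m f
    using Q[of m] that unfolding Q_def by blast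
  have Vlow: "mu (c m) - \<eta> m \<le> (\<Sum>l<L m. ww m l * knorm (xx m l))"
    and Vup: "(\<Sum>l<L m. ww m l * knorm (xx m l)) \<le> C2 * v" for m
    using Q[of m] unfolding Q_def by blast+
  define V where "V = (\<lambda>m. \<Sum>l<L m. ww m l * knorm (xx m l))"
  have Vl: "(1 - \<theta>) * mu (c m) \<le> V m" for m
  proof -
    have "C1 * v \<le> mu (c m)" using mu_bounds(1)[OF c(1)] unfolding c(2) .
    then have "\<theta> * (C1 * v) \<le> \<theta> * mu (c m)" using \<theta> by (intro mult_left_mono) auto
    moreover have "\<eta> m \<le> \<theta> * (C1 * v)" by (simp add: \<eta>_def)
    ultimately show ?thesis using Vlow[of m] by (simp add: V_def algebra_simps)
  qed
  have mupos: "mu (c m) > 0" for m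
    using mu_bounds(1)[OF c(1), of m] C1 v unfolding c(2) by (meson less_le_trans mult_pos_pos)
  have V0: "V m > 0" for m
  proof -
    have "0 < (1 - \<theta>) * mu (c m)" using \<theta> mupos[of m] by (intro mult_pos_pos) auto
    then show ?thesis using Vl[of m] by linarith
  qed
  have L0: "L m > 0" for m using V0[of m] by (cases "L m") (auto simp: V_def)
  define h where "h = (\<lambda>f m y. of_real (sqrt (V m / knorm (xx m (f m)))) * k (xx m (f m)) y)"
  have hH: "h f m \<in> H" for f m unfolding h_def by (intro H_scale kH)
  define P where "P = (\<lambda>M f. \<forall>a. (L2_norm (\<lambda>y. \<Sum>m<M. a m * h f m y))\<^sup>2 \<le> X * norm_sq {..<M} a)"
  have exP: "\<exists>f. (\<forall>m. f m \<in> {..<L m}) \<and> P M f" for M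
  proof -
    \<comment> \<open>\<open>upper_selection\<close> works on an initial segment of the naturals, so
      pairs of a cell and a candidate are encoded; numbers outside \<open>T\<close> carry weight
      0.\<close>
    define enc where "enc = (\<lambda>m l. prod_encode (m, l))"
    define b where "b = (\<lambda>m. enc m ` {..<L m})"
    define T where "T = (\<Union>m<M. b m)"
    have fT: "finite T" by (simp add: T_def b_def)
    have enc_inj: "enc m l = enc m' l' \<longleftrightarrow> m = m' \<and> l = l'" for m l m' l' by (simp add: enc_def)
    obtain n where n: "T \<subseteq> {..<n}" using finite_nat_bounded[OF fT] by blast
    define mm where "mm = (\<lambda>i. fst (prod_decode i))"
    define ll where "ll = (\<lambda>i. snd (prod_decode i))"
    have me: "mm (enc m l) = m" "ll (enc m l) = l" for m l by (simp_all add: mm_def ll_def enc_def)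
    define W where "W = (\<lambda>i. if i \<in> T then ww (mm i) (ll i) else 0)"
    define xi where "xi = (\<lambda>i. xx (mm i) (ll i))"
    have Ti: "mm i < M \<and> ll i < L (mm i)" if "i \<in> T" for i
      using that by (auto simp: T_def b_def me)
    have W0: "W i \<ge> 0" for i using cand[of "ll i" "mm i"] Ti[of i] by (auto simp: W_def less_imp_le)
    have Wp: "W i > 0" if "i \<in> T" for i using cand[of "ll i" "mm i"] Ti[OF that] that by (auto simp: W_def)
    define g where "g = (\<lambda>i y. of_real (sqrt (W i)) * k (xi i) y)"
    have gH: "g i \<in> H" for i unfolding g_def by (intro H_scale kH)
    define G where "G = (\<lambda>i j. L2_inner (g j) (g i))"
    have psdG: "pos_semidef {..<n} G" unfolding G_def by (rule gram_pos_semidef) (auto intro: gH)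
    have fg: "(cmod (L2_inner f (g i)))\<^sup>2 = W i * (cmod (f (xi i)))\<^sup>2" if "f \<in> H" for f i
      unfolding g_def inner_kernel[OF that] using W0[of i] by (simp add: norm_mult power_mult_distrib)
    have sumT: "sum F T = (\<Sum>m<M. \<Sum>l<L m. F (enc m l))" for F :: "nat \<Rightarrow> real"
    proof -
      have "sum F T = (\<Sum>m<M. sum F (b m))"
        unfolding T_def by (rule sum.UNION_disjoint) (auto simp: b_def enc_inj)
      also have "\<dots> = (\<Sum>m<M. \<Sum>l<L m. F (enc m l))"
        unfolding b_def by (intro sum.cong refl sum.reindex_cong[of "enc _"]) (auto simp: inj_on_def enc_inj)
      finally show ?thesis .
    qed
    have encT: "enc m l \<in> T" if "m < M" "l < L m" for m l using that by (auto simp: T_def b_def)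
    have LG: "quad_form G {..<n} a \<le> (1 + \<theta>) * norm_sq {..<n} a" for a
      unfolding G_def gram_norm[OF finite_lessThan gH]
    proof (rule synthesis_bound[OF finite_lessThan gH])
      fix f assume f: "f \<in> H"
      have "(\<Sum>i<n. (cmod (L2_inner f (g i)))\<^sup>2) = (\<Sum>i<n. W i * (cmod (f (xi i)))\<^sup>2)"
        unfolding fg[OF f] ..
      also have "\<dots> = (\<Sum>i\<in>T. W i * (cmod (f (xi i)))\<^sup>2)"
        using n by (intro sum.mono_neutral_right) (auto simp: W_def)
      also have "\<dots> = (\<Sum>m<M. \<Sum>l<L m. ww m l * (cmod (f (xx m l)))\<^sup>2)"
        unfolding sumT by (intro sum.cong refl) (auto simp: W_def xi_def me encT)
      also have "\<dots> \<le> (\<Sum>m<M. (LINT y|lebesgue. indicator (c m) y * (cmod (f y))\<^sup>2) + \<eta> m * (L2_norm f)\<^sup>2)"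
        by (intro sum_mono bes f)
      also have "\<dots> = (\<Sum>m<M. (LINT y|lebesgue. indicator (c m) y * (cmod (f y))\<^sup>2)) + (\<Sum>m<M. \<eta> m) * (L2_norm f)\<^sup>2"
        by (simp add: sum.distrib sum_distrib_right)
      also have "\<dots> \<le> (L2_norm f)\<^sup>2 + \<theta> * (L2_norm f)\<^sup>2"
      proof (intro add_mono mult_right_mono \<eta>sum)
        have fi: "integrable lebesgue (\<lambda>y. (cmod (f y))\<^sup>2)" using H_L2[OF f] by (simp add: L2_def)
        have ci: "integrable lebesgue (\<lambda>y. indicator (c m) y * (cmod (f y))\<^sup>2)" for m
          using integrable_mult_indicator[OF fmeasurableD[OF c(1)] fi, of m] by simp
        have "(\<Sum>m<M. (LINT y|lebesgue. indicator (c m) y * (cmod (f y))\<^sup>2)) = (LINT y|lebesgue. (\<Sum>m<M. indicator (c m) y * (cmod (f y))\<^sup>2))"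
          by (rule Bochner_Integration.integral_sum[symmetric]) (rule ci)
        also have "\<dots> \<le> (LINT y|lebesgue. (cmod (f y))\<^sup>2)"
        proof (rule integral_mono[OF _ fi])
          show "integrable lebesgue (\<lambda>y. \<Sum>m<M. indicator (c m) y * (cmod (f y))\<^sup>2)"
            by (intro Bochner_Integration.integrable_sum ci)
          fix y
          have "(\<Sum>m<M. indicator (c m) y) \<le> (1::real)"
          proof -
            have "(\<Sum>m<M. indicator (c m) y) = (indicator (\<Union>m<M. c m) y :: real)"
              using dis by (intro indicator_UN_disjoint[symmetric] finite_lessThan disjoint_family_on_mono[of "{..<M}" UNIV c]) auto
            then show ?thesis by (simp add: indicator_def)
          qed
          then have "(\<Sum>m<M. indicator (c m) y) * (cmod (f y))\<^sup>2 \<le> 1 * (cmod (f y))\<^sup>2"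
            by (rule mult_right_mono) simp
          then show "(\<Sum>m<M. indicator (c m) y * (cmod (f y))\<^sup>2) \<le> (cmod (f y))\<^sup>2"
            by (simp add: sum_distrib_right)
        qed
        finally show "(\<Sum>m<M. (LINT y|lebesgue. indicator (c m) y * (cmod (f y))\<^sup>2)) \<le> (L2_norm f)\<^sup>2"
          by (simp add: L2_norm_sq)
      qed simp
      finally show "(\<Sum>i<n. (cmod (L2_inner f (g i)))\<^sup>2) \<le> (1 + \<theta>) * (L2_norm f)\<^sup>2" by (simp add: algebra_simps)
    qed (use \<theta> in simp)
    define p where "p = (\<lambda>i. W i * knorm (xi i) / V (mm i))"
    have binj: "b m = b m' \<longleftrightarrow> m = m'" for m m'
      using L0[of m] unfolding b_def by (force simp: enc_inj)
    have bsum: "(\<Sum>i\<in>b m. F i) = (\<Sum>l<L m. F (enc m l))" for F :: "nat \<Rightarrow> real" and m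
      unfolding b_def by (subst sum.reindex) (auto simp: inj_on_def enc_inj)
    have Gii: "Re (G i i) = W i * knorm (xi i)" for i
    proof -
      have "G i i = of_real ((L2_norm (g i))\<^sup>2)" unfolding G_def by (rule L2_inner_self)
      then have "Re (G i i) = (L2_norm (g i))\<^sup>2" by (simp del: of_real_power)
      then show ?thesis unfolding g_def norm_scale using W0[of i] by (simp add: power_mult_distrib knorm_def)
    qed
    have "\<exists>sel. (\<forall>b\<in>b ` {..<M}. sel b \<in> b) \<and>
      (\<forall>a. quad_form (\<lambda>i j. G i j / of_real (sqrt (p i) * sqrt (p j))) (sel ` b ` {..<M}) a \<le> X * norm_sq (sel ` b ` {..<M}) a)"
    \<comment> \<open>The candidates have Bessel bound \<open>1 + \<theta>\<close>. With
      \<open>\<tau> = 1 + \<theta>\<close> one gets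
      \<open>X - \<tau> * (1 + \<theta>) = \<theta> * (1 + \<theta>)\<close>, and the condition on
      the block traces becomes \<open>C2 * v \<le> \<theta>\<^sup>2\<close>.\<close>
    proof (rule upper_selection[OF psdG LG, where \<tau> = "1 + \<theta>" and \<kappa> = "C2 * v"])
      show "disjoint (b ` {..<M})" by (auto simp: disjoint_def b_def enc_inj)
      show "\<Union> (b ` {..<M}) \<subseteq> {..<n}" using n by (simp add: T_def)
      show "sum p B = 1" if "B \<in> b ` {..<M}" for B
      proof -
        from that obtain m where m: "m < M" "B = b m" by auto
        have "sum p B = (\<Sum>l<L m. ww m l * knorm (xx m l) / V m)"
          unfolding m(2) bsum using m(1) by (intro sum.cong refl) (auto simp: p_def W_def xi_def me encT)
        also have "\<dots> = V m / V m" by (subst sum_divide_distrib[symmetric]) (simp only: V_def)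
        finally show ?thesis using V0[of m] by simp
      qed
      show "p i > 0" if "i \<in> \<Union> (b ` {..<M})" for i
        unfolding p_def using that by (intro divide_pos_pos mult_pos_pos Wp knorm_pos V0) (simp add: T_def)
      show "(\<Sum>i\<in>B. Re (G i i)) \<le> C2 * v" if "B \<in> b ` {..<M}" for B
      proof -
        from that obtain m where m: "m < M" "B = b m" by auto
        have "(\<Sum>i\<in>B. Re (G i i)) = (\<Sum>l<L m. ww m l * knorm (xx m l))"
          unfolding m(2) bsum Gii using m(1) by (intro sum.cong refl) (auto simp: W_def xi_def me encT)
        then show ?thesis using Vup[of m] by simp
      qed
      show "(1 + \<theta>) * (1 + \<theta>) < X" unfolding X_def using \<theta> by (intro mult_strict_left_mono) auto
      have "(1 + \<theta>) * (C2 * v) \<le> (1 + \<theta>) * \<theta>\<^sup>2" using \<theta> v by (intro mult_left_mono) auto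
      also have "\<dots> = (1 + \<theta> - 1) * (X - (1 + \<theta>) * (1 + \<theta>))" by (simp add: X_def power2_eq_square algebra_simps)
      finally show "(1 + \<theta>) * (C2 * v) \<le> (1 + \<theta> - 1) * (X - (1 + \<theta>) * (1 + \<theta>))" .
    qed (use \<theta> X0 in auto)
    then obtain sel where sel: "\<And>m. m < M \<Longrightarrow> sel (b m) \<in> b m"
      and qs: "\<And>a. quad_form (\<lambda>i j. G i j / of_real (sqrt (p i) * sqrt (p j))) (sel ` b ` {..<M}) a \<le> X * norm_sq (sel ` b ` {..<M}) a"
      by auto
    define s where "s = (\<lambda>m. sel (b m))"
    define f where "f = (\<lambda>m. if m < M then ll (s m) else 0)"
    have sb: "s m = enc m (f m) \<and> f m < L m" if "m < M" for m
      using sel[OF that] that by (auto simp: s_def f_def b_def me)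
    have sT: "s m \<in> T" if "m < M" for m using sb[OF that] encT that by simp
    have sinj: "inj_on s {..<M}" using sb by (intro inj_onI) (metis enc_inj lessThan_iff)
    have sim: "sel ` b ` {..<M} = s ` {..<M}" by (auto simp: s_def)
    have gh: "of_real (1 / sqrt (p (s m))) * g (s m) y = h f m y" if "m < M" for m y
    proof -
      have e: "W (s m) = ww m (f m)" "xi (s m) = xx m (f m)" "mm (s m) = m"
        using sb[OF that] sT[OF that] by (simp_all add: W_def xi_def me)
      have w0: "ww m (f m) > 0" using cand sb[OF that] by blast
      have "1 / sqrt (p (s m)) * sqrt (W (s m)) = sqrt (V m / knorm (xx m (f m)))"
        unfolding p_def e using w0 V0[of m] knorm_pos[of "xx m (f m)"]
        by (simp add: real_sqrt_divide real_sqrt_mult)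
      then have "complex_of_real (1 / sqrt (p (s m))) * of_real (sqrt (W (s m))) = of_real (sqrt (V m / knorm (xx m (f m))))"
        by (simp only: of_real_mult[symmetric])
      then show ?thesis unfolding g_def h_def e by (simp only: mult.assoc[symmetric])
    qed
    have "(L2_norm (\<lambda>y. \<Sum>m<M. a m * h f m y))\<^sup>2 \<le> X * norm_sq {..<M} a" for a
    proof -
      define a' where "a' = (\<lambda>i. a (mm i))"
      have as: "a' (s m) = a m" if "m < M" for m using sb[OF that] by (simp add: a'_def me)
      define g' where "g' = (\<lambda>i y. of_real (1 / sqrt (p i)) * g i y)"
      have g'H: "g' i \<in> H" for i unfolding g'_def by (intro H_scale gH)
      have Gg: "G i j / of_real (sqrt (p i) * sqrt (p j)) = L2_inner (g' j) (g' i)" for i j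
      proof -
        have "L2_inner (g' j) (g' i) = of_real (1 / sqrt (p j)) * (cnj (of_real (1 / sqrt (p i))) * L2_inner (g j) (g i))"
          unfolding g'_def L2_inner_scale_left inner_scale_right ..
        then show ?thesis by (simp add: G_def)
      qed
      have "(L2_norm (\<lambda>y. \<Sum>i\<in>s ` {..<M}. a' i * g' i y))\<^sup>2 \<le> X * norm_sq (s ` {..<M}) a'"
        using qs[of a'] unfolding sim Gg gram_norm[OF finite_imageI[OF finite_lessThan] g'H] .
      moreover have "(\<Sum>i\<in>s ` {..<M}. a' i * g' i y) = (\<Sum>m<M. a m * h f m y)" for y
        unfolding sum.reindex[OF sinj] comp_def g'_def by (intro sum.cong refl) (simp only: lessThan_iff gh as)
      moreover have "norm_sq (s ` {..<M}) a' = norm_sq {..<M} a"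
        unfolding norm_sq_def by (subst sum.reindex[OF sinj]) (auto simp: as)
      ultimately show ?thesis by simp
    qed
    moreover have "f m \<in> {..<L m}" for m using sb[of m] L0[of m] by (cases "m < M") (auto simp: f_def)
    ultimately show ?thesis unfolding P_def by blast
  qed
  \<comment> \<open>The constant \<open>X\<close> is the same for every number \<open>M\<close> of
    cells, so the finite selections have a common limit.\<close>
  have "\<exists>f. (\<forall>m. f m \<in> {..<L m}) \<and> (\<forall>N. P N f)"
  proof (rule compactness_choice)
    show "P N g" if "\<And>m. m < N \<Longrightarrow> f m = g m" "P N f" for N f g
    proof -
      have "h f m = h g m" if "m < N" for m using \<open>\<And>m. m < N \<Longrightarrow> f m = g m\<close>[OF that] by (simp add: h_def)
      then have "(\<Sum>m<N. a m * h g m y) = (\<Sum>m<N. a m * h f m y)" for a y by (intro sum.cong) auto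
      then show ?thesis using that(2) by (simp add: P_def)
    qed
    show "P N f" if "P (Suc N) f" for N f
      unfolding P_def
    proof
      fix a
      have "(L2_norm (\<lambda>y. \<Sum>m<Suc N. (a(N := 0)) m * h f m y))\<^sup>2 \<le> X * norm_sq {..<Suc N} (a(N := 0))"
        using that unfolding P_def by blast
      then show "(L2_norm (\<lambda>y. \<Sum>m<N. a m * h f m y))\<^sup>2 \<le> X * norm_sq {..<N} a" by (simp add: norm_sq_def)
    qed
  qed (use exP in auto)
  then obtain f where f: "\<And>m. f m < L m" "\<And>N. P N f" by auto
  show ?thesis
  proof (rule that[of "\<lambda>m. xx m (f m)" "\<lambda>m. V m / knorm (xx m (f m))"])
    show "xx m (f m) \<in> c m" for m using cand f(1) by blast
    show "V m / knorm (xx m (f m)) > 0" for m using V0 knorm_pos by simp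
    show "(1 - \<theta>) * mu (c m) \<le> V m / knorm (xx m (f m)) * knorm (xx m (f m))" for m
      using Vl[of m] knorm_pos[of "xx m (f m)"] by simp
    fix u M assume u: "u \<in> H"
    have "(\<Sum>m<M. (cmod (L2_inner u (h f m)))\<^sup>2) \<le> X * (L2_norm u)\<^sup>2"
      by (rule analysis_bound[OF finite_lessThan hH]) (use f(2) X0 u in \<open>auto simp: P_def\<close>)
    moreover have "(cmod (L2_inner u (h f m)))\<^sup>2 = V m / knorm (xx m (f m)) * (cmod (u (xx m (f m))))\<^sup>2" for m
      unfolding h_def inner_kernel[OF u] using V0[of m] knorm_pos[of "xx m (f m)"]
      by (simp add: norm_mult power_mult_distrib)
    ultimately show "(\<Sum>m<M. V m / knorm (xx m (f m)) * (cmod (u (xx m (f m))))\<^sup>2) \<le> (1 + \<theta>) * (1 + 2 * \<theta>) * (L2_norm u)\<^sup>2"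
      by (simp add: X_def)
  qed
qed

end

section \<open>Riesz subfamilies\<close>

lemma pos_semidefD:
  assumes "pos_semidef T G" shows "finite T" "hermitian T G" "quad_form G T v \<ge> 0"
  using assms unfolding pos_semidef_def hermitian_def by blast+

lemma mat_vec_restrict:
  assumes "finite T" "S \<subseteq> T" "\<And>i. i \<in> T - S \<Longrightarrow> v i = 0"
  shows "mat_vec G T v i = mat_vec G S v i"
  unfolding mat_vec_def using assms by (intro sum.mono_neutral_right) auto

lemma sum_CS_complex:
  "(cmod (\<Sum>i\<in>S. u i * v i))\<^sup>2 \<le> norm_sq S u * norm_sq S v"
proof -
  have "cmod (\<Sum>i\<in>S. u i * v i) \<le> (\<Sum>i\<in>S. cmod (u i) * cmod (v i))"
    by (rule order_trans[OF norm_sum]) (simp add: norm_mult)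
  then have "(cmod (\<Sum>i\<in>S. u i * v i))\<^sup>2 \<le> (\<Sum>i\<in>S. cmod (u i) * cmod (v i))\<^sup>2"
    by (rule power_mono) simp
  also have "\<dots> \<le> norm_sq S u * norm_sq S v" unfolding norm_sq_def by (rule Cauchy_Schwarz_ineq_sum)
  finally show ?thesis .
qed

text \<open>\<open>d i\<close> is column \<open>i\<close> of the inverse of \<open>G + a\<close>,
  and that inverse has norm at most \<open>1 / a\<close>. Concretely, \<open>q\<close> solves
  \<open>(G + a) q = cnj \<eta>\<close> for the output \<open>\<eta>\<close>, so \<open>a\<close>
  times the norm of \<open>q\<close> is at most that of \<open>\<eta>\<close>; and the squared norm
  of \<open>\<eta>\<close> is the pairing of \<open>e\<close> with \<open>q\<close>.\<close>

lemma inverse_row_bound: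
  assumes G: "pos_semidef S G" and a: "a > 0"
    and d: "\<And>i j. i \<in> S \<Longrightarrow> j \<in> S \<Longrightarrow> mat_vec G S (d i) j + of_real a * d i j = (if j = i then 1 else 0)"
  shows "(\<Sum>i\<in>S. (cmod (\<Sum>l\<in>S. e l * d i l))\<^sup>2) \<le> norm_sq S e / a\<^sup>2"
proof -
  have fS: "finite S" and h: "hermitian S G" and pos: "\<And>v. quad_form G S v \<ge> 0" by (rule pos_semidefD[OF G])+
  define \<eta> where "\<eta> = (\<lambda>i. \<Sum>l\<in>S. e l * d i l)"
  define q where "q = (\<lambda>l. \<Sum>i\<in>S. cnj (\<eta> i) * d i l)"
  have Mq: "mat_vec G S q j + of_real a * q j = cnj (\<eta> j)" if j: "j \<in> S" for j
  proof -
    have "mat_vec G S q j = (\<Sum>l\<in>S. \<Sum>i\<in>S. G j l * (cnj (\<eta> i) * d i l))"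
      unfolding mat_vec_def q_def sum_distrib_left ..
    also have "\<dots> = (\<Sum>i\<in>S. \<Sum>l\<in>S. G j l * (cnj (\<eta> i) * d i l))" by (rule sum.swap)
    also have "\<dots> = (\<Sum>i\<in>S. cnj (\<eta> i) * mat_vec G S (d i) j)"
      unfolding mat_vec_def sum_distrib_left by (intro sum.cong refl) (simp add: mult_ac)
    finally have "mat_vec G S q j + of_real a * q j = (\<Sum>i\<in>S. cnj (\<eta> i) * (mat_vec G S (d i) j + of_real a * d i j))"
      by (simp add: q_def sum_distrib_left sum.distrib distrib_left mult_ac)
    also have "\<dots> = (\<Sum>i\<in>S. if i = j then cnj (\<eta> j) else 0)"
      using d j by (intro sum.cong refl) auto
    finally show ?thesis using j fS by simp
  qed
  have "of_real (a * norm_sq S q) + sesq_form G S q q = (\<Sum>j\<in>S. cnj (q j) * (mat_vec G S q j + of_real a * q j))"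
    by (simp add: sesq_form_def norm_sq_def distrib_left sum.distrib sum_distrib_left mult_ac cnj_mult_self(2)[simplified])
  also have "\<dots> = (\<Sum>j\<in>S. cnj (q j) * cnj (\<eta> j))" using Mq by (intro sum.cong) auto
  finally have "of_real (a * norm_sq S q) + sesq_form G S q q = (\<Sum>j\<in>S. cnj (q j) * cnj (\<eta> j))" .
  then have "of_real (a * norm_sq S q + quad_form G S q) = (\<Sum>j\<in>S. cnj (q j) * cnj (\<eta> j))"
    unfolding sesq_form_self[OF h] by simp
  then have "a * norm_sq S q + quad_form G S q = cmod (\<Sum>j\<in>S. cnj (q j) * cnj (\<eta> j))"
    using a pos[of q] by (metis abs_of_nonneg add_nonneg_nonneg less_imp_le mult_nonneg_nonneg norm_sq_nonneg norm_of_real)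
  then have "a * norm_sq S q \<le> cmod (\<Sum>j\<in>S. cnj (q j) * cnj (\<eta> j))" using pos[of q] by linarith
  then have "(a * norm_sq S q)\<^sup>2 \<le> (cmod (\<Sum>j\<in>S. cnj (q j) * cnj (\<eta> j)))\<^sup>2"
    using a by (intro power_mono) auto
  also have "\<dots> \<le> norm_sq S (\<lambda>j. cnj (q j)) * norm_sq S (\<lambda>j. cnj (\<eta> j))" by (rule sum_CS_complex)
  also have "\<dots> = norm_sq S q * norm_sq S \<eta>" by (simp add: norm_sq_def)
  finally have "norm_sq S q * (a\<^sup>2 * norm_sq S q) \<le> norm_sq S q * norm_sq S \<eta>" by (simp add: power2_eq_square mult_ac)
  then have qn: "a\<^sup>2 * norm_sq S q \<le> norm_sq S \<eta>"
    using norm_sq_nonneg[of S q] by (cases "norm_sq S q = 0") (auto simp: mult_le_cancel_left)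
  have "of_real (norm_sq S \<eta>) = (\<Sum>i\<in>S. cnj (\<eta> i) * (\<Sum>l\<in>S. e l * d i l))"
    by (simp only: norm_sq_def of_real_sum cnj_mult_self(1)[symmetric]) (simp add: \<eta>_def)
  also have "\<dots> = (\<Sum>i\<in>S. \<Sum>l\<in>S. e l * (cnj (\<eta> i) * d i l))" by (simp add: sum_distrib_left mult_ac)
  also have "\<dots> = (\<Sum>l\<in>S. \<Sum>i\<in>S. e l * (cnj (\<eta> i) * d i l))" by (rule sum.swap)
  also have "\<dots> = (\<Sum>l\<in>S. e l * q l)" by (simp add: q_def sum_distrib_left)
  finally have "norm_sq S \<eta> = cmod (\<Sum>l\<in>S. e l * q l)" by (metis abs_of_nonneg norm_sq_nonneg norm_of_real)
  then have "(norm_sq S \<eta>)\<^sup>2 \<le> norm_sq S e * norm_sq S q" using sum_CS_complex[of e q S] by simp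
  then have "a\<^sup>2 * (norm_sq S \<eta>)\<^sup>2 \<le> a\<^sup>2 * (norm_sq S e * norm_sq S q)" by (rule mult_left_mono) simp
  also have "\<dots> = norm_sq S e * (a\<^sup>2 * norm_sq S q)" by simp
  also have "\<dots> \<le> norm_sq S e * norm_sq S \<eta>" by (intro mult_left_mono qn) simp
  finally have "norm_sq S \<eta> * (a\<^sup>2 * norm_sq S \<eta>) \<le> norm_sq S \<eta> * norm_sq S e" by (simp add: power2_eq_square mult_ac)
  then have "a\<^sup>2 * norm_sq S \<eta> \<le> norm_sq S e"
    using norm_sq_nonneg[of S \<eta>] by (cases "norm_sq S \<eta> = 0") (auto simp: mult_le_cancel_left)
  then have "norm_sq S \<eta> \<le> norm_sq S e / a\<^sup>2" using a by (simp add: field_simps)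
  then show ?thesis by (simp add: norm_sq_def \<eta>_def)
qed

text \<open>\<open>d\<close> is a dual vector: in the form of \<open>M = G + a\<close>, pairing
  \<open>c\<close> with \<open>d\<close> returns the conjugate of \<open>c i\<close> up to a term
  \<open>r\<close> from outside \<open>S\<close>. The form of \<open>d\<close> is
  \<open>Re (d i) \<le> 1 / e\<close>. The term \<open>r\<close> is controlled by
  \<open>\<tau>\<close> and the norm of \<open>c\<close>, and comparing that norm with the form
  costs \<open>1 / a\<close>; the factors 2 come from squaring a sum of two terms.\<close>

lemma coordinate_bound:
  assumes T: "pos_semidef T G" and a: "a > 0" and S: "S \<subseteq> T" and i: "i \<in> S" and e: "e > 0"
    and d0: "\<And>l. l \<notin> S \<Longrightarrow> d l = 0"
    and d: "\<And>j. j \<in> S \<Longrightarrow> mat_vec G S d j + of_real a * d j = (if j = i then 1 else 0)" and di: "Re (d i) \<le> 1 / e"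
    and out: "(\<Sum>m\<in>T - S. (cmod (mat_vec G S d m))\<^sup>2) \<le> \<tau>"
  shows "(cmod (c i))\<^sup>2 \<le> (2 / e + 2 * \<tau> / a) * (quad_form G T c + a * norm_sq T c)"
proof -
  have fT: "finite T" and h: "hermitian T G" and pos: "\<And>v. quad_form G T v \<ge> 0" by (rule pos_semidefD[OF T])+
  have fS: "finite S" using S fT finite_subset by blast
  define M where "M = (\<lambda>i j. G i j + (if i = j then complex_of_real a else 0))"
  have qM: "quad_form M T v = quad_form G T v + a * norm_sq T v" for v
    unfolding M_def using fT by (subst quad_form_diag) (simp_all add: norm_sq_def sum_distrib_left)
  have hM: "hermitian T M" unfolding M_def by (rule hermitian_diag[OF h])
  have pM: "pos_semidef T M" unfolding pos_semidef_def using hM pos a by (simp add: qM)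
  have mvd: "mat_vec G T d j = mat_vec G S d j" for j by (rule mat_vec_restrict[OF fT S]) (use d0 in auto)
  have Md: "mat_vec M T d j = (if j = i then 1 else 0)" if "j \<in> S" for j
    using that S d[OF that] unfolding M_def by (subst mat_vec_diag'[OF fT]) (auto simp: mvd)
  have Md': "mat_vec M T d j = mat_vec G S d j" if "j \<in> T - S" for j
    using that d0 unfolding M_def by (subst mat_vec_diag'[OF fT]) (auto simp: mvd)
  have split: "sesq_form M T v d = cnj (v i) + (\<Sum>j\<in>T - S. cnj (v j) * mat_vec G S d j)" for v
  proof -
    have "sesq_form M T v d = (\<Sum>j\<in>S. cnj (v j) * mat_vec M T d j) + (\<Sum>j\<in>T - S. cnj (v j) * mat_vec M T d j)"
      unfolding sesq_form_def using sum.subset_diff[OF S fT] by (simp add: add.commute)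
    also have "(\<Sum>j\<in>S. cnj (v j) * mat_vec M T d j) = (\<Sum>j\<in>S. if j = i then cnj (v i) else 0)"
      by (intro sum.cong refl) (auto simp: Md)
    also have "(\<Sum>j\<in>T - S. cnj (v j) * mat_vec M T d j) = (\<Sum>j\<in>T - S. cnj (v j) * mat_vec G S d j)"
      by (intro sum.cong refl) (simp only: Md')
    finally show ?thesis using i fS by simp
  qed
  have "sesq_form M T d d = cnj (d i)" unfolding split[of d] using d0 by simp
  then have qd: "quad_form M T d \<le> 1 / e" using di by (simp add: quad_form_def)
  let ?Q = "quad_form M T c"
  have Q0: "?Q \<ge> 0" using pM by (simp add: pos_semidef_def)
  have "(cmod (sesq_form M T c d))\<^sup>2 \<le> ?Q * quad_form M T d" by (rule sesq_form_CS[OF pM])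
  also have "\<dots> \<le> ?Q * (1 / e)" by (intro mult_left_mono qd Q0)
  finally have 1: "(cmod (sesq_form M T c d))\<^sup>2 \<le> ?Q / e" by simp
  define r where "r = (\<Sum>j\<in>T - S. cnj (c j) * mat_vec G S d j)"
  have "(cmod r)\<^sup>2 \<le> norm_sq (T - S) (\<lambda>j. cnj (c j)) * norm_sq (T - S) (mat_vec G S d)"
    unfolding r_def by (rule sum_CS_complex)
  also have "\<dots> \<le> norm_sq T c * \<tau>"
  proof (rule mult_mono)
    show "norm_sq (T - S) (\<lambda>j. cnj (c j)) \<le> norm_sq T c" unfolding norm_sq_def using fT by (simp, intro sum_mono2) auto
    show "norm_sq (T - S) (mat_vec G S d) \<le> \<tau>" unfolding norm_sq_def by (rule out)
  qed auto
  also have "\<dots> \<le> ?Q / a * \<tau>"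
  proof (rule mult_right_mono)
    show "norm_sq T c \<le> ?Q / a" using a pos[of c] by (simp add: qM field_simps)
    show "\<tau> \<ge> 0" using out by (rule order_trans[rotated]) (simp add: sum_nonneg)
  qed
  finally have 2: "(cmod r)\<^sup>2 \<le> ?Q / a * \<tau>" .
  have "cnj (c i) = sesq_form M T c d - r" unfolding split r_def by simp
  then have "cmod (c i) \<le> cmod (sesq_form M T c d) + cmod r"
    by (metis complex_mod_cnj norm_triangle_ineq4)
  then have "(cmod (c i))\<^sup>2 \<le> (cmod (sesq_form M T c d) + cmod r)\<^sup>2" by (rule power_mono) simp
  also have "\<dots> \<le> 2 * (cmod (sesq_form M T c d))\<^sup>2 + 2 * (cmod r)\<^sup>2"
    using sum_squares_bound[of "cmod (sesq_form M T c d)" "cmod r"] by (simp add: power2_sum)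
  also have "\<dots> \<le> 2 * (?Q / e) + 2 * (?Q / a * \<tau>)" using 1 2 by simp
  also have "\<dots> = (2 / e + 2 * \<tau> / a) * ?Q" by (simp add: algebra_simps)
  finally show ?thesis by (simp add: qM)
qed

lemma equal_blocks:
  assumes "finite A" "q * K \<le> card A" "K > 0"
  shows "\<exists>B. finite B \<and> disjoint B \<and> \<Union>B \<subseteq> A \<and> (\<forall>b\<in>B. card b = K \<and> finite b) \<and> card B = q"
  using assms(1,2)
proof (induction q arbitrary: A)
  case 0
  then show ?case by (intro exI[of _ "{}"]) auto
next
  case (Suc q)
  then obtain b where b: "b \<subseteq> A" "card b = K" by (metis add_leD1 mult_Suc obtain_subset_with_card_n)
  have fb: "finite b" using b Suc.prems finite_subset by blast
  have "q * K \<le> card (A - b)" using Suc.prems b fb by (simp add: card_Diff_subset)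
  then obtain B where B: "finite B" "disjoint B" "\<Union>B \<subseteq> A - b" "\<forall>b\<in>B. card b = K \<and> finite b" "card B = q"
    using Suc.IH[of "A - b"] Suc.prems by auto
  have "b \<notin> B" using B(3) b assms(3) by (metis Diff_disjoint Sup_le_iff card.empty disjoint_iff less_irrefl subset_empty subset_iff ex_in_conv)
  then show ?case
    using B b fb by (intro exI[of _ "insert b B"]) (auto simp: disjoint_def)
qed

section \<open>Distance to the span of finitely many vectors\<close>

context kernel_space begin

definition residual :: "(real ^ 'n \<Rightarrow> complex) set \<Rightarrow> (real ^ 'n \<Rightarrow> complex) \<Rightarrow> real ^ 'n \<Rightarrow> complex" where
  "residual E f = (\<lambda>x. f x - (\<Sum>b\<in>E. L2_inner f b * b x))"

lemma residual_norm:
  assumes "orthonormal E" "finite E" "f \<in> H"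
  shows "(L2_norm (residual E f))\<^sup>2 = (L2_norm f)\<^sup>2 - (\<Sum>b\<in>E. (cmod (L2_inner f b))\<^sup>2)"
  unfolding residual_def
  by (rule orth_residual(1)[OF assms(2), of "\<lambda>b. b"]) (simp_all add: orthonormalD[OF assms(1)] assms(3))

lemma residual_H: "orthonormal E \<Longrightarrow> f \<in> H \<Longrightarrow> residual E f \<in> H"
  unfolding residual_def by (intro H_diff H_sum[of E "\<lambda>b. b"]) (auto dest: orthonormalD(1))

text \<open>Gram-Schmidt, skipping vectors that already lie in the span up to norm 0; hence at most
  one basis vector per index.\<close>

lemma finite_span_basis:
  assumes "finite S" "\<And>i. i \<in> S \<Longrightarrow> g i \<in> H"
  shows "\<exists>E. orthonormal E \<and> finite E \<and> card E \<le> card S \<and> (\<forall>i\<in>S. L2_norm (residual E (g i)) = 0)"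
  using assms
proof (induction S)
  case empty
  show ?case by (intro exI[of _ "{}"]) (auto simp: orthonormal_def)
next
  case (insert j S)
  then obtain E where E: "orthonormal E" "finite E" "card E \<le> card S" "\<And>i. i \<in> S \<Longrightarrow> L2_norm (residual E (g i)) = 0"
    by auto
  have gj: "g j \<in> H" using insert by simp
  define r where "r = residual E (g j)"
  have rH: "r \<in> H" unfolding r_def by (rule residual_H[OF E(1) gj])
  show ?case
  proof (cases "L2_norm r = 0")
    case True
    then show ?thesis using E insert(1,2) by (intro exI[of _ E]) (auto simp: r_def)
  next
    case False
    define b where "b = (\<lambda>x. of_real (1 / L2_norm r) * r x)"
    have bH: "b \<in> H" unfolding b_def by (rule H_scale[OF rH])
    have b1: "L2_norm b = 1" unfolding b_def norm_scale using False by (simp add: norm_divide)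
    have rc: "L2_inner r c = 0" if "c \<in> E" for c
      unfolding r_def residual_def
      by (rule orth_residual(2)[OF E(2), of "\<lambda>b. b"]) (simp_all add: orthonormalD[OF E(1)] gj that)
    have bc: "L2_inner b c = 0" if "c \<in> E" for c unfolding b_def L2_inner_scale_left rc[OF that] by simp
    have cb: "L2_inner c b = 0" if "c \<in> E" for c using bc[OF that] L2_inner_cnj[of b c] by simp
    have bE: "b \<notin> E" using bc[of b] b1 by (auto simp: L2_inner_self)
    have oE: "orthonormal (insert b E)"
      using E(1) bH b1 bc cb unfolding orthonormal_def by auto
    have rn: "(L2_norm (residual (insert b E) f))\<^sup>2 = (L2_norm (residual E f))\<^sup>2 - (cmod (L2_inner f b))\<^sup>2" if "f \<in> H" for f
      using residual_norm[OF oE _ that] residual_norm[OF E(1,2) that] E(2) bE by simp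
    have "L2_norm (residual (insert b E) (g i)) = 0" if i: "i \<in> S" for i
    proof -
      have "(L2_norm (residual (insert b E) (g i)))\<^sup>2 \<le> 0"
        using rn[of "g i"] E(4)[OF i] insert.prems i by simp
      then show ?thesis by simp
    qed
    moreover have "L2_norm (residual (insert b E) (g j)) = 0"
    proof -
      have "L2_inner (\<lambda>x. \<Sum>c\<in>E. L2_inner (g j) c * c x) b = (\<Sum>c\<in>E. L2_inner (g j) c * L2_inner c b)"
        by (rule inner_sum_left[of E "\<lambda>c. c"]) (use orthonormalD[OF E(1)] bH in auto)
      also have "\<dots> = 0" using cb by simp
      finally have "L2_inner (g j) b = L2_inner r b"
        unfolding r_def residual_def
        using inner_diff_left[OF gj H_sum[of E "\<lambda>c. c"] bH, of "\<lambda>c. L2_inner (g j) c"] orthonormalD(1)[OF E(1)] by simp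
      also have "\<dots> = cnj (L2_inner b r)" by (simp add: L2_inner_cnj)
      also have "L2_inner b r = of_real (1 / L2_norm r) * of_real ((L2_norm r)\<^sup>2)"
        unfolding b_def L2_inner_scale_left L2_inner_self ..
      also have "\<dots> = of_real (L2_norm r)" using False by (simp add: power2_eq_square)
      finally have "cmod (L2_inner (g j) b) = L2_norm r" by simp
      then have "(L2_norm (residual (insert b E) (g j)))\<^sup>2 = 0" unfolding rn[OF gj] r_def by simp
      then show ?thesis by simp
    qed
    moreover have "card (insert b E) \<le> card (insert j S)"
      using E(2,3) bE insert(1,2) by simp
    ultimately show ?thesis using oE E(2) by (intro exI[of _ "insert b E"]) auto
  qed
qed

lemma residual_add_norm:
  assumes E: "orthonormal E" "finite E" and f: "f \<in> H" "g \<in> H"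
  shows "L2_norm (residual E (\<lambda>x. f x + g x)) \<le> L2_norm (residual E f) + L2_norm (residual E g)"
proof -
  have "L2_inner (\<lambda>x. f x + g x) b = L2_inner f b + L2_inner g b" if "b \<in> E" for b
    using that orthonormalD(1)[OF E(1)] f by (intro L2_inner_add_left H_L2)
  then have "(\<Sum>b\<in>E. L2_inner (\<lambda>x. f x + g x) b * b x) = (\<Sum>b\<in>E. L2_inner f b * b x) + (\<Sum>b\<in>E. L2_inner g b * b x)" for x
    by (simp add: distrib_right sum.distrib)
  then have "residual E (\<lambda>x. f x + g x) = (\<lambda>x. residual E f x + residual E g x)"
    unfolding residual_def by auto
  then show ?thesis using norm_triangle[OF residual_H[OF E(1) f(1)] residual_H[OF E(1) f(2)]] by simp
qed

lemma residual_scale_norm: "L2_norm (residual E (\<lambda>x. c * f x)) = cmod c * L2_norm (residual E f)"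
proof -
  have "residual E (\<lambda>x. c * f x) = (\<lambda>x. c * residual E f x)"
    unfolding residual_def L2_inner_scale_left by (auto simp: right_diff_distrib sum_distrib_left mult.assoc)
  then show ?thesis by (simp add: norm_scale)
qed

lemma residual_sum_zero:
  assumes E: "orthonormal E" "finite E" and S: "finite S" "\<And>i. i \<in> S \<Longrightarrow> g i \<in> H \<and> L2_norm (residual E (g i)) = 0"
  shows "L2_norm (residual E (\<lambda>x. \<Sum>i\<in>S. c i * g i x)) = 0"
  using S
proof (induction S)
  case empty
  have "L2_norm (residual E (\<lambda>x. 0 * 0)) = cmod 0 * L2_norm (residual E (\<lambda>x. 0))" by (rule residual_scale_norm)
  then show ?case by simp
next
  case (insert i S)
  have "L2_norm (residual E (\<lambda>x. c i * g i x + (\<Sum>i\<in>S. c i * g i x))) \<le>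
    L2_norm (residual E (\<lambda>x. c i * g i x)) + L2_norm (residual E (\<lambda>x. \<Sum>i\<in>S. c i * g i x))"
    using insert.prems by (intro residual_add_norm E H_scale H_sum) auto
  also have "\<dots> = 0" using insert by (simp add: residual_scale_norm)
  finally have "L2_norm (residual E (\<lambda>x. c i * g i x + (\<Sum>i\<in>S. c i * g i x))) = 0"
    using L2_norm_nonneg antisym by blast
  then show ?case using insert(1,2) by simp
qed

end

section \<open>The indices kept in one cube\<close>

context admissible_kernel_space begin

definition gram :: "(nat \<Rightarrow> real ^ 'n) \<Rightarrow> nat \<Rightarrow> nat \<Rightarrow> complex" where
  "gram x i j = L2_inner (k (x j)) (k (x i))"

lemma quad_form_gram:
  "finite T \<Longrightarrow> quad_form (gram x) T c = (L2_norm (\<lambda>y. \<Sum>i\<in>T. c i * k (x i) y))\<^sup>2"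
  unfolding gram_def by (rule gram_norm) (simp_all add: kH)

lemma pos_semidef_gram: "finite T \<Longrightarrow> pos_semidef T (gram x)"
  using gram_pos_semidef[of T "\<lambda>i. k (x i)"] by (simp add: gram_def[abs_def] kH)

text \<open>Pairing the equations with \<open>u\<close> shows that \<open>s\<close> is the squared
  norm of the combination plus \<open>a\<close> times that of \<open>u\<close>. As
  \<open>u j = 1\<close>, the Schur complement \<open>s\<close> bounds the squared distance of the
  kernel at \<open>j\<close> from the span of the others.\<close>

lemma regularised_solution_norm:
  assumes T: "finite T" and u: "\<And>i. i \<in> T \<Longrightarrow> u i \<noteq> 0 \<Longrightarrow> i \<noteq> j \<Longrightarrow> mat_vec (gram x) T u i + of_real a * u i = 0"
    and j: "j \<in> T" "u j = 1" "mat_vec (gram x) T u j + of_real a * u j = of_real s" and a: "a > 0"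
  shows "(L2_norm (\<lambda>y. \<Sum>i\<in>T. u i * k (x i) y))\<^sup>2 \<le> s"
proof -
  have "of_real (a * norm_sq T u) + sesq_form (gram x) T u u = (\<Sum>i\<in>T. cnj (u i) * (mat_vec (gram x) T u i + of_real a * u i))"
    by (simp add: sesq_form_def norm_sq_def distrib_left sum.distrib sum_distrib_left mult_ac cnj_mult_self(2)[simplified])
  also have "\<dots> = (\<Sum>i\<in>T. if i = j then of_real s else 0)"
    using u j by (intro sum.cong refl) auto
  also have "\<dots> = of_real s" using T j by simp
  finally have "Re (of_real (a * norm_sq T u) + sesq_form (gram x) T u u) = s" by simp
  then have "a * norm_sq T u + quad_form (gram x) T u = s" by (simp add: quad_form_def)
  moreover have "0 \<le> a * norm_sq T u" using a by simp
  ultimately show ?thesis unfolding quad_form_gram[OF T] by linarith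
qed

lemma residual_le:
  assumes "orthonormal E" "finite E" "f \<in> H"
  shows "L2_norm (residual E f) \<le> L2_norm f"
proof (rule power2_le_imp_le)
  show "(L2_norm (residual E f))\<^sup>2 \<le> (L2_norm f)\<^sup>2"
    unfolding residual_norm[OF assms] by (simp add: sum_nonneg)
qed simp

text \<open>The last claim is a dimension count. Every kernel of the cube lies within squared
  distance \<open>e\<close> of the span of the kernels of \<open>S\<close>, so for an orthonormal
  basis \<open>E\<close> of that span \<open>knorm (x m) - e\<close> is at most the sum of the
  squared values of \<open>E\<close> at \<open>x m\<close>. The weighted sum over \<open>m\<close>
  is at most \<open>X\<close> for each member of \<open>E\<close>, and
  \<open>card E \<le> card S\<close>.\<close>

lemma subset_of_cube:
  fixes x :: "nat \<Rightarrow> real ^ 'n"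
  assumes w: "\<And>m. w m > 0" and X: "X \<ge> 0" and fU: "finite U" and a: "a > 0" and e: "e > 0"
    and bes: "\<And>f M. f \<in> H \<Longrightarrow> (\<Sum>m<M. w m * (cmod (f (x m)))\<^sup>2) \<le> X * (L2_norm f)\<^sup>2"
  obtains S d where "S \<subseteq> U" "\<And>i l. i \<in> S \<Longrightarrow> l \<notin> S \<Longrightarrow> d i l = 0" "\<And>i. i \<in> S \<Longrightarrow> Re (d i i) \<le> 1 / e"
    "\<And>i j. i \<in> S \<Longrightarrow> j \<in> S \<Longrightarrow> mat_vec (gram x) S (d i) j + of_real a * d i j = (if j = i then 1 else 0)"
    "(\<Sum>m\<in>U. w m * (knorm (x m) - e)) \<le> X * card S"
proof -
  obtain n where n: "U \<subseteq> {..<n}" using finite_nat_bounded[OF fU] by blast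
  obtain S where S: "S \<subseteq> U"
    and inS: "\<And>k. k \<in> S \<Longrightarrow> \<exists>u s. s \<ge> e \<and> u k = 1 \<and> (\<forall>i. i \<notin> S \<longrightarrow> u i = 0) \<and>
        (\<forall>i\<in>S. mat_vec (gram x) {..<n} u i + of_real a * u i = (if i = k then of_real s else 0))"
    and offS: "\<And>k. k \<in> U - S \<Longrightarrow> \<exists>u s. s \<le> e \<and> u k = 1 \<and> (\<forall>i. i \<notin> insert k S \<longrightarrow> u i = 0) \<and>
        (\<forall>i\<in>insert k S. mat_vec (gram x) {..<n} u i + of_real a * u i = (if i = k then of_real s else 0))"
  proof (rule determinantal_subset[OF pos_semidef_gram[OF finite_lessThan, where x = x] a e n])
    fix S
    assume "S \<subseteq> U"
      "\<And>k. k \<in> S \<Longrightarrow> \<exists>u s. s \<ge> e \<and> u k = 1 \<and> (\<forall>i. i \<notin> S \<longrightarrow> u i = 0) \<and>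
        (\<forall>i\<in>S. mat_vec (gram x) {..<n} u i + of_real a * u i = (if i = k then of_real s else 0))"
      "\<And>k. k \<in> U - S \<Longrightarrow> \<exists>u s. s \<le> e \<and> u k = 1 \<and> (\<forall>i. i \<notin> insert k S \<longrightarrow> u i = 0) \<and>
        (\<forall>i\<in>insert k S. mat_vec (gram x) {..<n} u i + of_real a * u i = (if i = k then of_real s else 0))"
    then show thesis by (rule that)
  qed
  have Sn: "S \<subseteq> {..<n}" and fS: "finite S" using S n fU finite_subset by blast+
  have "\<exists>d. \<forall>i\<in>S. (\<forall>l. l \<notin> S \<longrightarrow> d i l = 0) \<and> Re (d i i) \<le> 1 / e \<and>
    (\<forall>j\<in>S. mat_vec (gram x) S (d i) j + of_real a * d i j = (if j = i then 1 else 0))"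
  proof (rule bchoice, rule ballI)
    fix i assume i: "i \<in> S"
    from inS[OF i] obtain u s where s: "s \<ge> e" "u i = 1" and u0: "\<And>l. l \<notin> S \<Longrightarrow> u l = 0"
      and u: "\<And>j. j \<in> S \<Longrightarrow> mat_vec (gram x) {..<n} u j + of_real a * u j = (if j = i then of_real s else 0)" by blast
    have s0: "s > 0" using s(1) e by linarith
    have mvu: "mat_vec (gram x) {..<n} u j = mat_vec (gram x) S u j" for j
      by (rule mat_vec_restrict) (use Sn u0 in auto)
    \<comment> \<open>Dividing by the Schur complement \<open>s \<ge> e\<close> normalises the
      diagonal equation to 1 and turns the lower bound for \<open>s\<close> into the upper bound for
      \<open>d i\<close>.\<close>
    define d where "d = (\<lambda>l. u l / of_real s)"
    have mvd: "mat_vec (gram x) S d j = mat_vec (gram x) S u j / of_real s" for j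
      by (simp add: mat_vec_def d_def sum_divide_distrib)
    have "mat_vec (gram x) S d j + of_real a * d j = (if j = i then 1 else 0)" if "j \<in> S" for j
    proof -
      have "mat_vec (gram x) S d j + of_real a * d j = (mat_vec (gram x) {..<n} u j + of_real a * u j) / of_real s"
        unfolding mvd mvu by (simp add: d_def add_divide_distrib)
      then show ?thesis unfolding u[OF that] using s0 by simp
    qed
    moreover have "d l = 0" if "l \<notin> S" for l using u0[OF that] by (simp add: d_def)
    moreover have "Re (d i) \<le> 1 / e" using s e s0 by (simp add: d_def Re_divide_of_real frac_le)
    ultimately show "\<exists>d. (\<forall>l. l \<notin> S \<longrightarrow> d l = 0) \<and> Re (d i) \<le> 1 / e \<and>
      (\<forall>j\<in>S. mat_vec (gram x) S d j + of_real a * d j = (if j = i then 1 else 0))" by blast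
  qed
  then obtain d where d: "\<forall>i\<in>S. (\<forall>l. l \<notin> S \<longrightarrow> d i l = 0) \<and> Re (d i i) \<le> 1 / e \<and>
    (\<forall>j\<in>S. mat_vec (gram x) S (d i) j + of_real a * d i j = (if j = i then 1 else 0))" ..
  have "\<exists>E. orthonormal E \<and> finite E \<and> card E \<le> card S \<and> (\<forall>i\<in>S. L2_norm (residual E (k (x i))) = 0)"
    by (rule finite_span_basis[OF fS kH])
  then obtain E where E: "orthonormal E" "finite E" and cE: "card E \<le> card S"
    and E0: "\<And>i. i \<in> S \<Longrightarrow> L2_norm (residual E (k (x i))) = 0" by blast
  have resU: "(L2_norm (residual E (k (x m))))\<^sup>2 \<le> e" if m: "m \<in> U" for m
  proof (cases "m \<in> S")
    case False
    then have mU: "m \<in> U - S" using m by simp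
    from offS[OF this] obtain u s where s: "s \<le> e" "u m = 1" and u0: "\<And>l. l \<notin> insert m S \<Longrightarrow> u l = 0"
      and u: "\<And>j. j \<in> insert m S \<Longrightarrow> mat_vec (gram x) {..<n} u j + of_real a * u j = (if j = m then of_real s else 0)" by blast
    define F where "F = (\<lambda>y. \<Sum>i<n. u i * k (x i) y)"
    define R where "R = (\<lambda>y. \<Sum>i\<in>S. (- u i) * k (x i) y)"
    have FH: "F \<in> H" unfolding F_def by (rule H_sum) (rule kH)
    have RH: "R \<in> H" unfolding R_def by (rule H_sum) (rule kH)
    have "(L2_norm F)\<^sup>2 \<le> s" unfolding F_def
    proof (rule regularised_solution_norm[OF finite_lessThan _ _ _ _ a])
      show "mat_vec (gram x) {..<n} u i + of_real a * u i = 0" if "u i \<noteq> 0" "i \<noteq> m" for i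
      proof -
        have "i \<in> insert m S" using u0 that(1) by blast
        from u[OF this] that(2) show ?thesis by simp
      qed
      show "m \<in> {..<n}" using m n by blast
      show "mat_vec (gram x) {..<n} u m + of_real a * u m = of_real s" using u[of m] by simp
    qed (use s in auto)
    moreover have "L2_norm (residual E (k (x m))) \<le> L2_norm F"
    proof -
      have "F y = (\<Sum>i\<in>insert m S. u i * k (x i) y)" for y
        unfolding F_def by (intro sum.mono_neutral_right) (use Sn m n u0 in auto)
      then have "k (x m) = (\<lambda>y. F y + R y)"
        using fS False s(2) by (auto simp: R_def sum_negf)
      then have "L2_norm (residual E (k (x m))) \<le> L2_norm (residual E F) + L2_norm (residual E R)"
        using residual_add_norm[OF E FH RH] by simp
      also have "L2_norm (residual E R) = 0"
        unfolding R_def by (rule residual_sum_zero[OF E fS]) (use E0 kH in auto)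
      finally show ?thesis using residual_le[OF E FH] by simp
    qed
    then have "(L2_norm (residual E (k (x m))))\<^sup>2 \<le> (L2_norm F)\<^sup>2" by (rule power_mono) simp
    ultimately show ?thesis using s(1) by linarith
  qed (use E0 e in simp)
  have "(\<Sum>m\<in>U. w m * (knorm (x m) - e)) \<le> (\<Sum>m\<in>U. \<Sum>b\<in>E. w m * (cmod (b (x m)))\<^sup>2)"
  proof (rule sum_mono)
    fix m assume m: "m \<in> U"
    have ev: "cmod (L2_inner (k (x m)) b) = cmod (b (x m))" if "b \<in> E" for b
      using reproducing[OF orthonormalD(1)[OF E(1) that], of "x m"] L2_inner_cnj[of "k (x m)" b]
      by (metis complex_mod_cnj)
    have "knorm (x m) - e \<le> (\<Sum>b\<in>E. (cmod (L2_inner (k (x m)) b))\<^sup>2)"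
      using resU[OF m] residual_norm[OF E kH, of "x m"] by (simp add: knorm_def)
    also have "\<dots> = (\<Sum>b\<in>E. (cmod (b (x m)))\<^sup>2)" by (intro sum.cong refl) (simp add: ev)
    finally have "w m * (knorm (x m) - e) \<le> w m * (\<Sum>b\<in>E. (cmod (b (x m)))\<^sup>2)"
      using w[of m] by (intro mult_left_mono) auto
    then show "w m * (knorm (x m) - e) \<le> (\<Sum>b\<in>E. w m * (cmod (b (x m)))\<^sup>2)" by (simp add: sum_distrib_left)
  qed
  also have "\<dots> = (\<Sum>b\<in>E. \<Sum>m\<in>U. w m * (cmod (b (x m)))\<^sup>2)" by (rule sum.swap)
  also have "\<dots> \<le> (\<Sum>b\<in>E. X)"
  proof (rule sum_mono)
    fix b assume b: "b \<in> E"
    have "(\<Sum>m\<in>U. w m * (cmod (b (x m)))\<^sup>2) \<le> (\<Sum>m<n. w m * (cmod (b (x m)))\<^sup>2)"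
      using n by (intro sum_mono2) (auto simp: less_imp_le[OF w])
    also have "\<dots> \<le> X * (L2_norm b)\<^sup>2" by (rule bes[OF orthonormalD(1)[OF E(1) b]])
    finally show "(\<Sum>m\<in>U. w m * (cmod (b (x m)))\<^sup>2) \<le> X" using orthonormalD(2)[OF E(1) b] by simp
  qed
  also have "\<dots> = X * card E" by simp
  also have "\<dots> \<le> X * card S" using cE X by (intro mult_left_mono) auto
  finally have fin: "(\<Sum>m\<in>U. w m * (knorm (x m) - e)) \<le> X * card S" .
  show ?thesis
    by (rule that[of S d]) (use S d fin in auto)
qed

text \<open>A Chebyshev estimate. For fixed \<open>m\<close> the sum over \<open>i\<close> is the
  squared norm of the inverse applied to the row \<open>gram x m\<close>, at most the mass of that
  row on \<open>S\<close> divided by \<open>a\<^sup>2\<close>. Summed over \<open>m\<close> first,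
  this mass is at most \<open>\<delta>\<close> for each index of \<open>S\<close>.\<close>

lemma card_bad_rows:
  fixes x :: "nat \<Rightarrow> real ^ 'n"
  assumes S: "finite S" and a: "a > 0" and t: "\<tau> > 0"
    and d: "\<And>i j. i \<in> S \<Longrightarrow> j \<in> S \<Longrightarrow> mat_vec (gram x) S (d i) j + of_real a * d i j = (if j = i then 1 else 0)"
    and off: "\<And>m F. m \<in> S \<Longrightarrow> finite F \<Longrightarrow> F \<subseteq> R \<Longrightarrow> (\<Sum>l\<in>F. (cmod (gram x l m))\<^sup>2) \<le> \<delta>"
  shows "\<tau> * a\<^sup>2 * card {i\<in>S. \<exists>F. finite F \<and> F \<subseteq> R \<and> \<tau> < (\<Sum>m\<in>F. (cmod (mat_vec (gram x) S (d i) m))\<^sup>2)} \<le> \<delta> * card S"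
proof -
  define Z where "Z = {i\<in>S. \<exists>F. finite F \<and> F \<subseteq> R \<and> \<tau> < (\<Sum>m\<in>F. (cmod (mat_vec (gram x) S (d i) m))\<^sup>2)}"
  have fZ: "finite Z" and ZS: "Z \<subseteq> S" using S by (auto simp: Z_def)
  have "\<forall>i\<in>Z. \<exists>F. finite F \<and> F \<subseteq> R \<and> \<tau> < (\<Sum>m\<in>F. (cmod (mat_vec (gram x) S (d i) m))\<^sup>2)"
    by (auto simp: Z_def)
  then obtain Fi where Fi: "\<forall>i\<in>Z. finite (Fi i) \<and> Fi i \<subseteq> R \<and> \<tau> < (\<Sum>m\<in>Fi i. (cmod (mat_vec (gram x) S (d i) m))\<^sup>2)"
    by (rule bchoice[THEN exE])
  \<comment> \<open>\<open>R\<close> may be infinite and each bad index has its own finite witness;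
    the union of the witnesses serves all of them.\<close>
  define F where "F = (\<Union>i\<in>Z. Fi i)"
  have F: "finite F" "F \<subseteq> R" using Fi fZ by (auto simp: F_def)
  have "\<tau> * card Z = (\<Sum>i\<in>Z. \<tau>)" by simp
  also have "\<dots> \<le> (\<Sum>i\<in>Z. \<Sum>m\<in>F. (cmod (mat_vec (gram x) S (d i) m))\<^sup>2)"
  proof (rule sum_mono)
    fix i assume i: "i \<in> Z"
    have "\<tau> \<le> (\<Sum>m\<in>Fi i. (cmod (mat_vec (gram x) S (d i) m))\<^sup>2)" using Fi i by (simp add: less_imp_le)
    also have "\<dots> \<le> (\<Sum>m\<in>F. (cmod (mat_vec (gram x) S (d i) m))\<^sup>2)"
      using F i by (intro sum_mono2) (auto simp: F_def)
    finally show "\<tau> \<le> (\<Sum>m\<in>F. (cmod (mat_vec (gram x) S (d i) m))\<^sup>2)" .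
  qed
  also have "\<dots> \<le> (\<Sum>i\<in>S. \<Sum>m\<in>F. (cmod (mat_vec (gram x) S (d i) m))\<^sup>2)"
    using S ZS by (intro sum_mono2) (auto intro: sum_nonneg)
  also have "\<dots> = (\<Sum>m\<in>F. \<Sum>i\<in>S. (cmod (mat_vec (gram x) S (d i) m))\<^sup>2)" by (rule sum.swap)
  also have "\<dots> \<le> (\<Sum>m\<in>F. norm_sq S (gram x m) / a\<^sup>2)"
    unfolding mat_vec_def by (intro sum_mono inverse_row_bound[OF pos_semidef_gram[OF S] a d])
  also have "\<dots> = (\<Sum>l\<in>S. \<Sum>m\<in>F. (cmod (gram x m l))\<^sup>2) / a\<^sup>2"
    unfolding norm_sq_def sum_divide_distrib by (rule sum.swap)
  also have "\<dots> \<le> (\<Sum>l\<in>S. \<delta>) / a\<^sup>2"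
    by (intro divide_right_mono sum_mono off F) auto
  finally have "\<tau> * card Z \<le> \<delta> * card S / a\<^sup>2" by (simp add: mult.commute)
  then have "\<tau> * card Z * a\<^sup>2 \<le> \<delta> * card S" using a by (simp add: field_simps)
  then show ?thesis by (simp add: Z_def mult_ac)
qed

end

section \<open>Deletion of indices in finitely many and in all cubes\<close>

context admissible_kernel_space begin

text \<open>The dual vectors of each cube remain usable in the union of the cubes of
  \<open>J\<close>, because \<open>out\<close> bounds what the other cubes see of them.
  \<open>coordinate_bound\<close> then supplies the hypothesis of \<open>lower_selection\<close>,
  with a \<open>\<beta>\<close> that does not depend on \<open>J\<close>.\<close>

lemma finite_window_selection:
  fixes x :: "nat \<Rightarrow> real ^ 'n" and S :: "'j \<Rightarrow> nat set" and B :: "'j \<Rightarrow> nat set set" and \<beta> :: real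
  assumes fJ: "finite J" and S: "\<And>j. finite (S j)" and dis: "\<And>i j. i \<noteq> j \<Longrightarrow> S i \<inter> S j = {}"
    and B: "\<And>j. finite (B j)" "\<And>j. disjoint (B j)" "\<And>j. \<Union>(B j) \<subseteq> S j"
      "\<And>j b. b \<in> B j \<Longrightarrow> b \<noteq> {} \<and> card b \<le> K"
    and a: "a > 0" and e: "e > 0" and K: "K > (0::nat)" and \<tau>: "\<tau> > 0" and \<beta>: "2 / e + 2 * \<tau> / a \<le> \<beta>"
    and d0: "\<And>j i l. i \<in> S j \<Longrightarrow> l \<notin> S j \<Longrightarrow> d j i l = 0" and di: "\<And>j i. i \<in> S j \<Longrightarrow> Re (d j i i) \<le> 1 / e"
    and d: "\<And>j i l. i \<in> S j \<Longrightarrow> l \<in> S j \<Longrightarrow> mat_vec (gram x) (S j) (d j i) l + of_real a * d j i l = (if l = i then 1 else 0)"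
    and out: "\<And>j i F. i \<in> \<Union>(B j) \<Longrightarrow> finite F \<Longrightarrow> F \<subseteq> (\<Union>j'\<in>- {j}. S j') \<Longrightarrow> (\<Sum>m\<in>F. (cmod (mat_vec (gram x) (S j) (d j i) m))\<^sup>2) \<le> \<tau>"
  shows "\<exists>sel. (\<forall>j\<in>J. \<forall>b\<in>B j. sel b \<in> b) \<and> (\<forall>F c. F \<subseteq> (\<Union>j\<in>J. \<Union>(B j)) - sel ` (\<Union>j\<in>J. B j) \<longrightarrow>
    (1 / (3 * real K * \<beta>) - a) * norm_sq F c \<le> (L2_norm (\<lambda>y. \<Sum>i\<in>F. c i * k (x i) y))\<^sup>2)"
proof -
  define T where "T = (\<Union>j\<in>J. S j)"
  define BB where "BB = (\<Union>j\<in>J. B j)"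
  have fT: "finite T" using fJ S by (simp add: T_def)
  obtain n where n: "T \<subseteq> {..<n}" using finite_nat_bounded[OF fT] by blast
  have UB: "\<Union>BB \<subseteq> T" using B(3) by (auto simp: BB_def T_def)
  \<comment> \<open>Zero vectors fill up the initial segment of the naturals on which
    \<open>lower_selection\<close> works.\<close>
  define g where "g = (\<lambda>i. if i \<in> T then k (x i) else (\<lambda>_. 0))"
  have gH: "g i \<in> H" for i by (simp add: g_def kH H_zero)
  define G where "G = (\<lambda>i j. L2_inner (g j) (g i))"
  have psdG: "pos_semidef {..<n} G" unfolding G_def by (rule gram_pos_semidef) (auto simp: gH)
  have gs: "(\<Sum>i<n. c i * g i y) = (\<Sum>i\<in>T. c i * k (x i) y)" for c y
  proof -
    have "(\<Sum>i<n. c i * g i y) = (\<Sum>i\<in>T. c i * g i y)"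
      using n by (intro sum.mono_neutral_right) (auto simp: g_def)
    also have "\<dots> = (\<Sum>i\<in>T. c i * k (x i) y)" by (intro sum.cong) (auto simp: g_def)
    finally show ?thesis .
  qed
  have qG: "quad_form G {..<n} c = quad_form (gram x) T c" for c
    unfolding G_def gram_norm[OF finite_lessThan gH] quad_form_gram[OF fT] gs ..
  have b0: "\<beta> > 0" using e a \<tau> by (intro less_le_trans[OF _ \<beta>]) (auto intro!: add_pos_pos)
  have disB: "disjoint BB"
    unfolding disjoint_def
  proof (intro ballI impI)
    fix b c assume bc: "b \<in> BB" "c \<in> BB" "b \<noteq> c"
    then obtain i j where ij: "b \<in> B i" "c \<in> B j" by (auto simp: BB_def)
    show "b \<inter> c = {}"
    proof (cases "i = j")
      case True
      then show ?thesis using ij bc(3) B(2)[of i] by (auto simp: disjoint_def)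
    next
      case False
      have "b \<subseteq> S i" "c \<subseteq> S j" using ij B(3)[of i] B(3)[of j] by blast+
      then show ?thesis using dis[OF False] by blast
    qed
  qed
  have "\<exists>sel. (\<forall>b\<in>BB. sel b \<in> b) \<and>
    (\<forall>c. (\<forall>i<n. i \<notin> \<Union>BB - sel ` BB \<longrightarrow> c i = 0) \<longrightarrow> (1 / (3 * real K * \<beta>) - a) * norm_sq {..<n} c \<le> quad_form G {..<n} c)"
  proof (rule lower_selection[OF psdG a b0 K _ disB])
    show "finite BB" using fJ B(1) by (simp add: BB_def)
    show "\<Union>BB \<subseteq> {..<n}" using UB n by blast
    show "b \<noteq> {} \<and> card b \<le> K" if "b \<in> BB" for b using that B(4) by (auto simp: BB_def)
    fix i c assume i: "i \<in> \<Union>BB"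
    then obtain j where j: "j \<in> J" "i \<in> \<Union>(B j)" by (auto simp: BB_def)
    have iS: "i \<in> S j" using j(2) B(3) by blast
    have TS: "T - S j \<subseteq> (\<Union>j'\<in>- {j}. S j')" by (auto simp: T_def)
    have Q0: "quad_form (gram x) T c + a * norm_sq T c \<ge> 0"
      using pos_semidefD(3)[OF pos_semidef_gram[OF fT]] a by simp
    have "(cmod (c i))\<^sup>2 \<le> (2 / e + 2 * \<tau> / a) * (quad_form (gram x) T c + a * norm_sq T c)"
    proof (rule coordinate_bound[OF pos_semidef_gram[OF fT] a _ iS e, where d = "d j i"])
      show "S j \<subseteq> T" using j(1) by (auto simp: T_def)
      show "(\<Sum>m\<in>T - S j. (cmod (mat_vec (gram x) (S j) (d j i) m))\<^sup>2) \<le> \<tau>"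
        by (rule out[OF j(2) _ TS]) (use fT in simp)
    qed (use d0[OF iS] di[OF iS] d[OF iS] in auto)
    also have "\<dots> \<le> \<beta> * (quad_form (gram x) T c + a * norm_sq T c)" by (rule mult_right_mono[OF \<beta> Q0])
    also have "\<dots> \<le> \<beta> * (quad_form G {..<n} c + a * norm_sq {..<n} c)"
    proof (intro mult_left_mono add_mono)
      show "norm_sq T c \<le> norm_sq {..<n} c" unfolding norm_sq_def using n by (intro sum_mono2) auto
    qed (use a b0 in \<open>auto simp: qG\<close>)
    finally show "(cmod (c i))\<^sup>2 \<le> \<beta> * (quad_form G {..<n} c + a * norm_sq {..<n} c)" .
  qed
  then obtain sel where sel: "\<forall>b\<in>BB. sel b \<in> b"
    and low: "\<forall>c. (\<forall>i<n. i \<notin> \<Union>BB - sel ` BB \<longrightarrow> c i = 0) \<longrightarrow> (1 / (3 * real K * \<beta>) - a) * norm_sq {..<n} c \<le> quad_form G {..<n} c"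
    by (elim exE conjE)
  show ?thesis
  proof (intro exI[of _ sel] conjI allI impI ballI)
    show "sel b \<in> b" if "j \<in> J" "b \<in> B j" for j b using sel that by (auto simp: BB_def)
    fix F :: "nat set" and c :: "nat \<Rightarrow> complex" assume "F \<subseteq> (\<Union>j\<in>J. \<Union>(B j)) - sel ` (\<Union>j\<in>J. B j)"
    moreover have "(\<Union>j\<in>J. \<Union>(B j)) = \<Union>BB" by (auto simp: BB_def)
    ultimately have F: "F \<subseteq> \<Union>BB - sel ` BB" by (simp add: BB_def)
    have FT: "F \<subseteq> T" using F UB by blast
    define c' where "c' = (\<lambda>i. if i \<in> F then c i else 0)"
    have "(1 / (3 * real K * \<beta>) - a) * norm_sq {..<n} c' \<le> quad_form G {..<n} c'"
      by (rule low[rule_format]) (use F in \<open>auto simp: c'_def\<close>)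
    moreover have "norm_sq {..<n} c' = norm_sq F c"
    proof -
      have "norm_sq {..<n} c' = norm_sq F c'" unfolding norm_sq_def
        using FT n by (intro sum.mono_neutral_right) (auto simp: c'_def)
      then show ?thesis by (simp add: norm_sq_def c'_def)
    qed
    moreover have "(\<Sum>i\<in>T. c' i * k (x i) y) = (\<Sum>i\<in>F. c i * k (x i) y)" for y
    proof -
      have "(\<Sum>i\<in>T. c' i * k (x i) y) = (\<Sum>i\<in>F. c' i * k (x i) y)"
        using FT fT by (intro sum.mono_neutral_right) (auto simp: c'_def)
      then show ?thesis by (simp add: c'_def)
    qed
    ultimately show "(1 / (3 * real K * \<beta>) - a) * norm_sq F c \<le> (L2_norm (\<lambda>y. \<Sum>i\<in>F. c i * k (x i) y))\<^sup>2"
      unfolding qG quad_form_gram[OF fT] by simp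
  qed
qed

text \<open>Deletion is recorded by a Boolean at each index, so there are two options at each place.
  \<open>P N\<close> looks only at blocks and finite sets below \<open>N\<close> and asks that a
  block lose at most one index; since blocks and the sets \<open>F\<close> are finite, nothing is
  missed in the limit.\<close>

lemma global_selection:
  fixes x :: "nat \<Rightarrow> real ^ 'n" and S :: "'j \<Rightarrow> nat set" and B :: "'j \<Rightarrow> nat set set"
  assumes S: "\<And>j. finite (S j)" and dis: "\<And>i j. i \<noteq> j \<Longrightarrow> S i \<inter> S j = {}"
    and B: "\<And>j. disjoint (B j)" "\<And>j. \<Union>(B j) \<subseteq> S j" "\<And>j b. b \<in> B j \<Longrightarrow> finite b"
    and win: "\<And>J. finite J \<Longrightarrow> \<exists>sel. (\<forall>j\<in>J. \<forall>b\<in>B j. sel b \<in> b) \<and> (\<forall>F c. F \<subseteq> (\<Union>j\<in>J. \<Union>(B j)) - sel ` (\<Union>j\<in>J. B j) \<longrightarrow>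
      a * norm_sq F c \<le> (L2_norm (\<lambda>y. \<Sum>i\<in>F. c i * k (x i) y))\<^sup>2)"
  obtains \<Lambda> where "\<And>j b. b \<in> B j \<Longrightarrow> card (b - \<Lambda>) \<le> 1" "\<Lambda> \<subseteq> (\<Union>j. \<Union>(B j))"
    "\<And>F c. finite F \<Longrightarrow> F \<subseteq> \<Lambda> \<Longrightarrow> a * norm_sq F c \<le> (L2_norm (\<lambda>y. \<Sum>i\<in>F. c i * k (x i) y))\<^sup>2"
proof -
  define P where "P = (\<lambda>N (f :: nat \<Rightarrow> bool). (\<forall>j. \<forall>b\<in>B j. b \<subseteq> {..<N} \<longrightarrow> card {i\<in>b. \<not> f i} \<le> 1) \<and>
    (\<forall>F c. F \<subseteq> {i\<in>\<Union>j. \<Union>(B j). i < N \<and> f i} \<longrightarrow> a * norm_sq F c \<le> (L2_norm (\<lambda>y. \<Sum>i\<in>F. c i * k (x i) y))\<^sup>2))"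
  have "\<exists>f. (\<forall>m. f m \<in> UNIV) \<and> (\<forall>N. P N f)"
  proof (rule compactness_choice)
    show "finite (UNIV :: bool set)" for m :: nat by simp
    fix N :: nat
    show "P N g" if fg: "\<And>m. m < N \<Longrightarrow> f m = g m" and P: "P N f" for f g
    proof -
      have "{i\<in>b. \<not> f i} = {i\<in>b. \<not> g i}" if "b \<subseteq> {..<N}" for b using that fg by auto
      moreover have "{i\<in>\<Union>j. \<Union>(B j). i < N \<and> f i} = {i\<in>\<Union>j. \<Union>(B j). i < N \<and> g i}" using fg by auto
      ultimately show ?thesis using P unfolding P_def by auto
    qed
    show "P N f" if P: "P (Suc N) f" for f
      unfolding P_def
    proof (intro conjI allI ballI impI)
      fix j b assume b: "b \<in> B j" "b \<subseteq> {..<N}"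
      then have "b \<subseteq> {..<Suc N}" by auto
      then show "card {i \<in> b. \<not> f i} \<le> 1" using P b(1) unfolding P_def by blast
    next
      fix F :: "nat set" and c :: "nat \<Rightarrow> complex" assume "F \<subseteq> {i\<in>\<Union>j. \<Union>(B j). i < N \<and> f i}"
      then have "F \<subseteq> {i\<in>\<Union>j. \<Union>(B j). i < Suc N \<and> f i}" by auto
      then show "a * norm_sq F c \<le> (L2_norm (\<lambda>y. \<Sum>i\<in>F. c i * k (x i) y))\<^sup>2" using P unfolding P_def by blast
    qed
    show "\<exists>f. (\<forall>m. f m \<in> (UNIV :: bool set)) \<and> P N f"
    proof -
      \<comment> \<open>Only the sets \<open>S j\<close> with an index below \<open>N\<close> matter
        for \<open>P N\<close>, and by disjointness there are finitely many of them.\<close>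
      define J where "J = {j. S j \<inter> {..<N} \<noteq> {}}"
      have "\<exists>jj. \<forall>j\<in>J. jj j < N \<and> jj j \<in> S j"
        by (rule bchoice) (auto simp: J_def)
      then obtain jj where jj: "\<And>j. j \<in> J \<Longrightarrow> jj j < N \<and> jj j \<in> S j" by blast
      have "inj_on jj J"
      proof (rule inj_onI, rule ccontr)
        fix p q assume pq: "p \<in> J" "q \<in> J" "jj p = jj q" "p \<noteq> q"
        then show False using jj[of p] jj[of q] dis[of p q] by auto
      qed
      moreover have "jj ` J \<subseteq> {..<N}" using jj by auto
      ultimately have fJ: "finite J" by (rule inj_on_finite) simp
      from win[OF fJ] obtain sel where sel: "\<forall>j\<in>J. \<forall>b\<in>B j. sel b \<in> b"
        and low: "\<forall>F c. F \<subseteq> (\<Union>j\<in>J. \<Union>(B j)) - sel ` (\<Union>j\<in>J. B j) \<longrightarrow> a * norm_sq F c \<le> (L2_norm (\<lambda>y. \<Sum>i\<in>F. c i * k (x i) y))\<^sup>2"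
        by (elim exE conjE)
      define f where "f = (\<lambda>i. i \<notin> sel ` (\<Union>j\<in>J. B j))"
      have "P N f"
        unfolding P_def
      proof (intro conjI allI ballI impI)
        fix j b assume b: "b \<in> B j" "b \<subseteq> {..<N}"
        have "{i\<in>b. \<not> f i} \<subseteq> {sel b}"
        proof
          fix i assume "i \<in> {i\<in>b. \<not> f i}"
          then obtain j' b' where i: "i \<in> b" "j' \<in> J" "b' \<in> B j'" "i = sel b'" by (auto simp: f_def)
          have ib': "i \<in> b'" using sel i by simp
          have "i \<in> S j" "i \<in> S j'" using B(2)[of j] B(2)[of j'] i b ib' by blast+
          then have jj': "j = j'" using dis[of j j'] by blast
          have "b = b'"
          proof (rule ccontr)
            assume "b \<noteq> b'"
            then have "b \<inter> b' = {}" using B(1)[of j] b(1) i(3) unfolding jj' disjoint_def by blast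
            then show False using i(1) ib' by blast
          qed
          then show "i \<in> {sel b}" using i(4) by simp
        qed
        then have "card {i\<in>b. \<not> f i} \<le> card {sel b}" by (intro card_mono) auto
        then show "card {i\<in>b. \<not> f i} \<le> 1" by simp
      next
        fix F :: "nat set" and c :: "nat \<Rightarrow> complex" assume F: "F \<subseteq> {i\<in>\<Union>j. \<Union>(B j). i < N \<and> f i}"
        show "a * norm_sq F c \<le> (L2_norm (\<lambda>y. \<Sum>i\<in>F. c i * k (x i) y))\<^sup>2"
        proof (rule low[rule_format], rule subsetI)
          fix i assume "i \<in> F"
          then have i: "i < N" "f i" "i \<in> (\<Union>j. \<Union>(B j))" using F by auto
          then obtain j where j: "i \<in> \<Union>(B j)" by blast
          then have "i \<in> S j" using B(2) by blast
          then have "j \<in> J" using i(1) by (auto simp: J_def)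
          then show "i \<in> (\<Union>j\<in>J. \<Union>(B j)) - sel ` (\<Union>j\<in>J. B j)" using j i(2) by (auto simp: f_def)
        qed
      qed
      then show ?thesis by auto
    qed
  qed
  then obtain f where f: "\<And>N. P N f" by blast
  show ?thesis
  proof (rule that[of "{i\<in>\<Union>j. \<Union>(B j). f i}"])
    fix j b assume b: "b \<in> B j"
    obtain N where N: "b \<subseteq> {..<N}" using finite_nat_bounded[OF B(3)[OF b]] by blast
    have "card {i\<in>b. \<not> f i} \<le> 1" using f[of N] b N unfolding P_def by blast
    moreover have "b - {i\<in>\<Union>j. \<Union>(B j). f i} = {i\<in>b. \<not> f i}" using b by auto
    ultimately show "card (b - {i\<in>\<Union>j. \<Union>(B j). f i}) \<le> 1" by simp
  next
    fix F :: "nat set" and c :: "nat \<Rightarrow> complex" assume F: "finite F" "F \<subseteq> {i\<in>\<Union>j. \<Union>(B j). f i}"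
    obtain N where N: "F \<subseteq> {..<N}" using finite_nat_bounded[OF F(1)] by blast
    have "F \<subseteq> {i\<in>\<Union>j. \<Union>(B j). i < N \<and> f i}" using F(2) N by auto
    then show "a * norm_sq F c \<le> (L2_norm (\<lambda>y. \<Sum>i\<in>F. c i * k (x i) y))\<^sup>2"
      using f[of N] unfolding P_def by blast
  qed auto
qed

end

context admissible_kernel_space begin

text \<open>Indices of \<open>S j\<close> whose dual vector is noticed by the other cubes make up at
  most a fraction \<open>\<theta>\<close>. Deleting one of \<open>K\<close> indices costs a second
  factor \<open>1 - \<theta>\<close>, because \<open>1 \<le> \<theta> * K\<close>, and the
  subtracted \<open>K\<close> covers the remainder that does not fill a block.\<close>

lemma riesz_subfamily:
  fixes x :: "nat \<Rightarrow> real ^ 'n" and U :: "'j \<Rightarrow> nat set" and K :: nat and \<theta> \<beta> :: real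
  assumes w: "\<And>m. w m > 0" and X: "X > 0"
    and bes: "\<And>f M. f \<in> H \<Longrightarrow> (\<Sum>m<M. w m * (cmod (f (x m)))\<^sup>2) \<le> X * (L2_norm f)\<^sup>2"
    and U: "\<And>j. finite (U j)" and dis: "\<And>i j. i \<noteq> j \<Longrightarrow> U i \<inter> U j = {}"
    and a: "a > 0" and e: "e > 0" and \<tau>: "\<tau> > 0" and \<beta>: "2 / e + 2 * \<tau> / a \<le> \<beta>"
    and \<theta>: "0 < \<theta>" "\<theta> < 1" and K: "1 \<le> \<theta> * K" and \<delta>: "\<delta> \<le> \<theta> * (\<tau> * a\<^sup>2)"
    and off: "\<And>j m F. m \<in> U j \<Longrightarrow> finite F \<Longrightarrow> F \<subseteq> (\<Union>j'\<in>- {j}. U j') \<Longrightarrow> (\<Sum>l\<in>F. (cmod (gram x l m))\<^sup>2) \<le> \<delta>"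
  obtains \<Lambda> where "\<Lambda> \<subseteq> (\<Union>j. U j)"
    "\<And>j. (1 - \<theta>)\<^sup>2 * ((\<Sum>m\<in>U j. w m * (knorm (x m) - e)) / X) - K \<le> card (\<Lambda> \<inter> U j)"
    "\<And>F c. finite F \<Longrightarrow> F \<subseteq> \<Lambda> \<Longrightarrow> (1 / (3 * real K * \<beta>) - a) * norm_sq F c \<le> (L2_norm (\<lambda>y. \<Sum>i\<in>F. c i * k (x i) y))\<^sup>2"
proof -
  have K0: "K > 0" using K by (cases K) auto
  have "\<forall>j. \<exists>S d. S \<subseteq> U j \<and> (\<forall>i\<in>S. \<forall>l. l \<notin> S \<longrightarrow> d i l = 0) \<and> (\<forall>i\<in>S. Re (d i i) \<le> 1 / e) \<and>
    (\<forall>i\<in>S. \<forall>l\<in>S. mat_vec (gram x) S (d i) l + of_real a * d i l = (if l = i then 1 else 0)) \<and>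
    (\<Sum>m\<in>U j. w m * (knorm (x m) - e)) \<le> X * card S"
  proof
    fix j
    show "\<exists>S d. S \<subseteq> U j \<and> (\<forall>i\<in>S. \<forall>l. l \<notin> S \<longrightarrow> d i l = 0) \<and> (\<forall>i\<in>S. Re (d i i) \<le> 1 / e) \<and>
      (\<forall>i\<in>S. \<forall>l\<in>S. mat_vec (gram x) S (d i) l + of_real a * d i l = (if l = i then 1 else 0)) \<and>
      (\<Sum>m\<in>U j. w m * (knorm (x m) - e)) \<le> X * card S"
    proof (rule subset_of_cube[OF w less_imp_le[OF X] U a e bes])
      fix S d
      assume "S \<subseteq> U j" "\<And>i l. i \<in> S \<Longrightarrow> l \<notin> S \<Longrightarrow> d i l = 0" "\<And>i. i \<in> S \<Longrightarrow> Re (d i i) \<le> 1 / e"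
        "\<And>i j. i \<in> S \<Longrightarrow> j \<in> S \<Longrightarrow> mat_vec (gram x) S (d i) j + of_real a * d i j = (if j = i then 1 else 0)"
        "(\<Sum>m\<in>U j. w m * (knorm (x m) - e)) \<le> X * card S"
      then show ?thesis by (intro exI[of _ S] exI[of _ d] conjI ballI allI impI) auto
    qed
  qed
  then obtain S where "\<forall>j. \<exists>d. S j \<subseteq> U j \<and> (\<forall>i\<in>S j. \<forall>l. l \<notin> S j \<longrightarrow> d i l = 0) \<and> (\<forall>i\<in>S j. Re (d i i) \<le> 1 / e) \<and>
    (\<forall>i\<in>S j. \<forall>l\<in>S j. mat_vec (gram x) (S j) (d i) l + of_real a * d i l = (if l = i then 1 else 0)) \<and>
    (\<Sum>m\<in>U j. w m * (knorm (x m) - e)) \<le> X * card (S j)"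
    by (rule choice[THEN exE])
  then obtain d where Sd: "\<forall>j. S j \<subseteq> U j \<and> (\<forall>i\<in>S j. \<forall>l. l \<notin> S j \<longrightarrow> d j i l = 0) \<and> (\<forall>i\<in>S j. Re (d j i i) \<le> 1 / e) \<and>
    (\<forall>i\<in>S j. \<forall>l\<in>S j. mat_vec (gram x) (S j) (d j i) l + of_real a * d j i l = (if l = i then 1 else 0)) \<and>
    (\<Sum>m\<in>U j. w m * (knorm (x m) - e)) \<le> X * card (S j)"
    by (rule choice[THEN exE])
  have SU: "S j \<subseteq> U j" and d0: "\<And>i l. i \<in> S j \<Longrightarrow> l \<notin> S j \<Longrightarrow> d j i l = 0" and di: "\<And>i. i \<in> S j \<Longrightarrow> Re (d j i i) \<le> 1 / e"
    and dd: "\<And>i l. i \<in> S j \<Longrightarrow> l \<in> S j \<Longrightarrow> mat_vec (gram x) (S j) (d j i) l + of_real a * d j i l = (if l = i then 1 else 0)"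
    and cS: "(\<Sum>m\<in>U j. w m * (knorm (x m) - e)) \<le> X * card (S j)" for j
    using Sd[rule_format, of j] by blast+
  have fS: "finite (S j)" for j using SU U finite_subset by blast
  have disS: "S i \<inter> S j = {}" if "i \<noteq> j" for i j using dis[OF that] SU by blast
  define R where "R = (\<lambda>j. \<Union>j'\<in>- {j}. S j')"
  define Z where "Z = (\<lambda>j. {i\<in>S j. \<exists>F. finite F \<and> F \<subseteq> R j \<and> \<tau> < (\<Sum>m\<in>F. (cmod (mat_vec (gram x) (S j) (d j i) m))\<^sup>2)})"
  define A where "A = (\<lambda>j. S j - Z j)"
  have AS: "A j \<subseteq> S j" and fA: "finite (A j)" for j using fS by (auto simp: A_def)
  have cA: "(1 - \<theta>) * card (S j) \<le> card (A j)" for j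
  proof -
    have "\<tau> * a\<^sup>2 * card (Z j) \<le> \<delta> * card (S j)"
      unfolding Z_def
    proof (rule card_bad_rows[OF fS a \<tau> dd])
      fix m and F :: "nat set" assume m: "m \<in> S j" "finite F" "F \<subseteq> R j"
      have "R j \<subseteq> (\<Union>j'\<in>- {j}. U j')" unfolding R_def by (intro UN_mono SU subset_refl)
      then show "(\<Sum>l\<in>F. (cmod (gram x l m))\<^sup>2) \<le> \<delta>"
        using m SU by (intro off[of m j]) auto
    qed
    also have "\<dots> \<le> \<theta> * (\<tau> * a\<^sup>2) * card (S j)" by (rule mult_right_mono[OF \<delta>]) simp
    finally have "(\<tau> * a\<^sup>2) * card (Z j) \<le> (\<tau> * a\<^sup>2) * (\<theta> * card (S j))" by (simp add: mult_ac)
    then have "card (Z j) \<le> \<theta> * card (S j)"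
      by (rule mult_left_le_imp_le) (use a \<tau> in simp)
    moreover have "card (A j) = card (S j) - card (Z j)" "card (Z j) \<le> card (S j)"
      unfolding A_def using fS[of j] by (auto simp: Z_def intro!: card_Diff_subset card_mono)
    ultimately show ?thesis by (simp add: of_nat_diff algebra_simps)
  qed
  have "\<forall>j. \<exists>B. finite B \<and> disjoint B \<and> \<Union>B \<subseteq> A j \<and> (\<forall>b\<in>B. card b = K \<and> finite b) \<and> card B = card (A j) div K"
    by (intro allI equal_blocks fA K0) simp
  then obtain B where Ball: "\<forall>j. finite (B j) \<and> disjoint (B j) \<and> \<Union>(B j) \<subseteq> A j \<and> (\<forall>b\<in>B j. card b = K \<and> finite b) \<and> card (B j) = card (A j) div K"
    by (rule choice[THEN exE])
  have B: "finite (B j)" "disjoint (B j)" "\<Union>(B j) \<subseteq> A j" "card (B j) = card (A j) div K"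
    "\<And>b. b \<in> B j \<Longrightarrow> card b = K \<and> finite b" for j
    using Ball by blast+
  have BS: "\<Union>(B j) \<subseteq> S j" for j using B(3) AS by blast
  have win: "\<exists>sel. (\<forall>j\<in>J. \<forall>b\<in>B j. sel b \<in> b) \<and> (\<forall>F c. F \<subseteq> (\<Union>j\<in>J. \<Union>(B j)) - sel ` (\<Union>j\<in>J. B j) \<longrightarrow>
    (1 / (3 * real K * \<beta>) - a) * norm_sq F c \<le> (L2_norm (\<lambda>y. \<Sum>i\<in>F. c i * k (x i) y))\<^sup>2)" if "finite J" for J
  proof (rule finite_window_selection[OF that fS disS B(1,2) BS _ a e K0 \<tau> \<beta> d0 di dd])
    show "b \<noteq> {} \<and> card b \<le> K" if "b \<in> B j" for j b using B(5)[OF that] K0 by auto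
    fix j i and F :: "nat set" assume i: "i \<in> \<Union>(B j)" "finite F" "F \<subseteq> (\<Union>j'\<in>- {j}. S j')"
    then have "i \<in> S j" "i \<notin> Z j" using B(3)[of j] by (auto simp: A_def)
    then show "(\<Sum>m\<in>F. (cmod (mat_vec (gram x) (S j) (d j i) m))\<^sup>2) \<le> \<tau>"
      using i(2,3) by (simp add: Z_def R_def not_less)
  qed
  show ?thesis
  proof (rule global_selection[OF fS disS B(2) BS _ win])
    show "finite b" if "b \<in> B j" for j b using B(5)[OF that] by blast
    fix \<Lambda>
    assume L1: "\<And>j b. b \<in> B j \<Longrightarrow> card (b - \<Lambda>) \<le> 1" and L2: "\<Lambda> \<subseteq> (\<Union>j. \<Union>(B j))"
      and L3: "\<And>F c. finite F \<Longrightarrow> F \<subseteq> \<Lambda> \<Longrightarrow> (1 / (3 * real K * \<beta>) - a) * norm_sq F c \<le> (L2_norm (\<lambda>y. \<Sum>i\<in>F. c i * k (x i) y))\<^sup>2"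
    have cnt: "(1 - \<theta>)\<^sup>2 * ((\<Sum>m\<in>U j. w m * (knorm (x m) - e)) / X) - K \<le> card (\<Lambda> \<inter> U j)" for j
    proof -
      let ?q = "card (B j)"
      have bL: "real K - 1 \<le> card (b \<inter> \<Lambda>)" if "b \<in> B j" for b
      proof -
        have "card b = card (b \<inter> \<Lambda>) + card (b - \<Lambda>)"
          using B(5)[OF that] card_Int_Diff by blast
        then show ?thesis using L1[OF that] B(5)[OF that] by simp
      qed
      have "(\<Sum>b\<in>B j. card (b \<inter> \<Lambda>)) = card (\<Union>b\<in>B j. b \<inter> \<Lambda>)"
      proof (rule card_UN_disjoint[OF B(1), symmetric])
        show "\<forall>b\<in>B j. finite (b \<inter> \<Lambda>)" using B(5) by blast
        show "\<forall>b\<in>B j. \<forall>c\<in>B j. b \<noteq> c \<longrightarrow> b \<inter> \<Lambda> \<inter> (c \<inter> \<Lambda>) = {}"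
          using B(2)[of j] unfolding disjoint_def by blast
      qed
      also have "\<dots> \<le> card (\<Lambda> \<inter> U j)"
        using BS[of j] SU[of j] U[of j] by (intro card_mono) auto
      finally have "(\<Sum>b\<in>B j. real (card (b \<inter> \<Lambda>))) \<le> card (\<Lambda> \<inter> U j)"
        unfolding of_nat_sum[symmetric] of_nat_le_iff .
      moreover have "(\<Sum>b\<in>B j. real K - 1) \<le> (\<Sum>b\<in>B j. real (card (b \<inter> \<Lambda>)))"
        by (rule sum_mono) (rule bL)
      ultimately have 1: "real ?q * (real K - 1) \<le> card (\<Lambda> \<inter> U j)" by simp
      have "real (card (A j)) \<le> real ?q * K + K"
      proof -
        have "card (A j) = ?q * K + card (A j) mod K" unfolding B(4) by simp
        moreover have "card (A j) mod K < K" using K0 by simp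
        ultimately have "card (A j) \<le> ?q * K + K" by linarith
        then show ?thesis by (metis of_nat_add of_nat_le_iff of_nat_mult)
      qed
      then have 2: "(1 - \<theta>) * (card (A j) - real K) \<le> (1 - \<theta>) * (real ?q * K)"
        using \<theta> by (intro mult_left_mono) auto
      have "real ?q * 1 \<le> real ?q * (\<theta> * K)" by (rule mult_left_mono[OF K]) simp
      then have 3: "(1 - \<theta>) * (real ?q * K) \<le> real ?q * (real K - 1)" by (simp add: algebra_simps)
      have "(\<Sum>m\<in>U j. w m * (knorm (x m) - e)) / X \<le> card (S j)"
        using cS[of j] X by (simp add: field_simps)
      then have "(1 - \<theta>)\<^sup>2 * ((\<Sum>m\<in>U j. w m * (knorm (x m) - e)) / X) \<le> (1 - \<theta>)\<^sup>2 * card (S j)"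
        by (rule mult_left_mono) simp
      also have "\<dots> = (1 - \<theta>) * ((1 - \<theta>) * card (S j))" by (simp add: power2_eq_square)
      also have "\<dots> \<le> (1 - \<theta>) * card (A j)" using \<theta> by (intro mult_left_mono cA) auto
      finally have 4: "(1 - \<theta>)\<^sup>2 * ((\<Sum>m\<in>U j. w m * (knorm (x m) - e)) / X) \<le> (1 - \<theta>) * card (A j)" .
      have "(1 - \<theta>) * K \<le> 1 * real K" using \<theta> by (intro mult_right_mono) auto
      then show ?thesis using 1 2 3 4 by (simp add: algebra_simps)
    qed
    have LU: "\<Lambda> \<subseteq> (\<Union>j. U j)"
    proof
      fix i assume "i \<in> \<Lambda>"
      then obtain j where "i \<in> \<Union>(B j)" using L2 by blast
      then have "i \<in> U j" using BS SU by blast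
      then show "i \<in> (\<Union>j. U j)" by blast
    qed
    show ?thesis by (rule that[OF LU cnt L3])
  qed
qed

end

section \<open>Bessel and Riesz sequences of kernels\<close>

context kernel_space begin

text \<open>The upper bound makes the finite partial sums Cauchy. \<open>complete\<close> yields a
  limit along the initial segments \<open>P M\<close> of \<open>I\<close>, the Cauchy property
  extends the convergence to all finite subsets, and both bounds pass to the limit.\<close>

lemma riesz_sequence_finite:
  fixes I :: "nat set"
  assumes g: "\<And>i. g i \<in> H" and A: "A > 0" and B: "B > 0"
    and low: "\<And>F c. finite F \<Longrightarrow> F \<subseteq> I \<Longrightarrow> A * norm_sq F c \<le> (L2_norm (\<lambda>y. \<Sum>i\<in>F. c i * g i y))\<^sup>2"
    and up: "\<And>F c. finite F \<Longrightarrow> F \<subseteq> I \<Longrightarrow> (L2_norm (\<lambda>y. \<Sum>i\<in>F. c i * g i y))\<^sup>2 \<le> B * norm_sq F c"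
  shows "riesz_sequence H I g"
  unfolding riesz_sequence_def
proof (intro conjI ballI g, simp, rule exI[of _ A], rule conjI[OF A], rule exI[of _ B], rule conjI[OF B], intro allI impI)
  fix c :: "nat \<Rightarrow> complex" assume sm: "(\<lambda>i. (cmod (c i))\<^sup>2) summable_on I"
  define q where "q = infsum (\<lambda>i. (cmod (c i))\<^sup>2) I"
  define D where "D = (\<lambda>F y. \<Sum>i\<in>F. c i * g i y)"
  have DH: "D F \<in> H" for F unfolding D_def by (rule H_sum[OF g])
  have tail: "\<exists>F0. finite F0 \<and> F0 \<subseteq> I \<and> (\<forall>F F'. finite F \<and> finite F' \<and> F0 \<subseteq> F \<and> F0 \<subseteq> F' \<and> F \<subseteq> I \<and> F' \<subseteq> I
    \<longrightarrow> L2_norm (\<lambda>y. D F y - D F' y) < e)" if e: "e > 0" for e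
  proof -
    define \<eta> where "\<eta> = e\<^sup>2 / B"
    have \<eta>: "\<eta> > 0" using e B by (simp add: \<eta>_def)
    have "\<forall>\<^sub>F F in finite_subsets_at_top I. dist (\<Sum>i\<in>F. (cmod (c i))\<^sup>2) q < \<eta>"
      unfolding q_def by (rule tendstoD[OF infsum_tendsto[OF sm] \<eta>])
    then obtain F0 where F0: "finite F0" "F0 \<subseteq> I" and F0': "dist (\<Sum>i\<in>F0. (cmod (c i))\<^sup>2) q < \<eta>"
      unfolding eventually_finite_subsets_at_top by blast
    have "L2_norm (\<lambda>y. D F y - D F' y) < e"
      if F: "finite F" "finite F'" "F0 \<subseteq> F" "F0 \<subseteq> F'" "F \<subseteq> I" "F' \<subseteq> I" for F F'
    proof -
      define T where "T = (F - F') \<union> (F' - F)"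
      \<comment> \<open>The difference of two partial sums is a sum over the symmetric difference,
        with the sign changed on \<open>F' - F\<close>.\<close>
      define c' where "c' = (\<lambda>i. if i \<in> F then c i else - c i)"
      have T: "finite T" "T \<subseteq> I" "T \<inter> F0 = {}" using F by (auto simp: T_def)
      have "D F y - D F' y = (\<Sum>i\<in>T. c' i * g i y)" for y
      proof -
        have "D F y = (\<Sum>i\<in>F - F'. c i * g i y) + (\<Sum>i\<in>F \<inter> F'. c i * g i y)"
          unfolding D_def using F by (subst sum.union_disjoint[symmetric]) (auto intro!: sum.cong)
        moreover have "D F' y = (\<Sum>i\<in>F' - F. c i * g i y) + (\<Sum>i\<in>F \<inter> F'. c i * g i y)"
          unfolding D_def using F by (subst sum.union_disjoint[symmetric]) (auto intro!: sum.cong)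
        moreover have "(\<Sum>i\<in>T. c' i * g i y) = (\<Sum>i\<in>F - F'. c' i * g i y) + (\<Sum>i\<in>F' - F. c' i * g i y)"
          unfolding T_def using F by (intro sum.union_disjoint) auto
        moreover have "(\<Sum>i\<in>F - F'. c' i * g i y) = (\<Sum>i\<in>F - F'. c i * g i y)"
          by (intro sum.cong) (auto simp: c'_def)
        moreover have "(\<Sum>i\<in>F' - F. c' i * g i y) = (\<Sum>i\<in>F' - F. - (c i * g i y))"
          by (intro sum.cong) (auto simp: c'_def)
        ultimately show ?thesis by (simp add: sum_negf)
      qed
      then have "(L2_norm (\<lambda>y. D F y - D F' y))\<^sup>2 = (L2_norm (\<lambda>y. \<Sum>i\<in>T. c' i * g i y))\<^sup>2" by simp
      also have "\<dots> \<le> B * norm_sq T c'" by (rule up[OF T(1,2)])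
      also have "norm_sq T c' = norm_sq T c" by (simp add: norm_sq_def c'_def if_distrib[of cmod] cong: if_cong)
      also have "B * norm_sq T c < B * \<eta>"
      proof (intro mult_strict_left_mono B)
        have "(\<Sum>i\<in>T \<union> F0. (cmod (c i))\<^sup>2) \<le> q"
          unfolding q_def by (rule finite_sum_le_infsum[OF sm]) (use T F0 in auto)
        moreover have "(\<Sum>i\<in>T \<union> F0. (cmod (c i))\<^sup>2) = norm_sq T c + (\<Sum>i\<in>F0. (cmod (c i))\<^sup>2)"
          unfolding norm_sq_def by (rule sum.union_disjoint) (use T F0 in auto)
        ultimately show "norm_sq T c < \<eta>" using F0' by (simp add: dist_real_def)
      qed
      also have "\<dots> = e\<^sup>2" using B by (simp add: \<eta>_def)
      finally show ?thesis using e by (meson less_imp_le power2_less_imp_less)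
    qed
    then show ?thesis using F0 by (intro exI[of _ F0] conjI allI impI) simp_all
  qed
  define P where "P = (\<lambda>M::nat. I \<inter> {..<M})"
  have P: "finite (P M)" "P M \<subseteq> I" for M by (auto simp: P_def)
  have Pbig: "\<exists>N. \<forall>M\<ge>N. F \<subseteq> P M" if F: "finite F" "F \<subseteq> I" for F
  proof -
    obtain N where N: "F \<subseteq> {..<N}" using finite_nat_bounded[OF F(1)] by blast
    show ?thesis
    proof (intro exI[of _ N] allI impI)
      fix M assume "N \<le> M"
      then have "{..<N} \<subseteq> {..<M}" by simp
      with N have "F \<subseteq> {..<M}" by (rule subset_trans)
      with F(2) show "F \<subseteq> P M" unfolding P_def by (rule Int_greatest)
    qed
  qed
  have "\<exists>h\<in>H. (\<lambda>M. L2_norm (\<lambda>y. D (P M) y - h y)) \<longlonglongrightarrow> 0"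
  proof (rule complete[OF DH])
    fix e :: real assume "e > 0"
    from tail[OF this] obtain F0 where F0: "finite F0" "F0 \<subseteq> I" and t: "\<forall>F F'. finite F \<and> finite F' \<and> F0 \<subseteq> F \<and> F0 \<subseteq> F' \<and> F \<subseteq> I \<and> F' \<subseteq> I
      \<longrightarrow> L2_norm (\<lambda>y. D F y - D F' y) < e" by (elim exE conjE)
    from Pbig[OF F0] obtain N where N: "\<forall>M\<ge>N. F0 \<subseteq> P M" by (elim exE)
    show "\<exists>N. \<forall>m\<ge>N. \<forall>l\<ge>N. L2_norm (\<lambda>x. D (P m) x - D (P l) x) < e"
      by (intro exI[of _ N] allI impI t[rule_format] conjI P) (use N in auto)
  qed
  then obtain s where s: "s \<in> H" and lim: "(\<lambda>M. L2_norm (\<lambda>y. D (P M) y - s y)) \<longlonglongrightarrow> 0" by blast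
  have hs: "L2_has_sum (\<lambda>i y. c i * g i y) s I"
    unfolding L2_has_sum_def tendsto_iff
  proof (intro allI impI)
    fix e :: real assume e: "e > 0"
    then have "e / 2 > 0" by simp
    from tail[OF this] obtain F0 where F0: "finite F0" "F0 \<subseteq> I" and t: "\<forall>F F'. finite F \<and> finite F' \<and> F0 \<subseteq> F \<and> F0 \<subseteq> F' \<and> F \<subseteq> I \<and> F' \<subseteq> I
      \<longrightarrow> L2_norm (\<lambda>y. D F y - D F' y) < e / 2" by (elim exE conjE)
    from Pbig[OF F0] obtain N where N: "\<forall>M\<ge>N. F0 \<subseteq> P M" by (elim exE)
    have "\<forall>\<^sub>F M in sequentially. N \<le> M \<and> dist (L2_norm (\<lambda>y. D (P M) y - s y)) 0 < e / 2"
      by (intro eventually_conj eventually_ge_at_top tendstoD[OF lim \<open>e / 2 > 0\<close>])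
    from eventually_happens'[OF sequentially_bot this]
    obtain M where M: "M \<ge> N" "dist (L2_norm (\<lambda>y. D (P M) y - s y)) 0 < e / 2" by (elim exE conjE)
    have "L2_norm (\<lambda>y. (\<Sum>i\<in>F. c i * g i y) - s y) < e" if F: "finite F" "F0 \<subseteq> F" "F \<subseteq> I" for F
    proof -
      have "L2_norm (\<lambda>y. D F y - s y) \<le> L2_norm (\<lambda>y. D F y - D (P M) y) + L2_norm (\<lambda>y. D (P M) y - s y)"
        by (rule norm_triangle_diff[OF DH DH s])
      also have "L2_norm (\<lambda>y. D F y - D (P M) y) < e / 2"
        by (rule t[rule_format]) (use F P N M in auto)
      finally show ?thesis using M(2) by (simp add: D_def dist_real_def)
    qed
    then show "\<forall>\<^sub>F F in finite_subsets_at_top I. dist (L2_norm (\<lambda>y. (\<Sum>i\<in>F. c i * g i y) - s y)) 0 < e"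
      unfolding eventually_finite_subsets_at_top using F0
      by (intro exI[of _ F0]) (simp add: dist_real_def)
  qed
  have nlim: "(\<lambda>M. (L2_norm (D (P M)))\<^sup>2) \<longlonglongrightarrow> (L2_norm s)\<^sup>2"
  proof (rule tendsto_power, rule LIM_zero_cancel)
    show "(\<lambda>M. L2_norm (D (P M)) - L2_norm s) \<longlonglongrightarrow> 0"
    proof (rule Lim_null_comparison[OF _ lim], rule always_eventually, rule allI)
      fix M
      have "L2_norm (D (P M)) \<le> L2_norm (\<lambda>y. D (P M) y - s y) + L2_norm s"
        using norm_triangle[OF H_diff[OF DH s] s] by simp
      moreover have "L2_norm s \<le> L2_norm (\<lambda>y. D (P M) y - s y) + L2_norm (D (P M))"
        using norm_triangle[OF H_diff[OF s DH] DH, of "P M" "P M"] norm_diff_commute[of s "D (P M)"] by simp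
      ultimately show "norm (L2_norm (D (P M)) - L2_norm s) \<le> L2_norm (\<lambda>y. D (P M) y - s y)" by simp
    qed
  qed
  have "filterlim P (finite_subsets_at_top I) sequentially"
    unfolding filterlim_finite_subsets_at_top eventually_sequentially
  proof (intro allI impI)
    fix F assume "finite F \<and> F \<subseteq> I"
    then have "finite F" "F \<subseteq> I" by simp_all
    from Pbig[OF this] obtain N where "\<forall>M\<ge>N. F \<subseteq> P M" by (elim exE)
    then show "\<exists>N. \<forall>M\<ge>N. finite (P M) \<and> F \<subseteq> P M \<and> P M \<subseteq> I" using P by (intro exI[of _ N]) simp
  qed
  from filterlim_compose[OF infsum_tendsto[OF sm] this] have qlim: "(\<lambda>M. norm_sq (P M) c) \<longlonglongrightarrow> q"
    by (simp add: norm_sq_def q_def)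
  have "A * q \<le> (L2_norm s)\<^sup>2"
    by (rule LIMSEQ_le[OF tendsto_mult_left[OF qlim] nlim]) (use low P in \<open>auto simp: D_def\<close>)
  moreover have "(L2_norm s)\<^sup>2 \<le> B * q"
    by (rule LIMSEQ_le[OF nlim tendsto_mult_left[OF qlim]]) (use up P in \<open>auto simp: D_def\<close>)
  ultimately show "\<exists>s\<in>H. L2_has_sum (\<lambda>i x. c i * g i x) s I \<and>
      A * (\<Sum>\<^sub>\<infinity>i\<in>I. (cmod (c i))\<^sup>2) \<le> (L2_norm s)\<^sup>2 \<and> (L2_norm s)\<^sup>2 \<le> B * (\<Sum>\<^sub>\<infinity>i\<in>I. (cmod (c i))\<^sup>2)"
    using hs unfolding q_def by (intro bexI[OF _ s] conjI) simp_all
qed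

lemma bessel_sequence_kernels:
  fixes x :: "nat \<Rightarrow> real ^ 'n"
  assumes B: "B > 0" and bes: "\<And>f M. f \<in> H \<Longrightarrow> (\<Sum>m<M. (cmod (f (x m)))\<^sup>2) \<le> B * (L2_norm f)\<^sup>2"
  shows "bessel_sequence H UNIV (\<lambda>m. k (x m))"
  unfolding bessel_sequence_def
proof (intro conjI exI[of _ B] B ballI kH)
  fix f assume f: "f \<in> H"
  show "(\<Sum>\<^sub>\<infinity>m\<in>UNIV. ennreal ((cmod (L2_inner f (k (x m))))\<^sup>2)) \<le> ennreal (B * (L2_norm f)\<^sup>2)"
  proof (rule infsum_le_finite_sums)
    show "(\<lambda>m. ennreal ((cmod (L2_inner f (k (x m))))\<^sup>2)) summable_on UNIV"
      by (rule nonneg_summable_on_complete) simp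
    fix F :: "nat set" assume F: "finite F"
    obtain M where M: "F \<subseteq> {..<M}" using finite_nat_bounded[OF F] by blast
    have "(\<Sum>m\<in>F. (cmod (L2_inner f (k (x m))))\<^sup>2) \<le> (\<Sum>m<M. (cmod (f (x m)))\<^sup>2)"
      unfolding reproducing[OF f, symmetric] using M by (intro sum_mono2) auto
    also have "\<dots> \<le> B * (L2_norm f)\<^sup>2" by (rule bes[OF f])
    finally show "(\<Sum>m\<in>F. ennreal ((cmod (L2_inner f (k (x m))))\<^sup>2)) \<le> ennreal (B * (L2_norm f)\<^sup>2)"
      by (simp add: sum_ennreal ennreal_leI)
  qed
qed simp

lemma homogeneous_approximation_finite:
  fixes x :: "nat \<Rightarrow> real ^ 'n"
  assumes "homogeneous_approximation H k" "bessel_sequence H UNIV (\<lambda>m. k (x m))" "\<delta> > 0"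
  obtains r where "r > 0" "\<And>y F. finite F \<Longrightarrow> (\<And>m. m \<in> F \<Longrightarrow> dist y (x m) \<ge> r) \<Longrightarrow>
    (\<Sum>m\<in>F. (cmod (L2_inner (k y) (k (x m))))\<^sup>2) \<le> \<delta>\<^sup>2"
proof -
  have "\<exists>r>0. (SUP y. \<Sum>\<^sub>\<infinity>i\<in>{i \<in> UNIV. x i \<notin> ball y r}. ennreal ((cmod (L2_inner (k y) (k (x i))))\<^sup>2)) < ennreal (\<delta>\<^sup>2)"
    using assms unfolding homogeneous_approximation_def by blast
  then obtain r where r: "r > 0" and S: "(SUP y. \<Sum>\<^sub>\<infinity>i\<in>{i \<in> UNIV. x i \<notin> ball y r}. ennreal ((cmod (L2_inner (k y) (k (x i))))\<^sup>2)) < ennreal (\<delta>\<^sup>2)"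
    by blast
  show ?thesis
  proof (rule that[OF r])
    fix y and F :: "nat set" assume F: "finite F" and far: "\<And>m. m \<in> F \<Longrightarrow> dist y (x m) \<ge> r"
    let ?f = "\<lambda>i. ennreal ((cmod (L2_inner (k y) (k (x i))))\<^sup>2)"
    have sub: "F \<subseteq> {i \<in> UNIV. x i \<notin> ball y r}" using far by (auto simp: not_less)
    have "ennreal (\<Sum>m\<in>F. (cmod (L2_inner (k y) (k (x m))))\<^sup>2) = sum ?f F" by (simp add: sum_ennreal)
    also have "\<dots> \<le> infsum ?f {i \<in> UNIV. x i \<notin> ball y r}"
      by (subst nonneg_infsum_complete) (use F sub in \<open>auto intro!: SUP_upper\<close>)
    also have "\<dots> \<le> (SUP y. \<Sum>\<^sub>\<infinity>i\<in>{i \<in> UNIV. x i \<notin> ball y r}. ennreal ((cmod (L2_inner (k y) (k (x i))))\<^sup>2))"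
      by (rule SUP_upper) simp
    also have "\<dots> \<le> ennreal (\<delta>\<^sup>2)" using S by (rule less_imp_le)
    finally show "(\<Sum>m\<in>F. (cmod (L2_inner (k y) (k (x m))))\<^sup>2) \<le> \<delta>\<^sup>2" by (subst (asm) ennreal_le_iff) auto
  qed
qed

end

section \<open>Counting points in cubes and balls\<close>

text \<open>Half-open cubes, so that they partition the space.\<close>

definition grid :: "real \<Rightarrow> int ^ 'n \<Rightarrow> (real ^ 'n) set" where
  "grid L z = {y. \<forall>i. L * of_int (z $ i) \<le> y $ i \<and> y $ i < L * (of_int (z $ i) + 1)}"

text \<open>A margin \<open>s\<close> inside each cube keeps points of different cubes at distance
  at least \<open>s\<close>, the separation that (HAP) asks for. For \<open>s = 0\<close> this is
  the closed cube.\<close>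

definition core :: "real \<Rightarrow> int ^ 'n \<Rightarrow> real \<Rightarrow> (real ^ 'n) set" where
  "core L z s = {y. \<forall>i. L * of_int (z $ i) + s \<le> y $ i \<and> y $ i \<le> L * (of_int (z $ i) + 1) - s}"

lemma grid_cover:
  fixes y :: "real ^ 'n"
  assumes "L > 0" shows "\<exists>z. y \<in> grid L z"
proof
  show "y \<in> grid L (\<chi> i. \<lfloor>y $ i / L\<rfloor>)"
    unfolding grid_def mem_Collect_eq vec_lambda_beta
  proof
    fix i
    have "real_of_int \<lfloor>y $ i / L\<rfloor> \<le> y $ i / L" "y $ i / L < real_of_int \<lfloor>y $ i / L\<rfloor> + 1" by linarith+
    then show "L * of_int \<lfloor>y $ i / L\<rfloor> \<le> y $ i \<and> y $ i < L * (of_int \<lfloor>y $ i / L\<rfloor> + 1)"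
      using assms unfolding pos_le_divide_eq[OF assms] pos_divide_less_eq[OF assms] by (simp only: mult.commute[of L])
  qed
qed

lemma grid_unique:
  assumes "L > 0" "y \<in> grid L z" "y \<in> grid L z'" shows "z = z'"
proof -
  have "z $ i = z' $ i" for i
  proof -
    have "L * of_int (z $ i) < L * (of_int (z' $ i) + 1)" "L * of_int (z' $ i) < L * (of_int (z $ i) + 1)"
      using assms(2,3) le_less_trans unfolding grid_def mem_Collect_eq by blast+
    then have "real_of_int (z $ i) < of_int (z' $ i) + 1" "real_of_int (z' $ i) < of_int (z $ i) + 1"
      using assms(1) by (simp_all add: mult_less_cancel_left_pos)
    then show ?thesis by linarith
  qed
  then show ?thesis by (simp add: Finite_Cartesian_Product.vec_eq_iff)
qed

lemma grid_disjoint: "L > 0 \<Longrightarrow> z \<noteq> z' \<Longrightarrow> grid L z \<inter> grid L z' = {}"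
  using grid_unique by blast

lemma grid_close:
  fixes y y' :: "real ^ 'n"
  assumes "y \<in> grid L z" "y' \<in> grid L z" shows "\<bar>y $ i - y' $ i\<bar> < L"
proof -
  have "L * of_int (z $ i) \<le> y $ i" "y $ i < L * (of_int (z $ i) + 1)"
    "L * of_int (z $ i) \<le> y' $ i" "y' $ i < L * (of_int (z $ i) + 1)"
    using assms by (auto simp: grid_def)
  then show ?thesis unfolding distrib_left mult_1_right by linarith
qed

lemma grid_dist:
  fixes y y' :: "real ^ 'n" and L :: real
  assumes "y \<in> grid L z" "y' \<in> grid L z" shows "dist y y' \<le> CARD('n) * L"
proof -
  have "dist y y' \<le> (\<Sum>i\<in>UNIV. \<bar>(y - y') $ i\<bar>)" unfolding dist_norm by (rule norm_le_l1_cart)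
  also have "\<dots> \<le> (\<Sum>i\<in>(UNIV::'n set). L)"
    using grid_close[OF assms] by (intro sum_mono) (simp add: less_imp_le)
  finally show ?thesis by simp
qed

lemma core_cbox: "core L z s = cbox (\<chi> i. L * of_int (z $ i) + s) (\<chi> i. L * (of_int (z $ i) + 1) - s)"
  by (auto simp: core_def mem_box_cart)

lemma core_subset_grid: "s > 0 \<Longrightarrow> core L z s \<subseteq> grid L z"
  unfolding core_def grid_def by (smt (verit) Collect_mono_iff)

lemma core_lmeasurable: "core L z s \<in> lmeasurable"
  unfolding core_cbox by simp

lemma core_measure:
  fixes z :: "int ^ 'n"
  assumes "2 * s \<le> L" shows "measure lebesgue (core L z s) = (L - 2 * s) ^ CARD('n)"
proof -
  have ne: "cbox (\<chi> i. L * of_int (z $ i) + s) (\<chi> i. L * (of_int (z $ i) + 1) - s) \<noteq> {}"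
    unfolding interval_ne_empty_cart using assms by (simp add: distrib_left)
  have "measure lebesgue (core L z s) = measure lborel (cbox (\<chi> i. L * of_int (z $ i) + s) (\<chi> i. L * (of_int (z $ i) + 1) - s))"
    unfolding core_cbox by (simp add: measure_completion)
  also have "\<dots> = (\<Prod>i\<in>(UNIV::'n set). L - 2 * s)"
    unfolding content_cbox_cart[OF ne] by (intro prod.cong refl) (simp add: algebra_simps)
  finally show ?thesis by simp
qed

lemma grid_lmeasurable: "grid L z \<in> lmeasurable"
  and grid_measure: "L > 0 \<Longrightarrow> measure lebesgue (grid L z) = L ^ CARD('n)" for z :: "int ^ 'n"
proof -
  have sub: "grid L z \<subseteq> core L z 0" by (auto simp: grid_def core_def less_imp_le)
  have "grid L z = (\<Inter>i. {y. L * of_int (z $ i) \<le> y $ i} \<inter> {y. y $ i < L * (of_int (z $ i) + 1)})"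
    by (auto simp: grid_def)
  moreover have "{y. L * of_int (z $ i) \<le> y $ i} \<inter> {y. y $ i < L * (of_int (z $ i) + 1)} \<in> sets lebesgue" for i

  proof (rule sets_completionI_sets)
    show "{y. L * of_int (z $ i) \<le> y $ i} \<inter> {y. y $ i < L * (of_int (z $ i) + 1)} \<in> sets lborel"
      using borel_closed[OF closed_halfspace_component_ge_cart] borel_open[OF open_halfspace_component_lt_cart] by auto
  qed
  ultimately have "grid L z \<in> sets lebesgue" by (simp add: sets.finite_INT)
  then show lm: "grid L z \<in> lmeasurable"
    using fmeasurableI2[OF core_lmeasurable sub] by blast
  show "measure lebesgue (grid L z) = L ^ CARD('n)" if L: "L > 0"
  proof (rule antisym)
    show "measure lebesgue (grid L z) \<le> L ^ CARD('n)"
      using measure_mono_fmeasurable[OF sub fmeasurableD[OF lm] core_lmeasurable] L by (simp add: core_measure)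
    have b: "box (\<chi> i. L * of_int (z $ i)) (\<chi> i. L * (of_int (z $ i) + 1)) \<subseteq> grid L z"
      by (auto simp: grid_def mem_box_cart less_imp_le)
    have "measure lebesgue (box (\<chi> i. L * of_int (z $ i)) (\<chi> i. L * (of_int (z $ i) + 1))) = measure lebesgue (core L z 0)"
      unfolding core_cbox by (simp add: measure_completion measure_lborel_box_eq measure_lborel_cbox_eq)
    then show "L ^ CARD('n) \<le> measure lebesgue (grid L z)"
      using measure_mono_fmeasurable[OF b _ lm] L by (simp add: core_measure)
  qed
qed

text \<open>Disjoint cubes of equal positive volume inside a set of finite measure.\<close>

lemma finite_grid:
  fixes A :: "(real ^ 'n) set"
  assumes L: "L > 0" and A: "A \<in> lmeasurable"
  shows "finite {z. grid L z \<subseteq> A}"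
proof (rule ccontr)
  assume inf: "infinite {z. grid L z \<subseteq> A}"
  obtain N :: nat where N: "measure lebesgue A / L ^ CARD('n) < N" using reals_Archimedean2 by blast
  obtain F where F: "finite F" "card F = N" "F \<subseteq> {z. grid L z \<subseteq> A}"
    using infinite_arbitrarily_large[OF inf] by blast
  have "N * L ^ CARD('n) = (\<Sum>z\<in>F. measure lebesgue (grid L z))" using F(2) L by (simp add: grid_measure)
  also have "\<dots> = measure lebesgue (\<Union>z\<in>F. grid L z)"
    by (rule measure_UNION'[OF F(1), symmetric]) (use grid_disjoint[OF L] in \<open>auto simp: grid_lmeasurable pairwise_def disjnt_def\<close>)
  also have "\<dots> \<le> measure lebesgue A"
    by (rule measure_mono_fmeasurable[OF _ _ A]) (use F in \<open>auto intro!: sets.finite_UN fmeasurableD[OF grid_lmeasurable]\<close>)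
  finally have "N * L ^ CARD('n) \<le> measure lebesgue A" .
  then show False using N L by (simp add: pos_divide_less_eq)
qed

lemma core_separated:
  fixes y y' :: "real ^ 'n"
  assumes L: "L > 0" and y: "y \<in> core L z s" "y' \<in> core L z' s" and z: "z \<noteq> z'" and s: "s \<ge> 0"
  shows "dist y y' \<ge> s"
proof -
  obtain i where i: "z $ i \<noteq> z' $ i" using z by (auto simp: Finite_Cartesian_Product.vec_eq_iff)
  have b: "L * of_int (z $ i) + s \<le> y $ i" "y $ i \<le> L * (of_int (z $ i) + 1) - s"
    "L * of_int (z' $ i) + s \<le> y' $ i" "y' $ i \<le> L * (of_int (z' $ i) + 1) - s"
    using y by (auto simp: core_def)
  have "s \<le> \<bar>y $ i - y' $ i\<bar>"
  proof (cases "z $ i < z' $ i")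
    case True
    then have "real_of_int (z $ i) + 1 \<le> of_int (z' $ i)" by linarith
    then have "L * (real_of_int (z $ i) + 1) \<le> L * of_int (z' $ i)" using L by simp
    then show ?thesis using b s by linarith
  next
    case False
    then have "real_of_int (z' $ i) + 1 \<le> of_int (z $ i)" using i by linarith
    then have "L * (real_of_int (z' $ i) + 1) \<le> L * of_int (z $ i)" using L by simp
    then show ?thesis using b s by linarith
  qed
  also have "\<dots> \<le> dist y y'" using dist_vec_nth_le[of y i y'] by (simp add: dist_real_def)
  finally show ?thesis .
qed

section \<open>The measure \<open>mu\<close> on cubes and balls\<close>

context admissible_kernel_space begin

lemma mu_nonneg: "mu A \<ge> 0"
  unfolding mu_def by (rule integral_nonneg_AE) (simp add: knorm_nonneg)

lemma mu_UN:
  assumes F: "finite F" and A: "\<And>i. i \<in> F \<Longrightarrow> A i \<in> lmeasurable"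
    and dis: "\<And>i j. i \<in> F \<Longrightarrow> j \<in> F \<Longrightarrow> i \<noteq> j \<Longrightarrow> A i \<inter> A j = {}"
  shows "mu (\<Union>i\<in>F. A i) = (\<Sum>i\<in>F. mu (A i))"
proof -
  have "(\<Sum>i\<in>F. indicator (A i) y) = (indicator (\<Union>i\<in>F. A i) y :: real)" for y
    using dis by (intro indicator_UN_disjoint[symmetric] F) (auto simp: disjoint_family_on_def)
  then have "mu (\<Union>i\<in>F. A i) = (LINT y|lebesgue. (\<Sum>i\<in>F. indicator (A i) y * knorm y))"
    unfolding mu_def sum_distrib_right[symmetric] by simp
  also have "\<dots> = (\<Sum>i\<in>F. mu (A i))"
    unfolding mu_def by (rule Bochner_Integration.integral_sum) (rule mu_integrable[OF A])
  finally show ?thesis .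
qed

lemma mu_subset:
  assumes A: "A \<in> lmeasurable" and B: "B \<in> lmeasurable" and AB: "A \<subseteq> B"
  shows "mu A \<le> mu B" "mu B - C2 * (measure lebesgue B - measure lebesgue A) \<le> mu A"
proof -
  have D: "B - A \<in> lmeasurable" by (rule fmeasurable_Diff[OF B fmeasurableD[OF A]])
  have "mu (\<Union>b. (if b then A else B - A)) = (\<Sum>b\<in>UNIV. mu (if b then A else B - A))"
    by (rule mu_UN) (use A D in auto)
  moreover have "(\<Union>b. (if b then A else B - A)) = B" using AB by auto
  ultimately have s: "mu B = mu A + mu (B - A)" by (simp add: UNIV_bool)
  then show "mu A \<le> mu B" using mu_nonneg[of "B - A"] by linarith
  have "mu (B - A) \<le> C2 * measure lebesgue (B - A)" by (rule mu_bounds(2)[OF D])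
  also have "measure lebesgue (B - A) = measure lebesgue B - measure lebesgue A"
    using A B AB by (simp add: measurable_measure_Diff fmeasurableD)
  finally show "mu B - C2 * (measure lebesgue B - measure lebesgue A) \<le> mu A" using s by linarith
qed

lemma nn_integral_kernel_fun:
  assumes A: "A \<in> lmeasurable"
  shows "(\<integral>\<^sup>+y\<in>A. ennreal (Re (kernel_fun k y y)) \<partial>lebesgue) = ennreal (mu A)"
proof -
  have "Re (kernel_fun k y y) = knorm y" for y
    unfolding kernel_fun_def L2_inner_self knorm_def by (rule Re_complex_of_real)
  then have "(\<integral>\<^sup>+y\<in>A. ennreal (Re (kernel_fun k y y)) \<partial>lebesgue) = (\<integral>\<^sup>+y. ennreal (indicator A y * knorm y) \<partial>lebesgue)"
    by (intro nn_integral_cong) (auto simp: indicator_def)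
  also have "\<dots> = ennreal (mu A)"
    unfolding mu_def by (rule nn_integral_eq_integral[OF mu_integrable[OF A]]) (simp add: knorm_nonneg)
  finally show ?thesis .
qed

end

text \<open>The boundary layer of fixed width of a large cube or ball has small relative
  volume.\<close>

lemma eventually_shrink:
  fixes c \<rho> :: real
  assumes "\<rho> > 0"
  shows "\<forall>\<^sub>F L in at_top. L ^ n - (L - c) ^ n \<le> \<rho> * L ^ n"
proof -
  have "((\<lambda>L::real. (1 - c * inverse L) ^ n) \<longlongrightarrow> (1 - c * 0) ^ n) at_top"
    by (intro tendsto_intros tendsto_inverse_0_at_top filterlim_ident)
  then have "\<forall>\<^sub>F L in at_top. (1 - c * inverse L) ^ n > 1 - \<rho>"
    by (rule order_tendstoD(1)) (use assms in simp)
  then show ?thesis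
    using eventually_gt_at_top[of "0::real"]
  proof eventually_elim
    case (elim L)
    have "(L - c) ^ n = L ^ n * (1 - c * inverse L) ^ n"
    proof -
      have "L - c = L * (1 - c * inverse L)" using elim by (simp add: right_diff_distrib)
      then show ?thesis by (metis power_mult_distrib)
    qed
    also have "\<dots> \<ge> L ^ n * (1 - \<rho>)" using elim by (intro mult_left_mono) auto
    finally show ?case by (simp add: algebra_simps)
  qed
qed

lemma lattice_enumeration:
  obtains f :: "nat \<Rightarrow> int ^ 'n" where "bij f"
proof -
  have "infinite (UNIV :: (int ^ 'n) set)"
  proof
    assume "finite (UNIV :: (int ^ 'n) set)"
    then have "finite (range (\<lambda>z :: int ^ 'n. z $ undefined))" by (rule finite_imageI)
    moreover have "range (\<lambda>z :: int ^ 'n. z $ undefined) = UNIV"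
      by (auto simp: image_iff intro!: exI[of _ "\<chi> i. _"])
    ultimately show False by (simp add: infinite_UNIV_int)
  qed
  then have "bij_betw (from_nat_into (UNIV :: (int ^ 'n) set)) UNIV UNIV"
    by (intro bij_betw_from_nat_into) (simp_all add: countableI_type)
  then show ?thesis by (rule that)
qed

text \<open>Bernoulli's inequality for the five factors \<open>1 - \<theta>\<close> accounts for
  \<open>5 * \<theta>\<close>, the Bessel bound
  \<open>1 + 3 * \<theta> + 2 * \<theta>\<^sup>2\<close> for the other
  \<open>3 * \<theta>\<close>.\<close>

lemma density_arith:
  fixes \<theta> :: real
  assumes "0 < \<theta>" "\<theta> < 1"
  shows "1 - 8 * \<theta> \<le> (1 - \<theta>) ^ 5 / ((1 + \<theta>) * (1 + 2 * \<theta>))"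
proof -
  have "1 + real 5 * (- \<theta>) \<le> (1 + - \<theta>) ^ 5"
    by (rule Bernoulli_inequality) (use assms in simp)
  then have b: "1 - 5 * \<theta> \<le> (1 - \<theta>) ^ 5" by simp
  have "(1 - 8 * \<theta>) * ((1 + \<theta>) * (1 + 2 * \<theta>)) = 1 - 5 * \<theta> - (22 * \<theta>\<^sup>2 + 16 * \<theta> ^ 3)"
    by (simp add: algebra_simps power2_eq_square power3_eq_cube)
  also have "\<dots> \<le> 1 - 5 * \<theta>"
  proof -
    have "0 \<le> 22 * \<theta>\<^sup>2 + 16 * \<theta> ^ 3" using assms by (intro add_nonneg_nonneg mult_nonneg_nonneg) auto
    then show ?thesis by linarith
  qed
  also note b
  finally show ?thesis using assms by (simp add: pos_le_divide_eq)
qed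

section \<open>Counts in cubes and in balls, and the density\<close>

context admissible_kernel_space begin

text \<open>The constants are fixed in this order: the side \<open>h\<close> of the cells, the
  points and weights, the Bessel bound \<open>B\<close>, the parameters up to
  \<open>\<delta>\<close>, the distance \<open>r\<close> from (HAP), and last the side
  \<open>L\<close>. The count loses \<open>8 * \<theta>\<close> by \<open>density_arith\<close> and
  one more \<open>\<theta>\<close> for the additive constant \<open>K\<close>.\<close>

lemma cube_counts:
  assumes HAP: "homogeneous_approximation H k" and \<theta>: "0 < \<theta>" "\<theta> < 1"
  obtains x :: "nat \<Rightarrow> real ^ 'n" and U :: "int ^ 'n \<Rightarrow> nat set" and \<Lambda> L
  where "L > 0" "\<And>z. finite (U z)" "\<And>z m. m \<in> U z \<Longrightarrow> x m \<in> grid L z"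
    "\<And>z. (1 - 9 * \<theta>) * mu (grid L z) \<le> card (\<Lambda> \<inter> U z)" "riesz_sequence H \<Lambda> (\<lambda>m. k (x m))"
proof -
  let ?n = "CARD('n)"
  have n1: "?n \<ge> 1" by (simp add: Suc_leI)
  define X where "X = (1 + \<theta>) * (1 + 2 * \<theta>)"
  have X: "X > 0" using \<theta> by (simp add: X_def)
  \<comment> \<open>The bound 1 gives \<open>h ^ CARD('n) \<le> h\<close>, so the volume of a cell
    meets the smallness condition in every dimension.\<close>
  define h where "h = min 1 (\<theta>\<^sup>2 / C2)"
  have h: "h > 0" "h \<le> 1" using C2_pos \<theta> by (simp_all add: h_def)
  have "h ^ ?n \<le> h ^ 1" by (rule power_decreasing[OF n1]) (use h in auto)
  also have "\<dots> \<le> \<theta>\<^sup>2 / C2" by (simp add: h_def)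
  finally have hv: "C2 * h ^ ?n \<le> \<theta>\<^sup>2" using C2_pos by (simp add: field_simps)
  obtain f :: "nat \<Rightarrow> int ^ 'n" where f: "bij f" by (rule lattice_enumeration)
  define c where "c = (\<lambda>m. grid h (f m))"
  have c: "c m \<in> lmeasurable" "measure lebesgue (c m) = h ^ ?n" for m
    using h by (simp_all add: c_def grid_lmeasurable grid_measure)
  have cdis: "c l \<inter> c m = {}" if "l \<noteq> m" for l m
    unfolding c_def using that f h by (intro grid_disjoint) (auto simp: bij_def inj_eq)
  then have "disjoint_family c" by (auto simp: disjoint_family_on_def)
  then obtain x w where xc: "\<And>m. x m \<in> c m" and w: "\<And>m. w m > 0"
    and wlow: "\<And>m. (1 - \<theta>) * mu (c m) \<le> w m * knorm (x m)"
    and bes: "\<And>f M. f \<in> H \<Longrightarrow> (\<Sum>m<M. w m * (cmod (f (x m)))\<^sup>2) \<le> X * (L2_norm f)\<^sup>2"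
  proof (rule bessel_points[OF \<theta> c _ _ hv])
    fix x w
    assume "\<And>m. x m \<in> c m" "\<And>m. w m > 0" "\<And>m. (1 - \<theta>) * mu (c m) \<le> w m * knorm (x m)"
      "\<And>f M. f \<in> H \<Longrightarrow> (\<Sum>m<M. w m * (cmod (f (x m)))\<^sup>2) \<le> (1 + \<theta>) * (1 + 2 * \<theta>) * (L2_norm f)\<^sup>2"
    then show thesis unfolding X_def[symmetric] by (rule that)
  qed (use h in auto)
  \<comment> \<open>All cells have the same volume, which bounds the weights from below. The kernels
    without weights are therefore a Bessel family, and this is the one to which (HAP) is
    applied.\<close>
  define w0 where "w0 = (1 - \<theta>) * (C1 * h ^ ?n) / C2"
  have w0: "w0 > 0" using \<theta> C1(1) C2_pos h by (simp add: w0_def)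
  have ww0: "w0 \<le> w m" for m
  proof -
    have "(1 - \<theta>) * (C1 * h ^ ?n) \<le> (1 - \<theta>) * mu (c m)"
      using mu_bounds(1)[OF c(1), of m] \<theta> unfolding c(2) by (intro mult_left_mono) auto
    also have "\<dots> \<le> w m * knorm (x m)" by (rule wlow)
    also have "\<dots> \<le> w m * C2" using knorm_le w by (intro mult_left_mono) (auto simp: less_imp_le)
    finally show ?thesis using C2_pos by (simp add: w0_def pos_divide_le_eq)
  qed
  define B where "B = X / w0"
  have B: "B > 0" using X w0 by (simp add: B_def)
  have bes1: "(\<Sum>m<M. (cmod (f (x m)))\<^sup>2) \<le> B * (L2_norm f)\<^sup>2" if "f \<in> H" for f M
  proof -
    have "w0 * (\<Sum>m<M. (cmod (f (x m)))\<^sup>2) \<le> (\<Sum>m<M. w m * (cmod (f (x m)))\<^sup>2)"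
      unfolding sum_distrib_left by (intro sum_mono mult_right_mono ww0) simp
    also have "\<dots> \<le> X * (L2_norm f)\<^sup>2" by (rule bes[OF that])
    finally show ?thesis using w0 by (simp add: B_def field_simps)
  qed
  have up: "(L2_norm (\<lambda>y. \<Sum>i\<in>F. d i * k (x i) y))\<^sup>2 \<le> B * norm_sq F d" if F: "finite F" for F d
  proof (rule synthesis_bound[OF F kH less_imp_le[OF B]])
    fix u assume u: "u \<in> H"
    obtain M where M: "F \<subseteq> {..<M}" using finite_nat_bounded[OF F] by blast
    have "(\<Sum>i\<in>F. (cmod (L2_inner u (k (x i))))\<^sup>2) \<le> (\<Sum>m<M. (cmod (u (x m)))\<^sup>2)"
      unfolding reproducing[OF u, symmetric] using M by (intro sum_mono2) auto
    also have "\<dots> \<le> B * (L2_norm u)\<^sup>2" by (rule bes1[OF u])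
    finally show "(\<Sum>i\<in>F. (cmod (L2_inner u (k (x i))))\<^sup>2) \<le> B * (L2_norm u)\<^sup>2" .
  qed
  text \<open>The constants satisfy \<open>2 / e + 2 * \<tau> / a = \<beta>\<close> and \<open>1 / (3 * K * \<beta>) = 2 * a\<close>, so that
    the lower Riesz bound becomes \<open>a\<close>.\<close>
  define K where "K = nat \<lceil>1 / \<theta>\<rceil>"
  have "1 / \<theta> \<le> K" unfolding K_def by (rule real_nat_ceiling_ge)
  then have K: "1 \<le> \<theta> * K" using \<theta> by (simp add: field_simps)
  then have K0: "real K > 0" using \<theta> by (cases K) auto
  \<comment> \<open>As \<open>knorm\<close> is at least \<open>C1\<close>, subtracting
    \<open>e\<close> from it costs at most a factor \<open>1 - \<theta>\<close>.\<close>
  define e where "e = \<theta> * C1"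
  define a where "a = e / (24 * K)"
  define \<tau> where "\<tau> = 1 / (24 * real K)"
  define \<beta> where "\<beta> = 1 / (6 * K * a)"
  have e: "e > 0" and a: "a > 0" and \<tau>: "\<tau> > 0"
    using \<theta> C1(1) K0 by (simp_all add: e_def a_def \<tau>_def)
  have \<beta>: "2 / e + 2 * \<tau> / a \<le> \<beta>"
  proof -
    have "e = 24 * K * a" using K0 by (simp add: a_def)
    then show ?thesis using K0 a by (simp add: \<beta>_def \<tau>_def field_simps)
  qed
  have aa: "1 / (3 * real K * \<beta>) - a = a" using K0 a by (simp add: \<beta>_def field_simps)
  define \<delta> where "\<delta> = sqrt (\<theta> * (\<tau> * a\<^sup>2))"
  have \<delta>: "\<delta> > 0" "\<delta>\<^sup>2 = \<theta> * (\<tau> * a\<^sup>2)" using \<theta> \<tau> a by (simp_all add: \<delta>_def)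
  obtain r where r: "r > 0" and far: "\<And>y F. finite F \<Longrightarrow> (\<And>m. m \<in> F \<Longrightarrow> dist y (x m) \<ge> r) \<Longrightarrow>
    (\<Sum>m\<in>F. (cmod (L2_inner (k y) (k (x m))))\<^sup>2) \<le> \<delta>\<^sup>2"
  proof (rule homogeneous_approximation_finite[OF HAP bessel_sequence_kernels[OF B bes1] \<delta>(1)])
    fix r :: real
    assume "r > 0" "\<And>y F. finite F \<Longrightarrow> (\<And>m. m \<in> F \<Longrightarrow> dist y (x m) \<ge> r) \<Longrightarrow>
      (\<Sum>m\<in>F. (cmod (L2_inner (k y) (k (x m))))\<^sup>2) \<le> \<delta>\<^sup>2"
    then show thesis by (rule that)
  qed
  \<comment> \<open>The bound \<open>K / (\<theta> * C1)\<close> makes \<open>K\<close> at most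
    \<open>\<theta>\<close> times the mass of a cube, with \<open>L \<le> L ^ CARD('n)\<close>
    because \<open>L \<ge> 1\<close>. The last condition makes the margin \<open>r + h\<close> cost
    at most the same amount; the summand \<open>h\<close> allows for the distance between a cell's
    point and the rest of the cell.\<close>
  have "\<forall>\<^sub>F L :: real in at_top. 0 < L \<and> 2 * (r + h) \<le> L \<and> 1 \<le> L \<and> K / (\<theta> * C1) \<le> L \<and>
    L ^ ?n - (L - 2 * (r + h)) ^ ?n \<le> \<theta> * C1 / C2 * L ^ ?n"
    by (intro eventually_conj eventually_gt_at_top eventually_ge_at_top eventually_shrink)
      (use \<theta> C1(1) C2_pos in simp)
  then obtain L :: real where L: "L > 0" "2 * (r + h) \<le> L" "1 \<le> L" "K / (\<theta> * C1) \<le> L"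
    and Ls: "L ^ ?n - (L - 2 * (r + h)) ^ ?n \<le> \<theta> * C1 / C2 * L ^ ?n"
    by (elim eventually_happens'[OF trivial_limit_at_top_linorder, THEN exE] conjE)
  \<comment> \<open>Only points in the core are used, so that those of different cubes are at
    distance at least \<open>r\<close>.\<close>
  define U where "U = (\<lambda>z. {m. x m \<in> core L z r})"
  have Ug: "x m \<in> grid L z" if "m \<in> U z" for m z
    using that core_subset_grid[OF r] by (auto simp: U_def)
  have Udis: "U z \<inter> U z' = {}" if "z \<noteq> z'" for z z'
    using Ug grid_unique[OF L(1)] that by blast
  have Ufin: "finite (U z)" for z
  proof -
    have "f ` U z \<subseteq> {y. grid h y \<subseteq> core L z (r - h)}"
    proof safe
      fix m y assume m: "m \<in> U z" and y: "y \<in> grid h (f m)"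
      have "\<bar>y $ i - x m $ i\<bar> < h" for i using xc[of m] y by (intro grid_close) (auto simp: c_def)
      then have "x m $ i - h \<le> y $ i \<and> y $ i \<le> x m $ i + h" for i by (smt (verit))
      then show "y \<in> core L z (r - h)" using m unfolding U_def core_def by (smt (verit) mem_Collect_eq)
    qed
    then have "finite (f ` U z)" by (rule finite_subset) (rule finite_grid[OF h(1) core_lmeasurable])
    then show ?thesis by (rule finite_imageD) (use f in \<open>auto simp: bij_def intro: inj_on_subset\<close>)
  qed
  obtain \<Lambda> where LU: "\<Lambda> \<subseteq> (\<Union>z. U z)"
    and cnt: "\<And>z. (1 - \<theta>)\<^sup>2 * ((\<Sum>m\<in>U z. w m * (knorm (x m) - e)) / X) - K \<le> card (\<Lambda> \<inter> U z)"
    and low: "\<And>F d. finite F \<Longrightarrow> F \<subseteq> \<Lambda> \<Longrightarrow> (1 / (3 * real K * \<beta>) - a) * norm_sq F d \<le> (L2_norm (\<lambda>y. \<Sum>i\<in>F. d i * k (x i) y))\<^sup>2"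
  proof (rule riesz_subfamily[OF w X bes Ufin Udis a e \<tau> \<beta> \<theta> K])
    show "\<delta>\<^sup>2 \<le> \<theta> * (\<tau> * a\<^sup>2)" unfolding \<delta>(2) ..
    fix z m and F :: "nat set" assume m: "m \<in> U z" and F: "finite F" "F \<subseteq> (\<Union>z'\<in>- {z}. U z')"
    show "(\<Sum>l\<in>F. (cmod (gram x l m))\<^sup>2) \<le> \<delta>\<^sup>2"
      unfolding gram_def
    proof (rule far[OF F(1)])
      fix l assume "l \<in> F"
      then obtain z' where "z' \<noteq> z" "l \<in> U z'" using F(2) by auto
      then show "dist (x m) (x l) \<ge> r"
        using m r L(1) core_separated[of L "x m" z r "x l" z'] by (auto simp: U_def)
    qed
  next
    fix \<Lambda>
    assume "\<Lambda> \<subseteq> (\<Union>z. U z)"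
      "\<And>z. (1 - \<theta>)\<^sup>2 * ((\<Sum>m\<in>U z. w m * (knorm (x m) - e)) / X) - K \<le> card (\<Lambda> \<inter> U z)"
      "\<And>F d. finite F \<Longrightarrow> F \<subseteq> \<Lambda> \<Longrightarrow> (1 / (3 * real K * \<beta>) - a) * norm_sq F d \<le> (L2_norm (\<lambda>y. \<Sum>i\<in>F. d i * k (x i) y))\<^sup>2"
    then show thesis by (rule that)
  qed
  have count: "(1 - 9 * \<theta>) * mu (grid L z) \<le> card (\<Lambda> \<inter> U z)" for z
  proof -
    let ?m = "mu (grid L z)"
    have gl: "C1 * L ^ ?n \<le> ?m" using mu_bounds(1)[OF grid_lmeasurable, of L z] L(1) by (simp add: grid_measure)
    \<comment> \<open>A cell that meets the smaller core has its point within \<open>h\<close> in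
      each coordinate, hence in the core with margin \<open>r\<close>.\<close>
    have sub: "core L z (r + h) \<subseteq> (\<Union>m\<in>U z. c m)"
    proof
      fix y assume y: "y \<in> core L z (r + h)"
      obtain z' where z': "y \<in> grid h z'" using grid_cover[OF h(1)] by blast
      obtain m where m: "f m = z'" using f by (metis bij_pointE)
      have "\<bar>y $ i - x m $ i\<bar> < h" for i using xc[of m] z' m by (intro grid_close) (auto simp: c_def)
      then have "x m $ i - h \<le> y $ i \<and> y $ i \<le> x m $ i + h" for i by (smt (verit))
      then have "x m \<in> core L z r" using y unfolding core_def by (smt (verit) mem_Collect_eq)
      then show "y \<in> (\<Union>m\<in>U z. c m)" using z' m by (auto simp: U_def c_def)
    qed
    have "(1 - \<theta>) * ?m \<le> ?m - \<theta> * (C1 * L ^ ?n)"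
      using mult_left_mono[OF gl, of \<theta>] \<theta> by (simp add: algebra_simps)
    also have "\<dots> \<le> ?m - C2 * (L ^ ?n - (L - 2 * (r + h)) ^ ?n)"
      using mult_left_mono[OF Ls, of C2] C2_pos by simp
    also have "\<dots> = ?m - C2 * (measure lebesgue (grid L z) - measure lebesgue (core L z (r + h)))"
      using L by (simp add: grid_measure core_measure)
    also have "\<dots> \<le> mu (core L z (r + h))"
      using r h by (intro mu_subset(2) core_lmeasurable grid_lmeasurable core_subset_grid) simp
    also have "\<dots> \<le> mu (\<Union>m\<in>U z. c m)"
      by (rule mu_subset(1)[OF core_lmeasurable _ sub]) (intro fmeasurable.finite_UN Ufin c(1))
    also have "\<dots> = (\<Sum>m\<in>U z. mu (c m))"
      by (rule mu_UN[OF Ufin c(1) cdis])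
    finally have 1: "(1 - \<theta>) * ?m \<le> (\<Sum>m\<in>U z. mu (c m))" .
    have "(1 - \<theta>) ^ 3 * ?m = (1 - \<theta>)\<^sup>2 * ((1 - \<theta>) * ?m)" by (simp add: power3_eq_cube power2_eq_square)
    also have "\<dots> \<le> (1 - \<theta>)\<^sup>2 * (\<Sum>m\<in>U z. mu (c m))" by (rule mult_left_mono[OF 1]) simp
    also have "\<dots> \<le> (\<Sum>m\<in>U z. w m * (knorm (x m) - e))"
      unfolding sum_distrib_left
    proof (rule sum_mono)
      fix m
      have "e \<le> \<theta> * knorm (x m)" unfolding e_def using \<theta> C1(2) by (intro mult_left_mono) auto
      then have "w m * ((1 - \<theta>) * knorm (x m)) \<le> w m * (knorm (x m) - e)"
        using w[of m] by (intro mult_left_mono) (auto simp: algebra_simps)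
      moreover have "(1 - \<theta>) * ((1 - \<theta>) * mu (c m)) \<le> (1 - \<theta>) * (w m * knorm (x m))"
        using \<theta> wlow by (intro mult_left_mono) auto
      ultimately show "(1 - \<theta>)\<^sup>2 * mu (c m) \<le> w m * (knorm (x m) - e)"
        by (simp add: power2_eq_square mult_ac)
    qed
    finally have "(1 - \<theta>) ^ 3 * ?m / X \<le> (\<Sum>m\<in>U z. w m * (knorm (x m) - e)) / X"
      using X by (intro divide_right_mono) auto
    then have "(1 - \<theta>)\<^sup>2 * ((1 - \<theta>) ^ 3 * ?m / X) \<le> (1 - \<theta>)\<^sup>2 * ((\<Sum>m\<in>U z. w m * (knorm (x m) - e)) / X)"
      by (rule mult_left_mono) simp
    moreover have "(1 - \<theta>)\<^sup>2 * ((1 - \<theta>) ^ 3 * ?m / X) = (1 - \<theta>) ^ 5 / X * ?m"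
      by (simp add: power_add[symmetric] mult.assoc[symmetric])
    moreover have "(1 - 8 * \<theta>) * ?m \<le> (1 - \<theta>) ^ 5 / X * ?m"
      unfolding X_def by (rule mult_right_mono[OF density_arith[OF \<theta>] mu_nonneg])
    moreover have "K \<le> \<theta> * ?m"
    proof -
      have "K \<le> \<theta> * C1 * L" using L(4) \<theta> C1(1) by (simp add: field_simps)
      also have "\<dots> \<le> \<theta> * C1 * L ^ ?n"
        using self_le_power[OF L(3), of ?n] \<theta> C1(1) by (intro mult_left_mono) auto
      also have "\<dots> \<le> \<theta> * ?m" using mult_left_mono[OF gl, of \<theta>] \<theta> by (simp add: mult.assoc)
      finally show ?thesis .
    qed
    ultimately show ?thesis using cnt[of z] by (simp add: algebra_simps)
  qed
  have rs: "riesz_sequence H \<Lambda> (\<lambda>m. k (x m))"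
    by (rule riesz_sequence_finite[OF kH a B]) (use low up in \<open>auto simp: aa\<close>)
  show ?thesis by (rule that[OF L(1) Ufin Ug count rs])
qed

lemma ball_measure:
  fixes x :: "real ^ 'n"
  assumes "R \<ge> 0"
  shows "ball x R \<in> lmeasurable" "measure lebesgue (ball x R) = unit_ball_vol CARD('n) * R ^ CARD('n)"
  using content_ball[OF assms, of x] by (simp_all add: measure_completion)

text \<open>Cubes have diameter at most \<open>D\<close>, so those inside a ball of radius
  \<open>R\<close> cover the concentric ball of radius \<open>R - D\<close>. For large
  \<open>R\<close> this keeps at least a fraction \<open>q\<close> of the mass, uniformly in the
  centre, and that is the second factor \<open>q\<close>.\<close>

lemma count_in_balls:
  fixes x :: "nat \<Rightarrow> real ^ 'n" and L q :: real
  assumes L: "L > 0" and U: "\<And>z. finite (U z)" "\<And>z m. m \<in> U z \<Longrightarrow> x m \<in> grid L z"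
    and cnt: "\<And>z. q * mu (grid L z) \<le> card (\<Lambda> \<inter> U z)" and q: "0 \<le> q" "q < 1"
  shows "\<forall>\<^sub>F R in at_top. \<forall>y. ennreal (q * q) \<le> emeasure (count_space \<Lambda>) {i \<in> \<Lambda>. x i \<in> ball y R} / ennreal (mu (ball y R))"
proof -
  let ?n = "CARD('n)"
  define D where "D = ?n * L"
  have D: "D \<ge> 0" using L by (simp add: D_def)
  have "(1 - q) * C1 / C2 > 0" using q C1(1) C2_pos by simp
  from eventually_shrink[OF this, of ?n D] eventually_gt_at_top[of D] show ?thesis
  proof eventually_elim
    case (elim R)
    have R: "R > 0" "R - D \<ge> 0" using elim D by linarith+
    show ?case
    proof
      fix y :: "real ^ 'n"
      let ?v = "unit_ball_vol (real ?n)"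
      have v: "?v > 0" by (simp add: unit_ball_vol_pos)
      have bR: "ball y R \<in> lmeasurable" "measure lebesgue (ball y R) = ?v * R ^ ?n"
        by (rule ball_measure, use R in simp)+
      have bD: "ball y (R - D) \<in> lmeasurable" "measure lebesgue (ball y (R - D)) = ?v * (R - D) ^ ?n"
        by (rule ball_measure, use R in simp)+
      define J where "J = {z. grid L z \<subseteq> ball y R}"
      have J: "finite J" unfolding J_def by (rule finite_grid[OF L bR(1)])
      have cover: "ball y (R - D) \<subseteq> (\<Union>z\<in>J. grid L z)"
      proof
        fix u assume u: "u \<in> ball y (R - D)"
        obtain z where z: "u \<in> grid L z" using grid_cover[OF L] by blast
        have "grid L z \<subseteq> ball y R"
        proof
          fix u' assume "u' \<in> grid L z"
          then have "dist u u' \<le> D" unfolding D_def using z by (intro grid_dist)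
          then show "u' \<in> ball y R" using u dist_triangle[of y u' u] by simp
        qed
        then show "u \<in> (\<Union>z\<in>J. grid L z)" using z by (auto simp: J_def)
      qed
      have lowm: "C1 * (?v * R ^ ?n) \<le> mu (ball y R)" using mu_bounds(1)[OF bR(1)] bR(2) by simp
      have mpos: "mu (ball y R) > 0"
        using lowm C1(1) v R by (intro less_le_trans[OF _ lowm] mult_pos_pos) auto
      have "q * mu (ball y R) \<le> mu (ball y R) - (1 - q) * (C1 * (?v * R ^ ?n))"
        using mult_left_mono[OF lowm, of "1 - q"] q by (simp add: algebra_simps)
      also have "\<dots> = mu (ball y R) - C2 * ?v * ((1 - q) * C1 / C2 * R ^ ?n)"
        using C2_pos by simp
      also have "\<dots> \<le> mu (ball y R) - C2 * ?v * (R ^ ?n - (R - D) ^ ?n)"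
        using mult_left_mono[OF elim(1), of "C2 * ?v"] C2_pos v by simp
      also have "\<dots> = mu (ball y R) - C2 * (measure lebesgue (ball y R) - measure lebesgue (ball y (R - D)))"
        unfolding bR(2) bD(2) by (simp add: algebra_simps)
      also have "\<dots> \<le> mu (ball y (R - D))"
        by (rule mu_subset(2)[OF bD(1) bR(1)]) (use D in auto)
      also have "\<dots> \<le> mu (\<Union>z\<in>J. grid L z)"
        by (rule mu_subset(1)[OF bD(1) _ cover]) (intro fmeasurable.finite_UN J grid_lmeasurable)
      also have "\<dots> = (\<Sum>z\<in>J. mu (grid L z))"
        by (rule mu_UN[OF J grid_lmeasurable grid_disjoint[OF L]])
      finally have "q * (q * mu (ball y R)) \<le> q * (\<Sum>z\<in>J. mu (grid L z))"
        by (rule mult_left_mono) (rule q)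
      also have "\<dots> \<le> (\<Sum>z\<in>J. real (card (\<Lambda> \<inter> U z)))"
        unfolding sum_distrib_left by (rule sum_mono) (rule cnt)
      also have "\<dots> = real (card (\<Union>z\<in>J. \<Lambda> \<inter> U z))"
      proof -
        have "card (\<Union>z\<in>J. \<Lambda> \<inter> U z) = (\<Sum>z\<in>J. card (\<Lambda> \<inter> U z))"
        proof (rule card_UN_disjoint[OF J])
          show "\<forall>z\<in>J. finite (\<Lambda> \<inter> U z)" using U(1) by simp
          show "\<forall>z\<in>J. \<forall>z'\<in>J. z \<noteq> z' \<longrightarrow> \<Lambda> \<inter> U z \<inter> (\<Lambda> \<inter> U z') = {}"
          proof (intro ballI impI)
            fix z z' :: "int ^ 'n" assume "z \<noteq> z'"
            from grid_disjoint[OF L this] show "\<Lambda> \<inter> U z \<inter> (\<Lambda> \<inter> U z') = {}"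
              using U(2)[of _ z] U(2)[of _ z'] by blast
          qed
        qed
        then show ?thesis by simp
      qed
      finally have q2: "q * q * mu (ball y R) \<le> real (card (\<Union>z\<in>J. \<Lambda> \<inter> U z))" by (simp add: mult.assoc)
      let ?S = "{i \<in> \<Lambda>. x i \<in> ball y R}"
      have sub: "(\<Union>z\<in>J. \<Lambda> \<inter> U z) \<subseteq> ?S"
        using U(2) unfolding J_def by blast
      have "ennreal (q * q) = ennreal (q * q * mu (ball y R)) / ennreal (mu (ball y R))"
        using mpos q by (subst divide_ennreal) auto
      also have "\<dots> \<le> emeasure (count_space \<Lambda>) ?S / ennreal (mu (ball y R))"
      proof (rule divide_right_mono_ennreal)
        show "ennreal (q * q * mu (ball y R)) \<le> emeasure (count_space \<Lambda>) ?S"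
        proof (cases "finite ?S")
          case True
          have "q * q * mu (ball y R) \<le> real (card ?S)"
            using q2 card_mono[OF True sub] by linarith
          then have "ennreal (q * q * mu (ball y R)) \<le> ennreal (real (card ?S))" by (rule ennreal_leI)
          then show ?thesis using True by (simp add: emeasure_count_space ennreal_of_nat_eq_real_of_nat)
        qed (simp add: emeasure_count_space)
      qed
      finally show "ennreal (q * q) \<le> emeasure (count_space \<Lambda>) ?S / ennreal (mu (ball y R))" .
    qed
  qed
qed

theorem dense_riesz_sequence:
  assumes HAP: "homogeneous_approximation H k" and \<epsilon>: "0 < \<epsilon>" "\<epsilon> \<le> 1"
  shows "\<exists>I (p :: nat \<Rightarrow> real ^ 'n). lower_density k I p \<ge> ennreal (1 - \<epsilon>) \<and> riesz_sequence H I (\<lambda>i. k (p i))"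
proof -
  \<comment> \<open>With \<open>\<theta> = \<epsilon> / 18\<close> a cube keeps the fraction
    \<open>1 - 9 * \<theta> = 1 - \<epsilon> / 2\<close>. The passage to balls squares it, and
    \<open>(1 - \<epsilon> / 2)\<^sup>2 \<ge> 1 - \<epsilon>\<close>.\<close>
  have "0 < \<epsilon> / 18" "\<epsilon> / 18 < 1" using \<epsilon> by auto
  from HAP this show ?thesis
  proof (rule cube_counts)
    fix x :: "nat \<Rightarrow> real ^ 'n" and U :: "int ^ 'n \<Rightarrow> nat set" and \<Lambda> L
    assume L: "L > 0" and U: "\<And>z. finite (U z)" "\<And>z m. m \<in> U z \<Longrightarrow> x m \<in> grid L z"
      and cnt: "\<And>z. (1 - 9 * (\<epsilon> / 18)) * mu (grid L z) \<le> card (\<Lambda> \<inter> U z)"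
      and rs: "riesz_sequence H \<Lambda> (\<lambda>m. k (x m))"
    let ?q = "1 - \<epsilon> / 2"
    have cnt': "?q * mu (grid L z) \<le> card (\<Lambda> \<inter> U z)" for z using cnt[of z] by simp
    have "1 - \<epsilon> \<le> ?q * ?q" by (simp add: algebra_simps)
    then have "ennreal (1 - \<epsilon>) \<le> ennreal (?q * ?q)" by (rule ennreal_leI)
    also have "\<dots> \<le> lower_density k \<Lambda> x"
      unfolding lower_density_def
    proof (rule Liminf_bounded)
      have "\<forall>\<^sub>F R in at_top. \<forall>y. ennreal (?q * ?q) \<le> emeasure (count_space \<Lambda>) {i \<in> \<Lambda>. x i \<in> ball y R} / ennreal (mu (ball y R))"
        by (rule count_in_balls[OF L U cnt']) (use \<epsilon> in auto)
      then show "\<forall>\<^sub>F R in at_top. ennreal (?q * ?q) \<le> (INF y. emeasure (count_space \<Lambda>) {i \<in> \<Lambda>. x i \<in> ball y R} /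
          (\<integral>\<^sup>+z\<in>ball y R. ennreal (Re (kernel_fun k z z)) \<partial>lebesgue))"
        using eventually_ge_at_top[of "0::real"]
      proof eventually_elim
        case (elim R)
        show ?case
          by (rule INF_greatest) (use elim in \<open>simp add: nn_integral_kernel_fun ball_measure\<close>)
      qed
    qed
    finally show ?thesis using rs by blast
  qed
qed

end

theorem theorem1p3:
  fixes H :: "(real ^ 'n \<Rightarrow> complex) set"
    and k :: "real ^ 'n \<Rightarrow> real ^ 'n \<Rightarrow> complex"
  assumes "rkhs H"
    and "reproducing_kernels H k"
    and DC: "diagonal_condition k"
    and WL: "weak_localization k"
    and HAP: "homogeneous_approximation H k"
  shows "\<forall>\<epsilon>>0. \<exists>(I :: nat set) (p :: nat \<Rightarrow> real ^ 'n).
           lower_density k I p \<ge> ennreal (1 - \<epsilon>) \<and> riesz_sequence H I (\<lambda>i. k (p i))"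
proof (intro allI impI)
  fix \<epsilon> :: real assume \<epsilon>: "\<epsilon> > 0"
  obtain C1 C2 where C: "0 < C1" "\<And>x. C1 \<le> (L2_norm (k x))\<^sup>2" "\<And>x. (L2_norm (k x))\<^sup>2 \<le> C2"
    using DC unfolding diagonal_condition_def by blast
  interpret bounded_kernel_space H k C2
    by unfold_locales (use assms(1,2) C(3) in auto)
  interpret admissible_kernel_space H k C2 C1
    by unfold_locales (use C in \<open>auto simp: knorm_def\<close>)
  \<comment> \<open>For \<open>\<epsilon> > 1\<close> the number \<open>1 - \<epsilon>\<close> is
    negative and \<open>ennreal\<close> maps it to 0, so the case \<open>\<epsilon> = 1\<close>
    covers it.\<close>
  have "0 < min \<epsilon> 1" "min \<epsilon> 1 \<le> 1" using \<epsilon> by auto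
  from dense_riesz_sequence[OF HAP this] obtain I and p :: "nat \<Rightarrow> real ^ 'n"
    where d: "lower_density k I p \<ge> ennreal (1 - min \<epsilon> 1)" and r: "riesz_sequence H I (\<lambda>i. k (p i))"
    by (elim exE conjE)
  have "ennreal (1 - \<epsilon>) \<le> ennreal (1 - min \<epsilon> 1)" by (rule ennreal_leI) simp
  also note d
  finally show "\<exists>(I :: nat set) (p :: nat \<Rightarrow> real ^ 'n).
      lower_density k I p \<ge> ennreal (1 - \<epsilon>) \<and> riesz_sequence H I (\<lambda>i. k (p i))"
    using r by (intro exI conjI)
qed

end
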